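(* Let $(Z,d,\nu)$ be a locally compact, non-complete, bounded metric measure space with $\nu$ a doubling measure, let $\overline Z$ be its completion and $\partial Z=\overline Z\setminus Z$, with $\nu$ extended to $\overline Z$ by $\nu(\partial Z)=0$. Let $\sigma>0$, equip $\partial Z$ with the codimension $\sigma$ Hausdorff measure $\pi=\mathcal H^{-\sigma}_\nu$, and assume $0<\pi(\partial Z)<\infty$. Let $0<\theta<1$ and $1<p<\infty$, and let $u\in B^\theta_{p,p}(\overline Z,\nu)$. (i) If $p>\max\{1,\sigma/\theta\}$ and there is a sequence $u_k\in B^\theta_{p,p}(\overline Z,\nu)$ of functions compactly supported in $Z$ such that $u_k\to u$ in $B^\theta_{p,p}(\overline Z,\nu)$, then for $\pi$-a.e. $\zeta\in\partial Z$, $$\lim_{r\to0^+}\frac{1}{\nu(B(\zeta,r))}\int_{B(\zeta,r)}|u|^p\,d\nu=0.\qquad(\ast)$$ (ii) If $(\ast)$ holds for $\mathrm{Cap}^{\overline Z}_{\theta,p}$-quasi-every $\zeta\in\partial Z$, then there is a sequence $u_k\in B^\theta_{p,p}(\overline Z,\nu)$ of functions compactly supported in $Z$ such that $u_k\to u$ in $B^\theta_{p,p}(\overline Z,\nu)$. Furthermore, if $p>\max\{1,\sigma/\theta\}$ and $\pi$ is $\sigma$-codimensional Ahlfors regular with respect to $\nu$, then there exist bounded linear operators $$T_Z:B^\theta_{p,p}(\overline Z,\nu)\to B^{\theta-\sigma/p}_{p,p}(\partial Z,\pi),\qquad E_Z:B^{\theta-\sigma/p}_{p,p}(\partial Z,\pi)\to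 B^\theta_{p,p}(\overline Z,\nu)$$ such that $T_Z\circ E_Z$ is the identity map on $B^{\theta-\sigma/p}_{p,p}(\partial Z,\pi)$, and for each $u\in B^\theta_{p,p}(\overline Z,\nu)$, $$\lim_{r\to0^+}\frac{1}{\nu(B(\zeta,r))}\int_{B(\zeta,r)}|u-T_Zu(\zeta)|\,d\nu=0\quad\text{for }\pi\text{-a.e. }\zeta\in\partial Z.$$
   Context: Doubling: there is $C_d\ge1$ with $0<\nu(B(z,2r))\le C_d\,\nu(B(z,r))<\infty$ for all $z\in Z$, $r>0$. Since $Z$ is locally compact, $Z$ is open in $\overline Z$, and $\overline Z$ is compact. Codimension $\sigma$ Hausdorff measure: for $A\subset\partial Z$, $\mathcal H^{-\sigma}_{\nu}(A)=\lim_{\delta\to0^+}\mathcal H^{-\sigma}_{\nu,\delta}(A)$, where $\mathcal H^{-\sigma}_{\nu,\delta}(A)=\inf\sum_i \nu(B_i)/\mathrm{rad}(B_i)^\sigma$, the infimum being over countable covers of $A$ by balls $B_i\subset\overline Z$ with $\mathrm{rad}(B_i)<\delta$. It is extended to $Z$ as a null measure. $\pi$ is $\sigma$-codimensional Ahlfors regular with respect to $\nu$ if there is $C\ge1$ with $C^{-1}\nu(B(\xi,r))/r^\sigma\le\pi(B(\xi,r))\le C\,\nu(B(\xi,r))/r^\sigma$ whenever $\xi\in\partial Z$ and $0<r<2\,\mathrm{diam}(Z)$ (balls in $\overline Z$). Besov spaces: for a metric measure space $(W,d_W,\mu_W)$, $0<s<1$ and $1\le p<\infty$, $B^s_{p,p}(W,\mu_W)$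 is the set of $u\in L^p(W,\mu_W)$ with $$\|u\|^p_{B^s_{p,p}(W,\mu_W)}:=\int_W\int_W\frac{|u(y)-u(x)|^p}{d_W(x,y)^{sp}\,\mu_W(B(x,d_W(x,y)))}\,d\mu_W(y)\,d\mu_W(x)<\infty .$$ Convergence in $B^s_{p,p}$ and boundedness of operators refer to the full norm $\|u\|_{L^p}+\|u\|_{B^s_{p,p}}$. Besov capacity: for $E\subset \overline Z$, $\mathrm{Cap}^{\overline Z}_{\theta,p}(E)=\inf_u\left(\int_{\overline Z}|u|^p\,d\nu+\|u\|^p_{B^\theta_{p,p}(\overline Z,\nu)}\right)$, the infimum over all $u\in B^\theta_{p,p}(\overline Z,\nu)$ with $u\ge1$ on a neighborhood of $E$ in $\overline Z$. A property holds $\mathrm{Cap}^{\overline Z}_{\theta,p}$-quasi-everywhere if it fails only on a set of zero $\mathrm{Cap}^{\overline Z}_{\theta,p}$-capacity. *)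

theory Defs
  imports "HOL-Analysis.Analysis"
begin

text \<open>A metric measure space \<open>(W, d, \<mu>)\<close> is encoded as a measure \<open>M\<close> on a metric type with
  \<open>space M = W\<close>, equipped with the Borel sets of \<open>W\<close> and with the metric inherited from the type.
  Its (open) balls are the sets \<open>ball x r \<inter> space M\<close>.\<close>

definition borel_measure_on :: "'a::metric_space set \<Rightarrow> 'a measure \<Rightarrow> bool" where
  "borel_measure_on W M \<longleftrightarrow> space M = W \<and> sets M = sets (restrict_space borel W)"

definition doubling_measure :: "'a::metric_space measure \<Rightarrow> bool" where
  "doubling_measure M \<longleftrightarrow>
     (\<exists>C\<ge>1. \<forall>z\<in>space M. \<forall>r>0.
        0 < emeasure M (ball z (2 * r) \<inter> space M) \<and>
        emeasure M (ball z (2 * r) \<inter> space M)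
          \<le> ennreal C * emeasure M (ball z r \<inter> space M) \<and>
        ennreal C * emeasure M (ball z r \<inter> space M) < \<infinity>)"

text \<open>Extension by zero to a larger set \<open>W\<close>, i.e. the push-forward under the inclusion.\<close>

definition null_extension :: "'a::metric_space measure \<Rightarrow> 'a set \<Rightarrow> 'a measure" where
  "null_extension M W = distr M (restrict_space borel W) (\<lambda>x. x)"

text \<open>A countable family of balls is given by a countable set of pairs (centre, radius); in
  particular finite covers are allowed.\<close>

definition codim_hausdorff_content ::
    "'a::metric_space measure \<Rightarrow> real \<Rightarrow> real \<Rightarrow> 'a set \<Rightarrow> ennreal" where
  "codim_hausdorff_content M \<sigma> \<delta> A =
     (INF C \<in> {C. countable C \<and> C \<subseteq> space M \<times> {0<..<\<delta>} \<and> A \<subseteq> (\<Union>(x, r)\<in>C. ball x r)}.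
        \<integral>\<^sup>+ (x, r). emeasure M (ball x r \<inter> space M) / ennreal (r powr \<sigma>) \<partial>count_space C)"

definition codim_hausdorff_outer ::
    "'a::metric_space measure \<Rightarrow> real \<Rightarrow> 'a set \<Rightarrow> ennreal" where
  "codim_hausdorff_outer M \<sigma> A = Lim (at_right 0) (\<lambda>\<delta>. codim_hausdorff_content M \<sigma> \<delta> A)"

text \<open>The codimension \<open>\<sigma>\<close> Hausdorff measure with respect to \<open>M\<close>, on the Borel subsets of \<open>S\<close>.\<close>

definition codim_hausdorff_measure ::
    "'a::metric_space measure \<Rightarrow> real \<Rightarrow> 'a set \<Rightarrow> 'a measure" where
  "codim_hausdorff_measure M \<sigma> S =
     measure_of S (sets (restrict_space borel S)) (codim_hausdorff_outer M \<sigma>)"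

text \<open>Since \<open>P\<close> lives on a subset of \<open>space M\<close>, the value \<open>emeasure P (ball \<xi> r \<inter> space P)\<close> is the
  measure of the ball of \<open>space M\<close> under the extension of \<open>P\<close> by zero.\<close>

definition codim_ahlfors_regular ::
    "'a::metric_space measure \<Rightarrow> real \<Rightarrow> 'a measure \<Rightarrow> bool" where
  "codim_ahlfors_regular M \<sigma> P \<longleftrightarrow>
     (\<exists>C\<ge>1. \<forall>\<xi>\<in>space P. \<forall>r. 0 < r \<and> r < 2 * diameter (space M) \<longrightarrow>
        ennreal (1 / C) * (emeasure M (ball \<xi> r \<inter> space M) / ennreal (r powr \<sigma>))
          \<le> emeasure P (ball \<xi> r \<inter> space P) \<and>
        emeasure P (ball \<xi> r \<inter> space P)
          \<le> ennreal C * (emeasure M (ball \<xi> r \<inter> space M) / ennreal (r powr \<sigma>)))"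

text \<open>The \<open>p\<close>-th power of the Besov seminorm. The integrand is \<open>0\<close> on the diagonal, by the
  conventions \<open>0 / 0 = 0\<close> in \<^typ>\<open>real\<close> and \<^typ>\<open>ennreal\<close>.\<close>

definition besov_energy ::
    "real \<Rightarrow> real \<Rightarrow> 'a::metric_space measure \<Rightarrow> ('a \<Rightarrow> real) \<Rightarrow> ennreal" where
  "besov_energy s p M u =
     (\<integral>\<^sup>+ x. \<integral>\<^sup>+ y. ennreal (\<bar>u y - u x\<bar> powr p / dist x y powr (s * p))
                  / emeasure M (ball x (dist x y) \<inter> space M) \<partial>M \<partial>M)"

text \<open>Besov functions are represented by measurable functions, not by classes modulo equality
  almost everywhere.\<close>

definition besov_space ::
    "real \<Rightarrow> real \<Rightarrow> 'a::metric_space measure \<Rightarrow> ('a \<Rightarrow> real) set" where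
  "besov_space s p M =
     {u \<in> borel_measurable M. integrable M (\<lambda>x. \<bar>u x\<bar> powr p) \<and> besov_energy s p M u < \<infinity>}"

definition besov_norm ::
    "real \<Rightarrow> real \<Rightarrow> 'a::metric_space measure \<Rightarrow> ('a \<Rightarrow> real) \<Rightarrow> real" where
  "besov_norm s p M u =
     (\<integral>x. \<bar>u x\<bar> powr p \<partial>M) powr (1 / p) + enn2real (besov_energy s p M u) powr (1 / p)"

text \<open>\<open>T\<close> induces a bounded linear operator between the spaces of classes modulo equality almost
  everywhere.\<close>

definition besov_operator ::
    "real \<Rightarrow> real \<Rightarrow> 'a::metric_space measure \<Rightarrow> real \<Rightarrow> real \<Rightarrow> 'b::metric_space measure \<Rightarrow>
      (('a \<Rightarrow> real) \<Rightarrow> ('b \<Rightarrow> real)) \<Rightarrow> bool" where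
  "besov_operator s p M t q N T \<longleftrightarrow>
     (\<forall>u\<in>besov_space s p M. T u \<in> besov_space t q N) \<and>
     (\<forall>u\<in>besov_space s p M. \<forall>v\<in>besov_space s p M.
        (AE x in M. u x = v x) \<longrightarrow> (AE x in N. T u x = T v x)) \<and>
     (\<forall>u\<in>besov_space s p M. \<forall>v\<in>besov_space s p M.
        AE x in N. T (\<lambda>y. u y + v y) x = T u x + T v x) \<and>
     (\<forall>c. \<forall>u\<in>besov_space s p M. AE x in N. T (\<lambda>y. c * u y) x = c * T u x) \<and>
     (\<exists>C\<ge>0. \<forall>u\<in>besov_space s p M. besov_norm t q N (T u) \<le> C * besov_norm s p M u)"

definition besov_capacity ::
    "real \<Rightarrow> real \<Rightarrow> 'a::metric_space measure \<Rightarrow> 'a set \<Rightarrow> ennreal" where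
  "besov_capacity s p M E =
     (INF u \<in> {u \<in> besov_space s p M.
                 \<exists>U. openin (top_of_set (space M)) U \<and> E \<subseteq> U \<and> (\<forall>x\<in>U. 1 \<le> u x)}.
        (\<integral>\<^sup>+ x. ennreal (\<bar>u x\<bar> powr p) \<partial>M) + besov_energy s p M u)"

definition ball_average ::
    "'a::metric_space measure \<Rightarrow> ('a \<Rightarrow> real) \<Rightarrow> 'a \<Rightarrow> real \<Rightarrow> real" where
  "ball_average M f x r =
     (\<integral>y\<in>ball x r \<inter> space M. f y \<partial>M) / measure M (ball x r \<inter> space M)"

text \<open>The support is taken relative to \<open>W\<close>; in the application \<open>W\<close> is closed.\<close>

definition compactly_supported_in ::
    "'a::metric_space set \<Rightarrow> 'a set \<Rightarrow> ('a \<Rightarrow> real) \<Rightarrow> bool" where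
  "compactly_supported_in W Z u \<longleftrightarrow>
     compact (closure {x \<in> W. u x \<noteq> 0}) \<and> closure {x \<in> W. u x \<noteq> 0} \<subseteq> Z"

definition besov_approximable ::
    "real \<Rightarrow> real \<Rightarrow> 'a::metric_space measure \<Rightarrow> 'a set \<Rightarrow> ('a \<Rightarrow> real) \<Rightarrow> bool" where
  "besov_approximable s p M Z u \<longleftrightarrow>
     (\<exists>v :: nat \<Rightarrow> 'a \<Rightarrow> real.
        (\<forall>k. v k \<in> besov_space s p M \<and> compactly_supported_in (space M) Z (v k)) \<and>
        (\<lambda>k. besov_norm s p M (\<lambda>x. v k x - u x)) \<longlonglongrightarrow> 0)"

end

theory Submission
  imports Defs
begin

text \<open>Averages are formed with the Lipschitz weight \<open>max 0 (2 r - d(x, y))\<close>, so that their increments in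
  the centre and in the radius are controlled by the \<open>p\<close>-th power oscillation of \<open>u\<close> over a ball of
  radius \<open>4 r\<close>. Summed over dyadic radii with weight \<open>r\<close> to the power \<open>- \<theta> p\<close>, these oscillations are
  bounded by the Besov energy, and because \<open>0 < \<theta> < 1\<close> the resulting geometric series also controls the
  Besov energy of the averages and of their supremum over all scales.

  (i) With \<open>2 b = \<theta> p - \<sigma> > 0\<close>, the averages telescope at every point where the oscillation at scale
  \<open>r\<close> is at most \<open>\<kappa> r\<^sup>b\<close> for all small \<open>r\<close>. The exceptional points of scale \<open>r\<close> are covered by the balls
  around a separated net, at a cost in codimension \<open>\<sigma>\<close> content of order \<open>r\<^sup>b / \<kappa>\<close> times the energy. This
  is applied to \<open>u - u\<^sub>k\<close>, which agrees with \<open>u\<close> near the boundary.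

  (ii) The supremum of the averages yields a capacitary weak type estimate: off the set where a function \<open>w\<close>
  of small Besov norm equals \<open>1\<close>, an average \<open>\<phi>\<close> of \<open>u\<close> is small at the boundary. Cutting off
  \<open>(1 - w) \<phi>\<close> at a small level gives functions with compact support in \<open>Z\<close>.

  The trace is the limit of the averages, and the extension at \<open>x\<close> is an average of the boundary function
  over a ball with radius comparable to the distance of \<open>x\<close> to the boundary.\<close>

section \<open>Powers and geometric scales\<close>

text \<open>Membership in the Besov space determines \<open>u\<close> only up to null sets, whereas
  the trace concerns points of the boundary, which is itself null. Every pointwise quantity at the
  boundary is therefore built from integrals over balls: where an estimate in the space compares
  \<open>u z\<close> with \<open>u x\<close> (\<open>osc\<close>), the boundary estimate compares
  \<open>u z\<close> with \<open>u w\<close> for independent \<open>z\<close> and \<open>w\<close>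
  (\<open>osc2\<close>). The Lipschitz weight has a second purpose: averages of bounded functions
  are Lipschitz, so their super-level sets are relatively open and the cut-off functions of (ii)
  vanish on a genuine neighbourhood of the boundary. Sizes are kept as \<open>p\<close>-th powers in
  \<open>ennreal\<close>, where sums over scales and Fubini carry no finiteness conditions; the norm
  itself enters only at the interface to the statement. The truncation in (ii) is nonlinear and
  offers no direct norm estimate of the error, so convergence comes from dominated convergence on
  the product space, with errors chosen summable. In the trace theorem the gap
  \<open>\<theta> p - \<sigma>\<close> is halved again: one half pays for telescoping, the other for
  the integration over the boundary.\<close>

abbreviation epow :: "real \<Rightarrow> real \<Rightarrow> ennreal" where
  "epow p t \<equiv> ennreal (\<bar>t\<bar> powr p)"

text \<open>Left unnormalised, because the mass by which it is divided often belongs to a different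
  ball.\<close>

abbreviation devint :: "real \<Rightarrow> 'a::metric_space measure \<Rightarrow> ('a \<Rightarrow> real) \<Rightarrow> real \<Rightarrow> 'a \<Rightarrow> real \<Rightarrow> ennreal" where
  "devint p M u c x r \<equiv> (\<integral>\<^sup>+z\<in>ball x r. epow p (u z - c) \<partial>M)"

section \<open>Hoelder's inequality and telescoping in terms of \<open>p\<close>-th powers\<close>

lemma powr_add_le:
  fixes a b p :: real
  assumes "0 \<le> a" "0 \<le> b" "0 \<le> p"
  shows "(a + b) powr p \<le> 2 powr p * (a powr p + b powr p)"
proof -
  have "(a + b) powr p \<le> (2 * max a b) powr p"
    using assms by (intro powr_mono2) auto
  also have "\<dots> = 2 powr p * max a b powr p"
    using assms by (simp add: powr_mult)
  also have "max a b powr p \<le> a powr p + b powr p"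
    by (auto simp: max_def)
  finally show ?thesis by simp
qed

lemma powr_add3_le:
  fixes a b c p :: real
  assumes "0 \<le> a" "0 \<le> b" "0 \<le> c" "0 \<le> p"
  shows "(a + b + c) powr p \<le> 3 powr p * (a powr p + b powr p + c powr p)"
proof -
  have "(a + b + c) powr p \<le> (3 * max a (max b c)) powr p"
    using assms by (intro powr_mono2) auto
  also have "\<dots> = 3 powr p * max a (max b c) powr p"
    using assms by (simp add: powr_mult)
  also have "max a (max b c) powr p \<le> a powr p + b powr p + c powr p"
    by (auto simp: max_def)
  finally show ?thesis by simp
qed

text \<open>Hoelder's inequality against the indicator of \<open>B\<close>, obtained by integrating
  Young's inequality. The second factor is a power of the mean \<open>c = I / b\<close>, for which
  Young's inequality is an equality when \<open>g\<close> is constant on \<open>B\<close>; the term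
  with \<open>c powr p\<close> is then absorbed on the left.\<close>

lemma powr_integral_le:
  fixes g :: "'a \<Rightarrow> real"
  assumes B: "B \<in> sets P" "emeasure P B < \<infinity>"
    and g[measurable]: "g \<in> borel_measurable P" and g0: "\<And>x. 0 \<le> g x" and p: "1 < p"
    and int: "integrable P (\<lambda>x. g x * indicator B x)"
  shows "ennreal ((\<integral>x. g x * indicator B x \<partial>P) powr p)
           \<le> ennreal (measure P B powr (p - 1)) * (\<integral>\<^sup>+x\<in>B. ennreal (g x powr p) \<partial>P)"
proof -
  define I where "I = (\<integral>x. g x * indicator B x \<partial>P)"
  define b where "b = measure P B"
  note B(1)[measurable]
  have I0: "0 \<le> I" unfolding I_def by (intro integral_nonneg_AE) (auto simp: g0)
  \<comment> \<open>A null set carries no integral, so the mean over \<open>B\<close> makes sense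
    whenever the claim is not trivial.\<close>
  have pos: "I = 0 \<or> b > 0"
  proof (rule disjCI)
    assume "\<not> b > 0"
    then have "b = 0" using zero_less_measure_iff by (auto simp: b_def)
    then have "emeasure P B = 0" using B(2) by (simp add: b_def emeasure_eq_ennreal_measure)
    then have "AE x in P. x \<notin> B" using B(1) by (intro AE_not_in) (auto simp: null_sets_def)
    then have "AE x in P. g x * indicator B x = 0" by eventually_elim auto
    then show "I = 0" unfolding I_def by (rule integral_eq_zero_AE)
  qed
  show ?thesis
  proof (cases "I = 0 \<or> (\<integral>\<^sup>+x\<in>B. ennreal (g x powr p) \<partial>P) = \<infinity>")
    case True
    with pos p show ?thesis by (auto simp: I_def[symmetric] b_def[symmetric] ennreal_mult_top)
  next
    case False
    then have Ipos: "I > 0" using I0 by auto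
    then have bpos: "b > 0" using pos by auto
    have eq: "(\<integral>\<^sup>+x\<in>B. ennreal (g x powr p) \<partial>P) = (\<integral>\<^sup>+x. ennreal (g x powr p * indicator B x) \<partial>P)"
      by (intro nn_integral_cong) (auto simp: indicator_def)
    have intp: "integrable P (\<lambda>x. g x powr p * indicator B x)"
      using False eq by (intro integrableI_nonneg) (auto simp: top.not_eq_extremum)
    define J where "J = (\<integral>x. g x powr p * indicator B x \<partial>P)"
    have J: "(\<integral>\<^sup>+x\<in>B. ennreal (g x powr p) \<partial>P) = ennreal J"
      unfolding eq J_def using intp by (intro nn_integral_eq_integral) auto
    have J0: "0 \<le> J" unfolding J_def by (intro integral_nonneg_AE) auto
    define c where "c = I / b"
    have c: "c > 0" using Ipos bpos by (simp add: c_def)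
    define q where "q = p / (p - 1)"
    have q: "q > 1" "1/p + 1/q = 1" using p by (auto simp: q_def field_simps)
    have young: "g x * c powr (p - 1) \<le> g x powr p / p + c powr p / q" for x
    proof -
      have "(c powr (p - 1)) powr q = c powr p"
        using p c by (simp add: powr_powr q_def)
      with Youngs_inequality[of p q "g x" "c powr (p - 1)"] p q g0[of x] show ?thesis by simp
    qed
    have intB: "integrable P (indicator B :: _ \<Rightarrow> real)"
      using B by (simp add: integrable_indicator_iff)
    have "I * c powr (p - 1) = (\<integral>x. c powr (p - 1) * (g x * indicator B x) \<partial>P)"
      by (simp add: I_def)
    also have "\<dots> \<le> (\<integral>x. (1 / p) * (g x powr p * indicator B x) + (c powr p / q) * indicator B x \<partial>P)"
    proof (rule integral_mono)
      show "integrable P (\<lambda>x. c powr (p - 1) * (g x * indicator B x))"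
        using int by (rule integrable_mult_right)
      show "integrable P (\<lambda>x. 1 / p * (g x powr p * indicator B x) + c powr p / q * indicator B x)"
        using intp intB by (intro Bochner_Integration.integrable_add integrable_mult_right)
      show "c powr (p - 1) * (g x * indicator B x) \<le> 1 / p * (g x powr p * indicator B x) + c powr p / q * indicator B x" for x
        using young[of x] by (simp add: mult.commute split: split_indicator)
    qed
    also have "\<dots> = J / p + c powr p / q * b"
      using intp intB B by (simp add: J_def b_def Bochner_Integration.integral_add)
    finally have 1: "I * c powr (p - 1) \<le> J / p + c powr p / q * b" .
    have cp: "c powr p = c * c powr (p - 1)"
      using c by (simp add: powr_diff)
    have "c powr p * b = I * c powr (p - 1)" unfolding cp using bpos by (simp add: c_def)
    then have "I * c powr (p - 1) \<le> J / p + I * c powr (p - 1) / q"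
      using 1 by (simp add: mult.commute)
    moreover have "1 / q = 1 - 1 / p" using q by simp
    moreover have "I * c powr (p - 1) / q = I * c powr (p - 1) * (1 / q)" by simp
    ultimately have "I * c powr (p - 1) * (1 / p) \<le> J * (1 / p)"
      by (simp only: right_diff_distrib) simp
    then have IJ: "I * c powr (p - 1) \<le> J" using p by (simp add: divide_simps)
    have "I powr p = I * I powr (p - 1)" using Ipos by (simp add: powr_diff)
    also have "\<dots> = b powr (p - 1) * (I * c powr (p - 1))"
      using Ipos bpos by (simp add: c_def powr_divide)
    also have "\<dots> \<le> b powr (p - 1) * J" using IJ by (intro mult_left_mono) auto
    finally show ?thesis
      unfolding J I_def[symmetric] b_def[symmetric] using J0
      by (simp add: ennreal_mult'[symmetric] ennreal_leI)
  qed
qed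

text \<open>In the applications \<open>m\<close> is the mass of a small ball that normalises a mean,
  \<open>K\<close> the doubling ratio between \<open>B\<close> and that ball, and \<open>L\<close>
  the constant of a pointwise estimate. The power \<open>p - 1\<close> of the mass of
  \<open>B\<close> against the power \<open>p\<close> of \<open>1 / m\<close> leaves a single factor
  \<open>1 / m\<close>.\<close>

lemma powr_le_mean_integral:
  fixes g :: "'a \<Rightarrow> real"
  assumes B: "B \<in> sets P" "emeasure P B < \<infinity>"
    and g: "g \<in> borel_measurable P" "\<And>x. 0 \<le> g x" and p: "1 < p"
    and int: "integrable P (\<lambda>x. g x * indicator B x)"
    and m: "0 < m" "measure P B \<le> K * m" "0 \<le> K" and L: "0 \<le> L"
    and t: "\<bar>t\<bar> \<le> L / m * (\<integral>x. g x * indicator B x \<partial>P)"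
  shows "epow p t
           \<le> ennreal (L powr p * K powr (p - 1) / m) * (\<integral>\<^sup>+x\<in>B. ennreal (g x powr p) \<partial>P)"
proof -
  define I where "I = (\<integral>x. g x * indicator B x \<partial>P)"
  have I0: "0 \<le> I" unfolding I_def by (intro integral_nonneg_AE) (auto simp: g)
  have "\<bar>t\<bar> powr p \<le> (L / m * I) powr p"
    using t p by (intro powr_mono2) (auto simp: I_def)
  also have "\<dots> = (L / m) powr p * I powr p" using I0 L m by (subst powr_mult[symmetric]) auto
  finally have "epow p t \<le> ennreal ((L / m) powr p) * ennreal (I powr p)"
    by (simp add: ennreal_mult'[symmetric] ennreal_leI)
  also have "\<dots> \<le> ennreal ((L / m) powr p) * (ennreal (measure P B powr (p - 1)) *
                     (\<integral>\<^sup>+x\<in>B. ennreal (g x powr p) \<partial>P))"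
    unfolding I_def using powr_integral_le[OF B g p int] by (intro mult_left_mono) auto
  also have "\<dots> = ennreal ((L / m) powr p * measure P B powr (p - 1)) *
                     (\<integral>\<^sup>+x\<in>B. ennreal (g x powr p) \<partial>P)"
    by (simp add: ennreal_mult' mult.assoc)
  also have "\<dots> \<le> ennreal (L powr p * K powr (p - 1) / m) * (\<integral>\<^sup>+x\<in>B. ennreal (g x powr p) \<partial>P)"
  proof (intro mult_right_mono ennreal_leI)
    have "(L / m) powr p * measure P B powr (p - 1) \<le> (L / m) powr p * (K * m) powr (p - 1)"
      using m p by (intro mult_left_mono powr_mono2) auto
    also have "\<dots> = L powr p * K powr (p - 1) / m"
      using m L by (simp add: powr_divide powr_mult powr_diff field_simps)
    finally show "(L / m) powr p * measure P B powr (p - 1) \<le> L powr p * K powr (p - 1) / m" .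
  qed auto
  finally show ?thesis .
qed

text \<open>The weighted series is used through its single terms only: each is at most the sum, so
  the increments are at most \<open>s powr (1 / p)\<close> times powers of
  \<open>q powr (1 / p) < 1\<close>, and the series of increments converges absolutely.\<close>

lemma telescope_powr_le:
  fixes a :: "nat \<Rightarrow> real" and h :: "nat \<Rightarrow> ennreal"
  assumes p: "1 < p" and q: "0 < q" "q < 1"
    and h: "\<And>j. k \<le> j \<Longrightarrow> epow p (a (Suc j) - a j) \<le> h j"
    and S: "(\<Sum>j. if k \<le> j then h j / ennreal (q ^ (j - k)) else 0) < \<infinity>"
  shows "convergent a"
    and "epow p (lim a - a k)
           \<le> ennreal (1 / (1 - q powr (1 / p)) powr p) *
              (\<Sum>j. if k \<le> j then h j / ennreal (q ^ (j - k)) else 0)"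
proof -
  define S where "S = (\<Sum>j. if k \<le> j then h j / ennreal (q ^ (j - k)) else 0)"
  define s where "s = enn2real S"
  have s: "S = ennreal s" "0 \<le> s" using S by (auto simp: s_def S_def)
  define t where "t = q powr (1 / p)"
  have t: "0 < t" "t < 1"
  proof -
    show "0 < t" using q by (simp add: t_def)
    have "q powr (1 / p) < 1 powr (1 / p)" using q p by (intro powr_less_mono2) auto
    then show "t < 1" by (simp add: t_def)
  qed
  have step: "\<bar>a (Suc (k + i)) - a (k + i)\<bar> \<le> s powr (1 / p) * t ^ i" for i
  proof -
    have "h (k + i) / ennreal (q ^ i) \<le> S"
    proof -
      have "(if k \<le> k + i then h (k + i) / ennreal (q ^ (k + i - k)) else 0) \<le> S"
        unfolding S_def by (rule sum_le_suminf[where I="{k+i}", simplified]) auto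
      then show ?thesis by simp
    qed
    then have "h (k + i) / ennreal (q ^ i) * ennreal (q ^ i) \<le> S * ennreal (q ^ i)"
      by (intro mult_right_mono) auto
    moreover have "h (k + i) / ennreal (q ^ i) * ennreal (q ^ i) = h (k + i)"
      using q mult_divide_eq_ennreal[of "ennreal (q ^ i)" "h (k + i)"]
      by (simp add: ennreal_times_divide mult.commute)
    ultimately have "h (k + i) \<le> ennreal (s * q ^ i)" using s q by (simp add: ennreal_mult)
    then have "epow p (a (Suc (k + i)) - a (k + i)) \<le> ennreal (s * q ^ i)"
      using h[of "k + i"] by (meson le_add1 order_trans)
    then have "\<bar>a (Suc (k + i)) - a (k + i)\<bar> powr p \<le> s * q ^ i"
      using s q by (subst (asm) ennreal_le_iff) auto
    then have "(\<bar>a (Suc (k + i)) - a (k + i)\<bar> powr p) powr (1 / p) \<le> (s * q ^ i) powr (1 / p)"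
      using p by (intro powr_mono2) auto
    also have "(s * q ^ i) powr (1 / p) = s powr (1 / p) * t ^ i"
      using s q by (simp add: powr_mult t_def powr_realpow[symmetric] powr_powr mult.commute)
    finally show ?thesis using p by (simp add: powr_powr)
  qed
  have gs: "summable (\<lambda>i. s powr (1 / p) * t ^ i)" using t by (intro summable_mult) auto
  have sn: "summable (\<lambda>i. norm (a (Suc (k + i)) - a (k + i)))"
    by (rule summable_comparison_test[OF _ gs]) (use step in auto)
  then have su: "summable (\<lambda>i. a (Suc (k + i)) - a (k + i))" by (rule summable_norm_cancel)
  have "(\<lambda>n. \<Sum>i<n. a (Suc (k + i)) - a (k + i)) = (\<lambda>n. a (k + n) - a k)"
  proof
    fix n show "(\<Sum>i<n. a (Suc (k + i)) - a (k + i)) = a (k + n) - a k"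
      by (induction n) auto
  qed
  then have lim1: "(\<lambda>n. a (k + n) - a k) \<longlonglongrightarrow> (\<Sum>i. a (Suc (k + i)) - a (k + i))"
    using su by (metis summable_LIMSEQ)
  then have "(\<lambda>n. (a (k + n) - a k) + a k) \<longlonglongrightarrow> (\<Sum>i. a (Suc (k + i)) - a (k + i)) + a k"
    by (intro tendsto_intros)
  then have "(\<lambda>n. a (n + k)) \<longlonglongrightarrow> (\<Sum>i. a (Suc (k + i)) - a (k + i)) + a k"
    by (simp add: add.commute)
  then have lim2: "a \<longlonglongrightarrow> (\<Sum>i. a (Suc (k + i)) - a (k + i)) + a k"
    by (rule LIMSEQ_offset)
  then show "convergent a" by (auto simp: convergent_def)
  have "lim a - a k = (\<Sum>i. a (Suc (k + i)) - a (k + i))" using limI[OF lim2] by simp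
  then have "\<bar>lim a - a k\<bar> \<le> (\<Sum>i. \<bar>a (Suc (k + i)) - a (k + i)\<bar>)"
    using summable_rabs[of "\<lambda>i. a (Suc (k + i)) - a (k + i)"] sn by simp
  also have "\<dots> \<le> (\<Sum>i. s powr (1 / p) * t ^ i)" using sn gs step by (intro suminf_le) auto
  also have "\<dots> = s powr (1 / p) / (1 - t)" using t by (simp add: suminf_mult suminf_geometric)
  finally have "\<bar>lim a - a k\<bar> powr p \<le> (s powr (1 / p) / (1 - t)) powr p"
    using p by (intro powr_mono2) auto
  also have "\<dots> = 1 / (1 - t) powr p * s" using t s p by (simp add: powr_divide powr_powr)
  finally show "epow p (lim a - a k)
           \<le> ennreal (1 / (1 - q powr (1 / p)) powr p) *
              (\<Sum>j. if k \<le> j then h j / ennreal (q ^ (j - k)) else 0)"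
    unfolding S_def[symmetric] s t_def[symmetric] using s
    by (simp add: ennreal_mult'[symmetric] ennreal_leI)
qed

lemma half_powr_power: "((1 / 2 :: real) powr a) ^ i = (1 / 2 ^ i) powr a"
proof (induction i)
  case (Suc i)
  have "((1 / 2 :: real) powr a) ^ Suc i = (1 / 2) powr a * (1 / 2 ^ i) powr a" using Suc by simp
  also have "\<dots> = (1 / 2 * (1 / 2 ^ i)) powr a" by (subst powr_mult) auto
  finally show ?case by simp
qed simp

section \<open>Dyadic shells inside and outside a ball\<close>

lemma shell_in_ball_exists:
  fixes d r :: real
  assumes "0 < d" "d < r"
  obtains i :: nat where "r / 2 ^ i / 2 \<le> d" "d < r / 2 ^ i"
proof -
  obtain n where n: "(1/2::real) ^ n < d / r"
    using real_arch_pow_inv[of "d / r" "1/2"] assms by auto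
  define m where "m = (LEAST n. r / 2 ^ n \<le> d)"
  have ex: "r / 2 ^ n \<le> d" using n assms by (simp add: field_simps power_divide)
  have m: "r / 2 ^ m \<le> d" unfolding m_def by (rule LeastI[of _ n]) (rule ex)
  have "m \<noteq> 0" using m assms by (cases "m = 0") auto
  then obtain i where i: "m = Suc i" by (cases m) auto
  have "\<not> r / 2 ^ i \<le> d" using not_less_Least[of i "\<lambda>n. r / 2 ^ n \<le> d"] i m_def by auto
  then show thesis using that[of i] m i by auto
qed

lemma shell_off_ball_exists:
  fixes d r :: real
  assumes "0 < r" "r \<le> d"
  obtains i :: nat where "r * 2 ^ i \<le> d" "d < r * 2 ^ Suc i"
proof -
  obtain n where n: "d / r < (2::real) ^ n"
    using real_arch_pow[of 2 "d / r"] by auto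
  define m where "m = (LEAST n. d < r * 2 ^ n)"
  have ex: "d < r * 2 ^ n" using n assms by (simp add: field_simps)
  have m: "d < r * 2 ^ m" unfolding m_def by (rule LeastI[of _ n]) (rule ex)
  have "m \<noteq> 0" using m assms by (cases "m = 0") auto
  then obtain i where i: "m = Suc i" by (cases m) auto
  have "\<not> d < r * 2 ^ i" using not_less_Least[of i "\<lambda>n. d < r * 2 ^ n"] i m_def by auto
  then show thesis using that[of i] m i by auto
qed

section \<open>Doubling measures\<close>

text \<open>The centre may lie outside \<open>space M\<close>: the extension operator measures
  boundary balls around interior points.\<close>

definition bm :: "'a::metric_space measure \<Rightarrow> 'a \<Rightarrow> real \<Rightarrow> real" where
  "bm M x r = measure M (ball x r \<inter> space M)"

text \<open>For \<open>a = s * p\<close> this is the kernel of the Besov energy; for negative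
  \<open>a\<close> it is a Riesz type kernel, integrable near the diagonal by doubling. On the
  diagonal the value is 0 because \<open>0 powr (- a) = 0\<close>.\<close>

definition kern :: "'a::metric_space measure \<Rightarrow> real \<Rightarrow> 'a \<Rightarrow> 'a \<Rightarrow> real" where
  "kern M a x y = dist x y powr (- a) / bm M x (dist x y)"

abbreviation bkern :: "real \<Rightarrow> 'a::metric_space measure \<Rightarrow> real \<Rightarrow> ('a \<Rightarrow> real) \<Rightarrow> 'a \<Rightarrow> 'a \<Rightarrow> ennreal" where
  "bkern p M a u x y \<equiv> ennreal (\<bar>u y - u x\<bar> powr p * kern M a x y)"

lemma bm_nonneg [simp]: "0 \<le> bm M x r" by (simp add: bm_def)

lemma kern_nonneg [simp]: "0 \<le> kern M a x y" by (simp add: kern_def)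

lemma kern_refl [simp]: "kern M a x x = 0" by (simp add: kern_def)

section \<open>Joint measurability of the distance\<close>

text \<open>Separability makes the distance measurable for the product sigma-algebra, which for
  non-separable spaces need not contain the Borel sets of the product. The countable set may contain
  points outside the space.\<close>

definition sep_borel :: "'a::metric_space measure \<Rightarrow> bool" where
  "sep_borel M \<longleftrightarrow> sets M = sets (restrict_space borel (space M)) \<and>
     (\<exists>Q. countable Q \<and> space M \<subseteq> closure Q)"

lemma measurable_dist_const:
  assumes "sets M = sets (restrict_space borel (space M))"
  shows "(\<lambda>x. dist x q) \<in> borel_measurable M"
proof -
  have "(\<lambda>x. dist x q) \<in> borel_measurable (restrict_space borel (space M))"
    by (intro measurable_restrict_space1 borel_measurable_continuous_onI continuous_intros)
  then show ?thesis using measurable_cong_sets[OF assms refl] by blast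
qed

text \<open>The distance is below \<open>a\<close> iff some point \<open>q\<close> of the countable
  dense set and some rational \<open>s\<close> satisfy \<open>dist (f w) q < s\<close> and
  \<open>dist (g w) q < a - s\<close>. Density is used at \<open>f w\<close> only, so it is enough
  that one of the two spaces is separable.\<close>

lemma measurable_dist_sep:
  assumes M: "sep_borel M" and P: "sets P = sets (restrict_space borel (space P))"
    and f: "f \<in> measurable N M" and g: "g \<in> measurable N P"
  shows "(\<lambda>w. dist (f w) (g w)) \<in> borel_measurable N"
proof (rule borel_measurableI_less)
  fix a :: real
  obtain Q where Q: "countable Q" "space M \<subseteq> closure Q" using M by (auto simp: sep_borel_def)
  have [measurable]: "(\<lambda>w. dist (f w) q) \<in> borel_measurable N" "(\<lambda>w. dist (g w) q) \<in> borel_measurable N" for q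
    using measurable_compose[OF f measurable_dist_const] measurable_compose[OF g measurable_dist_const] M P
    by (auto simp: sep_borel_def)
  have "{w \<in> space N. dist (f w) (g w) < a} =
      (\<Union>q\<in>Q. \<Union>s\<in>\<rat>. {w \<in> space N. dist (f w) q < s \<and> dist (g w) q < a - s})" (is "?L = ?R")
  proof
    show "?R \<subseteq> ?L"
    proof clarsimp
      fix w q s assume "dist (f w) q < s" "dist (g w) q < a - s"
      then show "dist (f w) (g w) < a" using dist_triangle2[of "f w" "g w" q] by linarith
    qed
    show "?L \<subseteq> ?R"
    proof
      fix w assume w: "w \<in> ?L"
      define e where "e = (a - dist (f w) (g w)) / 4"
      have e: "e > 0" using w by (simp add: e_def)
      have aeq: "a = dist (f w) (g w) + 4 * e" unfolding e_def by (simp add: field_simps)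
      have "f w \<in> closure Q" using w Q(2) f by (auto dest: measurable_space)
      then obtain q where q: "q \<in> Q" "dist q (f w) < e" using e by (auto simp: closure_approachable)
      obtain s where s: "s \<in> \<rat>" "e < s" "s < 2 * e" using Rats_dense_in_real[of e "2*e"] e by auto
      have "dist (g w) q \<le> dist (f w) (g w) + dist q (f w)"
        using dist_triangle[of "g w" q "f w"] by (simp add: dist_commute)
      then have "dist (g w) q < a - s" using q s e aeq by linarith
      moreover have "dist (f w) q < s" using q s by (simp add: dist_commute)
      ultimately show "w \<in> ?R" using q(1) s(1) w by auto
    qed
  qed
  also have "\<dots> \<in> sets N"
    using Q(1) countable_rat by (intro sets.countable_UN'') auto
  finally show "{w \<in> space N. dist (f w) (g w) < a} \<in> sets N" .
qed

section \<open>Masses of balls and separated nets\<close>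

text \<open>Used for the measure on the completion and for the boundary measure alike.
  \<open>R\<close> is a strict bound for distances, so a ball of radius \<open>R\<close> about a
  point of the space is the whole space, and the dyadic scales can start there.\<close>

locale doubling_space =
  fixes M :: "'a::metric_space measure" and D R :: real
  assumes sets_M: "sets M = sets (restrict_space borel (space M))"
    and finite_M: "emeasure M (space M) \<noteq> \<infinity>"
    and dist_less: "\<And>x y. x \<in> space M \<Longrightarrow> y \<in> space M \<Longrightarrow> dist x y < R"
    and bm_pos: "\<And>x r. x \<in> space M \<Longrightarrow> 0 < r \<Longrightarrow> 0 < bm M x r"
    and bm_double: "\<And>x r. x \<in> space M \<Longrightarrow> 0 < r \<Longrightarrow> bm M x (2 * r) \<le> D * bm M x r"
    and R_pos: "0 < R"
    and D_ge_1: "1 \<le> D"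
begin

sublocale finite_measure M
  by (rule finite_measureI) (rule finite_M)

lemma ball_in_sets [measurable, simp]: "ball x r \<inter> space M \<in> sets M"
proof -
  have "space M \<inter> ball x r \<in> sets (restrict_space borel (space M))"
    unfolding sets_restrict_space by (intro imageI) simp
  then show ?thesis using sets_M by (simp add: Int_commute)
qed

lemma emeasure_ball: "emeasure M (ball x r \<inter> space M) = ennreal (bm M x r)"
  by (simp add: bm_def emeasure_eq_measure)

lemma bm_mono: "r \<le> s \<Longrightarrow> bm M x r \<le> bm M x s"
  unfolding bm_def by (intro finite_measure_mono) auto

lemma bm_double_pow:
  assumes "x \<in> space M" "0 < r"
  shows "bm M x (2 ^ n * r) \<le> D ^ n * bm M x r"
proof (induction n)
  case (Suc n)
  have "bm M x (2 ^ Suc n * r) \<le> D * bm M x (2 ^ n * r)"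
    using bm_double[of x "2 ^ n * r"] assms by (simp add: mult.assoc)
  also have "\<dots> \<le> D * (D ^ n * bm M x r)" using Suc D_ge_1 by (intro mult_left_mono) auto
  finally show ?case by (simp add: mult.assoc)
qed simp

text \<open>The comparison behind most constants \<open>D ^ n\<close> below: \<open>ball x r\<close>
  lies in a ball about \<open>y\<close> that is reached from radius \<open>s\<close> by
  \<open>n\<close> doublings. Only \<open>y\<close> has to belong to the space.\<close>

lemma bm_comp:
  assumes "y \<in> space M" "0 < s" "r + dist x y \<le> 2 ^ n * s"
  shows "bm M x r \<le> D ^ n * bm M y s"
proof -
  have "ball x r \<inter> space M \<subseteq> ball y (2 ^ n * s) \<inter> space M"
  proof
    fix z assume "z \<in> ball x r \<inter> space M"
    then show "z \<in> ball y (2 ^ n * s) \<inter> space M"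
      using dist_triangle[of y z x] assms by (auto simp: dist_commute)
  qed
  then have "bm M x r \<le> bm M y (2 ^ n * s)" unfolding bm_def by (intro finite_measure_mono) auto
  also have "\<dots> \<le> D ^ n * bm M y s" by (rule bm_double_pow) fact+
  finally show ?thesis .
qed

lemma bm_whole: "x \<in> space M \<Longrightarrow> R \<le> r \<Longrightarrow> bm M x r = measure M (space M)"
  unfolding bm_def using dist_less by (intro arg_cong[where f="measure M"]) force

text \<open>The whole space is reached from radius \<open>r\<close> by a number of doublings that
  does not depend on the centre. This turns a small \<open>p\<close>-th power integral into a
  uniform bound for averages at a fixed scale.\<close>

lemma bm_lower_bound:
  assumes "0 < r"
  obtains c where "0 < c" "\<And>x. x \<in> space M \<Longrightarrow> c \<le> bm M x r"
proof -
  obtain n where n: "R / r < 2 ^ n" using real_arch_pow[of 2 "R / r"] by auto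
  show thesis
  proof (cases "space M = {}")
    case False
    then obtain x0 where x0: "x0 \<in> space M" by auto
    have m: "0 < measure M (space M)"
      using bm_pos[OF x0 R_pos] bm_whole[OF x0, of R] by simp
    show thesis
    proof (rule that[of "measure M (space M) / D ^ n"])
      show "0 < measure M (space M) / D ^ n" using m D_ge_1 by simp
      fix x assume x: "x \<in> space M"
      have "measure M (space M) = bm M x R" using bm_whole[OF x, of R] by simp
      also have "\<dots> \<le> D ^ n * bm M x r"
        using n assms x by (intro bm_comp) (auto simp: field_simps)
      finally show "measure M (space M) / D ^ n \<le> bm M x r"
        using D_ge_1 by (simp add: field_simps)
    qed
  qed (use that[of 1] in auto)
qed

text \<open>Packing: the balls of radius \<open>r / 2\<close> about the points are disjoint, lie in
  \<open>ball z (t + r)\<close>, and each carries at least the fraction \<open>1 / D ^ n\<close> of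
  its mass.\<close>

lemma card_separated_ball_le:
  assumes F: "finite F" "F \<subseteq> space M" "\<And>x y. x \<in> F \<Longrightarrow> y \<in> F \<Longrightarrow> x \<noteq> y \<Longrightarrow> r \<le> dist x y"
    and z: "z \<in> space M" "\<And>x. x \<in> F \<Longrightarrow> dist x z < t"
    and r: "0 < r" "0 < t" "2 * t + r \<le> 2 ^ n * (r / 2)"
  shows "real (card F) \<le> D ^ n"
proof -
  define b where "b = bm M z (t + r)"
  have b: "0 < b" using bm_pos z r by (simp add: b_def)
  have disj: "disjoint_family_on (\<lambda>x. ball x (r/2) \<inter> space M) F"
    unfolding disjoint_family_on_def
  proof (intro ballI impI)
    fix x y assume xy: "x \<in> F" "y \<in> F" "x \<noteq> y"
    show "(ball x (r/2) \<inter> space M) \<inter> (ball y (r/2) \<inter> space M) = {}"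
    proof (rule ccontr)
      assume "\<not> ?thesis"
      then obtain w where "dist x w < r/2" "dist y w < r/2" by auto
      then show False using dist_triangle2[of x y w] F(3)[OF xy] by linarith
    qed
  qed
  have "real (card F) * (b / D ^ n) = (\<Sum>x\<in>F. b / D ^ n)" by simp
  also have "\<dots> \<le> (\<Sum>x\<in>F. measure M (ball x (r/2) \<inter> space M))"
  proof (intro sum_mono)
    fix x assume x: "x \<in> F"
    have "t + r + dist z x \<le> 2 ^ n * (r / 2)" using z(2)[OF x] r(3) by (simp add: dist_commute)
    then have "b \<le> D ^ n * bm M x (r/2)" unfolding b_def
      using x F r by (intro bm_comp) auto
    then show "b / D ^ n \<le> measure M (ball x (r/2) \<inter> space M)"
      using D_ge_1 by (simp add: bm_def field_simps)
  qed
  also have "\<dots> = measure M (\<Union>x\<in>F. ball x (r/2) \<inter> space M)"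
    using F disj by (intro finite_measure_finite_Union[symmetric]) auto
  also have "\<dots> \<le> b" unfolding b_def bm_def
  proof (intro finite_measure_mono)
    show "(\<Union>x\<in>F. ball x (r / 2) \<inter> space M) \<subseteq> ball z (t + r) \<inter> space M"
    proof
      fix w assume "w \<in> (\<Union>x\<in>F. ball x (r / 2) \<inter> space M)"
      then obtain x where "x \<in> F" "dist x w < r/2" "w \<in> space M" by auto
      then show "w \<in> ball z (t + r) \<inter> space M"
        using dist_triangle[of z w x] z(2)[of x] r by (auto simp: dist_commute)
    qed
  qed auto
  finally have "b * (real (card F) / D ^ n) \<le> b * 1" by (simp add: mult_ac)
  then have "real (card F) / D ^ n \<le> 1" using b by (rule mult_left_le_imp_le)
  then show ?thesis using D_ge_1 by (simp add: field_simps)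
qed

lemma card_separated_le:
  assumes r: "0 < r"
  obtains n :: nat where
    "\<And>N. N \<subseteq> space M \<Longrightarrow> (\<And>x y. x \<in> N \<Longrightarrow> y \<in> N \<Longrightarrow> x \<noteq> y \<Longrightarrow> r \<le> dist x y) \<Longrightarrow>
       finite N \<and> card N \<le> n"
proof -
  obtain m where "(2 * R + r) / (r / 2) < 2 ^ m" using real_arch_pow[of 2 "(2 * R + r) / (r / 2)"] by auto
  then have m: "2 * R + r \<le> 2 ^ m * (r / 2)" using r by (simp add: field_simps)
  define n where "n = nat \<lceil>D ^ m\<rceil>"
  have fin: "card F \<le> n"
    if F: "finite F" "F \<subseteq> space M" "\<And>x y. x \<in> F \<Longrightarrow> y \<in> F \<Longrightarrow> x \<noteq> y \<Longrightarrow> r \<le> dist x y" for F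
  proof (cases "F = {}")
    case False
    then obtain z where z: "z \<in> F" by auto
    have "real (card F) \<le> D ^ m"
      using F z dist_less R_pos by (intro card_separated_ball_le[OF F _ _ r R_pos m, of z]) (auto simp: subset_eq)
    then show ?thesis unfolding n_def by linarith
  qed simp
  show thesis
  proof (rule that[of n])
    fix N assume N: "N \<subseteq> space M" "\<And>x y. x \<in> N \<Longrightarrow> y \<in> N \<Longrightarrow> x \<noteq> y \<Longrightarrow> r \<le> dist x y"
    have "finite N"
    proof (rule ccontr)
      assume "infinite N"
      then obtain F where F: "F \<subseteq> N" "finite F" "card F = Suc n"
        using infinite_arbitrarily_large by blast
      have "card F \<le> n" using F(1,2) N by (intro fin) blast+
      with F show False by simp
    qed
    then show "finite N \<and> card N \<le> n" using fin N by auto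
  qed
qed

text \<open>Separated sets have bounded cardinality, so one of greatest cardinality exists; a point
  left uncovered could be added to it.\<close>

lemma separated_net_exists:
  assumes r: "0 < r" and S: "S \<subseteq> space M"
  obtains N where "finite N" "N \<subseteq> S" "\<And>x y. x \<in> N \<Longrightarrow> y \<in> N \<Longrightarrow> x \<noteq> y \<Longrightarrow> r \<le> dist x y"
    "S \<subseteq> (\<Union>x\<in>N. ball x r)"
proof -
  define sep where "sep N \<longleftrightarrow> N \<subseteq> S \<and> (\<forall>x\<in>N. \<forall>y\<in>N. x \<noteq> y \<longrightarrow> r \<le> dist x y)" for N
  obtain n where n: "\<And>N. sep N \<Longrightarrow> finite N \<and> card N \<le> n"
    using card_separated_le[OF r] S unfolding sep_def by (metis subset_trans)
  have "sep {}" by (simp add: sep_def)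
  then obtain N where N: "sep N" "\<And>N'. sep N' \<Longrightarrow> card N' \<le> card N"
    using ex_has_greatest_nat[of sep "{}" card "Suc n"] n by (metis le_imp_less_Suc)
  have "S \<subseteq> (\<Union>x\<in>N. ball x r)"
  proof (rule ccontr)
    assume "\<not> ?thesis"
    then obtain x where x: "x \<in> S" "x \<notin> (\<Union>x\<in>N. ball x r)" by blast
    then have x2: "\<And>y. y \<in> N \<Longrightarrow> r \<le> dist y x" by (auto simp: not_less)
    then have "sep (insert x N)" using N(1) x(1) by (auto simp: sep_def dist_commute)
    moreover have "x \<notin> N" using x2[of x] r by auto
    ultimately have "Suc (card N) \<le> card N" using N(2)[of "insert x N"] n[OF N(1)] by simp
    then show False by simp
  qed
  then show thesis using that[of N] N(1) n[OF N(1)] by (auto simp: sep_def)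
qed

lemma sep_borel_M: "sep_borel M"
proof -
  have "\<exists>N. finite N \<and> space M \<subseteq> (\<Union>x\<in>N. ball x (1 / real (Suc n)))" for n
    using separated_net_exists[of "1 / real (Suc n)" "space M"] by (metis order_refl zero_less_divide_1_iff of_nat_0_less_iff zero_less_Suc)
  then obtain N where N: "\<And>n. finite (N n)" "\<And>n. space M \<subseteq> (\<Union>x\<in>N n. ball x (1 / real (Suc n)))"
    by metis
  have "space M \<subseteq> closure (\<Union>n. N n)"
  proof
    fix x assume x: "x \<in> space M"
    show "x \<in> closure (\<Union>n. N n)" unfolding closure_approachable
    proof (intro allI impI)
      fix e :: real assume "0 < e"
      then obtain n where n: "1 / real (Suc n) < e" using nat_approx_posE by blast
      then show "\<exists>y\<in>\<Union>n. N n. dist y x < e" using N(2)[of n] x by (fastforce intro: less_trans)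
    qed
  qed
  moreover have "countable (\<Union>n. N n)" using N(1) by (auto intro: countable_finite)
  ultimately show ?thesis using sets_M by (auto simp: sep_borel_def)
qed

lemma measurable_dist [measurable (raw)]:
  assumes "f \<in> measurable N M" "g \<in> measurable N M"
  shows "(\<lambda>w. dist (f w) (g w)) \<in> borel_measurable N"
  using measurable_dist_sep[OF sep_borel_M sets_M assms] .

lemma measurable_continuous_on:
  assumes "continuous_on (space M) (f :: 'a \<Rightarrow> real)"
  shows "f \<in> borel_measurable M"
  using borel_measurable_continuous_on_restrict[OF assms] measurable_cong_sets[OF sets_M refl] by blast

end

lemma indicator_ball: "indicator (ball x r) y = (if dist x y < r then 1 else 0)"
  by (auto simp: indicator_def)

section \<open>Integrals of the kernel over balls and their complements\<close>

context doubling_space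
begin

text \<open>The mass of a ball is a parameter integral of a jointly measurable indicator.\<close>

lemma measurable_bm [measurable (raw)]:
  assumes [measurable]: "f \<in> measurable N M" "r \<in> borel_measurable N"
  shows "(\<lambda>w. bm M (f w) (r w)) \<in> borel_measurable N"
proof -
  have "bm M x r = enn2real (\<integral>\<^sup>+y. (if dist x y < r then 1 else 0) \<partial>M)" for x r
  proof -
    have "(\<integral>\<^sup>+y. (if dist x y < r then 1 else 0) \<partial>M) = (\<integral>\<^sup>+y. indicator (ball x r \<inter> space M) y \<partial>M)"
      by (intro nn_integral_cong) (auto simp: indicator_def)
    then show ?thesis by (simp add: bm_def measure_def)
  qed
  then show ?thesis by simp
qed

lemma measurable_kern [measurable (raw)]:
  assumes [measurable]: "f \<in> measurable N M" "g \<in> measurable N M"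
  shows "(\<lambda>w. kern M a (f w) (g w)) \<in> borel_measurable N"
  unfolding kern_def by measurable

lemma bm_dist_commute:
  assumes "x \<in> space M" "y \<in> space M"
  shows "bm M x (dist x y) \<le> D * bm M y (dist x y)"
proof (cases "x = y")
  case False
  then show ?thesis using bm_comp[of y "dist x y" "dist x y" x 1] assms by simp
qed (simp add: bm_def)

text \<open>The kernel is centred at its first argument; doubling makes it symmetric up to
  \<open>D\<close>, which suffices for the double integrals.\<close>

lemma kern_commute:
  assumes "x \<in> space M" "y \<in> space M"
  shows "kern M a x y \<le> D * kern M a y x"
proof (cases "x = y")
  case False
  then have pos: "0 < bm M x (dist x y)" "0 < bm M y (dist x y)" using assms bm_pos by auto
  have "1 / bm M x (dist x y) \<le> D / bm M y (dist x y)"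
    using bm_dist_commute[of y x] assms pos by (simp add: field_simps dist_commute)
  then have "dist x y powr - a * (1 / bm M x (dist x y)) \<le> dist x y powr - a * (D / bm M y (dist x y))"
    by (intro mult_left_mono) auto
  then show ?thesis by (simp add: kern_def dist_commute mult.commute)
qed simp

text \<open>On the shell \<open>\<rho> i / 2 \<le> d < \<rho> i\<close> the balls of radius
  \<open>d\<close> and \<open>\<rho> i\<close> have comparable mass, so \<open>1 / bm\<close>
  integrates to at most \<open>D\<close> over the shell and only the decay \<open>c * q ^ i\<close>
  of the power remains. The next two lemmas take shells going inwards and outwards.\<close>

lemma kern_shells:
  assumes x: "x \<in> space M" and q: "0 \<le> q" "q < 1" and c: "0 \<le> c"
    and \<rho>: "\<And>i. 0 < \<rho> i"
    and A[measurable]: "{y \<in> space M. y \<in> A} \<in> sets M"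
    and ex: "\<And>y. y \<in> A \<Longrightarrow> y \<in> space M \<Longrightarrow> x \<noteq> y \<Longrightarrow> \<exists>i::nat. \<rho> i / 2 \<le> dist x y \<and> dist x y < \<rho> i \<and>
                dist x y powr (- a) \<le> c * q ^ i"
  shows "(\<integral>\<^sup>+y\<in>A. ennreal (kern M a x y) \<partial>M) \<le> ennreal (D * c / (1 - q))"
proof -
  have "(\<integral>\<^sup>+y\<in>A. ennreal (kern M a x y) \<partial>M)
      \<le> (\<integral>\<^sup>+y. (\<Sum>i. ennreal (D * c * q ^ i / bm M x (\<rho> i)) * indicator (ball x (\<rho> i) \<inter> space M) y) \<partial>M)"
  proof (intro nn_integral_mono)
    fix y assume y: "y \<in> space M"
    show "ennreal (kern M a x y) * indicator A y
        \<le> (\<Sum>i. ennreal (D * c * q ^ i / bm M x (\<rho> i)) * indicator (ball x (\<rho> i) \<inter> space M) y)"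
    proof (cases "y \<in> A \<and> x \<noteq> y")
      case True
      then obtain i where i: "\<rho> i / 2 \<le> dist x y" "dist x y < \<rho> i" "dist x y powr (- a) \<le> c * q ^ i"
        using ex y by blast
      have "bm M x (\<rho> i) \<le> D * bm M x (\<rho> i / 2)" using bm_double[of x "\<rho> i / 2"] x \<rho>[of i] by simp
      also have "\<dots> \<le> D * bm M x (dist x y)" using bm_mono[OF i(1)] D_ge_1 by (intro mult_left_mono) auto
      finally have b: "bm M x (\<rho> i) \<le> D * bm M x (dist x y)" .
      have pos: "0 < bm M x (\<rho> i)" "0 < bm M x (dist x y)" using bm_pos x \<rho> True by auto
      have "kern M a x y = dist x y powr (- a) * (1 / bm M x (dist x y))" by (simp add: kern_def)
      also have "\<dots> \<le> (c * q ^ i) * (D / bm M x (\<rho> i))"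
        using i(3) b pos D_ge_1 c q by (intro mult_mono mult_nonneg_nonneg zero_le_power) (auto simp: field_simps)
      finally have "ennreal (kern M a x y) * indicator A y
          \<le> ennreal (D * c * q ^ i / bm M x (\<rho> i)) * indicator (ball x (\<rho> i) \<inter> space M) y"
        using True i y by (auto intro!: ennreal_leI simp: mult_ac)
      also have "\<dots> \<le> (\<Sum>i. ennreal (D * c * q ^ i / bm M x (\<rho> i)) * indicator (ball x (\<rho> i) \<inter> space M) y)"
        by (rule sum_le_suminf[where I="{i}", simplified]) auto
      finally show ?thesis .
    qed (auto simp: indicator_def)
  qed
  also have "\<dots> = (\<Sum>i. \<integral>\<^sup>+y. ennreal (D * c * q ^ i / bm M x (\<rho> i)) * indicator (ball x (\<rho> i) \<inter> space M) y \<partial>M)"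
    by (intro nn_integral_suminf) measurable
  also have "\<dots> = (\<Sum>i. ennreal (D * c * q ^ i))"
  proof (intro suminf_cong)
    fix i
    have "0 < bm M x (\<rho> i)" using bm_pos x \<rho> by auto
    then show "(\<integral>\<^sup>+y. ennreal (D * c * q ^ i / bm M x (\<rho> i)) * indicator (ball x (\<rho> i) \<inter> space M) y \<partial>M)
        = ennreal (D * c * q ^ i)"
      using D_ge_1 c q by (simp add: nn_integral_cmult emeasure_ball ennreal_mult'[symmetric])
  qed
  also have "\<dots> = ennreal (D * c / (1 - q))"
    using geometric_sums[of q] q c D_ge_1
    by (intro suminf_ennreal_eq) (auto dest: sums_mult[of _ _ "D * c"])
  finally show ?thesis .
qed

lemma kern_integral_ball:
  assumes a: "0 < a"
  obtains C where "0 \<le> C" "\<And>x r. x \<in> space M \<Longrightarrow> 0 < r \<Longrightarrow>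
      (\<integral>\<^sup>+y\<in>ball x r. ennreal (kern M (- a) x y) \<partial>M) \<le> ennreal (C * r powr a)"
proof -
  define q where "q = (1/2::real) powr a"
  have q: "0 \<le> q" "q < 1"
    using powr_less_mono2[of a "1/2" 1] a by (auto simp: q_def)
  show thesis
  proof (rule that[of "D / (1 - q)"])
    show "0 \<le> D / (1 - q)" using D_ge_1 q by simp
    fix x and r :: real assume x: "x \<in> space M" and r: "0 < r"
    have [measurable]: "{y \<in> space M. y \<in> ball x r} \<in> sets M"
      using ball_in_sets[of x r] by (simp add: Int_def conj_commute)
    have "(\<integral>\<^sup>+y\<in>ball x r. ennreal (kern M (- a) x y) \<partial>M) \<le> ennreal (D * r powr a / (1 - q))"
    proof (rule kern_shells[where \<rho>="\<lambda>i. r / 2 ^ i"])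
      fix y assume y: "y \<in> ball x r" "y \<in> space M" "x \<noteq> y"
      then obtain i where i: "r / 2 ^ i / 2 \<le> dist x y" "dist x y < r / 2 ^ i"
        using shell_in_ball_exists[of "dist x y" r] by auto
      have "dist x y powr a \<le> (r / 2 ^ i) powr a" using i a by (intro powr_mono2) auto
      also have "\<dots> = r powr a * q ^ i"
        unfolding q_def half_powr_power using r by (subst powr_mult[symmetric]) auto
      finally show "\<exists>i. r / 2 ^ i / 2 \<le> dist x y \<and> dist x y < r / 2 ^ i \<and> dist x y powr - (- a) \<le> r powr a * q ^ i"
        using i by auto
    qed (use x q r in auto)
    then show "(\<integral>\<^sup>+y\<in>ball x r. ennreal (kern M (- a) x y) \<partial>M) \<le> ennreal (D / (1 - q) * r powr a)" by simp
  qed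
qed

lemma kern_integral_off_ball:
  assumes a: "0 < a"
  obtains C where "0 \<le> C" "\<And>x r. x \<in> space M \<Longrightarrow> 0 < r \<Longrightarrow>
      (\<integral>\<^sup>+y\<in>- ball x r. ennreal (kern M a x y) \<partial>M) \<le> ennreal (C * r powr (- a))"
proof -
  define q where "q = (1/2::real) powr a"
  have q: "0 \<le> q" "q < 1"
    using powr_less_mono2[of a "1/2" 1] a by (auto simp: q_def)
  show thesis
  proof (rule that[of "D / (1 - q)"])
    show "0 \<le> D / (1 - q)" using D_ge_1 q by simp
    fix x and r :: real assume x: "x \<in> space M" and r: "0 < r"
    have [measurable]: "{y \<in> space M. y \<in> - ball x r} \<in> sets M"
      using sets.compl_sets[OF ball_in_sets[of x r]] by (rule back_subst[where P="\<lambda>A. A \<in> sets M"]) auto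
    have "(\<integral>\<^sup>+y\<in>- ball x r. ennreal (kern M a x y) \<partial>M) \<le> ennreal (D * r powr (- a) / (1 - q))"
    proof (rule kern_shells[where \<rho>="\<lambda>i. r * 2 ^ Suc i"])
      fix y assume y: "y \<in> - ball x r" "y \<in> space M" "x \<noteq> y"
      then obtain i where i: "r * 2 ^ i \<le> dist x y" "dist x y < r * 2 ^ Suc i"
        using shell_off_ball_exists[of r "dist x y"] r by auto
      have "dist x y powr (- a) \<le> (r * 2 ^ i) powr (- a)" using i a r by (intro powr_mono2') auto
      also have "\<dots> = r powr (- a) * q ^ i"
        unfolding q_def half_powr_power using r by (simp add: powr_mult powr_minus powr_divide divide_simps)
      finally show "\<exists>i. r * 2 ^ Suc i / 2 \<le> dist x y \<and> dist x y < r * 2 ^ Suc i \<and> dist x y powr - a \<le> r powr (- a) * q ^ i"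
        using i by auto
    qed (use x q r in auto)
    then show "(\<integral>\<^sup>+y\<in>- ball x r. ennreal (kern M a x y) \<partial>M) \<le> ennreal (D / (1 - q) * r powr (- a))" by simp
  qed
qed

end

section \<open>Weighted averages\<close>

text \<open>The factor 2 makes the weight at least \<open>r\<close> on \<open>ball x r\<close>, so
  the normaliser is at least \<open>r * bm P x r\<close>, while nothing beyond
  \<open>ball x (2 * r)\<close> is seen.\<close>

definition avg :: "'a::metric_space measure \<Rightarrow> real \<Rightarrow> ('a \<Rightarrow> real) \<Rightarrow> 'a \<Rightarrow> real" where
  "avg P r u x = (\<integral>y. max 0 (2 * r - dist x y) * u y \<partial>P) / (\<integral>y. max 0 (2 * r - dist x y) \<partial>P)"

lemma set_nn_integral_space:
  "(\<integral>\<^sup>+y\<in>A \<inter> space P. f y \<partial>P) = (\<integral>\<^sup>+y\<in>A. f y \<partial>P)"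
  by (intro nn_integral_cong) (auto simp: indicator_def)

text \<open>The extension operator averages over the boundary about centres outside it. Averages are
  therefore studied about arbitrary centres, with explicit assumptions on the masses of the balls
  involved.\<close>

locale finite_borel = finite_measure P for P :: "'a::metric_space measure" +
  assumes sets_P: "sets P = sets (restrict_space borel (space P))"
begin

lemma ball_in_sets_P [measurable, simp]: "ball x r \<inter> space P \<in> sets P"
proof -
  have "space P \<inter> ball x r \<in> sets (restrict_space borel (space P))"
    unfolding sets_restrict_space by (intro imageI) simp
  then show ?thesis using sets_P by (simp add: Int_commute)
qed

lemma measurable_dist_P [measurable]: "(\<lambda>y. dist x y) \<in> borel_measurable P"
  using measurable_dist_const[OF sets_P, of x] by (simp add: dist_commute)

lemma measurable_compl_ball_P [measurable]: "(\<lambda>y. indicator (- ball x r) y :: ennreal) \<in> borel_measurable P"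
proof -
  have "(\<lambda>y. indicator (- ball x r) y :: ennreal) = (\<lambda>y. if dist x y < r then 0 else 1)"
    by (auto simp: indicator_def)
  then show ?thesis by simp
qed

lemma bm_mono_P: "r \<le> s \<Longrightarrow> bm P x r \<le> bm P x s"
  unfolding bm_def by (intro finite_measure_mono) auto

lemma integrable_weight:
  assumes "integrable P u"
  shows "integrable P (\<lambda>y. max 0 (2 * r - dist x y) * u y)"
proof (rule Bochner_Integration.integrable_bound[of P "\<lambda>y. max 0 (2 * r) * u y"])
  show "(\<lambda>y. max 0 (2 * r - dist x y) * u y) \<in> borel_measurable P" using assms by measurable
  show "AE y in P. norm (max 0 (2 * r - dist x y) * u y) \<le> norm (max 0 (2 * r) * u y)"
  proof (intro AE_I2)
    fix y
    have "max 0 (2 * r - dist x y) \<le> max 0 (2 * r)" using zero_le_dist[of x y] by linarith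
    then show "norm (max 0 (2 * r - dist x y) * u y) \<le> norm (max 0 (2 * r) * u y)"
      by (simp add: abs_mult mult_right_mono)
  qed
qed (use assms in simp)

lemma integrable_weight1: "integrable P (\<lambda>y. max 0 (2 * r - dist x y))"
  using integrable_weight[of "\<lambda>_. 1" r x] by simp

lemma weight_integral_ge:
  assumes "0 \<le> r"
  shows "r * bm P x r \<le> (\<integral>y. max 0 (2 * r - dist x y) \<partial>P)"
proof -
  have "r * bm P x r = (\<integral>y. r * indicator (ball x r \<inter> space P) y \<partial>P)"
    by (simp add: bm_def)
  also have "\<dots> \<le> (\<integral>y. max 0 (2 * r - dist x y) \<partial>P)"
    using assms by (intro integral_mono integrable_weight1 integrable_mult_right integrable_real_indicator)
      (auto simp: indicator_def less_top[symmetric])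
  finally show ?thesis .
qed

lemma integrable_abs_diff_ball:
  fixes u :: "'a \<Rightarrow> real"
  assumes "integrable P u"
  shows "integrable P (\<lambda>y. \<bar>u y - c\<bar> * indicator (ball x r \<inter> space P) y)"
proof -
  have "integrable P (\<lambda>y. \<bar>u y - c\<bar>)" using assms by simp
  from integrable_real_mult_indicator[OF ball_in_sets_P this] show ?thesis .
qed

text \<open>The weight is at most \<open>2 * r\<close> and its integral at least
  \<open>r * bm P x r\<close>; their quotient gives the factor 2.\<close>

lemma avg_diff_const:
  assumes u: "integrable P u" and r: "0 < r" and m: "0 < bm P x r"
  shows "\<bar>avg P r u x - c\<bar> \<le> 2 / bm P x r * (\<integral>y. \<bar>u y - c\<bar> * indicator (ball x (2 * r) \<inter> space P) y \<partial>P)"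
proof -
  define \<phi> where "\<phi> y = max 0 (2 * r - dist x y)" for y
  define F where "F = (\<integral>y. \<phi> y \<partial>P)"
  define I where "I = (\<integral>y. \<bar>u y - c\<bar> * indicator (ball x (2 * r) \<inter> space P) y \<partial>P)"
  have I0: "0 \<le> I" unfolding I_def by (intro integral_nonneg_AE) auto
  have F: "r * bm P x r \<le> F" using weight_integral_ge[of r x] r by (simp add: F_def \<phi>_def)
  have Fpos: "0 < F" using F r m by (meson less_le_trans mult_pos_pos)
  have int: "integrable P (\<lambda>y. \<phi> y * u y)" "integrable P \<phi>" "integrable P (\<lambda>y. \<phi> y * (u y - c))"
    unfolding \<phi>_def using u by (auto intro!: integrable_weight integrable_weight1)
  have "(\<integral>y. \<phi> y * (u y - c) \<partial>P) = (\<integral>y. \<phi> y * u y - c * \<phi> y \<partial>P)"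
    by (intro Bochner_Integration.integral_cong) (auto simp: algebra_simps)
  also have "\<dots> = (\<integral>y. \<phi> y * u y \<partial>P) - c * F"
    using int by (simp add: F_def)
  finally have eq: "avg P r u x - c = (\<integral>y. \<phi> y * (u y - c) \<partial>P) / F"
    using Fpos unfolding avg_def \<phi>_def[symmetric] F_def[symmetric] by (simp add: field_simps)
  have "\<bar>\<integral>y. \<phi> y * (u y - c) \<partial>P\<bar> \<le> (\<integral>y. \<bar>\<phi> y * (u y - c)\<bar> \<partial>P)" by (rule integral_abs_bound)
  also have "\<dots> \<le> (\<integral>y. 2 * r * (\<bar>u y - c\<bar> * indicator (ball x (2 * r) \<inter> space P) y) \<partial>P)"
  proof (rule integral_mono)
    show "integrable P (\<lambda>y. \<bar>\<phi> y * (u y - c)\<bar>)" using int by simp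
    show "integrable P (\<lambda>y. 2 * r * (\<bar>u y - c\<bar> * indicator (ball x (2 * r) \<inter> space P) y))"
      using integrable_abs_diff_ball[OF u] by (rule integrable_mult_right)
    fix y assume "y \<in> space P"
    then show "\<bar>\<phi> y * (u y - c)\<bar> \<le> 2 * r * (\<bar>u y - c\<bar> * indicator (ball x (2 * r) \<inter> space P) y)"
      using r by (auto simp: \<phi>_def indicator_def abs_mult max_def intro!: mult_right_mono)
  qed
  also have "\<dots> = 2 * r * I" by (simp add: I_def)
  finally have "\<bar>\<integral>y. \<phi> y * (u y - c) \<partial>P\<bar> \<le> 2 * r * I" .
  then have "\<bar>avg P r u x - c\<bar> \<le> 2 * r * I / F"
    unfolding eq using Fpos by (simp add: abs_divide divide_right_mono)
  also have "\<dots> \<le> 2 * r * I / (r * bm P x r)"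
    using F r m I0 Fpos by (intro divide_left_mono mult_pos_pos) auto
  finally show ?thesis using r by (simp add: I_def)
qed

lemma avg_diff_const_powr:
  assumes u: "integrable P u" and r: "0 < r" and m: "0 < bm P x r" and K: "bm P x (2 * r) \<le> K * bm P x r"
    and p: "1 < p"
  shows "epow p (avg P r u x - c)
    \<le> ennreal (2 powr p * K powr (p - 1) / bm P x r) * devint p P u c x (2 * r)"
proof -
  have "0 \<le> K" using K m bm_nonneg[of P x "2*r"] by (meson mult_neg_pos not_le order_trans less_le_trans)
  then have "epow p (avg P r u x - c)
    \<le> ennreal (2 powr p * K powr (p - 1) / bm P x r) *
       (\<integral>\<^sup>+y\<in>ball x (2 * r) \<inter> space P. epow p (u y - c) \<partial>P)"
    using assms
    by (intro powr_le_mean_integral[OF _ _ _ _ _ _ _ _ _ _ avg_diff_const] integrable_abs_diff_ball)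
       (auto simp: bm_def less_top[symmetric])
  then show ?thesis by (simp add: set_nn_integral_space)
qed

text \<open>Centre and radius move together because the extension uses a radius proportional to the
  distance to the boundary. With numerators \<open>A\<close>, \<open>B\<close> and normalisers
  \<open>F\<close>, \<open>G\<close> the difference is
  \<open>(A - B) / F + B * (G - F) / (F * G)\<close>. The two weights differ by at most
  \<open>9 * d\<close>, namely \<open>d\<close> from the centre and \<open>2 * (4 * d)\<close> from
  the radius.\<close>

lemma avg_lipschitz:
  assumes u: "integrable P u" and r: "0 < r" and d: "16 * dist x y \<le> r"
    and r': "\<bar>r - r'\<bar> \<le> 4 * dist x y"
    and m: "0 < bm P x (r / 2)" and K: "bm P x (4 * r) \<le> K * bm P x (r / 2)" and K0: "0 \<le> K"
  shows "\<bar>avg P r u x - avg P r' u y\<bar> \<le> ((9 + 30 * K) * (dist x y / r)) / bm P x (r / 2) *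
           (\<integral>z. \<bar>u z - c\<bar> * indicator (ball x (4 * r) \<inter> space P) z \<partial>P)"
proof -
  define d where "d = dist x y"
  define m where "m = bm P x (r / 2)"
  define \<phi> where "\<phi> z = max 0 (2 * r - dist x z)" for z
  define \<psi> where "\<psi> z = max 0 (2 * r' - dist y z)" for z
  define F where "F = (\<integral>z. \<phi> z \<partial>P)"
  define G where "G = (\<integral>z. \<psi> z \<partial>P)"
  define A where "A = (\<integral>z. \<phi> z * (u z - c) \<partial>P)"
  define B where "B = (\<integral>z. \<psi> z * (u z - c) \<partial>P)"
  define S where "S = ball x (4 * r) \<inter> space P"
  define I where "I = (\<integral>z. \<bar>u z - c\<bar> * indicator S z \<partial>P)"
  have S[measurable]: "S \<in> sets P" by (simp add: S_def)
  have d0: "0 \<le> d" "16 * d \<le> r" using \<open>16 * dist x y \<le> r\<close> by (auto simp: d_def)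
  have rr: "\<bar>r - r'\<bar> \<le> 4 * d" using r' by (simp add: d_def)
  \<comment> \<open>Since \<open>4 * d \<le> r / 4\<close>, the two radii are comparable, and
    everything seen from \<open>y\<close> with radius \<open>r'\<close> stays inside
    \<open>ball x (4 * r)\<close>.\<close>
  have r1: "3/4 * r \<le> r'" "r' \<le> 5/4 * r" "0 < r'" using rr d0 r by linarith+
  have mpos: "0 < m" using m by (simp add: m_def)
  have I0: "0 \<le> I" unfolding I_def by (intro integral_nonneg_AE) auto
  have intI: "integrable P (\<lambda>z. \<bar>u z - c\<bar> * indicator S z)"
    unfolding S_def by (rule integrable_abs_diff_ball[OF u])
  have F: "r * m \<le> F"
  proof -
    have "r * m \<le> r * bm P x r" unfolding m_def using r by (intro mult_left_mono bm_mono_P) auto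
    also have "\<dots> \<le> F" using weight_integral_ge[of r x] r by (simp add: F_def \<phi>_def)
    finally show ?thesis .
  qed
  have G: "3/4 * r * m \<le> G"
  proof -
    have "ball x (r / 2) \<subseteq> ball y r'"
    proof
      fix z assume "z \<in> ball x (r / 2)"
      then show "z \<in> ball y r'" using dist_triangle[of y z x] d0 rr r unfolding d_def by (auto simp: dist_commute)
    qed
    then have "m \<le> bm P y r'" unfolding m_def bm_def by (intro finite_measure_mono) auto
    then have "3/4 * r * m \<le> r' * bm P y r'" using r1 r mpos by (intro mult_mono) auto
    also have "\<dots> \<le> G" using weight_integral_ge[of r' y] r1 by (simp add: G_def \<psi>_def)
    finally show ?thesis .
  qed
  have Fpos: "0 < F" using F r mpos by (meson less_le_trans mult_pos_pos)
  have Gpos: "0 < G" using G r mpos mult_pos_pos[of "3/4 * r" m] by linarith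
  have int: "integrable P (\<lambda>z. \<phi> z * u z)" "integrable P \<phi>" "integrable P (\<lambda>z. \<phi> z * (u z - c))"
    "integrable P (\<lambda>z. \<psi> z * u z)" "integrable P \<psi>" "integrable P (\<lambda>z. \<psi> z * (u z - c))"
    unfolding \<phi>_def \<psi>_def using u by (auto intro!: integrable_weight integrable_weight1)
  have "A = (\<integral>z. \<phi> z * u z - c * \<phi> z \<partial>P)"
    unfolding A_def by (intro Bochner_Integration.integral_cong) (auto simp: algebra_simps)
  also have "\<dots> = (\<integral>z. \<phi> z * u z \<partial>P) - c * F" using int by (simp add: F_def)
  finally have eqA: "avg P r u x - c = A / F"
    using Fpos unfolding avg_def \<phi>_def[symmetric] F_def[symmetric] by (simp add: field_simps)
  have "B = (\<integral>z. \<psi> z * u z - c * \<psi> z \<partial>P)"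
    unfolding B_def by (intro Bochner_Integration.integral_cong) (auto simp: algebra_simps)
  also have "\<dots> = (\<integral>z. \<psi> z * u z \<partial>P) - c * G" using int by (simp add: G_def)
  finally have eqB: "avg P r' u y - c = B / G"
    using Gpos unfolding avg_def \<psi>_def[symmetric] G_def[symmetric] by (simp add: field_simps)
  have diff: "\<bar>\<phi> z - \<psi> z\<bar> \<le> 9 * d * indicator S z" if "z \<in> space P" for z
  proof (cases "z \<in> S")
    case True
    have "\<bar>dist x z - dist y z\<bar> \<le> d" using abs_dist_diff_le[of x z y] by (simp add: d_def dist_commute)
    then have "\<bar>\<phi> z - \<psi> z\<bar> \<le> 9 * d" using rr unfolding \<phi>_def \<psi>_def by linarith
    with True show ?thesis by simp
  next
    case False
    then have "4 * r \<le> dist x z" using that by (auto simp: S_def)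
    moreover have "dist x z \<le> d + dist y z" using dist_triangle[of x z y] by (simp add: d_def)
    ultimately have "\<phi> z = 0" "\<psi> z = 0" using r1 d0 r by (auto simp: \<phi>_def \<psi>_def)
    then show ?thesis using False by simp
  qed
  have psi: "\<bar>\<psi> z\<bar> \<le> 5/2 * r * indicator S z" if "z \<in> space P" for z
  proof (cases "z \<in> S")
    case True
    have "max 0 (2 * r' - dist y z) \<le> 5/2 * r" using r1 zero_le_dist[of y z] r by linarith
    with True show ?thesis by (simp add: \<psi>_def)
  next
    case False
    then have "4 * r \<le> dist x z" using that by (auto simp: S_def)
    moreover have "dist x z \<le> d + dist y z" using dist_triangle[of x z y] by (simp add: d_def)
    ultimately have "\<psi> z = 0" using r1 d0 r by (auto simp: \<psi>_def)
    then show ?thesis using False by simp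
  qed
  have AB: "\<bar>A - B\<bar> \<le> 9 * d * I"
  proof -
    have "\<bar>A - B\<bar> = \<bar>\<integral>z. \<phi> z * (u z - c) - \<psi> z * (u z - c) \<partial>P\<bar>" using int by (simp add: A_def B_def)
    also have "\<dots> \<le> (\<integral>z. \<bar>\<phi> z * (u z - c) - \<psi> z * (u z - c)\<bar> \<partial>P)" by (rule integral_abs_bound)
    also have "\<dots> \<le> (\<integral>z. 9 * d * (\<bar>u z - c\<bar> * indicator S z) \<partial>P)"
    proof (rule integral_mono)
      show "integrable P (\<lambda>z. \<bar>\<phi> z * (u z - c) - \<psi> z * (u z - c)\<bar>)" using int by simp
      show "integrable P (\<lambda>z. 9 * d * (\<bar>u z - c\<bar> * indicator S z))" using intI by (rule integrable_mult_right)
      fix z assume "z \<in> space P"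
      from mult_right_mono[OF diff[OF this], of "\<bar>u z - c\<bar>"]
      show "\<bar>\<phi> z * (u z - c) - \<psi> z * (u z - c)\<bar> \<le> 9 * d * (\<bar>u z - c\<bar> * indicator S z)"
        by (simp add: abs_mult[symmetric] algebra_simps)
    qed
    finally show ?thesis by (simp add: I_def)
  qed
  have Bb: "\<bar>B\<bar> \<le> 5/2 * r * I"
  proof -
    have "\<bar>B\<bar> \<le> (\<integral>z. \<bar>\<psi> z * (u z - c)\<bar> \<partial>P)" unfolding B_def by (rule integral_abs_bound)
    also have "\<dots> \<le> (\<integral>z. 5/2 * r * (\<bar>u z - c\<bar> * indicator S z) \<partial>P)"
    proof (rule integral_mono)
      show "integrable P (\<lambda>z. \<bar>\<psi> z * (u z - c)\<bar>)" using int by simp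
      show "integrable P (\<lambda>z. 5/2 * r * (\<bar>u z - c\<bar> * indicator S z))" using intI by (rule integrable_mult_right)
      fix z assume "z \<in> space P"
      from mult_right_mono[OF psi[OF this], of "\<bar>u z - c\<bar>"]
      show "\<bar>\<psi> z * (u z - c)\<bar> \<le> 5/2 * r * (\<bar>u z - c\<bar> * indicator S z)"
        by (simp only: abs_mult mult_ac)
    qed
    finally show ?thesis by (simp add: I_def)
  qed
  have FG: "\<bar>G - F\<bar> \<le> 9 * d * (K * m)"
  proof -
    have "\<bar>G - F\<bar> = \<bar>\<integral>z. \<psi> z - \<phi> z \<partial>P\<bar>" using int by (simp add: G_def F_def)
    also have "\<dots> \<le> (\<integral>z. \<bar>\<psi> z - \<phi> z\<bar> \<partial>P)" by (rule integral_abs_bound)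
    also have "\<dots> \<le> (\<integral>z. 9 * d * indicator S z \<partial>P)"
    proof (rule integral_mono)
      show "integrable P (\<lambda>z. \<bar>\<psi> z - \<phi> z\<bar>)" using int by simp
      show "integrable P (\<lambda>z. 9 * d * indicator S z)" using S by (intro integrable_mult_right integrable_real_indicator) (auto simp: less_top[symmetric])
      fix z assume "z \<in> space P"
      from diff[OF this] show "\<bar>\<psi> z - \<phi> z\<bar> \<le> 9 * d * indicator S z" by (simp add: abs_minus_commute)
    qed
    also have "\<dots> = 9 * d * bm P x (4 * r)" by (simp add: S_def bm_def)
    also have "\<dots> \<le> 9 * d * (K * m)" using K d0 by (intro mult_left_mono) (auto simp: m_def)
    finally show ?thesis .
  qed
  have "avg P r u x - avg P r' u y = (A - B) / F + B * (G - F) / (F * G)"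
  proof -
    have "avg P r u x - avg P r' u y = A / F - B / G" using eqA eqB by linarith
    also have "\<dots> = (A - B) / F + B * (G - F) / (F * G)" using Fpos Gpos by (simp add: field_simps)
    finally show ?thesis .
  qed
  then have "\<bar>avg P r u x - avg P r' u y\<bar> \<le> \<bar>A - B\<bar> / F + \<bar>B\<bar> * \<bar>G - F\<bar> / (F * G)"
    using Fpos Gpos abs_triangle_ineq[of "(A - B) / F" "B * (G - F) / (F * G)"] by (simp add: abs_mult abs_divide)
  also have "\<dots> \<le> 9 * d * I / (r * m) + (5/2 * r * I) * (9 * d * (K * m)) / ((r * m) * (3/4 * r * m))"
    using AB Bb FG F G I0 d0 K0 mpos r Fpos Gpos
    by (intro add_mono frac_le mult_mono mult_nonneg_nonneg mult_pos_pos) auto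
  \<comment> \<open>The constant 30 is \<open>5/2\<close> times 9 divided by \<open>3/4\<close>,
    from the bound \<open>5/2 * r\<close> of the second weight and the lower bound
    \<open>3/4 * r * m\<close> of its integral.\<close>
  also have "\<dots> = ((9 + 30 * K) * (d / r)) / m * I" using r mpos by (simp add: field_simps)
  finally show ?thesis by (simp add: d_def m_def I_def S_def)
qed

lemma avg_lipschitz_powr:
  assumes u: "integrable P u" and r: "0 < r" and d: "16 * dist x y \<le> r"
    and r': "\<bar>r - r'\<bar> \<le> 4 * dist x y"
    and m: "0 < bm P x (r / 2)" and K: "bm P x (4 * r) \<le> K * bm P x (r / 2)" and K0: "0 \<le> K" and p: "1 < p"
  shows "epow p (avg P r u x - avg P r' u y) \<le>
    ennreal ((9 + 30 * K) powr p * K powr (p - 1) * (dist x y / r) powr p / bm P x (r / 2)) *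
           devint p P u c x (4 * r)"
proof -
  have "epow p (avg P r u x - avg P r' u y) \<le>
    ennreal (((9 + 30 * K) * (dist x y / r)) powr p * K powr (p - 1) / bm P x (r / 2)) *
           (\<integral>\<^sup>+z\<in>ball x (4 * r) \<inter> space P. epow p (u z - c) \<partial>P)"
    using assms
    by (intro powr_le_mean_integral[OF _ _ _ _ _ _ _ _ _ _ avg_lipschitz] integrable_abs_diff_ball)
       (auto simp: bm_def less_top[symmetric])
  also have "((9 + 30 * K) * (dist x y / r)) powr p = (9 + 30 * K) powr p * (dist x y / r) powr p"
    using K0 r by (subst powr_mult) auto
  finally show ?thesis by (simp add: set_nn_integral_space mult_ac)
qed

text \<open>Measurability is asked of the joint distance, so the centres may come from one space and
  the integration points from another.\<close>

lemma measurable_avg: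
  assumes [measurable]: "(\<lambda>(w, y). dist (f w) y) \<in> borel_measurable (N \<Otimes>\<^sub>M P)"
    "\<rho> \<in> borel_measurable N" "u \<in> borel_measurable P"
  shows "(\<lambda>w. avg P (\<rho> w) u (f w)) \<in> borel_measurable N"
  unfolding avg_def by measurable

end

section \<open>Double integrals and sums over scales\<close>

lemma ennreal_powr_le2:
  fixes a b t :: real
  assumes "\<bar>t\<bar> \<le> \<bar>a\<bar> + \<bar>b\<bar>" "1 < p"
  shows "epow p t \<le> ennreal (2 powr p) * (epow p a + epow p b)"
proof -
  have "\<bar>t\<bar> powr p \<le> (\<bar>a\<bar> + \<bar>b\<bar>) powr p" using assms by (intro powr_mono2) auto
  also have "\<dots> \<le> 2 powr p * (\<bar>a\<bar> powr p + \<bar>b\<bar> powr p)" using assms by (intro powr_add_le) auto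
  finally show ?thesis by (simp add: ennreal_mult'[symmetric] ennreal_plus[symmetric] ennreal_leI del: ennreal_plus)
qed

lemma ennreal_powr_le3:
  fixes a b c t :: real
  assumes "\<bar>t\<bar> \<le> \<bar>a\<bar> + \<bar>b\<bar> + \<bar>c\<bar>" "1 < p"
  shows "epow p t \<le>
    ennreal (3 powr p) * (epow p a + epow p b + epow p c)"
proof -
  have "\<bar>t\<bar> powr p \<le> (\<bar>a\<bar> + \<bar>b\<bar> + \<bar>c\<bar>) powr p" using assms by (intro powr_mono2) auto
  also have "\<dots> \<le> 3 powr p * (\<bar>a\<bar> powr p + \<bar>b\<bar> powr p + \<bar>c\<bar> powr p)" using assms by (intro powr_add3_le) auto
  finally show ?thesis by (simp add: ennreal_mult'[symmetric] ennreal_plus[symmetric] ennreal_leI del: ennreal_plus)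
qed

lemma (in sigma_finite_measure) nn_integral_double_cmult:
  assumes f: "(\<lambda>(x, y). f x y) \<in> borel_measurable (N \<Otimes>\<^sub>M M)"
  shows "(\<integral>\<^sup>+x. \<integral>\<^sup>+y. c * f x y \<partial>M \<partial>N) = c * (\<integral>\<^sup>+x. \<integral>\<^sup>+y. f x y \<partial>M \<partial>N)"
proof -
  note f[measurable]
  have "(\<integral>\<^sup>+x. \<integral>\<^sup>+y. c * f x y \<partial>M \<partial>N) = (\<integral>\<^sup>+x. c * (\<integral>\<^sup>+y. f x y \<partial>M) \<partial>N)"
    by (intro nn_integral_cong nn_integral_cmult) measurable
  then show ?thesis by (simp add: nn_integral_cmult)
qed

lemma (in sigma_finite_measure) nn_integral_double_add:
  assumes f: "(\<lambda>(x, y). f x y) \<in> borel_measurable (N \<Otimes>\<^sub>M M)" and g: "(\<lambda>(x, y). g x y) \<in> borel_measurable (N \<Otimes>\<^sub>M M)"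
  shows "(\<integral>\<^sup>+x. \<integral>\<^sup>+y. f x y + g x y \<partial>M \<partial>N) = (\<integral>\<^sup>+x. \<integral>\<^sup>+y. f x y \<partial>M \<partial>N) + (\<integral>\<^sup>+x. \<integral>\<^sup>+y. g x y \<partial>M \<partial>N)"
proof -
  note f[measurable] g[measurable]
  have "(\<integral>\<^sup>+x. \<integral>\<^sup>+y. f x y + g x y \<partial>M \<partial>N) = (\<integral>\<^sup>+x. (\<integral>\<^sup>+y. f x y \<partial>M) + (\<integral>\<^sup>+y. g x y \<partial>M) \<partial>N)"
    by (intro nn_integral_cong nn_integral_add) measurable
  then show ?thesis by (simp add: nn_integral_add)
qed

lemma (in sigma_finite_measure) nn_integral_double_suminf:
  assumes [measurable]: "\<And>j. (\<lambda>(x, y). f j x y) \<in> borel_measurable (M \<Otimes>\<^sub>M M)"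
  shows "(\<integral>\<^sup>+x. \<integral>\<^sup>+y. (\<Sum>j::nat. f j x y) \<partial>M \<partial>M) = (\<Sum>j. \<integral>\<^sup>+x. \<integral>\<^sup>+y. f j x y \<partial>M \<partial>M)"
proof -
  have "(\<integral>\<^sup>+x. \<integral>\<^sup>+y. (\<Sum>j. f j x y) \<partial>M \<partial>M) = (\<integral>\<^sup>+x. (\<Sum>j. \<integral>\<^sup>+y. f j x y \<partial>M) \<partial>M)"
    by (intro nn_integral_cong nn_integral_suminf) measurable
  also have "\<dots> = (\<Sum>j. \<integral>\<^sup>+x. \<integral>\<^sup>+y. f j x y \<partial>M \<partial>M)" by (intro nn_integral_suminf) measurable
  finally show ?thesis .
qed

text \<open>Fubini turns the part with \<open>h y\<close> into the part with \<open>h x\<close>;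
  exchanging the arguments of the kernel costs the factor \<open>c\<close>.\<close>

lemma (in sigma_finite_measure) nn_integral_kernel_symmetric:
  assumes k[measurable]: "(\<lambda>(x, y). k x y) \<in> borel_measurable (M \<Otimes>\<^sub>M M)"
    and h[measurable]: "h \<in> borel_measurable M"
    and sym: "\<And>x y. x \<in> space M \<Longrightarrow> y \<in> space M \<Longrightarrow> k x y \<le> c * k y x"
  shows "(\<integral>\<^sup>+x. \<integral>\<^sup>+y. k x y * (h x + h y) \<partial>M \<partial>M) \<le> (1 + c) * (\<integral>\<^sup>+x. h x * (\<integral>\<^sup>+y. k x y \<partial>M) \<partial>M)"
proof -
  interpret MM: pair_sigma_finite M M by unfold_locales
  have "(\<integral>\<^sup>+x. \<integral>\<^sup>+y. k x y * h y \<partial>M \<partial>M) = (\<integral>\<^sup>+y. \<integral>\<^sup>+x. k x y * h y \<partial>M \<partial>M)"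
    by (rule MM.Fubini'[symmetric]) measurable
  also have "\<dots> \<le> (\<integral>\<^sup>+y. \<integral>\<^sup>+x. c * (h y * k y x) \<partial>M \<partial>M)"
  proof (intro nn_integral_mono)
    fix x y assume "x \<in> space M" "y \<in> space M"
    from mult_right_mono[OF sym[OF this(2,1)], of "h x"]
    show "k y x * h x \<le> c * (h x * k x y)" by (simp add: mult_ac)
  qed
  also have "\<dots> = c * (\<integral>\<^sup>+y. \<integral>\<^sup>+x. h y * k y x \<partial>M \<partial>M)"
    by (intro nn_integral_double_cmult) measurable
  also have "\<dots> = c * (\<integral>\<^sup>+y. h y * (\<integral>\<^sup>+x. k y x \<partial>M) \<partial>M)"
    by (intro arg_cong2[where f="(*)"] nn_integral_cong nn_integral_cmult refl) measurable
  finally have 1: "(\<integral>\<^sup>+x. \<integral>\<^sup>+y. k x y * h y \<partial>M \<partial>M) \<le> c * (\<integral>\<^sup>+y. h y * (\<integral>\<^sup>+x. k y x \<partial>M) \<partial>M)" .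
  have "(\<integral>\<^sup>+x. \<integral>\<^sup>+y. k x y * (h x + h y) \<partial>M \<partial>M)
      = (\<integral>\<^sup>+x. \<integral>\<^sup>+y. h x * k x y \<partial>M \<partial>M) + (\<integral>\<^sup>+x. \<integral>\<^sup>+y. k x y * h y \<partial>M \<partial>M)"
    by (subst nn_integral_double_add[symmetric]) (simp_all add: distrib_left mult.commute)
  also have "(\<integral>\<^sup>+x. \<integral>\<^sup>+y. h x * k x y \<partial>M \<partial>M) = (\<integral>\<^sup>+x. h x * (\<integral>\<^sup>+y. k x y \<partial>M) \<partial>M)"
    by (intro nn_integral_cong nn_integral_cmult) measurable
  finally show ?thesis using 1 by (simp add: distrib_right add_left_mono)
qed

text \<open>The summands grow geometrically in \<open>j\<close> and stop at the last scale above
  \<open>t\<close>, so the sum is comparable to its last term.\<close>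

lemma geometric_scales_ge:
  fixes a R :: real
  assumes a: "0 < a" and R: "0 < R"
  obtains C where "0 \<le> C"
    "\<And>t. 0 < t \<Longrightarrow> (\<Sum>j. if t < R / 2 ^ j then ennreal ((R / 2 ^ j) powr (- a)) else 0) \<le> ennreal (C * t powr (- a))"
proof -
  define q where "q = (1/2::real) powr a"
  have q: "0 \<le> q" "q < 1" using powr_less_mono2[of a "1/2" 1] a by (auto simp: q_def)
  show thesis
  proof (rule that[of "1 / (1 - q)"])
    show "0 \<le> 1 / (1 - q)" using q by simp
    fix t :: real assume t: "0 < t"
    show "(\<Sum>j. if t < R / 2 ^ j then ennreal ((R / 2 ^ j) powr (- a)) else 0) \<le> ennreal (1 / (1 - q) * t powr (- a))"
    proof (cases "t < R")
      case False
      have "\<not> t < R / 2 ^ j" for j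
      proof -
        have "R / 2 ^ j \<le> R" using R by (simp add: field_simps)
        with False show ?thesis by simp
      qed
      then show ?thesis by simp
    next
      case True
      obtain J where J: "R / 2 ^ J / 2 \<le> t" "t < R / 2 ^ J" using shell_in_ball_exists[OF t True] by auto
      have le: "j \<le> J" if "t < R / 2 ^ j" for j
      proof (rule ccontr)
        assume "\<not> j \<le> J"
        then have "(2::real) ^ Suc J \<le> 2 ^ j" by (intro power_increasing) auto
        then have "R / 2 ^ j \<le> R / 2 ^ Suc J" using R by (intro divide_left_mono) auto
        with that J show False by simp
      qed
      have "(\<Sum>j. if t < R / 2 ^ j then ennreal ((R / 2 ^ j) powr (- a)) else 0)
          = (\<Sum>j\<le>J. if t < R / 2 ^ j then ennreal ((R / 2 ^ j) powr (- a)) else 0)"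
        using le by (intro suminf_finite) auto
      also have "\<dots> \<le> (\<Sum>j\<le>J. ennreal (t powr (- a) * q ^ (J - j)))"
      proof (intro sum_mono)
        fix j assume "j \<in> {..J}"
        then have j: "j \<le> J" by simp
        have "(R / 2 ^ j) powr (- a) = (R / 2 ^ J) powr (- a) * (1 / 2 ^ (J - j)) powr a"
        proof -
          have "(2::real) ^ J = 2 ^ j * 2 ^ (J - j)" using j by (simp add: power_add[symmetric])
          then have "R / 2 ^ j = (R / 2 ^ J) * 2 ^ (J - j)" by simp
          then have "(R / 2 ^ j) powr (- a) = (R / 2 ^ J) powr (- a) * (2 ^ (J - j)) powr (- a)"
            using R by (simp only: powr_mult[of "R / 2 ^ J" "2 ^ (J - j)"])
          also have "((2::real) ^ (J - j)) powr (- a) = (1 / 2 ^ (J - j)) powr a"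
            by (simp add: powr_minus powr_divide divide_simps)
          finally show ?thesis .
        qed
        also have "\<dots> \<le> t powr (- a) * q ^ (J - j)"
          unfolding q_def half_powr_power using J t a by (intro mult_right_mono powr_mono2') auto
        finally show "(if t < R / 2 ^ j then ennreal ((R / 2 ^ j) powr (- a)) else 0) \<le> ennreal (t powr (- a) * q ^ (J - j))"
          by (auto intro: ennreal_leI)
      qed
      also have "\<dots> = ennreal (\<Sum>j\<le>J. t powr (- a) * q ^ (J - j))" using q by (intro sum_ennreal) auto
      also have "(\<Sum>j\<le>J. t powr (- a) * q ^ (J - j)) = t powr (- a) * (\<Sum>j\<le>J. q ^ j)"
        unfolding sum_distrib_left by (rule sum.reindex_bij_witness[of _ "\<lambda>j. J - j" "\<lambda>j. J - j"]) auto
      also have "\<dots> \<le> t powr (- a) * (1 / (1 - q))"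
      proof (intro mult_left_mono)
        have "(\<Sum>j\<le>J. q ^ j) \<le> (\<Sum>j. q ^ j)" using q by (intro sum_le_suminf) auto
        also have "\<dots> = 1 / (1 - q)" using q by (intro suminf_geometric) auto
        finally show "(\<Sum>j\<le>J. q ^ j) \<le> 1 / (1 - q)" .
      qed simp
      finally show ?thesis by (simp add: mult.commute ennreal_leI)
    qed
  qed
qed

section \<open>Besov energy and dyadic oscillations\<close>

text \<open>The \<open>p\<close>-th powers of the two parts of the norm, added in
  \<open>ennreal\<close>. For measurable functions its finiteness is membership in the Besov
  space.\<close>

definition besov_total :: "real \<Rightarrow> real \<Rightarrow> 'a::metric_space measure \<Rightarrow> ('a \<Rightarrow> real) \<Rightarrow> ennreal" where
  "besov_total s p M u = (\<integral>\<^sup>+x. epow p (u x) \<partial>M) + besov_energy s p M u"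

text \<open>Mean deviation from the point value. Radius \<open>4 * r\<close> contains all that
  averages of radius \<open>r\<close> about \<open>x\<close> and about nearby points can
  see.\<close>

definition osc :: "real \<Rightarrow> 'a::metric_space measure \<Rightarrow> ('a \<Rightarrow> real) \<Rightarrow> real \<Rightarrow> 'a \<Rightarrow> ennreal" where
  "osc p M u r x = ennreal (1 / bm M x r) * devint p M u (u x) x (4 * r)"

context doubling_space
begin

sublocale finite_borel M by unfold_locales (rule sets_M)

lemma besov_energy_kern:
  "besov_energy s p M u = (\<integral>\<^sup>+x. \<integral>\<^sup>+y. bkern p M (s * p) u x y \<partial>M \<partial>M)"
  unfolding besov_energy_def
proof (intro nn_integral_cong)
  fix x y assume x: "x \<in> space M" and y: "y \<in> space M"
  show "ennreal (\<bar>u y - u x\<bar> powr p / dist x y powr (s * p)) / emeasure M (ball x (dist x y) \<inter> space M)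
      = bkern p M (s * p) u x y"
  proof (cases "x = y")
    case False
    then have "0 < bm M x (dist x y)" using bm_pos x by simp
    then show ?thesis by (simp add: emeasure_ball divide_ennreal kern_def powr_minus divide_simps)
  qed (simp add: kern_def)
qed

lemma besov_total_less_topI:
  assumes "u \<in> besov_space s p M"
  shows "besov_total s p M u < \<infinity>" and "u \<in> borel_measurable M"
proof -
  have u: "u \<in> borel_measurable M" "integrable M (\<lambda>x. \<bar>u x\<bar> powr p)" "besov_energy s p M u < \<infinity>"
    using assms by (auto simp: besov_space_def)
  then show "u \<in> borel_measurable M" by simp
  have "(\<integral>\<^sup>+x. epow p (u x) \<partial>M) < \<infinity>"
    using u(2) by (simp add: integrable_iff_bounded)
  then show "besov_total s p M u < \<infinity>" using u(3) by (simp add: besov_total_def)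
qed

lemma besov_space_iff:
  "u \<in> besov_space s p M \<longleftrightarrow> u \<in> borel_measurable M \<and> besov_total s p M u < \<infinity>"
proof
  assume "u \<in> borel_measurable M \<and> besov_total s p M u < \<infinity>"
  then show "u \<in> besov_space s p M"
    by (auto simp: besov_space_def besov_total_def integrable_iff_bounded)
qed (use besov_total_less_topI in blast)

lemma integrable_of_powr:
  assumes "u \<in> borel_measurable M" "(\<integral>\<^sup>+x. epow p (u x) \<partial>M) < \<infinity>" "1 < p"
  shows "integrable M u"
proof (rule integrableI_bounded)
  have "(\<integral>\<^sup>+x. ennreal (norm (u x)) \<partial>M) \<le> (\<integral>\<^sup>+x. epow p (u x) + 1 \<partial>M)"
  proof (intro nn_integral_mono)
    fix x
    have "\<bar>u x\<bar> \<le> \<bar>u x\<bar> powr p + 1"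
    proof (cases "\<bar>u x\<bar> \<le> 1")
      case False
      then have "\<bar>u x\<bar> powr 1 \<le> \<bar>u x\<bar> powr p" using \<open>1 < p\<close> by (intro powr_mono) auto
      then show ?thesis using False by simp
    qed (use powr_ge_zero[of "\<bar>u x\<bar>" p] in linarith)
    then have "ennreal \<bar>u x\<bar> \<le> ennreal (\<bar>u x\<bar> powr p + 1)" by (rule ennreal_leI)
    then show "ennreal (norm (u x)) \<le> epow p (u x) + 1" by simp
  qed
  also have "\<dots> < \<infinity>" using assms by (subst nn_integral_add) (auto simp: less_top[symmetric])
  finally show "(\<integral>\<^sup>+x. ennreal (norm (u x)) \<partial>M) < \<infinity>" .
qed fact

lemma besov_integrable:
  assumes "u \<in> besov_space s p M" "1 < p"
  shows "integrable M u"
  using besov_total_less_topI[OF assms(1)] assms(2)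
  by (intro integrable_of_powr[of u p]) (auto simp: besov_total_def)

text \<open>Phrased through increments so as to cover sums, differences and maxima at once.\<close>

lemma besov_total_le2:
  assumes u[measurable]: "u \<in> borel_measurable M" and v[measurable]: "v \<in> borel_measurable M" and p: "1 < p"
    and 1: "\<And>x. x \<in> space M \<Longrightarrow> \<bar>w x\<bar> \<le> \<bar>u x\<bar> + \<bar>v x\<bar>"
    and 2: "\<And>x y. x \<in> space M \<Longrightarrow> y \<in> space M \<Longrightarrow> \<bar>w y - w x\<bar> \<le> \<bar>u y - u x\<bar> + \<bar>v y - v x\<bar>"
  shows "besov_total s p M w \<le> ennreal (2 powr p) * (besov_total s p M u + besov_total s p M v)"
proof -
  have "(\<integral>\<^sup>+x. epow p (w x) \<partial>M)
      \<le> (\<integral>\<^sup>+x. ennreal (2 powr p) * (epow p (u x) + epow p (v x)) \<partial>M)"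
    by (intro nn_integral_mono ennreal_powr_le2 1 p)
  also have "\<dots> = ennreal (2 powr p) * ((\<integral>\<^sup>+x. epow p (u x) \<partial>M) + (\<integral>\<^sup>+x. epow p (v x) \<partial>M))"
    by (simp add: nn_integral_cmult nn_integral_add)
  finally have A: "(\<integral>\<^sup>+x. epow p (w x) \<partial>M) \<le> \<dots>" .
  have "besov_energy s p M w \<le> (\<integral>\<^sup>+x. \<integral>\<^sup>+y. ennreal (2 powr p) *
      (bkern p M (s * p) u x y + bkern p M (s * p) v x y) \<partial>M \<partial>M)"
    unfolding besov_energy_kern
  proof (intro nn_integral_mono)
    fix x y assume xy: "x \<in> space M" "y \<in> space M"
    from mult_right_mono[OF ennreal_powr_le2[OF 2[OF xy] p], of "ennreal (kern M (s * p) x y)"]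
    show "bkern p M (s * p) w x y \<le> ennreal (2 powr p) *
      (bkern p M (s * p) u x y + bkern p M (s * p) v x y)"
      by (simp add: ennreal_mult distrib_right mult.assoc)
  qed
  also have "\<dots> = ennreal (2 powr p) * (besov_energy s p M u + besov_energy s p M v)"
    unfolding besov_energy_kern
    by (subst nn_integral_double_cmult, measurable) (subst nn_integral_double_add, measurable)
  finally have B: "besov_energy s p M w \<le> \<dots>" .
  show ?thesis unfolding besov_total_def using add_mono[OF A B] by (simp add: distrib_left add_ac)
qed

lemma besov_total_add:
  assumes "u \<in> borel_measurable M" "v \<in> borel_measurable M" "1 < p"
  shows "besov_total s p M (\<lambda>x. u x + v x) \<le> ennreal (2 powr p) * (besov_total s p M u + besov_total s p M v)"
  by (rule besov_total_le2) (use assms in auto)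

text \<open>Meant for normal contractions such as the absolute value and truncations.\<close>

lemma besov_total_mono:
  assumes p: "1 < p" and 1: "\<And>x. x \<in> space M \<Longrightarrow> \<bar>w x\<bar> \<le> \<bar>u x\<bar>"
    and 2: "\<And>x y. x \<in> space M \<Longrightarrow> y \<in> space M \<Longrightarrow> \<bar>w y - w x\<bar> \<le> \<bar>u y - u x\<bar>"
  shows "besov_total s p M w \<le> besov_total s p M u"
  unfolding besov_total_def besov_energy_kern using p
  by (intro add_mono nn_integral_mono ennreal_leI mult_right_mono powr_mono2 1 2) auto

lemma measurable_osc [measurable]:
  assumes [measurable]: "u \<in> borel_measurable M"
  shows "(\<lambda>x. osc p M u r x) \<in> borel_measurable M"
  unfolding osc_def indicator_ball by measurable

lemma measurable_avg_M [measurable (raw)]: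
  assumes [measurable]: "u \<in> borel_measurable M"
  shows "avg M r u \<in> borel_measurable M"
proof -
  have "(\<lambda>x. avg M r u x) \<in> borel_measurable M"
    by (intro measurable_avg) measurable
  then show ?thesis .
qed

section \<open>Increments of averages and the energy they carry\<close>

lemma avg_diff_le_osc:
  assumes p: "1 < p"
  obtains C where "0 \<le> C" "\<And>u x r. integrable M u \<Longrightarrow> x \<in> space M \<Longrightarrow> 0 < r \<Longrightarrow>
    epow p (avg M r u x - u x) \<le> ennreal C * osc p M u r x"
proof (rule that[of "2 powr p * D powr (p - 1)"])
  fix u :: "'a \<Rightarrow> real" and x and r :: real
  assume u: "integrable M u" and x: "x \<in> space M" and r: "0 < r"
  have "epow p (avg M r u x - u x)
    \<le> ennreal (2 powr p * D powr (p - 1) / bm M x r) * devint p M u (u x) x (2 * r)"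
    using u r x p bm_pos bm_double by (intro avg_diff_const_powr) auto
  also have "\<dots> \<le> ennreal (2 powr p * D powr (p - 1) / bm M x r) * devint p M u (u x) x (4 * r)"
    using r by (intro mult_left_mono nn_integral_mono) (auto simp: indicator_def)
  also have "\<dots> = ennreal (2 powr p * D powr (p - 1)) * osc p M u r x"
    unfolding osc_def mult.assoc[symmetric] by (simp add: ennreal_mult'[symmetric])
  finally show "epow p (avg M r u x - u x) \<le> ennreal (2 powr p * D powr (p - 1)) * osc p M u r x" .
qed simp

lemma avg_lipschitz_osc:
  assumes p: "1 < p"
  obtains C where "0 \<le> C" "\<And>u x y r. integrable M u \<Longrightarrow> x \<in> space M \<Longrightarrow> 0 < r \<Longrightarrow> 16 * dist x y \<le> r \<Longrightarrow>
    epow p (avg M r u x - avg M r u y) \<le> ennreal (C * (dist x y / r) powr p) * osc p M u r x"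
proof -
  define C where "C = (9 + 30 * D ^ 3) powr p * (D ^ 3) powr (p - 1)"
  have C: "0 \<le> C" by (simp add: C_def)
  show thesis
  proof (rule that[of "C * D"])
    fix u :: "'a \<Rightarrow> real" and x y and r :: real
    assume u: "integrable M u" and x: "x \<in> space M" and r: "0 < r" and d: "16 * dist x y \<le> r"
    have m: "0 < bm M x (r / 2)" using bm_pos x r by simp
    have "epow p (avg M r u x - avg M r u y) \<le>
      ennreal ((9 + 30 * D ^ 3) powr p * (D ^ 3) powr (p - 1) * (dist x y / r) powr p / bm M x (r / 2)) *
           devint p M u (u x) x (4 * r)"
    proof (rule avg_lipschitz_powr[OF u r d _ m _ _ p])
      show "bm M x (4 * r) \<le> D ^ 3 * bm M x (r / 2)" using bm_double_pow[OF x, of "r / 2" 3] r by simp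
    qed (use D_ge_1 in auto)
    also have "\<dots> \<le> ennreal (C * D * (dist x y / r) powr p * (1 / bm M x r)) *
           devint p M u (u x) x (4 * r)"
    proof (intro mult_right_mono ennreal_leI)
      have "bm M x r \<le> D * bm M x (r / 2)" using bm_double[OF x, of "r / 2"] r by simp
      then have "1 / bm M x (r / 2) \<le> D * (1 / bm M x r)" using m bm_pos[OF x r] by (simp add: field_simps)
      then have "C * (dist x y / r) powr p * (1 / bm M x (r / 2)) \<le> C * (dist x y / r) powr p * (D * (1 / bm M x r))"
        using C by (intro mult_left_mono mult_nonneg_nonneg) auto
      then show "(9 + 30 * D ^ 3) powr p * (D ^ 3) powr (p - 1) * (dist x y / r) powr p / bm M x (r / 2)
          \<le> C * D * (dist x y / r) powr p * (1 / bm M x r)" by (simp add: C_def mult_ac)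
    qed simp
    also have "\<dots> = ennreal (C * D * (dist x y / r) powr p) * osc p M u r x"
      unfolding osc_def using C D_ge_1 by (simp add: ennreal_mult'[symmetric] mult.assoc[symmetric])
    finally show "epow p (avg M r u x - avg M r u y) \<le> ennreal (C * D * (dist x y / r) powr p) * osc p M u r x" .
  qed (use C D_ge_1 in simp)
qed

abbreviation osc_cut :: "real \<Rightarrow> ('a \<Rightarrow> real) \<Rightarrow> real \<Rightarrow> 'a \<Rightarrow> 'a \<Rightarrow> ennreal" where
  "osc_cut p u r x y \<equiv> ennreal ((min 1 (dist x y / r)) powr p) * (osc p M u r x + osc p M u r y)"

text \<open>If \<open>16 * dist x y \<le> r\<close>, the Lipschitz bound compares the averages.
  Otherwise each is compared with \<open>u\<close> at its own centre; there
  \<open>dist x y / r\<close> is bounded below, so the cut-off factor costs only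
  \<open>16 powr p\<close>. In the estimate for the average minus \<open>u\<close> the increment of
  \<open>u\<close> survives near the diagonal only, which is what lets that part of the energy tend
  to 0.\<close>

lemma avg_increment:
  assumes p: "1 < p"
  obtains C where "0 \<le> C"
    "\<And>u x y r. integrable M u \<Longrightarrow> x \<in> space M \<Longrightarrow> y \<in> space M \<Longrightarrow> 0 < r \<Longrightarrow>
      epow p (avg M r u y - avg M r u x) \<le> ennreal C * (epow p (u y - u x)
         + osc_cut p u r x y)"
    "\<And>u x y r. integrable M u \<Longrightarrow> x \<in> space M \<Longrightarrow> y \<in> space M \<Longrightarrow> 0 < r \<Longrightarrow>
      epow p ((avg M r u y - u y) - (avg M r u x - u x)) \<le> ennreal C * (
          (if 16 * dist x y \<le> r then epow p (u y - u x) else 0)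
         + osc_cut p u r x y)"
proof (rule avg_diff_le_osc[OF p], rule avg_lipschitz_osc[OF p], goal_cases)
  case cst: (1 C1 C2)
  note C1 = cst(2,3) and C2 = cst(4,5)
  define C where "C = 3 powr p * (1 + C2 + 16 powr p * C1)"
  have C0: "0 \<le> C" using C1 C2 by (simp add: C_def)
  have near: "epow p (avg M r u y - avg M r u x)
      \<le> ennreal C2 * (osc_cut p u r x y)"
    if u: "integrable M u" and x: "x \<in> space M" and r: "0 < r" and d: "16 * dist x y \<le> r" for u x y r
  proof -
    have "min 1 (dist x y / r) = dist x y / r" using d r zero_le_dist[of x y] by (simp add: field_simps min_def)
    then have "epow p (avg M r u y - avg M r u x)
        \<le> ennreal C2 * (ennreal ((min 1 (dist x y / r)) powr p) * osc p M u r x)"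
      using C2(2)[OF u x r d] C2(1) by (simp add: abs_minus_commute ennreal_mult mult.assoc)
    also have "\<dots> \<le> ennreal C2 * (osc_cut p u r x y)"
      by (intro mult_left_mono) auto
    finally show ?thesis .
  qed
  have far: "epow p (avg M r u x - u x) + epow p (avg M r u y - u y)
      \<le> ennreal (16 powr p * C1) * (osc_cut p u r x y)"
    if u: "integrable M u" and x: "x \<in> space M" and y: "y \<in> space M" and r: "0 < r" and d: "\<not> 16 * dist x y \<le> r" for u x y r
  proof -
    have m: "1 / 16 \<le> min 1 (dist x y / r)" using d r by (simp add: field_simps min_def)
    have "1 = 16 powr p * (1 / 16) powr p" by (simp add: powr_mult[symmetric])
    also have "\<dots> \<le> 16 powr p * (min 1 (dist x y / r)) powr p"
      using m p by (intro mult_left_mono powr_mono2) auto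
    finally have one: "1 \<le> ennreal (16 powr p) * ennreal ((min 1 (dist x y / r)) powr p)"
      by (simp add: ennreal_mult'[symmetric] ennreal_1[symmetric] ennreal_leI del: ennreal_1)
    have "epow p (avg M r u x - u x) + epow p (avg M r u y - u y)
        \<le> 1 * (ennreal C1 * (osc p M u r x + osc p M u r y))"
      using add_mono[OF C1(2)[OF u x r] C1(2)[OF u y r]] by (simp add: distrib_left)
    also have "\<dots> \<le> ennreal (16 powr p) * ennreal ((min 1 (dist x y / r)) powr p) * (ennreal C1 * (osc p M u r x + osc p M u r y))"
      by (intro mult_right_mono one) auto
    also have "\<dots> = ennreal (16 powr p * C1) * (osc_cut p u r x y)"
      using C1(1) by (simp add: ennreal_mult mult_ac)
    finally show ?thesis .
  qed
  show thesis
  proof (rule that[of C])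
    show "0 \<le> C" by fact
    fix u :: "'a \<Rightarrow> real" and x y and r :: real
    assume u: "integrable M u" and x: "x \<in> space M" and y: "y \<in> space M" and r: "0 < r"
    define Os where "Os = osc_cut p u r x y"
    define U where "U = epow p (u y - u x)"
    let ?F = "ennreal (16 powr p * C1)"
    let ?B = "1 + ennreal C2 + ?F"
    let ?d = "(avg M r u y - u y) - (avg M r u x - u x)"
    have CC: "ennreal C = ennreal (3 powr p) * (?B)"
      using C1(1) C2(1) unfolding C_def by (simp add: ennreal_mult ennreal_plus)
    have w1: "U + ennreal C2 * Os \<le> (?B) * (U + Os)"
    proof -
      have "U + ennreal C2 * Os \<le> (U + Os) + ennreal C2 * (U + Os)" by (intro add_mono mult_left_mono) auto
      also have "\<dots> = (1 + ennreal C2) * (U + Os)" by (simp add: distrib_right)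
      also have "\<dots> \<le> (?B) * (U + Os)" by (intro mult_right_mono) auto
      finally show ?thesis .
    qed
    have w2: "?F * Os \<le> (?B) * Os"
      by (intro mult_right_mono) auto
    have w3: "U + ?F * Os \<le> (?B) * (U + Os)"
    proof -
      have "U + ?F * Os \<le> (U + Os) + ?F * (U + Os)" by (intro add_mono mult_left_mono) auto
      also have "\<dots> = (1 + ?F) * (U + Os)" by (simp add: distrib_right)
      also have "\<dots> \<le> (?B) * (U + Os)" by (intro mult_right_mono add_mono) auto
      finally show ?thesis .
    qed
    have "epow p (avg M r u y - avg M r u x) \<le> ennreal C * (U + Os)"
    proof (cases "16 * dist x y \<le> r")
      case True
      have "epow p (avg M r u y - avg M r u x) \<le> ennreal C2 * Os" unfolding Os_def by (rule near[OF u x r True])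
      also have "\<dots> \<le> 1 * (U + ennreal C2 * Os)" by simp
      also have "\<dots> \<le> ennreal (3 powr p) * ((?B) * (U + Os))"
        using p ge_one_powr_ge_zero[of 3 p] by (intro mult_mono w1) (auto simp: ennreal_1[symmetric] simp del: ennreal_1)
      finally show ?thesis by (simp add: CC mult.assoc)
    next
      case False
      have "epow p (avg M r u y - avg M r u x) \<le> ennreal (3 powr p) *
          (U + epow p (avg M r u x - u x) + epow p (avg M r u y - u y))"
        unfolding U_def using p by (intro ennreal_powr_le3) auto
      also have "\<dots> \<le> ennreal (3 powr p) * (U + ?F * Os)"
        unfolding Os_def add.assoc by (intro mult_left_mono add_left_mono far[OF u x y r False]) auto
      also have "\<dots> \<le> ennreal (3 powr p) * ((?B) * (U + Os))"
        by (intro mult_left_mono w3) auto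
      finally show ?thesis by (simp add: CC mult.assoc)
    qed
    then show "epow p (avg M r u y - avg M r u x) \<le> ennreal C * (epow p (u y - u x)
         + osc_cut p u r x y)"
      by (simp add: U_def Os_def)
    have "epow p (?d) \<le> ennreal C * ((if 16 * dist x y \<le> r then U else 0) + Os)"
    proof (cases "16 * dist x y \<le> r")
      case True
      have "epow p (?d) \<le> ennreal (3 powr p) *
          (U + epow p (avg M r u y - avg M r u x) + epow p 0)"
        unfolding U_def using p by (intro ennreal_powr_le3) auto
      also have "\<dots> \<le> ennreal (3 powr p) * (U + ennreal C2 * Os)"
        using near[OF u x r True] by (intro mult_left_mono) (auto simp: Os_def intro: add_left_mono)
      also have "\<dots> \<le> ennreal (3 powr p) * ((?B) * (U + Os))"
        by (intro mult_left_mono w1) auto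
      finally show ?thesis using True by (simp add: CC mult.assoc)
    next
      case False
      have "epow p (?d) \<le> ennreal (3 powr p) *
          (epow p (avg M r u x - u x) + epow p (avg M r u y - u y) + epow p 0)"
        using p by (intro ennreal_powr_le3) auto
      also have "\<dots> \<le> ennreal (3 powr p) * (?F * Os)"
        using far[OF u x y r False] by (intro mult_left_mono) (auto simp: Os_def)
      also have "\<dots> \<le> ennreal (3 powr p) * ((?B) * Os)"
        by (intro mult_left_mono w2) auto
      finally show ?thesis using False by (simp add: CC mult.assoc)
    qed
    then show "epow p (?d) \<le> ennreal C * (
          (if 16 * dist x y \<le> r then epow p (u y - u x) else 0)
         + osc_cut p u r x y)"
      unfolding U_def Os_def .
  qed
qed

text \<open>Inside \<open>ball x r\<close> the factor \<open>(d / r) powr p\<close> leaves a kernel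
  with the positive power \<open>(1 - s) * p\<close> of the distance, integrable at the centre;
  outside, the decay of order \<open>s * p > 0\<close> is integrable at large distances. Both halves
  of \<open>0 < s < 1\<close> enter here.\<close>

lemma min_kern_integral:
  assumes p: "1 < p" and s: "0 < s" "s < 1"
  obtains C where "0 \<le> C" "\<And>x r. x \<in> space M \<Longrightarrow> 0 < r \<Longrightarrow>
    (\<integral>\<^sup>+y. ennreal ((min 1 (dist x y / r)) powr p * kern M (s * p) x y) \<partial>M) \<le> ennreal (C * r powr (- (s * p)))"
proof -
  define a where "a = (1 - s) * p"
  have a: "0 < a" "0 < s * p" using p s by (auto simp: a_def)
  obtain C1 where C1: "0 \<le> C1" "\<And>x r. x \<in> space M \<Longrightarrow> 0 < r \<Longrightarrow>
      (\<integral>\<^sup>+y\<in>ball x r. ennreal (kern M (- a) x y) \<partial>M) \<le> ennreal (C1 * r powr a)" using kern_integral_ball[OF a(1)] by blast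
  obtain C2 where C2: "0 \<le> C2" "\<And>x r. x \<in> space M \<Longrightarrow> 0 < r \<Longrightarrow>
      (\<integral>\<^sup>+y\<in>- ball x r. ennreal (kern M (s * p) x y) \<partial>M) \<le> ennreal (C2 * r powr (- (s * p)))"
    using kern_integral_off_ball[OF a(2)] by blast
  show thesis
  proof (rule that[of "C1 + C2"])
    show "0 \<le> C1 + C2" using C1 C2 by simp
    fix x and r :: real assume x: "x \<in> space M" and r: "0 < r"
    have [measurable]: "(\<lambda>y. kern M b x y) \<in> borel_measurable M" for b using x by measurable
    have [measurable]: "ball x r \<inter> space M \<in> sets M" by simp
    have [measurable]: "(\<lambda>y. indicator (ball x r) y :: ennreal) \<in> borel_measurable M"
      using x by (simp add: indicator_def[abs_def])
    have "(\<integral>\<^sup>+y. ennreal ((min 1 (dist x y / r)) powr p * kern M (s * p) x y) \<partial>M)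
        \<le> (\<integral>\<^sup>+y. ennreal (r powr (- p)) * (ennreal (kern M (- a) x y) * indicator (ball x r) y)
              + ennreal (kern M (s * p) x y) * indicator (- ball x r) y \<partial>M)"
    proof (intro nn_integral_mono)
      fix y assume y: "y \<in> space M"
      show "ennreal ((min 1 (dist x y / r)) powr p * kern M (s * p) x y)
        \<le> ennreal (r powr (- p)) * (ennreal (kern M (- a) x y) * indicator (ball x r) y)
              + ennreal (kern M (s * p) x y) * indicator (- ball x r) y"
      proof (cases "dist x y < r")
        case True
        then have mn: "min 1 (dist x y / r) = dist x y / r" using r by (simp add: min_def)
        have "(min 1 (dist x y / r)) powr p * kern M (s * p) x y = r powr (- p) * kern M (- a) x y"
          unfolding mn using r by (cases "x = y") (simp_all add: kern_def powr_divide powr_minus a_def powr_add[symmetric] algebra_simps divide_simps powr_diff)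
        then show ?thesis using True r by (simp add: ennreal_mult)
      next
        case False
        then have "min 1 (dist x y / r) = 1" using r by (simp add: min_def)
        then show ?thesis using False by simp
      qed
    qed
    also have "\<dots> = ennreal (r powr (- p)) * (\<integral>\<^sup>+y\<in>ball x r. ennreal (kern M (- a) x y) \<partial>M)
        + (\<integral>\<^sup>+y\<in>- ball x r. ennreal (kern M (s * p) x y) \<partial>M)"
      by (subst nn_integral_add, measurable, subst nn_integral_cmult, measurable)
    also have "\<dots> \<le> ennreal (r powr (- p)) * ennreal (C1 * r powr a) + ennreal (C2 * r powr (- (s * p)))"
      using C1(2)[OF x r] C2(2)[OF x r] by (intro add_mono mult_left_mono) auto
    also have "\<dots> = ennreal ((C1 + C2) * r powr (- (s * p)))"
    proof -
      have "r powr (- p) * (C1 * r powr a) = C1 * r powr (- (s * p))"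
        using r by (simp add: a_def powr_add[symmetric] algebra_simps)
      then show ?thesis using C1 C2 by (simp add: ennreal_mult'[symmetric] ennreal_plus[symmetric] algebra_simps del: ennreal_plus)
    qed
    finally show "(\<integral>\<^sup>+y. ennreal ((min 1 (dist x y / r)) powr p * kern M (s * p) x y) \<partial>M)
       \<le> ennreal ((C1 + C2) * r powr (- (s * p)))" .
  qed
qed

lemma osc_energy_le:
  assumes p: "1 < p" and s: "0 < s" "s < 1"
  obtains C where "0 \<le> C" "\<And>u r. u \<in> borel_measurable M \<Longrightarrow> 0 < r \<Longrightarrow>
    (\<integral>\<^sup>+x. \<integral>\<^sup>+y. ennreal ((min 1 (dist x y / r)) powr p * kern M (s * p) x y) * (osc p M u r x + osc p M u r y) \<partial>M \<partial>M)
     \<le> ennreal (C * r powr (- (s * p))) * (\<integral>\<^sup>+x. osc p M u r x \<partial>M)"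
proof (rule min_kern_integral[OF assms], goal_cases)
  case cst: (1 C)
  note C = cst(2,3)
  show thesis
  proof (rule that[of "(1 + D) * C"])
    show "0 \<le> (1 + D) * C" using C D_ge_1 by simp
    fix u :: "'a \<Rightarrow> real" and r :: real assume u[measurable]: "u \<in> borel_measurable M" and r: "0 < r"
    let ?k = "\<lambda>x y. ennreal ((min 1 (dist x y / r)) powr p * kern M (s * p) x y)"
    have "(\<integral>\<^sup>+x. \<integral>\<^sup>+y. ?k x y * (osc p M u r x + osc p M u r y) \<partial>M \<partial>M)
      \<le> (1 + ennreal D) * (\<integral>\<^sup>+x. osc p M u r x * (\<integral>\<^sup>+y. ?k x y \<partial>M) \<partial>M)"
    proof (rule nn_integral_kernel_symmetric)
      fix x y assume xy: "x \<in> space M" "y \<in> space M"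
      have "(min 1 (dist x y / r)) powr p * kern M (s * p) x y \<le> (min 1 (dist x y / r)) powr p * (D * kern M (s * p) y x)"
        using kern_commute[OF xy] by (intro mult_left_mono) auto
      then show "?k x y \<le> ennreal D * ?k y x"
        using D_ge_1 by (simp add: ennreal_mult'[symmetric] ennreal_leI dist_commute mult_ac)
    qed measurable
    also have "\<dots> \<le> (1 + ennreal D) * (\<integral>\<^sup>+x. osc p M u r x * ennreal (C * r powr (- (s * p))) \<partial>M)"
      by (intro mult_left_mono nn_integral_mono C(2) r) auto
    also have "\<dots> = (1 + ennreal D) * (ennreal (C * r powr (- (s * p))) * (\<integral>\<^sup>+x. osc p M u r x \<partial>M))"
      by (simp add: nn_integral_multc mult.commute)
    also have "\<dots> = ennreal ((1 + D) * C * r powr (- (s * p))) * (\<integral>\<^sup>+x. osc p M u r x \<partial>M)"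
    proof -
      have "(1 + ennreal D) = ennreal (1 + D)" using D_ge_1 by (simp add: ennreal_plus)
      then show ?thesis using C(1) D_ge_1 by (simp add: ennreal_mult mult.assoc)
    qed
    finally show "(\<integral>\<^sup>+x. \<integral>\<^sup>+y. ?k x y * (osc p M u r x + osc p M u r y) \<partial>M \<partial>M)
     \<le> ennreal ((1 + D) * C * r powr (- (s * p))) * (\<integral>\<^sup>+x. osc p M u r x \<partial>M)" .
  qed
qed

text \<open>Sum and integrals are exchanged: a pair at distance \<open>d\<close> contributes only at
  scales \<open>r > d / 4\<close>, where \<open>1 / bm M x r \<le> D ^ 2 / bm M x d\<close>, and the
  sum of \<open>r powr (- (s * p))\<close> over these scales is of order
  \<open>d powr (- (s * p))\<close>. This rebuilds the kernel of the energy.\<close>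

lemma osc_sum_le:
  assumes p: "1 < p" and s: "0 < s"
  obtains C where "0 \<le> C" "\<And>u. u \<in> borel_measurable M \<Longrightarrow>
    (\<Sum>j. ennreal ((R / 2 ^ j) powr (- (s * p))) * (\<integral>\<^sup>+x. osc p M u (R / 2 ^ j) x \<partial>M)) \<le> ennreal C * besov_energy s p M u"
proof (rule geometric_scales_ge[OF mult_pos_pos[OF s less_trans[OF zero_less_one p]] R_pos], goal_cases)
  case cst: (1 C)
  note C = cst(2,3)
  show thesis
  proof (rule that[of "D ^ 2 * (C * 4 powr (s * p))"])
    show "0 \<le> D ^ 2 * (C * 4 powr (s * p))" using C by simp
    fix u :: "'a \<Rightarrow> real" assume u[measurable]: "u \<in> borel_measurable M"
    let ?r = "\<lambda>j::nat. R / 2 ^ j"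
    let ?t = "\<lambda>j x z. ennreal (?r j powr (- (s * p))) * (ennreal (1 / bm M x (?r j)) *
                     (epow p (u z - u x) * indicator (ball x (4 * ?r j)) z))"
    have rpos: "0 < ?r j" for j using R_pos by simp
    have "(\<Sum>j. ennreal (?r j powr (- (s * p))) * (\<integral>\<^sup>+x. osc p M u (?r j) x \<partial>M))
        = (\<integral>\<^sup>+x. (\<Sum>j. ennreal (?r j powr (- (s * p))) * osc p M u (?r j) x) \<partial>M)"
      by (subst nn_integral_suminf) (simp_all add: nn_integral_cmult)
    also have "\<dots> = (\<integral>\<^sup>+x. \<integral>\<^sup>+z. (\<Sum>j. ?t j x z) \<partial>M \<partial>M)"
    proof (intro nn_integral_cong)
      fix x assume x: "x \<in> space M"
      have [measurable]: "(\<lambda>z. indicator (ball x r) z :: ennreal) \<in> borel_measurable M" for r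
        using x unfolding indicator_ball by measurable
      show "(\<Sum>j. ennreal (?r j powr (- (s * p))) * osc p M u (?r j) x) =
        (\<integral>\<^sup>+z. (\<Sum>j. ?t j x z) \<partial>M)"
        unfolding osc_def by (subst nn_integral_suminf) (simp_all add: nn_integral_cmult)
    qed
    also have "\<dots> \<le> (\<integral>\<^sup>+x. \<integral>\<^sup>+z. ennreal (D ^ 2 * (C * 4 powr (s * p))) * bkern p M (s * p) u x z \<partial>M \<partial>M)"
    proof (intro nn_integral_mono)
      fix x z assume x: "x \<in> space M" and z: "z \<in> space M"
      define d where "d = dist x z"
      show "(\<Sum>j. ?t j x z)
        \<le> ennreal (D ^ 2 * (C * 4 powr (s * p))) * bkern p M (s * p) u x z"
      proof (cases "x = z")
        case False
        then have d: "0 < d" by (simp add: d_def)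
        have bd: "0 < bm M x d" using bm_pos x d by simp
        define K where "K = \<bar>u z - u x\<bar> powr p * (D ^ 2 / bm M x d)"
        have K: "0 \<le> K" using D_ge_1 by (simp add: K_def)
        have "(\<Sum>j. ?t j x z)
          \<le> (\<Sum>j. ennreal K * (if d / 4 < ?r j then ennreal (?r j powr (- (s * p))) else 0))"
        proof (intro suminf_le summableI)
          fix j
          show "?t j x z
              \<le> ennreal K * (if d / 4 < ?r j then ennreal (?r j powr (- (s * p))) else 0)"
          proof (cases "d < 4 * ?r j")
            case True
            have "bm M x d \<le> D ^ 2 * bm M x (?r j)"
              using True x rpos[of j] by (intro bm_comp) auto
            then have "1 / bm M x (?r j) \<le> D ^ 2 / bm M x d" using bd bm_pos[OF x rpos[of j]] by (simp add: field_simps)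
            then have "1 / bm M x (?r j) * \<bar>u z - u x\<bar> powr p \<le> K" unfolding K_def
              by (subst mult.commute) (intro mult_left_mono, auto)
            then have "ennreal (1 / bm M x (?r j)) * epow p (u z - u x) \<le> ennreal K"
              by (simp add: ennreal_mult'[symmetric] ennreal_leI)
            then have "ennreal (?r j powr (- (s * p))) * (ennreal (1 / bm M x (?r j)) * epow p (u z - u x))
               \<le> ennreal (?r j powr (- (s * p))) * ennreal K" by (rule mult_left_mono) simp
            then show ?thesis using True by (auto simp: indicator_ball d_def mult.commute)
          qed (simp add: indicator_ball d_def)
        qed
        also have "\<dots> \<le> ennreal K * ennreal (C * (d / 4) powr (- (s * p)))"
          unfolding ennreal_suminf_cmult using C(2)[of "d / 4"] d by (intro mult_left_mono) auto
        also have "\<dots> = ennreal (D ^ 2 * (C * 4 powr (s * p))) * bkern p M (s * p) u x z"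
          using d K C(1) by (simp add: K_def kern_def d_def powr_divide powr_minus ennreal_mult'[symmetric] divide_simps mult_ac)
        finally show ?thesis .
      qed simp
    qed
    also have "\<dots> = ennreal (D ^ 2 * (C * 4 powr (s * p))) * besov_energy s p M u"
      unfolding besov_energy_kern by (intro nn_integral_double_cmult) measurable
    finally show "(\<Sum>j. ennreal (?r j powr (- (s * p))) * (\<integral>\<^sup>+x. osc p M u (?r j) x \<partial>M))
        \<le> ennreal (D ^ 2 * (C * 4 powr (s * p))) * besov_energy s p M u" .
  qed
qed

end

section \<open>Series, almost everywhere limits and suprema\<close>

lemma ennreal_suminf_tendsto_0:
  fixes f :: "nat \<Rightarrow> ennreal"
  assumes "(\<Sum>j. f j) < \<infinity>"
  shows "f \<longlonglongrightarrow> 0"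
proof -
  have fin: "f j < \<infinity>" for j
  proof -
    have "f j \<le> suminf f" using sum_le_suminf[of f "{j}"] by simp
    then show ?thesis using assms by (rule order.strict_trans1)
  qed
  define g where "g j = enn2real (f j)" for j
  have g: "f j = ennreal (g j)" "0 \<le> g j" for j using fin[of j] by (auto simp: g_def)
  have "summable g"
  proof (rule summable_suminf_not_top)
    show "0 \<le> g j" for j by (rule g(2))
    have "(\<Sum>j. ennreal (g j)) = (\<Sum>j. f j)" by (rule suminf_cong) (rule g(1)[symmetric])
    then show "(\<Sum>j. ennreal (g j)) \<noteq> top" using assms by simp
  qed
  then have "(\<lambda>j. ennreal (g j)) \<longlonglongrightarrow> ennreal 0"
    by (intro tendsto_ennrealI summable_LIMSEQ_zero)
  then show ?thesis unfolding g(1)[abs_def, symmetric] by (simp add: g(1)[symmetric])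
qed

lemma AE_tendsto_0_of_suminf:
  fixes f :: "nat \<Rightarrow> 'a \<Rightarrow> ennreal"
  assumes [measurable]: "\<And>n. f n \<in> borel_measurable M" and "(\<Sum>n. \<integral>\<^sup>+x. f n x \<partial>M) < \<infinity>"
  shows "AE x in M. (\<lambda>n. f n x) \<longlonglongrightarrow> 0"
proof -
  have "(\<integral>\<^sup>+x. (\<Sum>n. f n x) \<partial>M) \<noteq> \<infinity>" using assms(2) by (simp add: nn_integral_suminf)
  then have "AE x in M. (\<Sum>n. f n x) \<noteq> \<infinity>" by (intro nn_integral_noteq_infinite) auto
  then show ?thesis
  proof eventually_elim
    fix x assume "(\<Sum>n. f n x) \<noteq> \<infinity>"
    then show "(\<lambda>n. f n x) \<longlonglongrightarrow> 0" by (intro ennreal_suminf_tendsto_0) (simp add: less_top)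
  qed
qed

lemma tendsto_0_of_powr:
  fixes a :: "nat \<Rightarrow> real"
  assumes "(\<lambda>n. epow p (a n)) \<longlonglongrightarrow> 0" "0 < p"
  shows "a \<longlonglongrightarrow> 0"
proof -
  have "(\<lambda>n. \<bar>a n\<bar> powr p) \<longlonglongrightarrow> 0"
    using assms(1) by (simp add: ennreal_tendsto_0_iff)
  then have "(\<lambda>n. (\<bar>a n\<bar> powr p) powr (1 / p)) \<longlonglongrightarrow> 0 powr (1 / p)"
    using assms(2) by (intro tendsto_powr2 tendsto_const) auto
  then show ?thesis using assms(2) by (simp add: powr_powr tendsto_rabs_zero_iff)
qed

lemma (in finite_measure) AE_pair_coordinates:
  assumes "AE x in M. Q x"
  shows "AE z in M \<Otimes>\<^sub>M M. Q (fst z) \<and> Q (snd z)"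
proof -
  obtain N where N: "N \<in> null_sets M" "{x \<in> space M. \<not> Q x} \<subseteq> N"
    using assms by (auto simp: eventually_ae_filter)
  have "N \<times> space M \<union> space M \<times> N \<in> null_sets (M \<Otimes>\<^sub>M M)"
    using N(1) by (intro null_sets.Un) (auto simp: null_sets_def emeasure_pair_measure_Times)
  then show ?thesis
  proof (rule AE_I')
    show "{z \<in> space (M \<Otimes>\<^sub>M M). \<not> (Q (fst z) \<and> Q (snd z))} \<subseteq> N \<times> space M \<union> space M \<times> N"
      using N(2) by (auto simp: space_pair_measure)
  qed
qed

lemma abs_cSUP_diff_le:
  fixes f g :: "nat \<Rightarrow> real"
  assumes "bdd_above (range f)" "bdd_above (range g)" "\<And>j. \<bar>f j - g j\<bar> \<le> e"
  shows "\<bar>(SUP j. f j) - (SUP j. g j)\<bar> \<le> e"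
proof -
  have "(SUP j. f j) \<le> (SUP j. g j) + e"
  proof (rule cSUP_least)
    fix j have "g j \<le> (SUP j. g j)" using assms(2) by (intro cSUP_upper) auto
    then show "f j \<le> (SUP j. g j) + e" using assms(3)[of j] by linarith
  qed simp
  moreover have "(SUP j. g j) \<le> (SUP j. f j) + e"
  proof (rule cSUP_least)
    fix j have "f j \<le> (SUP j. f j)" using assms(1) by (intro cSUP_upper) auto
    then show "g j \<le> (SUP j. f j) + e" using assms(3)[of j] by linarith
  qed simp
  ultimately show ?thesis by linarith
qed

section \<open>Convergence of averages and the maximal function\<close>

text \<open>Soft thresholding: the band \<open>[- c, c]\<close> is collapsed to 0, and
  \<open>t - soft c t\<close> is the truncation of \<open>t\<close> to that band. Both maps are
  1-Lipschitz, so both act on the Besov space.\<close>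

definition soft :: "real \<Rightarrow> real \<Rightarrow> real" where
  "soft c t = t - max (- c) (min c t)"

lemma soft_lipschitz: "\<bar>soft c t - soft c s\<bar> \<le> \<bar>t - s\<bar>"
  unfolding soft_def by (auto simp: max_def min_def)

lemma clamp_lipschitz: "\<bar>(t - soft c t) - (s - soft c s)\<bar> \<le> \<bar>t - s\<bar>"
  unfolding soft_def by (auto simp: max_def min_def)

lemma soft_le: "0 \<le> c \<Longrightarrow> \<bar>soft c t\<bar> \<le> \<bar>t\<bar>"
  unfolding soft_def by (auto simp: max_def min_def)

lemma clamp_le: "0 \<le> c \<Longrightarrow> \<bar>t - soft c t\<bar> \<le> c" "0 \<le> c \<Longrightarrow> \<bar>t - soft c t\<bar> \<le> \<bar>t\<bar>"
  unfolding soft_def by (auto simp: max_def min_def)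

lemma soft_eq_0: "\<bar>t\<bar> \<le> c \<Longrightarrow> soft c t = 0"
  unfolding soft_def by (auto simp: max_def min_def)

lemma measurable_soft [measurable]: "soft c \<in> borel_measurable borel"
  unfolding soft_def[abs_def] by measurable

context doubling_space
begin

definition scale :: "nat \<Rightarrow> real" where "scale j = R / 2 ^ j"

lemma scale_pos [simp]: "0 < scale j" using R_pos by (simp add: scale_def)

lemma scale_neq_0 [simp]: "scale j \<noteq> 0" by (rule less_imp_neq[OF scale_pos, symmetric])

lemma scale_nonneg [simp]: "0 \<le> scale j" by (rule less_imp_le[OF scale_pos])

lemma scale_le: "scale j \<le> R"
  using R_pos by (simp add: scale_def field_simps)

lemma scale_tendsto: "scale \<longlonglongrightarrow> 0"
  unfolding scale_def using LIMSEQ_inverse_realpow_zero[of 2] by (auto simp: divide_inverse intro: tendsto_mult_right_zero)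

text \<open>The weighted oscillations are the terms of a convergent series and tend to 0. What
  remains is the energy of \<open>u\<close> over pairs with
  \<open>16 * dist x y \<le> scale j\<close>, which tends to 0 by dominated convergence on the
  product space. The \<open>p\<close>-th power integral comes without weight; as all scales are at
  most \<open>R\<close>, the weight can be put back.\<close>

lemma avg_total_tendsto:
  assumes p: "1 < p" and s: "0 < s" "s < 1" and uB: "u \<in> besov_space s p M"
  shows "(\<lambda>j. besov_total s p M (\<lambda>x. avg M (scale j) u x - u x)) \<longlonglongrightarrow> 0"
proof (rule avg_increment[OF p],
    rule avg_diff_le_osc[OF p],
    rule osc_energy_le[OF p s],
    rule osc_sum_le[OF p s(1)], goal_cases)
  case cst: (1 C C1 C2 C3)
  note C = cst(1,3) and C1 = cst(4,5) and C2 = cst(6,7) and C3 = cst(8,9)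
  have u[measurable]: "u \<in> borel_measurable M" and uf: "besov_energy s p M u < \<infinity>"
    using uB by (auto simp: besov_space_def)
  have ui: "integrable M u" using besov_integrable[OF uB p] .
  define a where "a j = ennreal (scale j powr (- (s * p))) * (\<integral>\<^sup>+x. osc p M u (scale j) x \<partial>M)" for j
  have "(\<Sum>j. a j) < \<infinity>"
    using C3(2)[OF u] uf by (auto simp: a_def scale_def ennreal_mult_less_top elim: order.strict_trans1)
  then have a0: "a \<longlonglongrightarrow> 0" by (rule ennreal_suminf_tendsto_0)
  define e where "e j x y = (if 16 * dist x y \<le> scale j then bkern p M (s * p) u x y else 0)" for j x y
  define t where "t j = (\<integral>\<^sup>+x. \<integral>\<^sup>+y. e j x y \<partial>M \<partial>M)" for j
  interpret MM: pair_sigma_finite M M by unfold_locales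
  have t0: "t \<longlonglongrightarrow> 0"
  proof -
    have "(\<lambda>j. \<integral>\<^sup>+z. e j (fst z) (snd z) \<partial>(M \<Otimes>\<^sub>M M)) \<longlonglongrightarrow> (\<integral>\<^sup>+z. 0 \<partial>(M \<Otimes>\<^sub>M M))"
    proof (rule nn_integral_dominated_convergence[where w="\<lambda>z. ennreal (\<bar>u (snd z) - u (fst z)\<bar> powr p * kern M (s * p) (fst z) (snd z))"])
      show "(\<integral>\<^sup>+z. ennreal (\<bar>u (snd z) - u (fst z)\<bar> powr p * kern M (s * p) (fst z) (snd z)) \<partial>(M \<Otimes>\<^sub>M M)) < \<infinity>"
        using uf unfolding besov_energy_kern by (subst nn_integral_fst[symmetric]) auto
      show "AE z in M \<Otimes>\<^sub>M M. (\<lambda>j. e j (fst z) (snd z)) \<longlonglongrightarrow> 0"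
      proof (intro AE_I2)
        fix z
        show "(\<lambda>j. e j (fst z) (snd z)) \<longlonglongrightarrow> 0"
        proof (cases "fst z = snd z")
          case False
          then have "0 < 16 * dist (fst z) (snd z)" by simp
          then have "\<forall>\<^sub>F j in sequentially. scale j < 16 * dist (fst z) (snd z)"
            by (intro order_tendstoD(2)[OF scale_tendsto])
          then have "\<forall>\<^sub>F j in sequentially. e j (fst z) (snd z) = 0"
            by eventually_elim (auto simp: e_def)
          then show ?thesis by (rule tendsto_eventually)
        next
          case True
          then have "e j (fst z) (snd z) = 0" for j unfolding e_def True by simp
          then show ?thesis by simp
        qed
      qed
    qed (auto simp: e_def)
    moreover have "t j = (\<integral>\<^sup>+z. e j (fst z) (snd z) \<partial>(M \<Otimes>\<^sub>M M))" for j
    proof -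
      have "(\<lambda>z. e j (fst z) (snd z)) \<in> borel_measurable (M \<Otimes>\<^sub>M M)" unfolding e_def by measurable
      from nn_integral_fst[OF this] show ?thesis by (simp only: t_def fst_conv snd_conv)
    qed
    then have "t = (\<lambda>j. \<integral>\<^sup>+z. e j (fst z) (snd z) \<partial>(M \<Otimes>\<^sub>M M))" by (rule ext)
    ultimately show ?thesis by simp
  qed
  have osc_a: "(\<integral>\<^sup>+x. osc p M u (scale j) x \<partial>M) \<le> ennreal (R powr (s * p)) * a j" for j
  proof -
    have "1 = scale j powr (s * p) * scale j powr (- (s * p))" by (simp add: powr_add[symmetric])
    also have "\<dots> \<le> R powr (s * p) * scale j powr (- (s * p))"
      using scale_le[of j] p s scale_pos[of j] by (intro mult_right_mono powr_mono2) auto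
    finally have "1 * (\<integral>\<^sup>+x. osc p M u (scale j) x \<partial>M) \<le> ennreal (R powr (s * p) * scale j powr (- (s * p))) * (\<integral>\<^sup>+x. osc p M u (scale j) x \<partial>M)"
      by (intro mult_right_mono) (auto simp: ennreal_1[symmetric] simp del: ennreal_1 intro: ennreal_leI)
    then show ?thesis by (simp add: a_def ennreal_mult mult.assoc)
  qed
  define b where "b j = ennreal C1 * (ennreal (R powr (s * p)) * a j) + ennreal C * (t j + ennreal C2 * a j)" for j
  have bound: "besov_total s p M (\<lambda>x. avg M (scale j) u x - u x) \<le> b j" for j
  proof -
    have "(\<integral>\<^sup>+x. epow p (avg M (scale j) u x - u x) \<partial>M) \<le> (\<integral>\<^sup>+x. ennreal C1 * osc p M u (scale j) x \<partial>M)"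
      by (intro nn_integral_mono C1(2)[OF ui]) auto
    also have "\<dots> = ennreal C1 * (\<integral>\<^sup>+x. osc p M u (scale j) x \<partial>M)" by (simp add: nn_integral_cmult)
    also have "\<dots> \<le> ennreal C1 * (ennreal (R powr (s * p)) * a j)" by (intro mult_left_mono osc_a) auto
    finally have A: "(\<integral>\<^sup>+x. epow p (avg M (scale j) u x - u x) \<partial>M) \<le> \<dots>" .
    let ?k = "\<lambda>x y. ennreal ((min 1 (dist x y / scale j)) powr p * kern M (s * p) x y) * (osc p M u (scale j) x + osc p M u (scale j) y)"
    have "besov_energy s p M (\<lambda>x. avg M (scale j) u x - u x) \<le> (\<integral>\<^sup>+x. \<integral>\<^sup>+y. ennreal C * (e j x y + ?k x y) \<partial>M \<partial>M)"
      unfolding besov_energy_kern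
    proof (intro nn_integral_mono)
      fix x y assume xy: "x \<in> space M" "y \<in> space M"
      from mult_right_mono[OF C(2)[OF ui xy scale_pos[of j]], of "ennreal (kern M (s * p) x y)"]
      show "ennreal (\<bar>avg M (scale j) u y - u y - (avg M (scale j) u x - u x)\<bar> powr p * kern M (s * p) x y)
         \<le> ennreal C * (e j x y + ?k x y)"
        by (auto simp: e_def ennreal_mult distrib_left distrib_right mult_ac split: if_splits)
    qed
    also have "\<dots> = ennreal C * (\<integral>\<^sup>+x. \<integral>\<^sup>+y. e j x y + ?k x y \<partial>M \<partial>M)"
      unfolding e_def by (intro nn_integral_double_cmult) measurable
    also have "(\<integral>\<^sup>+x. \<integral>\<^sup>+y. e j x y + ?k x y \<partial>M \<partial>M) = t j + (\<integral>\<^sup>+x. \<integral>\<^sup>+y. ?k x y \<partial>M \<partial>M)"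
      unfolding e_def t_def by (intro nn_integral_double_add) measurable
    also have "\<dots> \<le> t j + ennreal C2 * a j"
      using C2(2)[OF u scale_pos[of j]] C2(1) by (intro add_left_mono) (simp add: a_def ennreal_mult mult.assoc)
    finally have B: "besov_energy s p M (\<lambda>x. avg M (scale j) u x - u x) \<le> ennreal C * (t j + ennreal C2 * a j)"
      by (auto simp: mult_left_mono)
    show ?thesis unfolding besov_total_def b_def by (intro add_mono A B)
  qed
  have "b \<longlonglongrightarrow> ennreal C1 * (ennreal (R powr (s * p)) * 0) + ennreal C * (0 + ennreal C2 * 0)"
    unfolding b_def by (intro tendsto_add ennreal_tendsto_cmult a0 t0) auto
  then have "b \<longlonglongrightarrow> 0" by simp
  then show ?thesis
    by (rule tendsto_sandwich[OF _ _ tendsto_const, rotated 2]) (use bound in auto)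
qed

lemma avg_nonneg: "(\<And>x. 0 \<le> u x) \<Longrightarrow> 0 \<le> avg M r u x"
  unfolding avg_def by (intro divide_nonneg_nonneg integral_nonneg_AE AE_I2) auto

text \<open>The function \<open>w\<close> is the dyadic maximal function of
  \<open>\<bar>v\<bar>\<close>, divided by the level and cut at 1. The \<open>p\<close>-th power of
  a supremum over scales is at most the sum over scales, and the oscillations are summable over the
  scales against the Besov weight; so passing to the supremum costs a constant, and the level enters
  as \<open>\<kappa> powr (- p)\<close>.\<close>

lemma maximal_weak_type:
  assumes p: "1 < p" and s: "0 < s" "s < 1"
  obtains C where "0 \<le> C" "\<And>v \<kappa>. v \<in> besov_space s p M \<Longrightarrow> 0 < \<kappa> \<Longrightarrow>
     \<exists>w\<in>borel_measurable M. besov_total s p M w \<le> ennreal (C * \<kappa> powr (- p)) * besov_total s p M v \<and>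
        (\<forall>x\<in>space M. 0 \<le> w x \<and> w x \<le> 1 \<and> (\<forall>j. \<kappa> < avg M (scale j) (\<lambda>y. \<bar>v y\<bar>) x \<longrightarrow> w x = 1))"
proof (rule avg_increment[OF p],
    rule avg_diff_le_osc[OF p],
    rule osc_energy_le[OF p s],
    rule osc_sum_le[OF p s(1)], goal_cases)
  case cst: (1 C C1 C2 C3)
  note C = cst(2,3) and C1 = cst(5,6) and C2 = cst(7,8) and C3 = cst(9,10)
  define K where "K = 2 powr p * (1 + C1 * R powr (s * p) * C3) + C * (1 + C2 * C3)"
  have K0: "0 \<le> K" using C C1 C2 C3 by (simp add: K_def)
  show thesis
  proof (rule that[of K])
    show "0 \<le> K" by fact
    fix v0 :: "'a \<Rightarrow> real" and \<kappa> :: real assume v0: "v0 \<in> besov_space s p M" and l: "0 < \<kappa>"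
    define v where "v x = \<bar>v0 x\<bar>" for x
    have v0m[measurable]: "v0 \<in> borel_measurable M" using v0 by (simp add: besov_space_def)
    have vm[measurable]: "v \<in> borel_measurable M" unfolding v_def by measurable
    have vN: "besov_total s p M v \<le> besov_total s p M v0"
      using p by (intro besov_total_mono) (auto simp: v_def)
    have vi: "integrable M v" using besov_integrable[OF v0 p] by (simp add: v_def[abs_def])
    define f where "f j x = min 1 (avg M (scale j) v x / \<kappa>)" for j x
    define w where "w x = (SUP j. f j x)" for x
    have A0: "0 \<le> avg M (scale j) v x" for j x by (rule avg_nonneg) (simp add: v_def)
    have f01: "0 \<le> f j x" "f j x \<le> 1" for j x using A0 l by (auto simp: f_def)
    have bdd: "bdd_above (range (\<lambda>j. f j x))" for x using f01 by (intro bdd_aboveI[of _ 1]) auto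
    have wm[measurable]: "w \<in> borel_measurable M"
      unfolding w_def f_def by (rule borel_measurable_cSUP) (use bdd f_def in auto)
    have w01: "0 \<le> w x" "w x \<le> 1" for x
    proof -
      show "w x \<le> 1" unfolding w_def by (rule cSUP_least) (use f01 in auto)
      show "0 \<le> w x" unfolding w_def using cSUP_upper[OF UNIV_I bdd[of x], of 0] f01(1)[of 0 x] by linarith
    qed
    have w1: "w x = 1" if "\<kappa> < avg M (scale j) v x" for x j
    proof -
      have "f j x = 1" using that l by (simp add: f_def min_def)
      then show ?thesis using cSUP_upper[OF UNIV_I bdd[of x], of j] w01[of x] by (simp add: w_def)
    qed
    let ?k = "\<lambda>j x y. ennreal ((min 1 (dist x y / scale j)) powr p * kern M (s * p) x y) * (osc p M v (scale j) x + osc p M v (scale j) y)"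
    let ?b = "\<lambda>x y. bkern p M (s * p) v x y + (\<Sum>j. ?k j x y)"
    let ?m = "\<lambda>x. ennreal (2 powr p) * (epow p (v x) + ennreal C1 * (\<Sum>j. osc p M v (scale j) x))"
    let ?L = "ennreal (2 powr p * (1 + C1 * R powr (s * p) * C3)) * besov_total s p M v"
    let ?l = "ennreal (\<kappa> powr (- p))"
    let ?o = "\<lambda>j. \<integral>\<^sup>+x. osc p M v (scale j) x \<partial>M"
    \<comment> \<open>An infinite \<open>X\<close> is harmless: the factor
      \<open>\<kappa> powr (- p)\<close> is positive, so the right side is then infinite.\<close>
    have powr_bound: "epow p b \<le> ?l * X" if "X < \<infinity> \<Longrightarrow> \<bar>b\<bar> \<le> enn2real X powr (1 / p) / \<kappa>" for b X
    proof (cases "X < \<infinity>")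
      case True
      then have "\<bar>b\<bar> powr p \<le> (enn2real X powr (1 / p) / \<kappa>) powr p" using that p by (intro powr_mono2) auto
      also have "\<dots> = \<kappa> powr (- p) * enn2real X"
        using l p by (simp add: powr_divide powr_powr powr_minus divide_simps)
      finally have "epow p b \<le> ?l * ennreal (enn2real X)"
        by (simp add: ennreal_mult'[symmetric] ennreal_leI)
      then show ?thesis using True by simp
    next
      case False
      then have "X = top" by (metis infinity_ennreal_def top.not_eq_extremum)
      then show ?thesis using l by (simp add: ennreal_mult_top)
    qed
    have root: "\<bar>b\<bar> \<le> enn2real X powr (1 / p)" if "epow p b \<le> X" "X < \<infinity>" for b X
    proof -
      have "\<bar>b\<bar> powr p \<le> enn2real X" using that enn2real_mono[of "epow p b" X] by simp
      then have "(\<bar>b\<bar> powr p) powr (1 / p) \<le> enn2real X powr (1 / p)" using p by (intro powr_mono2) auto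
      then show ?thesis using p by (simp add: powr_powr)
    qed
    have diff: "bkern p M (s * p) w x y \<le> ?l *
        (ennreal C * ?b x y)"
      if x: "x \<in> space M" and y: "y \<in> space M" for x y
    proof -
      \<comment> \<open>One bound for the increments of all averages: it contains the whole sum over
        scales, does not depend on \<open>j\<close>, and so passes to the supremum.\<close>
      define X where "X = ennreal C * (epow p (v y - v x) +
          (\<Sum>j. osc_cut p v (scale j) x y))"
      have XA: "epow p (avg M (scale j) v y - avg M (scale j) v x) \<le> X" for j
      proof -
        have "epow p (avg M (scale j) v y - avg M (scale j) v x) \<le> ennreal C * (epow p (v y - v x)
         + osc_cut p v (scale j) x y)"
          by (rule C(2)[OF vi x y scale_pos])
        also have "\<dots> \<le> X" unfolding X_def
          by (intro mult_left_mono add_left_mono sum_le_suminf[where I="{j}" and f="\<lambda>j. osc_cut p v (scale j) x y", simplified]) auto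
        finally show ?thesis .
      qed
      have "epow p (w y - w x) \<le> ?l * X"
      proof (rule powr_bound)
        assume fin: "X < \<infinity>"
        show "\<bar>w y - w x\<bar> \<le> enn2real X powr (1 / p) / \<kappa>" unfolding w_def
        proof (rule abs_cSUP_diff_le[OF bdd bdd])
          fix j
          have "\<bar>f j y - f j x\<bar> \<le> \<bar>avg M (scale j) v y / \<kappa> - avg M (scale j) v x / \<kappa>\<bar>"
            unfolding f_def by (auto simp: min_def)
          also have "\<dots> = \<bar>avg M (scale j) v y - avg M (scale j) v x\<bar> / \<kappa>"
            using l by (simp add: diff_divide_distrib[symmetric])
          also have "\<dots> \<le> enn2real X powr (1 / p) / \<kappa>"
            using root[OF XA fin] l by (intro divide_right_mono) auto
          finally show "\<bar>f j y - f j x\<bar> \<le> enn2real X powr (1 / p) / \<kappa>" .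
        qed
      qed
      from mult_right_mono[OF this, of "ennreal (kern M (s * p) x y)"]
      have "bkern p M (s * p) w x y \<le> ?l * (X * ennreal (kern M (s * p) x y))"
        by (simp add: ennreal_mult mult.assoc)
      also have "X * ennreal (kern M (s * p) x y) = ennreal C * ?b x y"
      proof -
        have "(\<Sum>j. ?k j x y) = (\<Sum>j. osc_cut p v (scale j) x y) * ennreal (kern M (s * p) x y)"
          unfolding ennreal_suminf_multc[symmetric] by (intro suminf_cong) (simp add: ennreal_mult mult_ac)
        then show ?thesis unfolding X_def by (simp add: ennreal_mult distrib_right mult.assoc)
      qed
      finally show ?thesis .
    qed
    define a where "a j = ennreal (scale j powr (- (s * p))) * ?o j" for j
    have sa: "(\<Sum>j. a j) \<le> ennreal C3 * besov_energy s p M v"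
      using C3(2)[OF vm] by (simp add: a_def scale_def)
    have E: "besov_energy s p M w \<le> ?l * (ennreal (C * (1 + C2 * C3)) * besov_energy s p M v)"
    proof -
      have "besov_energy s p M w \<le> (\<integral>\<^sup>+x. \<integral>\<^sup>+y. ?l *
        (ennreal C * ?b x y) \<partial>M \<partial>M)"
        unfolding besov_energy_kern by (intro nn_integral_mono diff)
      also have "\<dots> = ?l * (\<integral>\<^sup>+x. \<integral>\<^sup>+y.
        ennreal C * ?b x y \<partial>M \<partial>M)"
        by (intro nn_integral_double_cmult) measurable
      also have "(\<integral>\<^sup>+x. \<integral>\<^sup>+y. ennreal C * ?b x y \<partial>M \<partial>M)
         = ennreal C * (\<integral>\<^sup>+x. \<integral>\<^sup>+y. ?b x y \<partial>M \<partial>M)"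
        by (intro nn_integral_double_cmult) measurable
      also have "(\<integral>\<^sup>+x. \<integral>\<^sup>+y. ?b x y \<partial>M \<partial>M)
         = besov_energy s p M v + (\<integral>\<^sup>+x. \<integral>\<^sup>+y. (\<Sum>j. ?k j x y) \<partial>M \<partial>M)"
        unfolding besov_energy_kern by (intro nn_integral_double_add) measurable
      also have "(\<integral>\<^sup>+x. \<integral>\<^sup>+y. (\<Sum>j. ?k j x y) \<partial>M \<partial>M) = (\<Sum>j. \<integral>\<^sup>+x. \<integral>\<^sup>+y. ?k j x y \<partial>M \<partial>M)"
        by (rule nn_integral_double_suminf) measurable
      also have "\<dots> \<le> (\<Sum>j. ennreal C2 * a j)"
        using C2(2)[OF vm scale_pos] C2(1) by (intro suminf_le summableI) (auto simp: a_def ennreal_mult mult.assoc)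
      also have "\<dots> \<le> ennreal C2 * (ennreal C3 * besov_energy s p M v)"
        unfolding ennreal_suminf_cmult by (intro mult_left_mono sa) auto
      finally have "besov_energy s p M w \<le> ?l * (ennreal C * (besov_energy s p M v + ennreal C2 * (ennreal C3 * besov_energy s p M v)))"
        by (auto simp: mult_left_mono add_left_mono)
      also have "\<dots> = ?l * (ennreal (C * (1 + C2 * C3)) * besov_energy s p M v)"
        using C C2 C3 by (simp add: ennreal_mult ennreal_plus distrib_right distrib_left mult_ac)
      finally show ?thesis .
    qed
    have L: "(\<integral>\<^sup>+x. epow p (w x) \<partial>M) \<le> ?l * ?L"
    proof -
      have pt: "epow p (w x) \<le> ?l *
          ?m x"
        if x: "x \<in> space M" for x
      proof (rule powr_bound)
        define X where "X = ?m x"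
        have XA: "epow p (avg M (scale j) v x) \<le> X" for j
        proof -
          have "epow p (avg M (scale j) v x) \<le> ennreal (2 powr p) *
             (epow p (v x) + epow p (avg M (scale j) v x - v x))"
            using p by (intro ennreal_powr_le2) auto
          also have "\<dots> \<le> ennreal (2 powr p) * (epow p (v x) + ennreal C1 * osc p M v (scale j) x)"
            by (intro mult_left_mono add_left_mono C1(2)[OF vi x]) auto
          also have "\<dots> \<le> X" unfolding X_def
            by (intro mult_left_mono add_left_mono sum_le_suminf[where I="{j}" and f="\<lambda>j. osc p M v (scale j) x", simplified]) auto
          finally show ?thesis .
        qed
        assume "?m x < \<infinity>"
        then have fin: "X < \<infinity>" by (simp add: X_def)
        have "w x \<le> enn2real X powr (1 / p) / \<kappa>" unfolding w_def
        proof (rule cSUP_least)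
          fix j
          have "f j x \<le> \<bar>avg M (scale j) v x\<bar> / \<kappa>" using A0[of j x] by (simp add: f_def)
          also have "\<dots> \<le> enn2real X powr (1 / p) / \<kappa>"
            using root[OF XA fin] l by (intro divide_right_mono) auto
          finally show "f j x \<le> enn2real X powr (1 / p) / \<kappa>" .
        qed simp
        then show "\<bar>w x\<bar> \<le> enn2real (?m x) powr (1 / p) / \<kappa>"
          using w01(1)[of x] by (simp add: X_def)
      qed
      have osc_a: "?o j \<le> ennreal (R powr (s * p)) * a j" for j
      proof -
        have "1 = scale j powr (s * p) * scale j powr (- (s * p))" by (simp add: powr_add[symmetric])
        also have "\<dots> \<le> R powr (s * p) * scale j powr (- (s * p))"
          using scale_le[of j] p s scale_pos[of j] by (intro mult_right_mono powr_mono2) auto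
        finally have "1 * ?o j \<le> ennreal (R powr (s * p) * scale j powr (- (s * p))) * ?o j"
          by (intro mult_right_mono) (auto simp: ennreal_1[symmetric] simp del: ennreal_1 intro: ennreal_leI)
        then show ?thesis by (simp add: a_def ennreal_mult mult.assoc)
      qed
      have "(\<integral>\<^sup>+x. epow p (w x) \<partial>M) \<le> (\<integral>\<^sup>+x. ?l *
          ?m x \<partial>M)"
        by (intro nn_integral_mono pt)
      also have "\<dots> = ?l * (ennreal (2 powr p) * ((\<integral>\<^sup>+x. epow p (v x) \<partial>M)
           + ennreal C1 * (\<Sum>j. \<integral>\<^sup>+x. osc p M v (scale j) x \<partial>M)))"
        by (simp add: nn_integral_cmult nn_integral_add nn_integral_suminf)
      also have "\<dots> \<le> ?l * (ennreal (2 powr p) * (besov_total s p M v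
           + ennreal C1 * (ennreal (R powr (s * p)) * (ennreal C3 * besov_total s p M v))))"
      proof (intro mult_left_mono add_mono)
        show "(\<integral>\<^sup>+x. epow p (v x) \<partial>M) \<le> besov_total s p M v" by (simp add: besov_total_def)
        have "(\<Sum>j. \<integral>\<^sup>+x. osc p M v (scale j) x \<partial>M) \<le> (\<Sum>j. ennreal (R powr (s * p)) * a j)"
          by (intro suminf_le summableI osc_a)
        also have "\<dots> \<le> ennreal (R powr (s * p)) * (ennreal C3 * besov_total s p M v)"
          unfolding ennreal_suminf_cmult
          by (intro mult_left_mono order_trans[OF sa]) (auto simp: besov_total_def)
        finally show "(\<Sum>j. \<integral>\<^sup>+x. osc p M v (scale j) x \<partial>M) \<le> \<dots>" .
      qed auto
      also have "\<dots> = ?l * ?L"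
        using C1 C3 by (simp add: ennreal_mult ennreal_plus distrib_right distrib_left mult_ac)
      finally show ?thesis .
    qed
    have "besov_total s p M w \<le> ?l * ?L + ?l * (ennreal (C * (1 + C2 * C3)) * besov_total s p M v)"
      unfolding besov_total_def[of s p M w]
      by (intro add_mono L order_trans[OF E] mult_left_mono) (auto simp: besov_total_def)
    also have "\<dots> = ennreal (K * \<kappa> powr (- p)) * besov_total s p M v"
    proof -
      have "ennreal K = ennreal (2 powr p * (1 + C1 * R powr (s * p) * C3)) + ennreal (C * (1 + C2 * C3))"
        unfolding K_def using C C1 C2 C3 by (intro ennreal_plus) auto
      then show ?thesis using K0 by (simp add: ennreal_mult distrib_right distrib_left mult_ac)
    qed
    also have "\<dots> \<le> ennreal (K * \<kappa> powr (- p)) * besov_total s p M v0" by (intro mult_left_mono vN) auto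
    finally have N: "besov_total s p M w \<le> ennreal (K * \<kappa> powr (- p)) * besov_total s p M v0" .
    show "\<exists>w\<in>borel_measurable M. besov_total s p M w \<le> ennreal (K * \<kappa> powr (- p)) * besov_total s p M v0 \<and>
        (\<forall>x\<in>space M. 0 \<le> w x \<and> w x \<le> 1 \<and> (\<forall>j. \<kappa> < avg M (scale j) (\<lambda>y. \<bar>v0 y\<bar>) x \<longrightarrow> w x = 1))"
      using N w01 w1 wm unfolding v_def by (intro bexI[of _ w]) auto
  qed
qed

end

section \<open>Approximation of functions with zero trace\<close>

lemma measure_ball_average:
  assumes "bm M x r > 0"
  shows "(\<integral>y\<in>ball x r \<inter> space M. f y \<partial>M) = bm M x r * ball_average M f x r"
  using assms by (simp add: ball_average_def bm_def)

context doubling_space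
begin

lemma nn_integral_ball_average:
  assumes f: "integrable M f" "\<And>x. 0 \<le> f x" and x: "x \<in> space M" and r: "0 < r"
  shows "(\<integral>\<^sup>+y\<in>ball x r. ennreal (f y) \<partial>M) = ennreal (bm M x r * ball_average M f x r)"
proof -
  have "(\<integral>\<^sup>+y\<in>ball x r. ennreal (f y) \<partial>M) = (\<integral>\<^sup>+y. ennreal (indicator (ball x r \<inter> space M) y *\<^sub>R f y) \<partial>M)"
    by (intro nn_integral_cong) (auto simp: indicator_def)
  also have "\<dots> = ennreal (\<integral>y. indicator (ball x r \<inter> space M) y *\<^sub>R f y \<partial>M)"
    using f by (intro nn_integral_eq_integral integrable_mult_indicator) (auto simp: indicator_def)
  also have "(\<integral>y. indicator (ball x r \<inter> space M) y *\<^sub>R f y \<partial>M) = bm M x r * ball_average M f x r"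
    using measure_ball_average[OF bm_pos[OF x r], of f] by (simp add: set_lebesgue_integral_def)
  finally show ?thesis .
qed

lemma ball_average_nonneg: "(\<And>x. 0 \<le> f x) \<Longrightarrow> 0 \<le> ball_average M f x r"
  unfolding ball_average_def set_lebesgue_integral_def
  by (intro divide_nonneg_nonneg integral_nonneg_AE AE_I2) (auto simp: indicator_def)

text \<open>Hoelder bounds the average by the \<open>p\<close>-mean over the doubled ball. The
  function \<open>v\<close> stands for truncations of \<open>u\<close>, which inherit the vanishing
  of the means.\<close>

lemma avg_tendsto_0_of_ball_average:
  assumes p: "1 < p" and u: "u \<in> borel_measurable M" "integrable M (\<lambda>x. \<bar>u x\<bar> powr p)"
    and v: "v \<in> borel_measurable M" "\<And>x. \<bar>v x\<bar> \<le> \<bar>u x\<bar>" and x: "x \<in> space M"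
    and lim: "(ball_average M (\<lambda>x. \<bar>u x\<bar> powr p) x \<longlongrightarrow> 0) (at_right 0)"
  shows "(\<lambda>j. avg M (scale j) v x) \<longlonglongrightarrow> 0"
proof (rule tendsto_0_of_powr[where p=p])
  define A where "A = ball_average M (\<lambda>x. \<bar>u x\<bar> powr p) x"
  have A0: "0 \<le> A r" for r unfolding A_def by (rule ball_average_nonneg) simp
  have vi: "integrable M v"
  proof (rule integrable_of_powr[OF v(1) _ p])
    have "(\<integral>\<^sup>+x. epow p (v x) \<partial>M) \<le> (\<integral>\<^sup>+x. epow p (u x) \<partial>M)"
      using p v(2) by (intro nn_integral_mono ennreal_leI powr_mono2) auto
    also have "\<dots> < \<infinity>" using u(2) by (simp add: integrable_iff_bounded)
    finally show "(\<integral>\<^sup>+x. epow p (v x) \<partial>M) < \<infinity>" .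
  qed
  define C where "C = 2 powr p * D powr (p - 1)"
  have bound: "epow p (avg M r v x) \<le> ennreal (C * D * A (2 * r))" if r: "0 < r" for r
  proof -
    have "epow p (avg M r v x - 0) \<le> ennreal (2 powr p * D powr (p - 1) / bm M x r) *
        devint p M v 0 x (2 * r)"
      using vi r x p bm_pos bm_double by (intro avg_diff_const_powr) auto
    also have "\<dots> \<le> ennreal (C / bm M x r) * (\<integral>\<^sup>+y\<in>ball x (2 * r). epow p (u y) \<partial>M)"
      unfolding C_def using v(2) p by (intro mult_left_mono nn_integral_mono mult_right_mono ennreal_leI powr_mono2) auto
    also have "\<dots> = ennreal (C / bm M x r) * ennreal (bm M x (2 * r) * A (2 * r))"
      unfolding A_def using u x r by (subst nn_integral_ball_average) auto
    also have "\<dots> = ennreal (C / bm M x r * (bm M x (2 * r) * A (2 * r)))"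
      by (simp add: ennreal_mult'[symmetric] C_def)
    also have "\<dots> \<le> ennreal (C / bm M x r * (D * bm M x r * A (2 * r)))"
      using bm_double[OF x r] A0 by (intro ennreal_leI mult_left_mono mult_right_mono) (auto simp: C_def)
    also have "C / bm M x r * (D * bm M x r * A (2 * r)) = C * D * A (2 * r)"
      using bm_pos[OF x r] by simp
    finally show ?thesis by simp
  qed
  have "filterlim (\<lambda>j. 2 * scale j) (at_right 0) sequentially"
  proof -
    have "(\<lambda>j. 2 * scale j) \<longlonglongrightarrow> 2 * 0" by (intro tendsto_intros scale_tendsto)
    then show ?thesis by (intro tendsto_imp_filterlim_at_right) auto
  qed
  then have "(\<lambda>j. A (2 * scale j)) \<longlonglongrightarrow> 0"
    using lim unfolding A_def by (rule filterlim_compose[rotated])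
  then have "(\<lambda>j. ennreal (C * D * A (2 * scale j))) \<longlonglongrightarrow> ennreal (C * D * 0)"
    by (intro tendsto_intros)
  then have "(\<lambda>j. ennreal (C * D * A (2 * scale j))) \<longlonglongrightarrow> 0" by simp
  then show "(\<lambda>j. epow p (avg M (scale j) v x)) \<longlonglongrightarrow> 0"
    by (rule tendsto_sandwich[OF _ _ tendsto_const, rotated 2]) (use bound in auto)
qed (use p in simp)

lemma avg_bounded:
  assumes x: "x \<in> space M" and r: "0 < r" and u: "integrable M u" and m: "\<And>x. \<bar>u x\<bar> \<le> m"
  shows "\<bar>avg M r u x\<bar> \<le> m"
proof -
  define \<phi> where "\<phi> y = max 0 (2 * r - dist x y)" for y
  define F where "F = (\<integral>y. \<phi> y \<partial>M)"
  have "0 < r * bm M x r" using bm_pos[OF x r] r by simp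
  also have "\<dots> \<le> F" using weight_integral_ge[of r x] r by (simp add: F_def \<phi>_def)
  finally have F: "0 < F" .
  have int: "integrable M (\<lambda>y. \<phi> y * u y)" "integrable M \<phi>"
    unfolding \<phi>_def using u by (auto intro!: integrable_weight integrable_weight1)
  have "\<bar>\<integral>y. \<phi> y * u y \<partial>M\<bar> \<le> (\<integral>y. \<bar>\<phi> y * u y\<bar> \<partial>M)" by (rule integral_abs_bound)
  also have "\<dots> \<le> (\<integral>y. m * \<phi> y \<partial>M)"
  proof (rule integral_mono)
    show "\<bar>\<phi> y * u y\<bar> \<le> m * \<phi> y" for y
      using mult_left_mono[OF m[of y], of "\<phi> y"] by (simp add: abs_mult \<phi>_def mult.commute)
  qed (use int in auto)
  also have "\<dots> = m * F" by (simp add: F_def)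
  finally show ?thesis unfolding avg_def \<phi>_def[symmetric] F_def[symmetric] using F
    by (simp add: abs_divide field_simps)
qed

text \<open>Close points use the local estimate with \<open>c = 0\<close>. If
  \<open>dist x y > r / 16\<close>, the trivial bound \<open>2 * m\<close> is at most
  \<open>32 * m / r * dist x y\<close>.\<close>

lemma avg_lipschitz_global:
  assumes r: "0 < r" and u: "integrable M u" and m: "\<And>x. \<bar>u x\<bar> \<le> m"
  obtains L where "0 \<le> L" "\<And>x y. x \<in> space M \<Longrightarrow> y \<in> space M \<Longrightarrow> \<bar>avg M r u x - avg M r u y\<bar> \<le> L * dist x y"
proof -
  have m0: "0 \<le> m" using m[of undefined] by (rule order_trans[OF abs_ge_zero])
  define L1 where "L1 = (9 + 30 * D ^ 3) / r * (D ^ 3 * m)"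
  define L where "L = max L1 (32 * m / r)"
  show thesis
  proof (rule that[of L])
    show "0 \<le> L" using m0 r by (simp add: L_def le_max_iff_disj)
    fix x y assume x: "x \<in> space M" and y: "y \<in> space M"
    show "\<bar>avg M r u x - avg M r u y\<bar> \<le> L * dist x y"
    proof (cases "16 * dist x y \<le> r")
      case True
      have bp: "0 < bm M x (r / 2)" using bm_pos[OF x] r by simp
      have b4: "bm M x (4 * r) \<le> D ^ 3 * bm M x (r / 2)" using bm_double_pow[OF x, of "r / 2" 3] r by simp
      have "\<bar>avg M r u x - avg M r u y\<bar> \<le> ((9 + 30 * D ^ 3) * (dist x y / r)) / bm M x (r / 2) *
           (\<integral>z. \<bar>u z - 0\<bar> * indicator (ball x (4 * r) \<inter> space M) z \<partial>M)"
        by (rule avg_lipschitz[OF u r True _ bp b4]) (use D_ge_1 in auto)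
      also have "\<dots> \<le> ((9 + 30 * D ^ 3) * (dist x y / r)) / bm M x (r / 2) * (m * bm M x (4 * r))"
      proof (intro mult_left_mono)
        have "(\<integral>z. \<bar>u z - 0\<bar> * indicator (ball x (4 * r) \<inter> space M) z \<partial>M) \<le> (\<integral>z. m * indicator (ball x (4 * r) \<inter> space M) z \<partial>M)"
          using m by (intro integral_mono integrable_abs_diff_ball u integrable_mult_right integrable_real_indicator)
             (auto simp: indicator_def less_top[symmetric])
        then show "(\<integral>z. \<bar>u z - 0\<bar> * indicator (ball x (4 * r) \<inter> space M) z \<partial>M) \<le> m * bm M x (4 * r)"
          by (simp add: bm_def)
      qed (use r D_ge_1 in auto)
      also have "\<dots> \<le> ((9 + 30 * D ^ 3) * (dist x y / r)) / bm M x (r / 2) * (m * (D ^ 3 * bm M x (r / 2)))"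
        using b4 m0 r D_ge_1 by (intro mult_left_mono) auto
      also have "\<dots> = L1 * dist x y" using bp by (simp add: L1_def)
      also have "\<dots> \<le> L * dist x y" by (intro mult_right_mono) (auto simp: L_def)
      finally show ?thesis .
    next
      case False
      have "\<bar>avg M r u x - avg M r u y\<bar> \<le> 2 * m"
        using avg_bounded[OF x r u m] avg_bounded[OF y r u m] by linarith
      also have "\<dots> \<le> 32 * m / r * dist x y"
      proof -
        have "m * r \<le> m * (16 * dist x y)" using False m0 by (intro mult_left_mono) auto
        then show ?thesis using r by (simp add: field_simps)
      qed
      also have "\<dots> \<le> L * dist x y" by (intro mult_right_mono) (auto simp: L_def)
      finally show ?thesis .
    qed
  qed
qed

text \<open>The constant collects the factor 2 of the mean, the radius \<open>2 * r\<close> of the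
  ball it sees, and the doubling from \<open>r\<close> to \<open>2 * r\<close>.\<close>

lemma avg_lipschitz_approx:
  assumes x: "x \<in> space M" and r: "0 < r" and f: "integrable M f"
    and L: "0 \<le> L" "\<And>x y. x \<in> space M \<Longrightarrow> y \<in> space M \<Longrightarrow> \<bar>f x - f y\<bar> \<le> L * dist x y"
  shows "\<bar>avg M r f x - f x\<bar> \<le> 4 * D * L * r"
proof -
  have "\<bar>avg M r f x - f x\<bar> \<le> 2 / bm M x r * (\<integral>y. \<bar>f y - f x\<bar> * indicator (ball x (2 * r) \<inter> space M) y \<partial>M)"
    by (rule avg_diff_const[OF f r bm_pos[OF x r]])
  also have "\<dots> \<le> 2 / bm M x r * (L * (2 * r) * bm M x (2 * r))"
  proof (intro mult_left_mono)
    have "(\<integral>y. \<bar>f y - f x\<bar> * indicator (ball x (2 * r) \<inter> space M) y \<partial>M) \<le> (\<integral>y. L * (2 * r) * indicator (ball x (2 * r) \<inter> space M) y \<partial>M)"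
    proof (intro integral_mono integrable_abs_diff_ball f integrable_mult_right integrable_real_indicator)
      fix y assume y: "y \<in> space M"
      show "\<bar>f y - f x\<bar> * indicator (ball x (2 * r) \<inter> space M) y \<le> L * (2 * r) * indicator (ball x (2 * r) \<inter> space M) y"
      proof (cases "dist x y < 2 * r")
        case True
        have "\<bar>f y - f x\<bar> \<le> L * dist x y" using L(2)[OF y x] by (simp add: dist_commute)
        also have "\<dots> \<le> L * (2 * r)" using True L(1) by (intro mult_left_mono) auto
        finally show ?thesis by (simp add: indicator_def)
      qed (simp add: indicator_def)
    qed (auto simp: less_top[symmetric])
    then show "(\<integral>y. \<bar>f y - f x\<bar> * indicator (ball x (2 * r) \<inter> space M) y \<partial>M) \<le> L * (2 * r) * bm M x (2 * r)"
      by (simp add: bm_def)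
  qed simp
  also have "\<dots> \<le> 2 / bm M x r * (L * (2 * r) * (D * bm M x r))"
    using bm_double[OF x r] L(1) r by (intro mult_left_mono) auto
  also have "\<dots> = 4 * D * L * r" using bm_pos[OF x r] by simp
  finally show ?thesis .
qed

lemma openin_less:
  assumes "continuous_on (space M) (f :: 'a \<Rightarrow> real)"
  shows "openin (top_of_set (space M)) {x \<in> space M. c < f x}"
proof -
  have "openin (top_of_set (space M)) (space M \<inter> f -` {c<..})"
    using assms by (rule continuous_openin_preimage_gen) simp
  also have "space M \<inter> f -` {c<..} = {x \<in> space M. c < f x}" by auto
  finally show ?thesis .
qed

lemma continuous_on_of_lipschitz:
  assumes "\<And>x y. x \<in> space M \<Longrightarrow> y \<in> space M \<Longrightarrow> \<bar>f x - f y\<bar> \<le> L * dist x y"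
  shows "continuous_on (space M) (f :: 'a \<Rightarrow> real)"
proof -
  have "lipschitz_on (max L 0) (space M) f"
  proof (rule lipschitz_onI)
    fix x y assume "x \<in> space M" "y \<in> space M"
    then have "\<bar>f x - f y\<bar> \<le> L * dist x y" by (rule assms)
    also have "\<dots> \<le> max L 0 * dist x y" by (intro mult_right_mono) auto
    finally show "dist (f x) (f y) \<le> max L 0 * dist x y" by (simp add: dist_real_def)
  qed simp
  then show ?thesis by (rule lipschitz_on_continuous_on)
qed

text \<open>A competitor for the capacity is cut to \<open>[0, 1]\<close>, which does not increase
  its size. The neighbourhood is kept, because the cut-off built from \<open>w\<close> has to vanish
  on an open set.\<close>

lemma capacity_zero_function:
  assumes p: "1 < p" and cap: "besov_capacity s p M E = 0" and e: "0 < e"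
  obtains w U where "w \<in> borel_measurable M" "besov_total s p M w \<le> e" "\<And>x. 0 \<le> w x \<and> w x \<le> 1"
    "openin (top_of_set (space M)) U" "E \<subseteq> U" "\<And>x. x \<in> U \<Longrightarrow> w x = 1"
proof -
  have "besov_capacity s p M E < e" using cap e by simp
  then obtain u U where u: "u \<in> besov_space s p M" "openin (top_of_set (space M)) U" "E \<subseteq> U" "\<And>x. x \<in> U \<Longrightarrow> 1 \<le> u x"
     "besov_total s p M u < e"
    unfolding besov_capacity_def INF_less_iff by (auto simp: besov_total_def)
  have [measurable]: "u \<in> borel_measurable M" using u(1) by (simp add: besov_space_def)
  define w where "w x = max 0 (min 1 (u x))" for x
  show thesis
  proof (rule that[of w U])
    show "w \<in> borel_measurable M" unfolding w_def by measurable
    have "besov_total s p M w \<le> besov_total s p M u"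
      using p by (intro besov_total_mono) (auto simp: w_def max_def min_def)
    then show "besov_total s p M w \<le> e" using u(5) by simp
    show "0 \<le> w x \<and> w x \<le> 1" for x by (auto simp: w_def)
    show "w x = 1" if "x \<in> U" for x using u(4)[OF that] by (simp add: w_def)
  qed (use u in auto)
qed

text \<open>Quasicontinuity enters only here: off the set where the truncated maximal function of
  \<open>u - \<phi>\<close> equals \<open>1\<close>, the Lipschitz function \<open>\<phi>\<close> is small at the boundary points at which the
  averages of \<open>u\<close> vanish in the limit.\<close>

lemma bounded_zero_trace_step:
  assumes p: "1 < p" and s: "0 < s" "s < 1" and uB: "u \<in> besov_space s p M" and m: "\<And>x. \<bar>u x\<bar> \<le> m"
    and compact: "compact (space M)" and S: "S \<subseteq> space M"
    and cap: "besov_capacity s p M E = 0"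
    and lim: "\<And>x. x \<in> S - E \<Longrightarrow> (\<lambda>j. avg M (scale j) u x) \<longlonglongrightarrow> 0"
    and \<epsilon>: "0 < \<epsilon>" and \<eta>: "0 < (\<eta> :: ennreal)"
  obtains \<phi> w f where "\<phi> \<in> borel_measurable M" "w \<in> borel_measurable M"
    "besov_total s p M (\<lambda>x. \<phi> x - u x) \<le> \<eta>" "besov_total s p M w \<le> \<eta>"
    "\<And>x. x \<in> space M \<Longrightarrow> \<bar>\<phi> x\<bar> \<le> m" "\<And>x. x \<in> space M \<Longrightarrow> 0 \<le> w x \<and> w x \<le> 1"
    "f = (\<lambda>x. soft (3 * \<epsilon>) ((1 - w x) * \<phi> x))" "compactly_supported_in (space M) (space M - S) f"
proof (rule maximal_weak_type[OF p s], goal_cases)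
  case cst: (1 C)
  note C = cst(2,3)
  have u[measurable]: "u \<in> borel_measurable M" using uB by (simp add: besov_space_def)
  have ui: "integrable M u" using besov_integrable[OF uB p] .
  have m0: "0 \<le> m" using m[of undefined] by (rule order_trans[OF abs_ge_zero])
  define a where "a j = besov_total s p M (\<lambda>x. avg M (scale j) u x - u x)" for j
  have a0: "a \<longlonglongrightarrow> 0" unfolding a_def by (rule avg_total_tendsto[OF p s uB])
  define K where "K = ennreal (2 powr p)"
  have K: "K < \<infinity>" "K \<noteq> 0" by (auto simp: K_def)
  \<comment> \<open>The budget is shared by two functions, since their maximum costs
    \<open>2 powr p\<close> times the sum of their sizes.\<close>
  obtain \<eta>' where \<eta>': "0 < \<eta>'" "K * (\<eta>' + \<eta>') \<le> \<eta>"
  proof (cases "\<eta> = \<infinity>")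
    case False
    then obtain h where h: "\<eta> = ennreal h" "0 < h" using \<eta> by (cases \<eta>) auto
    have "K * (ennreal (h / 2 powr p / 2) + ennreal (h / 2 powr p / 2)) = \<eta>"
      using h by (simp add: K_def ennreal_plus[symmetric] ennreal_mult'[symmetric] del: ennreal_plus)
    then show thesis using h that[of "ennreal (h / 2 powr p / 2)"] by simp
  qed (use that[of 1] in simp)
  \<comment> \<open>The level \<open>\<epsilon>\<close> is fixed before the scale, so the possibly
    large factor \<open>\<epsilon> powr (- p)\<close> is beaten by a fine enough scale.\<close>
  have "(\<lambda>j. ennreal (C * \<epsilon> powr (- p)) * a j) \<longlonglongrightarrow> ennreal (C * \<epsilon> powr (- p)) * 0"
    by (intro ennreal_tendsto_cmult a0) auto
  then have "\<forall>\<^sub>F j in sequentially. ennreal (C * \<epsilon> powr (- p)) * a j < \<eta>'"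
    using \<eta>'(1) by (intro order_tendstoD(2)) auto
  moreover have "\<forall>\<^sub>F j in sequentially. a j < \<eta>" using a0 \<eta> by (rule order_tendstoD(2))
  moreover have "\<forall>\<^sub>F j in sequentially. a j < \<infinity>" using a0 by (rule order_tendstoD(2)) simp
  ultimately have "\<forall>\<^sub>F j in sequentially. ennreal (C * \<epsilon> powr (- p)) * a j < \<eta>' \<and> a j < \<eta> \<and> a j < \<infinity>"
    by eventually_elim blast
  then have "\<exists>n. ennreal (C * \<epsilon> powr (- p)) * a n < \<eta>' \<and> a n < \<eta> \<and> a n < \<infinity>"
    using eventually_happens[of _ sequentially] sequentially_bot by blast
  then obtain n where n: "ennreal (C * \<epsilon> powr (- p)) * a n < \<eta>'" "a n < \<eta>" "a n < \<infinity>" by blast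
  define \<phi> where "\<phi> = avg M (scale n) u"
  have \<phi>m[measurable]: "\<phi> \<in> borel_measurable M" unfolding \<phi>_def by measurable
  have \<phi>b: "\<bar>\<phi> x\<bar> \<le> m" if "x \<in> space M" for x unfolding \<phi>_def by (rule avg_bounded[OF that scale_pos ui m])
  obtain L where L: "0 \<le> L" "\<And>x y. x \<in> space M \<Longrightarrow> y \<in> space M \<Longrightarrow> \<bar>\<phi> x - \<phi> y\<bar> \<le> L * dist x y"
    unfolding \<phi>_def using avg_lipschitz_global[OF scale_pos ui m] by blast
  have \<phi>i: "integrable M \<phi>"
    by (rule integrable_const_bound[of _ m]) (use \<phi>b in auto)
  define v where "v x = \<phi> x - u x" for x
  have vt: "besov_total s p M v = a n" by (simp add: v_def[abs_def] a_def \<phi>_def)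
  have vm[measurable]: "v \<in> borel_measurable M" unfolding v_def by measurable
  have vB: "v \<in> besov_space s p M" using n(3) vt by (simp add: besov_space_iff)
  obtain w1 where w1: "w1 \<in> borel_measurable M" "besov_total s p M w1 \<le> ennreal (C * \<epsilon> powr (- p)) * besov_total s p M v"
      "\<And>x. x \<in> space M \<Longrightarrow> 0 \<le> w1 x \<and> w1 x \<le> 1"
      "\<And>x j. x \<in> space M \<Longrightarrow> \<epsilon> < avg M (scale j) (\<lambda>y. \<bar>v y\<bar>) x \<Longrightarrow> w1 x = 1"
    using C(2)[OF vB \<epsilon>] by blast
  obtain w2 U2 where w2: "w2 \<in> borel_measurable M" "besov_total s p M w2 \<le> \<eta>'" "\<And>x. 0 \<le> w2 x \<and> w2 x \<le> 1"
    "openin (top_of_set (space M)) U2" "E \<subseteq> U2" "\<And>x. x \<in> U2 \<Longrightarrow> w2 x = 1"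
    using capacity_zero_function[OF p cap \<eta>'(1)] by blast
  note [measurable] = w1(1) w2(1)
  \<comment> \<open>\<open>w1\<close> equals 1 where some average of
    \<open>\<bar>\<phi> - u\<bar>\<close> exceeds \<open>\<epsilon>\<close>; \<open>w2\<close>
    equals 1 near \<open>E\<close>, where nothing is known about the averages of
    \<open>u\<close>.\<close>
  define w where "w x = max (w1 x) (w2 x)" for x
  have wm[measurable]: "w \<in> borel_measurable M" unfolding w_def by measurable
  have w01: "0 \<le> w x \<and> w x \<le> 1" if "x \<in> space M" for x using w1(3)[OF that] w2(3)[of x] by (auto simp: w_def)
  have wN: "besov_total s p M w \<le> \<eta>"
  proof -
    have "besov_total s p M w \<le> ennreal (2 powr p) * (besov_total s p M w1 + besov_total s p M w2)"
      by (intro besov_total_le2 w1(1) w2(1) p) (auto simp: w_def max_def)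
    also have "\<dots> \<le> ennreal (2 powr p) * (\<eta>' + \<eta>')"
      using w1(2) w2(2) n(1) vt by (intro mult_left_mono add_mono) auto
    also have "\<dots> \<le> \<eta>" using \<eta>'(2) by (simp add: K_def)
    finally show ?thesis .
  qed
  define f where "f x = soft (3 * \<epsilon>) ((1 - w x) * \<phi> x)" for x
  define G where "G = (\<Union>j. {x \<in> space M. \<epsilon> < avg M (scale j) (\<lambda>y. \<bar>v y\<bar>) x})"
  \<comment> \<open>The set where \<open>\<bar>\<phi>\<bar> < 3 * \<epsilon>\<close>, written as a
    super-level set to match \<open>openin_less\<close>.\<close>
  define V where "V = {x \<in> space M. - (3 * \<epsilon>) < - \<bar>\<phi> x\<bar>}"
  have vb: "\<bar>\<bar>v x\<bar>\<bar> \<le> m + m" if "x \<in> space M" for x using \<phi>b[OF that] m[of x] by (simp add: v_def)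
  have openG: "openin (top_of_set (space M)) G"
    unfolding G_def
  proof (intro openin_Union ballI, clarify)
    fix j
    \<comment> \<open>The Lipschitz lemma asks for a bound at all points of the type, while
      \<open>v\<close> is bounded on the space only; redefining it outside leaves the averages
      unchanged.\<close>
    define v' where "v' x = (if x \<in> space M then \<bar>v x\<bar> else 0)" for x
    have av: "avg M r v' = avg M r (\<lambda>y. \<bar>v y\<bar>)" for r
      unfolding avg_def v'_def by (intro ext arg_cong2[where f="(/)"] Bochner_Integration.integral_cong) auto
    have "integrable M v'"
      unfolding v'_def by (rule integrable_const_bound[of _ "m + m"]) (use vb in auto)
    moreover have "\<bar>v' x\<bar> \<le> m + m" for x using vb[of x] m0 by (simp add: v'_def)
    ultimately obtain L' where "\<And>x y. x \<in> space M \<Longrightarrow> y \<in> space M \<Longrightarrow> \<bar>avg M (scale j) v' x - avg M (scale j) v' y\<bar> \<le> L' * dist x y"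
      using avg_lipschitz_global[OF scale_pos[of j], of v' "m + m"] by metis
    then show "openin (top_of_set (space M)) {x \<in> space M. \<epsilon> < avg M (scale j) (\<lambda>y. \<bar>v y\<bar>) x}"
      unfolding av by (intro openin_less continuous_on_of_lipschitz)
  qed
  have openV: "openin (top_of_set (space M)) V"
    unfolding V_def by (intro openin_less continuous_intros continuous_on_of_lipschitz[of \<phi> L] L(2))
  define Os where "Os = G \<union> U2 \<union> V"
  have openO: "openin (top_of_set (space M)) Os" unfolding Os_def by (intro openin_Un openG w2(4) openV)
  have f0: "f x = 0" if xO: "x \<in> Os" for x
  proof -
    have xM: "x \<in> space M" using xO openin_imp_subset[OF openO] by auto
    consider "x \<in> G" | "x \<in> U2" | "x \<in> V" using xO unfolding Os_def by blast
    then show ?thesis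
    proof cases
      case 1
      then have "w1 x = 1" using w1(4) by (auto simp: G_def)
      then have "w x = 1" using w2(3)[of x] by (simp add: w_def)
      then show ?thesis using \<epsilon> by (simp add: f_def soft_eq_0)
    next
      case 2
      then have "w x = 1" using w2(6)[of x] w1(3)[OF xM] by (simp add: w_def)
      then show ?thesis using \<epsilon> by (simp add: f_def soft_eq_0)
    next
      case 3
      have "\<bar>(1 - w x) * \<phi> x\<bar> \<le> 1 * \<bar>\<phi> x\<bar>" unfolding abs_mult using w01[OF xM] by (intro mult_right_mono) auto
      then show ?thesis using 3 by (auto simp: f_def V_def intro!: soft_eq_0)
    qed
  qed
  have SO: "S \<subseteq> Os"
  proof
    fix x assume x: "x \<in> S"
    then have xM: "x \<in> space M" using S by auto
    show "x \<in> Os"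
    proof (cases "x \<in> E \<or> x \<in> G")
      case False
      \<comment> \<open>The averages of \<open>\<phi>\<close> tend to \<open>\<phi> x\<close>, those
        of \<open>u\<close> tend to 0, and outside \<open>G\<close> those of
        \<open>\<phi> - u\<close> are at most \<open>\<epsilon>\<close>.\<close>
      have "\<bar>\<phi> x\<bar> \<le> 2 * \<epsilon>"
      proof -
        have lim0: "(\<lambda>j. avg M (scale j) u x) \<longlonglongrightarrow> 0" using lim x False by auto
        have "\<bar>avg M (scale j) u x - \<phi> x\<bar> \<le> \<epsilon> + 4 * D * L * scale j" for j
        proof -
          have vi: "integrable M v" unfolding v_def using \<phi>i ui by simp
          have av: "avg M (scale j) \<phi> x = avg M (scale j) u x + avg M (scale j) v x"
          proof -
            have "(\<integral>y. max 0 (2 * scale j - dist x y) * \<phi> y \<partial>M) = (\<integral>y. max 0 (2 * scale j - dist x y) * u y + max 0 (2 * scale j - dist x y) * v y \<partial>M)"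
              by (intro Bochner_Integration.integral_cong) (auto simp: v_def algebra_simps)
            also have "\<dots> = (\<integral>y. max 0 (2 * scale j - dist x y) * u y \<partial>M) + (\<integral>y. max 0 (2 * scale j - dist x y) * v y \<partial>M)"
              by (intro Bochner_Integration.integral_add integrable_weight ui vi)
            finally show ?thesis by (simp add: avg_def add_divide_distrib)
          qed
          have "\<bar>avg M (scale j) v x\<bar> \<le> avg M (scale j) (\<lambda>y. \<bar>v y\<bar>) x"
          proof -
            have "\<bar>\<integral>y. max 0 (2 * scale j - dist x y) * v y \<partial>M\<bar> \<le> (\<integral>y. \<bar>max 0 (2 * scale j - dist x y) * v y\<bar> \<partial>M)"
              by (rule integral_abs_bound)
            then show ?thesis by (auto simp: avg_def abs_divide abs_mult intro!: divide_right_mono integral_nonneg_AE)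
          qed
          also have "\<dots> \<le> \<epsilon>" using False xM by (auto simp: G_def not_less)
          finally have "\<bar>avg M (scale j) v x\<bar> \<le> \<epsilon>" .
          moreover have "\<bar>avg M (scale j) \<phi> x - \<phi> x\<bar> \<le> 4 * D * L * scale j"
            by (rule avg_lipschitz_approx[OF xM scale_pos \<phi>i L])
          ultimately show ?thesis unfolding av by linarith
        qed
        moreover have "(\<lambda>j. \<bar>avg M (scale j) u x - \<phi> x\<bar>) \<longlonglongrightarrow> \<bar>0 - \<phi> x\<bar>"
          by (intro tendsto_intros lim0)
        moreover have "(\<lambda>j. \<epsilon> + 4 * D * L * scale j) \<longlonglongrightarrow> \<epsilon> + 4 * D * L * 0"
          by (intro tendsto_intros scale_tendsto)
        ultimately have "\<bar>0 - \<phi> x\<bar> \<le> \<epsilon> + 4 * D * L * 0" by (intro LIMSEQ_le) auto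
        then show ?thesis using \<epsilon> by simp
      qed
      then have "x \<in> V" using xM \<epsilon> by (simp add: V_def)
      then show ?thesis by (simp add: Os_def)
    qed (use w2(5) in \<open>auto simp: Os_def\<close>)
  qed
  have "compactly_supported_in (space M) (space M - S) f"
  proof -
    have cl: "closed (space M - Os)"
      using openin_closedin_eq[of "top_of_set (space M)" Os] openO compact
      by (metis closedin_closed_trans closedin_diff closedin_topspace compact_imp_closed topspace_euclidean_subtopology)
    have "closure {x \<in> space M. f x \<noteq> 0} \<subseteq> space M - Os" using f0 by (intro closure_minimal cl) auto
    moreover have "compact (space M - Os)"
      using compact cl by (metis Diff_subset compact_Int_closed inf.absorb_iff2)
    ultimately show ?thesis
      unfolding compactly_supported_in_def using SO
      by (metis (no_types, lifting) Diff_mono closed_closure compact_Int_closed inf.absorb_iff2 order_refl subset_trans)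
  qed
  then show thesis
    using that[of \<phi> w f] \<phi>m wm n(2) wN \<phi>b w01 by (auto simp: f_def[abs_def] a_def \<phi>_def)
qed

section \<open>Dominated convergence in the Besov space\<close>

text \<open>The energy is an integral over the product space, where convergence almost everywhere on
  \<open>M\<close> holds in both coordinates for almost every pair; so the increments converge as
  well, and dominated convergence applies twice.\<close>

lemma besov_total_tendsto_0_dominated:
  assumes p: "1 < p" and h[measurable]: "\<And>n. h n \<in> borel_measurable M"
    and lim: "AE x in M. (\<lambda>n. h n x) \<longlonglongrightarrow> 0"
    and g[measurable]: "g \<in> borel_measurable M" "(\<lambda>(x, y). G x y) \<in> borel_measurable (M \<Otimes>\<^sub>M M)"
    and gfin: "(\<integral>\<^sup>+x. g x \<partial>M) < \<infinity>" "(\<integral>\<^sup>+x. \<integral>\<^sup>+y. G x y \<partial>M \<partial>M) < \<infinity>"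
    and dom: "\<And>n x. x \<in> space M \<Longrightarrow> epow p (h n x) \<le> g x"
      "\<And>n x y. x \<in> space M \<Longrightarrow> y \<in> space M \<Longrightarrow> bkern p M (s * p) (h n) x y \<le> G x y"
  shows "(\<lambda>n. besov_total s p M (h n)) \<longlonglongrightarrow> 0"
proof -
  have "(\<lambda>n. \<integral>\<^sup>+x. epow p (h n x) \<partial>M) \<longlonglongrightarrow> (\<integral>\<^sup>+x. 0 \<partial>M)"
  proof (rule nn_integral_dominated_convergence[where w=g])
    show "AE x in M. (\<lambda>n. epow p (h n x)) \<longlonglongrightarrow> 0"
      using lim
    proof eventually_elim
      case (elim x)
      then have "(\<lambda>n. epow p (h n x)) \<longlonglongrightarrow> epow p 0"
        using p by (intro tendsto_ennrealI tendsto_powr2 tendsto_rabs tendsto_const) auto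
      then show ?case by simp
    qed
  qed (use gfin dom in auto)
  moreover have "(\<lambda>n. besov_energy s p M (h n)) \<longlonglongrightarrow> 0"
  proof -
    let ?e = "\<lambda>n z. ennreal (\<bar>h n (snd z) - h n (fst z)\<bar> powr p * kern M (s * p) (fst z) (snd z))"
    have eq: "besov_energy s p M (h n) = (\<integral>\<^sup>+z. ?e n z \<partial>(M \<Otimes>\<^sub>M M))" for n
    proof -
      have "(\<lambda>z. ?e n z) \<in> borel_measurable (M \<Otimes>\<^sub>M M)" by measurable
      from nn_integral_fst[OF this] show ?thesis unfolding besov_energy_kern by (simp only: fst_conv snd_conv)
    qed
    have "(\<lambda>n. \<integral>\<^sup>+z. ?e n z \<partial>(M \<Otimes>\<^sub>M M)) \<longlonglongrightarrow> (\<integral>\<^sup>+z. 0 \<partial>(M \<Otimes>\<^sub>M M))"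
    proof (rule nn_integral_dominated_convergence[where w="\<lambda>z. G (fst z) (snd z)"])
      show "(\<integral>\<^sup>+z. G (fst z) (snd z) \<partial>(M \<Otimes>\<^sub>M M)) < \<infinity>"
      proof -
        have "(\<lambda>z. G (fst z) (snd z)) \<in> borel_measurable (M \<Otimes>\<^sub>M M)" by measurable
        from nn_integral_fst[OF this] show ?thesis using gfin(2) by (simp only: fst_conv snd_conv)
      qed
      show "AE z in M \<Otimes>\<^sub>M M. (\<lambda>n. ?e n z) \<longlonglongrightarrow> 0"
        using AE_pair_coordinates[OF lim]
      proof eventually_elim
        case (elim z)
        have "(\<lambda>n. ?e n z) \<longlonglongrightarrow> ennreal (\<bar>0 - 0\<bar> powr p * kern M (s * p) (fst z) (snd z))"
          using elim p by (intro tendsto_ennrealI tendsto_mult tendsto_powr2 tendsto_rabs tendsto_diff tendsto_const) auto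
        then show ?case by simp
      qed
      show "AE z in M \<Otimes>\<^sub>M M. ?e n z \<le> G (fst z) (snd z)" for n
        using dom(2) by (intro AE_I2) (auto simp: space_pair_measure)
    qed auto
    then show ?thesis by (simp add: eq)
  qed
  ultimately show ?thesis unfolding besov_total_def using tendsto_add[of _ "0::ennreal"] by fastforce
qed

text \<open>Errors summable in \<open>n\<close> serve twice: they give convergence almost
  everywhere, and they make the sums of the energy integrands of \<open>\<phi> n - u\<close> and of
  \<open>w n\<close> an integrable majorant, together with that of \<open>u\<close>, for the
  increments of all \<open>f n - u\<close>.\<close>

lemma bounded_zero_trace_approx:
  assumes p: "1 < p" and s: "0 < s" "s < 1" and uB: "u \<in> besov_space s p M" and m: "\<And>x. \<bar>u x\<bar> \<le> m"
    and compact: "compact (space M)" and S: "S \<subseteq> space M"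
    and cap: "besov_capacity s p M E = 0"
    and lim: "\<And>x. x \<in> S - E \<Longrightarrow> (\<lambda>j. avg M (scale j) u x) \<longlonglongrightarrow> 0"
    and e: "0 < e"
  shows "\<exists>f\<in>borel_measurable M. compactly_supported_in (space M) (space M - S) f \<and> besov_total s p M (\<lambda>x. f x - u x) < e"
proof -
  have u[measurable]: "u \<in> borel_measurable M" and uf: "besov_energy s p M u < \<infinity>"
    using uB by (auto simp: besov_space_def)
  have m0: "0 \<le> m" using m[of undefined] by (rule order_trans[OF abs_ge_zero])
  define \<epsilon> where "\<epsilon> n = 1 / real (Suc n)" for n
  have \<epsilon>: "0 < \<epsilon> n" for n by (simp add: \<epsilon>_def)
  define \<eta> where "\<eta> n = ennreal ((1 / 2) ^ n)" for n
  have \<eta>: "0 < \<eta> n" for n by (simp add: \<eta>_def)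
  have s\<eta>: "(\<Sum>n. \<eta> n) < \<infinity>"
    unfolding \<eta>_def by (subst suminf_ennreal_eq[OF _ geometric_sums[of "1/2::real"]]) auto
  define good where "good n \<phi> w \<longleftrightarrow> \<phi> \<in> borel_measurable M \<and> w \<in> borel_measurable M \<and>
      besov_total s p M (\<lambda>x. \<phi> x - u x) \<le> \<eta> n \<and> besov_total s p M w \<le> \<eta> n \<and>
      (\<forall>x\<in>space M. \<bar>\<phi> x\<bar> \<le> m \<and> 0 \<le> w x \<and> w x \<le> 1) \<and>
      compactly_supported_in (space M) (space M - S) (\<lambda>x. soft (3 * \<epsilon> n) ((1 - w x) * \<phi> x))" for n \<phi> w
  have "\<forall>n. \<exists>z. good n (fst z) (snd z)"
  proof
    fix n
    have "\<exists>\<phi> w. good n \<phi> w" unfolding good_def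
      by (rule bounded_zero_trace_step[OF p s uB m compact S cap lim \<epsilon>[of n] \<eta>[of n]]) blast+
    then show "\<exists>z. good n (fst z) (snd z)" by simp
  qed
  from choice[OF this] obtain z where z: "\<And>n. good n (fst (z n)) (snd (z n))" by blast
  define \<phi> where "\<phi> n = fst (z n)" for n
  define w where "w n = snd (z n)" for n
  define f where "f n = (\<lambda>x. soft (3 * \<epsilon> n) ((1 - w n x) * \<phi> n x))" for n
  have F: "\<And>n. \<phi> n \<in> borel_measurable M" "\<And>n. w n \<in> borel_measurable M"
    "\<And>n. besov_total s p M (\<lambda>x. \<phi> n x - u x) \<le> \<eta> n" "\<And>n. besov_total s p M (w n) \<le> \<eta> n"
    "\<And>n x. x \<in> space M \<Longrightarrow> \<bar>\<phi> n x\<bar> \<le> m \<and> 0 \<le> w n x \<and> w n x \<le> 1"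
    "\<And>n. f n = (\<lambda>x. soft (3 * \<epsilon> n) ((1 - w n x) * \<phi> n x))" "\<And>n. compactly_supported_in (space M) (space M - S) (f n)"
    using z unfolding good_def \<phi>_def[symmetric] w_def[symmetric] f_def by auto
  note [measurable] = F(1,2)
  have fm[measurable]: "f n \<in> borel_measurable M" for n unfolding F(6) by measurable
  define v where "v n x = \<phi> n x - u x" for n x
  have vm[measurable]: "v n \<in> borel_measurable M" for n unfolding v_def by measurable
  have Nv: "besov_total s p M (v n) \<le> \<eta> n" for n using F(3)[of n] by (simp add: v_def[abs_def])
  have zero: "AE x in M. (\<lambda>n. z n x) \<longlonglongrightarrow> 0"
    if [measurable]: "\<And>n. z n \<in> borel_measurable M" and z: "\<And>n. besov_total s p M (z n) \<le> \<eta> n" for z :: "nat \<Rightarrow> 'a \<Rightarrow> real"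
  proof -
    have "(\<Sum>n. \<integral>\<^sup>+x. epow p (z n x) \<partial>M) \<le> (\<Sum>n. \<eta> n)"
      by (intro suminf_le summableI order_trans[OF _ z]) (simp add: besov_total_def)
    then have "AE x in M. (\<lambda>n. epow p (z n x)) \<longlonglongrightarrow> 0"
      using s\<eta> by (intro AE_tendsto_0_of_suminf) (auto elim: order.strict_trans1)
    then show ?thesis by eventually_elim (use p in \<open>auto intro: tendsto_0_of_powr\<close>)
  qed
  have \<epsilon>0: "\<epsilon> \<longlonglongrightarrow> 0" unfolding \<epsilon>_def using lim_1_over_n LIMSEQ_Suc by blast
  have lim0: "AE x in M. (\<lambda>n. f n x - u x) \<longlonglongrightarrow> 0"
    using zero[OF F(2,4)] zero[OF vm Nv] AE_space
  proof eventually_elim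
    case (elim x)
    have b: "\<bar>f n x - u x\<bar> \<le> 3 * \<epsilon> n + m * \<bar>w n x\<bar> + \<bar>v n x\<bar>" for n
    proof -
      have "\<bar>f n x - (1 - w n x) * \<phi> n x\<bar> \<le> 3 * \<epsilon> n"
        using clamp_le(1)[of "3 * \<epsilon> n" "(1 - w n x) * \<phi> n x"] \<epsilon>[of n] unfolding F(6) by (simp add: abs_minus_commute)
      moreover have "\<bar>w n x * \<phi> n x\<bar> \<le> m * \<bar>w n x\<bar>"
        unfolding abs_mult using F(5)[OF elim(3), of n] by (subst mult.commute) (intro mult_right_mono, auto)
      moreover have "f n x - u x = (f n x - (1 - w n x) * \<phi> n x) - w n x * \<phi> n x + v n x"
        by (simp add: v_def algebra_simps)
      ultimately show ?thesis by linarith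
    qed
    have "(\<lambda>n. 3 * \<epsilon> n + m * \<bar>w n x\<bar> + \<bar>v n x\<bar>) \<longlonglongrightarrow> 3 * 0 + m * \<bar>0\<bar> + \<bar>0\<bar>"
      by (intro tendsto_intros \<epsilon>0 elim(1) elim(2))
    then have "(\<lambda>n. 3 * \<epsilon> n + m * \<bar>w n x\<bar> + \<bar>v n x\<bar>) \<longlonglongrightarrow> 0" by simp
    then show ?case by (rule Lim_null_comparison[rotated]) (use b in auto)
  qed
  define U where "U x y = bkern p M (s * p) u x y" for x y
  define Vn where "Vn n x y = bkern p M (s * p) (v n) x y" for n x y
  define Wn where "Wn n x y = bkern p M (s * p) (w n) x y" for n x y
  have [measurable]: "(\<lambda>(x, y). U x y) \<in> borel_measurable (M \<Otimes>\<^sub>M M)"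
    "(\<lambda>(x, y). Vn n x y) \<in> borel_measurable (M \<Otimes>\<^sub>M M)" "(\<lambda>(x, y). Wn n x y) \<in> borel_measurable (M \<Otimes>\<^sub>M M)" for n
    unfolding U_def Vn_def Wn_def by measurable
  define c where "c = ennreal (3 powr p)"
  define c2 where "c2 = ennreal (2 powr p)"
  define cm where "cm = ennreal (m powr p)"
  define G where "G x y = c * (c2 * U x y + (\<Sum>n. Vn n x y) + cm * (\<Sum>n. Wn n x y))" for x y
  have "(\<lambda>n. besov_total s p M (\<lambda>x. f n x - u x)) \<longlonglongrightarrow> 0"
  proof (rule besov_total_tendsto_0_dominated[OF p, where g="\<lambda>x. ennreal ((2 * m) powr p)" and G=G])
    show "(\<lambda>(x, y). G x y) \<in> borel_measurable (M \<Otimes>\<^sub>M M)" unfolding G_def by measurable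
    show "(\<integral>\<^sup>+x. ennreal ((2 * m) powr p) \<partial>M) < \<infinity>"
      by (simp add: ennreal_mult_less_top less_top[symmetric] ennreal_mult_eq_top_iff)
    have "(\<integral>\<^sup>+x. \<integral>\<^sup>+y. G x y \<partial>M \<partial>M) = c * (c2 * (\<integral>\<^sup>+x. \<integral>\<^sup>+y. U x y \<partial>M \<partial>M) +
        (\<integral>\<^sup>+x. \<integral>\<^sup>+y. (\<Sum>n. Vn n x y) \<partial>M \<partial>M) + cm * (\<integral>\<^sup>+x. \<integral>\<^sup>+y. (\<Sum>n. Wn n x y) \<partial>M \<partial>M))"
      unfolding G_def
      by (subst nn_integral_double_cmult, measurable)
         (subst nn_integral_double_add, measurable, subst nn_integral_double_add, measurable,
          subst nn_integral_double_cmult, measurable, subst nn_integral_double_cmult, measurable)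
    also have "(\<integral>\<^sup>+x. \<integral>\<^sup>+y. (\<Sum>n. Vn n x y) \<partial>M \<partial>M) = (\<Sum>n. \<integral>\<^sup>+x. \<integral>\<^sup>+y. Vn n x y \<partial>M \<partial>M)"
        by (rule nn_integral_double_suminf) measurable
    also have "(\<integral>\<^sup>+x. \<integral>\<^sup>+y. (\<Sum>n. Wn n x y) \<partial>M \<partial>M) = (\<Sum>n. \<integral>\<^sup>+x. \<integral>\<^sup>+y. Wn n x y \<partial>M \<partial>M)"
        by (rule nn_integral_double_suminf) measurable
    finally have eq: "(\<integral>\<^sup>+x. \<integral>\<^sup>+y. G x y \<partial>M \<partial>M) = c * (c2 * besov_energy s p M u + (\<Sum>n. besov_energy s p M (v n))
       + cm * (\<Sum>n. besov_energy s p M (w n)))"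
      unfolding besov_energy_kern U_def Vn_def Wn_def .
    have sV: "(\<Sum>n. besov_energy s p M (v n)) < \<infinity>"
    proof -
      have "(\<Sum>n. besov_energy s p M (v n)) \<le> (\<Sum>n. \<eta> n)"
        by (intro suminf_le summableI order_trans[OF _ Nv]) (simp add: besov_total_def)
      with s\<eta> show ?thesis by (rule order.strict_trans1[rotated])
    qed
    have sW: "(\<Sum>n. besov_energy s p M (w n)) < \<infinity>"
    proof -
      have "(\<Sum>n. besov_energy s p M (w n)) \<le> (\<Sum>n. \<eta> n)"
        by (intro suminf_le summableI order_trans[OF _ F(4)]) (simp add: besov_total_def)
      with s\<eta> show ?thesis by (rule order.strict_trans1[rotated])
    qed
    show "(\<integral>\<^sup>+x. \<integral>\<^sup>+y. G x y \<partial>M \<partial>M) < \<infinity>"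
      unfolding eq using sV sW uf by (simp add: c_def c2_def cm_def ennreal_mult_less_top)
    fix n x assume x: "x \<in> space M"
    have fb: "\<bar>f n x\<bar> \<le> m"
    proof -
      have "\<bar>f n x\<bar> \<le> \<bar>(1 - w n x) * \<phi> n x\<bar>" unfolding F(6) using \<epsilon>[of n] by (intro soft_le) auto
      also have "\<dots> \<le> 1 * m" unfolding abs_mult using F(5)[OF x, of n] by (intro mult_mono) auto
      finally show ?thesis by simp
    qed
    then show "epow p (f n x - u x) \<le> ennreal ((2 * m) powr p)"
      using m[of x] p by (intro ennreal_leI powr_mono2) auto
    fix y assume y: "y \<in> space M"
    \<comment> \<open>The factor 2 counts the increment of \<open>u\<close> once for
      \<open>u\<close> itself and once inside \<open>\<phi> n = u + v n\<close>.\<close>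
    have "\<bar>(f n y - u y) - (f n x - u x)\<bar> \<le> \<bar>2 * (u y - u x)\<bar> + \<bar>v n y - v n x\<bar> + \<bar>m * (w n y - w n x)\<bar>"
    proof -
      have "\<bar>f n y - f n x\<bar> \<le> \<bar>(1 - w n y) * \<phi> n y - (1 - w n x) * \<phi> n x\<bar>" unfolding F(6) by (rule soft_lipschitz)
      also have "(1 - w n y) * \<phi> n y - (1 - w n x) * \<phi> n x = (1 - w n y) * (\<phi> n y - \<phi> n x) - \<phi> n x * (w n y - w n x)"
        by (simp add: algebra_simps)
      also have "\<bar>\<dots>\<bar> \<le> \<bar>(1 - w n y) * (\<phi> n y - \<phi> n x)\<bar> + \<bar>\<phi> n x * (w n y - w n x)\<bar>" by linarith
      also have "\<dots> \<le> 1 * \<bar>\<phi> n y - \<phi> n x\<bar> + m * \<bar>w n y - w n x\<bar>"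
        unfolding abs_mult using F(5)[OF x, of n] F(5)[OF y, of n] by (intro add_mono mult_right_mono) auto
      also have "\<dots> = \<bar>(u y - u x) + (v n y - v n x)\<bar> + \<bar>m * (w n y - w n x)\<bar>"
        using m0 by (simp add: v_def abs_mult)
      finally have "\<bar>f n y - f n x\<bar> \<le> \<bar>(u y - u x) + (v n y - v n x)\<bar> + \<bar>m * (w n y - w n x)\<bar>" .
      moreover have "\<bar>2 * (u y - u x)\<bar> = 2 * \<bar>u y - u x\<bar>" by (simp only: abs_mult abs_numeral)
      moreover have "\<bar>(u y - u x) + (v n y - v n x)\<bar> \<le> \<bar>u y - u x\<bar> + \<bar>v n y - v n x\<bar>" by (rule abs_triangle_ineq)
      moreover have "\<bar>(f n y - u y) - (f n x - u x)\<bar> \<le> \<bar>f n y - f n x\<bar> + \<bar>u y - u x\<bar>" by linarith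
      ultimately show ?thesis by simp
    qed
    from ennreal_powr_le3[OF this p]
    have "epow p ((f n y - u y) - (f n x - u x)) \<le> c * (c2 * epow p (u y - u x)
        + epow p (v n y - v n x) + cm * epow p (w n y - w n x))"
    proof -
      have "epow p (2 * (u y - u x)) = c2 * epow p (u y - u x)"
        unfolding c2_def abs_mult abs_numeral by (subst powr_mult) (auto simp: ennreal_mult)
      moreover have "epow p (m * (w n y - w n x)) = cm * epow p (w n y - w n x)"
        unfolding cm_def abs_mult using m0 by (subst powr_mult) (auto simp: ennreal_mult)
      ultimately show ?thesis
        using \<open>epow p ((f n y - u y) - (f n x - u x)) \<le> _\<close> by (simp only: c_def)
    qed
    from mult_right_mono[OF this, of "ennreal (kern M (s * p) x y)"]
    have "ennreal (\<bar>(f n y - u y) - (f n x - u x)\<bar> powr p * kern M (s * p) x y) \<le> c * (c2 * U x y + Vn n x y + cm * Wn n x y)"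
      by (simp add: U_def Vn_def Wn_def ennreal_mult distrib_right mult.assoc)
    also have "\<dots> \<le> G x y" unfolding G_def
      by (intro mult_left_mono add_mono order_refl
           sum_le_suminf[where I="{n}" and f="\<lambda>n. Vn n x y", simplified]
           sum_le_suminf[where I="{n}" and f="\<lambda>n. Wn n x y", simplified]) auto
    finally show "ennreal (\<bar>(f n y - u y) - (f n x - u x)\<bar> powr p * kern M (s * p) x y) \<le> G x y" .
  qed (use lim0 in auto)
  then have "\<forall>\<^sub>F n in sequentially. besov_total s p M (\<lambda>x. f n x - u x) < e"
    using e by (rule order_tendstoD(2))
  then obtain n where "besov_total s p M (\<lambda>x. f n x - u x) < e" by (auto dest: eventually_happens)
  then show ?thesis using fm F(7) by blast
qed

section \<open>Truncation of unbounded functions\<close>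

text \<open>At each point the part of \<open>u\<close> beyond height \<open>n\<close> vanishes for
  large \<open>n\<close>, and both its values and its increments are dominated by those of
  \<open>u\<close>.\<close>

lemma clamp_approx:
  assumes p: "1 < p" and uB: "u \<in> besov_space s p M" and e: "0 < e"
  obtains m where "0 \<le> m" "besov_total s p M (\<lambda>x. soft m (u x)) < e"
proof -
  have u[measurable]: "u \<in> borel_measurable M" and uf: "besov_total s p M u < \<infinity>"
    using uB by (auto simp: besov_space_iff)
  have "(\<lambda>n. besov_total s p M (\<lambda>x. soft (real n) (u x))) \<longlonglongrightarrow> 0"
  proof (rule besov_total_tendsto_0_dominated[OF p, where g="\<lambda>x. epow p (u x)"
        and G="\<lambda>x y. bkern p M (s * p) u x y"])
    show "AE x in M. (\<lambda>n. soft (real n) (u x)) \<longlonglongrightarrow> 0"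
    proof (intro AE_I2)
      fix x
      obtain N where "\<bar>u x\<bar> \<le> real N" using real_arch_simple by blast
      then have "soft (real n) (u x) = 0" if "N \<le> n" for n using that by (intro soft_eq_0) linarith
      then show "(\<lambda>n. soft (real n) (u x)) \<longlonglongrightarrow> 0"
        by (intro tendsto_eventually) (auto simp: eventually_sequentially)
    qed
    show "(\<integral>\<^sup>+x. epow p (u x) \<partial>M) < \<infinity>" "(\<integral>\<^sup>+x. \<integral>\<^sup>+y. bkern p M (s * p) u x y \<partial>M \<partial>M) < \<infinity>"
      using uf by (auto simp: besov_total_def besov_energy_kern)
    fix n x y
    show "epow p (soft (real n) (u x)) \<le> epow p (u x)"
      using p by (intro ennreal_leI powr_mono2 soft_le) auto
    show "ennreal (\<bar>soft (real n) (u y) - soft (real n) (u x)\<bar> powr p * kern M (s * p) x y)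
       \<le> bkern p M (s * p) u x y"
      using p by (intro ennreal_leI mult_right_mono powr_mono2 soft_lipschitz) auto
  qed auto
  then have "\<forall>\<^sub>F n in sequentially. besov_total s p M (\<lambda>x. soft (real n) (u x)) < e"
    using e by (rule order_tendstoD(2))
  then obtain n where "besov_total s p M (\<lambda>x. soft (real n) (u x)) < e" by (auto dest: eventually_happens)
  then show thesis using that[of "real n"] by simp
qed

text \<open>Smallness of the \<open>p\<close>-th powers is translated into convergence of the norm,
  a sum of two \<open>p\<close>-th roots; the approximants lie in the space because they are
  \<open>u\<close> plus a small function.\<close>

lemma besov_approximableI:
  assumes p: "1 < p" and uB: "u \<in> besov_space s p M"
    and ex: "\<And>e. 0 < e \<Longrightarrow> \<exists>f\<in>borel_measurable M. compactly_supported_in (space M) Z f \<and> besov_total s p M (\<lambda>x. f x - u x) < e"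
  shows "besov_approximable s p M Z u"
proof -
  have u: "u \<in> borel_measurable M" "besov_total s p M u < \<infinity>" using uB by (auto simp: besov_space_iff)
  have "\<exists>v. \<forall>n. v n \<in> borel_measurable M \<and> compactly_supported_in (space M) Z (v n) \<and>
      besov_total s p M (\<lambda>x. v n x - u x) < ennreal (1 / real (Suc n))"
    by (intro choice allI) (use ex in \<open>force simp: Bex_def\<close>)
  then obtain v where v: "\<And>n. v n \<in> borel_measurable M" "\<And>n. compactly_supported_in (space M) Z (v n)"
      "\<And>n. besov_total s p M (\<lambda>x. v n x - u x) < ennreal (1 / real (Suc n))" by blast
  have vB: "v n \<in> besov_space s p M" for n
  proof -
    have "besov_total s p M (\<lambda>x. (v n x - u x) + u x) \<le> ennreal (2 powr p) * (besov_total s p M (\<lambda>x. v n x - u x) + besov_total s p M u)"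
      using u v(1)[of n] p by (intro besov_total_add) auto
    also have "\<dots> < \<infinity>"
    proof -
      have "besov_total s p M (\<lambda>x. v n x - u x) < top" using v(3)[of n] by (rule order.strict_trans) simp
      then show ?thesis using u(2) by (simp add: ennreal_mult_less_top)
    qed
    finally show ?thesis using v(1) by (simp add: besov_space_iff)
  qed
  have tot0: "(\<lambda>n. besov_total s p M (\<lambda>x. v n x - u x)) \<longlonglongrightarrow> 0"
  proof -
    have "(\<lambda>n. ennreal (1 / real (Suc n))) \<longlonglongrightarrow> ennreal 0"
      by (intro tendsto_ennrealI LIMSEQ_Suc lim_1_over_n)
    then have "(\<lambda>n. ennreal (1 / real (Suc n))) \<longlonglongrightarrow> 0" by simp
    then show ?thesis
      by (rule tendsto_sandwich[OF _ _ tendsto_const, rotated 2]) (auto intro!: always_eventually less_imp_le[OF v(3)] simp del: of_nat_Suc)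
  qed
  have "(\<lambda>n. besov_norm s p M (\<lambda>x. v n x - u x)) \<longlonglongrightarrow> 0 powr (1 / p) + 0 powr (1 / p)"
    unfolding besov_norm_def
  proof (intro tendsto_add tendsto_powr2 tendsto_const)
    have le: "besov_energy s p M w \<le> besov_total s p M w" "(\<integral>\<^sup>+x. epow p (w x) \<partial>M) \<le> besov_total s p M w" for w
      by (simp_all add: besov_total_def)
    have "(\<lambda>n. besov_energy s p M (\<lambda>x. v n x - u x)) \<longlonglongrightarrow> 0"
      by (rule tendsto_sandwich[OF _ _ tendsto_const tot0]) (use le in auto)
    then show "(\<lambda>n. enn2real (besov_energy s p M (\<lambda>x. v n x - u x))) \<longlonglongrightarrow> 0"
      using tendsto_enn2real[of _ 0] by fastforce
    have "(\<lambda>n. \<integral>\<^sup>+x. epow p (v n x - u x) \<partial>M) \<longlonglongrightarrow> 0"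
      by (rule tendsto_sandwich[OF _ _ tendsto_const tot0]) (use le in auto)
    then have "(\<lambda>n. enn2real (\<integral>\<^sup>+x. epow p (v n x - u x) \<partial>M)) \<longlonglongrightarrow> 0"
      using tendsto_enn2real[of _ 0] by fastforce
    moreover have "(\<integral>x. \<bar>v n x - u x\<bar> powr p \<partial>M) = enn2real (\<integral>\<^sup>+x. epow p (v n x - u x) \<partial>M)" for n
      using v(1)[of n] u(1) by (intro integral_eq_nn_integral) auto
    ultimately show "(\<lambda>n. \<integral>x. \<bar>v n x - u x\<bar> powr p \<partial>M) \<longlonglongrightarrow> 0" by simp
  qed (use p in \<open>auto intro!: eventuallyI integral_nonneg_AE\<close>)
  then show ?thesis unfolding besov_approximable_def using vB v(2) p by (intro exI[of _ v]) auto
qed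

text \<open>Reduction to bounded functions: \<open>u\<close> is truncated at a height beyond which
  little of its norm is left. The truncation is pointwise at most \<open>u\<close> in modulus, so it
  satisfies the limit condition with the same exceptional set.\<close>

theorem zero_trace_approximable:
  assumes p: "1 < p" and s: "0 < s" "s < 1" and uB: "u \<in> besov_space s p M"
    and compact: "compact (space M)" and S: "S \<subseteq> space M"
    and cap: "besov_capacity s p M {\<zeta> \<in> S. \<not> (ball_average M (\<lambda>x. \<bar>u x\<bar> powr p) \<zeta> \<longlongrightarrow> 0) (at_right 0)} = 0"
  shows "besov_approximable s p M (space M - S) u"
proof (rule besov_approximableI[OF p uB])
  define K where "K = ennreal (2 powr p)"
  have u[measurable]: "u \<in> borel_measurable M" and up: "integrable M (\<lambda>x. \<bar>u x\<bar> powr p)"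
    using uB by (auto simp: besov_space_def)
  fix e :: ennreal assume e: "0 < e"
  obtain e' where e': "0 < e'" "\<And>a b. a < e' \<Longrightarrow> b < e' \<Longrightarrow> K * (a + b) < e"
  proof (cases "e = \<infinity>")
    case True
    have "K * (a + b) < e" if "a < 1" "b < 1" for a b
    proof -
      have "a < top" "b < top" using that order.strict_trans[OF _ ennreal_one_less_top] by auto
      then show ?thesis using True by (simp add: K_def ennreal_mult_less_top)
    qed
    then show thesis using that[of 1] by simp
  next
    case False
    then obtain h where h: "e = ennreal h" "0 < h" using e by (cases e) auto
    show thesis
    proof (rule that[of "ennreal (h / 2 powr p / 2)"])
      show "0 < ennreal (h / 2 powr p / 2)" using h by simp
      fix a b assume a: "a < ennreal (h / 2 powr p / 2)" and b: "b < ennreal (h / 2 powr p / 2)"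
      obtain a' where a': "a = ennreal a'" "0 \<le> a'" using a by (cases a) auto
      obtain b' where b': "b = ennreal b'" "0 \<le> b'" using b by (cases b) auto
      have "a' < h / 2 powr p / 2" "b' < h / 2 powr p / 2" using a b a' b' by (simp_all add: ennreal_less_iff)
      then have "a' + b' < h / 2 powr p" by linarith
      then have "2 powr p * (a' + b') < h" by (simp add: field_simps)
      then show "K * (a + b) < e"
        using a' b' h by (simp add: K_def ennreal_plus[symmetric] ennreal_mult'[symmetric] ennreal_less_iff del: ennreal_plus)
    qed
  qed
  obtain m where m: "0 \<le> m" "besov_total s p M (\<lambda>x. soft m (u x)) < e'" using clamp_approx[OF p uB e'(1)] by blast
  define v where "v x = u x - soft m (u x)" for x
  have vm[measurable]: "v \<in> borel_measurable M" unfolding v_def by measurable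
  have vB: "v \<in> besov_space s p M"
  proof -
    have "besov_total s p M v \<le> besov_total s p M u"
      unfolding v_def using p m(1) by (intro besov_total_mono clamp_le clamp_lipschitz)
    also have "\<dots> < \<infinity>" using uB by (simp add: besov_space_iff)
    finally show ?thesis by (simp add: besov_space_iff)
  qed
  have "\<exists>f\<in>borel_measurable M. compactly_supported_in (space M) (space M - S) f \<and> besov_total s p M (\<lambda>x. f x - v x) < e'"
  proof (rule bounded_zero_trace_approx[OF p s vB _ compact S cap _ e'(1)])
    show "\<bar>v x\<bar> \<le> m" for x unfolding v_def using m(1) by (rule clamp_le)
    fix x assume "x \<in> S - {\<zeta> \<in> S. \<not> (ball_average M (\<lambda>x. \<bar>u x\<bar> powr p) \<zeta> \<longlongrightarrow> 0) (at_right 0)}"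
    then have x: "x \<in> space M" "(ball_average M (\<lambda>x. \<bar>u x\<bar> powr p) x \<longlongrightarrow> 0) (at_right 0)" using S by auto
    show "(\<lambda>j. avg M (scale j) v x) \<longlonglongrightarrow> 0"
      by (rule avg_tendsto_0_of_ball_average[OF p u up vm _ x]) (use m(1) in \<open>auto simp: v_def intro: clamp_le\<close>)
  qed
  then obtain f where f: "f \<in> borel_measurable M" "compactly_supported_in (space M) (space M - S) f"
      "besov_total s p M (\<lambda>x. f x - v x) < e'" by blast
  have "besov_total s p M (\<lambda>x. (f x - v x) - soft m (u x)) \<le> K * (besov_total s p M (\<lambda>x. f x - v x) + besov_total s p M (\<lambda>x. soft m (u x)))"
    unfolding K_def using f(1) p by (intro besov_total_le2) auto
  also have "\<dots> < e" using f(3) m(2) by (rule e'(2))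
  finally have "besov_total s p M (\<lambda>x. f x - u x) < e" by (simp add: v_def)
  then show "\<exists>f\<in>borel_measurable M. compactly_supported_in (space M) (space M - S) f \<and> besov_total s p M (\<lambda>x. f x - u x) < e"
    using f by blast
qed

end

section \<open>Zero trace of approximable functions\<close>

text \<open>Both arguments of the difference run over the ball, so no point value at
  \<open>x\<close> enters and the quantity makes sense on a null set such as the boundary. The
  squared mass normalises the double integral.\<close>

definition osc2 :: "real \<Rightarrow> 'a::metric_space measure \<Rightarrow> ('a \<Rightarrow> real) \<Rightarrow> real \<Rightarrow> 'a \<Rightarrow> ennreal" where
  "osc2 p M u r x = ennreal (1 / (bm M x r)\<^sup>2) *
     (\<integral>\<^sup>+z\<in>ball x (4 * r). devint p M u (u z) x (4 * r) \<partial>M)"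

context doubling_space
begin

lemma measurable_ball_indicator [measurable]:
  "(\<lambda>y. indicator (ball x r) y :: ennreal) \<in> borel_measurable M"
  unfolding indicator_ball using measurable_dist_P by measurable

lemma measurable_osc2 [measurable]:
  assumes [measurable]: "u \<in> borel_measurable M"
  shows "(\<lambda>x. osc2 p M u r x) \<in> borel_measurable M"
  unfolding osc2_def indicator_ball by measurable

text \<open>The condition \<open>dist x y + 2 * s \<le> 4 * r\<close> puts the ball seen by the
  average inside \<open>ball x (4 * r)\<close>, and \<open>r + dist x y \<le> 2 * s\<close> bounds
  the mass of \<open>ball x r\<close> by that of \<open>ball y s\<close>. Changes of centre and of
  scale are thus treated alike.\<close>

lemma avg_osc2_mean:
  assumes p: "1 < p"
  obtains K where "0 \<le> K"
    "\<And>u x r y s. integrable M u \<Longrightarrow> x \<in> space M \<Longrightarrow> y \<in> space M \<Longrightarrow> 0 < r \<Longrightarrow> 0 < s \<Longrightarrow>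
       dist x y + 2 * s \<le> 4 * r \<Longrightarrow> r + dist x y \<le> 2 * s \<Longrightarrow>
       ennreal (1 / bm M x r) * devint p M u (avg M s u y) x (4 * r) \<le> ennreal K * osc2 p M u r x"
proof -
  define K where "K = 2 powr p * D powr (p - 1) * D"
  have K: "0 \<le> K" using D_ge_1 by (simp add: K_def)
  show thesis
  proof (rule that[OF K])
  show "ennreal (1 / bm M x r) * devint p M u (avg M s u y) x (4 * r) \<le> ennreal K * osc2 p M u r x"
    if u: "integrable M u" and x: "x \<in> space M" and y: "y \<in> space M" and r: "0 < r" and s: "0 < s"
      and d1: "dist x y + 2 * s \<le> 4 * r" and d2: "r + dist x y \<le> 2 * s" for u x r y s
  proof -
    have [measurable]: "u \<in> borel_measurable M" using u by simp
    have bx: "0 < bm M x r" and bY: "0 < bm M y s" using bm_pos x y r s by auto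
    have pt: "epow p (u z - avg M s u y) \<le> ennreal (K / bm M x r) * devint p M u (u z) x (4 * r)" for z
    proof -
      have "epow p (avg M s u y - u z) \<le> ennreal (2 powr p * D powr (p - 1) / bm M y s) *
          devint p M u (u z) y (2 * s)"
        using u s y p bm_pos bm_double by (intro avg_diff_const_powr) auto
      also have "\<dots> \<le> ennreal (K / bm M x r) * devint p M u (u z) x (4 * r)"
      proof (intro mult_mono ennreal_leI nn_integral_mono)
        have "bm M x r \<le> D ^ 1 * bm M y s" using y s d2 by (intro bm_comp) auto
        then have "1 / bm M y s \<le> D / bm M x r" using bx bY by (simp add: field_simps)
        then have "2 powr p * D powr (p - 1) * (1 / bm M y s) \<le> 2 powr p * D powr (p - 1) * (D / bm M x r)"
          by (intro mult_left_mono) auto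
        then show "2 powr p * D powr (p - 1) / bm M y s \<le> K / bm M x r" by (simp add: K_def)
        fix w
        have "indicator (ball y (2 * s)) w \<le> (indicator (ball x (4 * r)) w :: ennreal)"
          using d1 dist_triangle[of x w y] by (auto simp: indicator_def)
        then show "indicator (ball y (2 * s)) w \<le> (indicator (ball x (4 * r)) w :: ennreal)" .
      qed auto
      finally show ?thesis by (simp add: abs_minus_commute)
    qed
    have "ennreal (1 / bm M x r) * devint p M u (avg M s u y) x (4 * r)
        \<le> ennreal (1 / bm M x r) * (\<integral>\<^sup>+z\<in>ball x (4 * r). (ennreal (K / bm M x r) * devint p M u (u z) x (4 * r)) \<partial>M)"
      by (intro mult_left_mono nn_integral_mono mult_right_mono pt) auto
    also have "\<dots> = ennreal (1 / bm M x r) * (ennreal (K / bm M x r) * (\<integral>\<^sup>+z\<in>ball x (4 * r). devint p M u (u z) x (4 * r) \<partial>M))"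
      unfolding mult.assoc by (subst nn_integral_cmult) measurable
    also have "\<dots> = ennreal K * osc2 p M u r x"
      unfolding osc2_def mult.assoc[symmetric] using K bx
      by (simp add: ennreal_mult'[symmetric] power2_eq_square)
    finally show ?thesis .
  qed
  qed
qed

text \<open>Both averages are compared with \<open>u z\<close>, and the comparison is averaged over
  all \<open>z\<close> in \<open>ball x (4 * r)\<close>.\<close>

lemma avg_osc2_diff:
  assumes p: "1 < p"
  obtains K where "0 \<le> K"
    "\<And>u x r y s y' s'. integrable M u \<Longrightarrow> x \<in> space M \<Longrightarrow> y \<in> space M \<Longrightarrow> y' \<in> space M \<Longrightarrow> 0 < r \<Longrightarrow> 0 < s \<Longrightarrow> 0 < s' \<Longrightarrow>
       dist x y + 2 * s \<le> 4 * r \<Longrightarrow> r + dist x y \<le> 2 * s \<Longrightarrow>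
       dist x y' + 2 * s' \<le> 4 * r \<Longrightarrow> r + dist x y' \<le> 2 * s' \<Longrightarrow>
       epow p (avg M s u y - avg M s' u y') \<le> ennreal K * osc2 p M u r x"
proof (rule avg_osc2_mean[OF p], goal_cases)
  case cst: (1 K)
  note K = cst(2,3)
  show thesis
  proof (rule that[of "2 powr p * (2 * K)"])
    show "0 \<le> 2 powr p * (2 * K)" using K(1) by simp
  show "epow p (avg M s u y - avg M s' u y') \<le> ennreal (2 powr p * (2 * K)) * osc2 p M u r x"
    if u: "integrable M u" and x: "x \<in> space M" and y: "y \<in> space M" and y': "y' \<in> space M" and r: "0 < r" and s: "0 < s" and s': "0 < s'"
      and d: "dist x y + 2 * s \<le> 4 * r" "r + dist x y \<le> 2 * s" "dist x y' + 2 * s' \<le> 4 * r" "r + dist x y' \<le> 2 * s'"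
    for u x r y s y' s'
  proof -
    have [measurable]: "u \<in> borel_measurable M" using u by simp
    have bx: "0 < bm M x r" using bm_pos x r by auto
    define a where "a = avg M s u y"
    define b where "b = avg M s' u y'"
    have "bm M x r \<le> bm M x (4 * r)" using r by (intro bm_mono) auto
    then have one: "1 \<le> ennreal (1 / bm M x r) * emeasure M (ball x (4 * r) \<inter> space M)"
      using bx by (simp add: emeasure_ball ennreal_mult'[symmetric] ennreal_1[symmetric] ennreal_leI del: ennreal_1)
    have "epow p (a - b) = 1 * epow p (a - b)" by simp
    also have "\<dots> \<le> (ennreal (1 / bm M x r) * emeasure M (ball x (4 * r) \<inter> space M)) * epow p (a - b)"
      by (intro mult_right_mono one) auto
    also have "\<dots> = ennreal (1 / bm M x r) * (\<integral>\<^sup>+z\<in>ball x (4 * r). epow p (a - b) \<partial>M)"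
    proof -
      have "(\<integral>\<^sup>+z\<in>ball x (4 * r). epow p (a - b) \<partial>M) = (\<integral>\<^sup>+z\<in>ball x (4 * r) \<inter> space M. epow p (a - b) \<partial>M)"
        by (rule set_nn_integral_space[symmetric])
      also have "\<dots> = epow p (a - b) * emeasure M (ball x (4 * r) \<inter> space M)"
        by (subst nn_integral_cmult_indicator) auto
      finally show ?thesis by (simp add: mult_ac)
    qed
    also have "\<dots> \<le> ennreal (1 / bm M x r) * (\<integral>\<^sup>+z\<in>ball x (4 * r). (ennreal (2 powr p) * (epow p (u z - a) + epow p (u z - b))) \<partial>M)"
      using p by (intro mult_left_mono nn_integral_mono mult_right_mono ennreal_powr_le2) auto
    also have "\<dots> = ennreal (2 powr p) * (ennreal (1 / bm M x r) * devint p M u a x (4 * r)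
        + ennreal (1 / bm M x r) * devint p M u b x (4 * r))"
    proof -
      have "(\<integral>\<^sup>+z\<in>ball x (4 * r). (ennreal (2 powr p) * (epow p (u z - a) + epow p (u z - b))) \<partial>M)
        = ennreal (2 powr p) * (\<integral>\<^sup>+z. epow p (u z - a) * indicator (ball x (4 * r)) z + epow p (u z - b) * indicator (ball x (4 * r)) z \<partial>M)"
        by (subst nn_integral_cmult[symmetric]) (auto simp: distrib_right mult.assoc)
      also have "\<dots> = ennreal (2 powr p) * (devint p M u a x (4 * r) + devint p M u b x (4 * r))"
        by (subst nn_integral_add) auto
      finally show ?thesis by (simp add: distrib_left mult_ac)
    qed
    also have "\<dots> \<le> ennreal (2 powr p) * (ennreal K * osc2 p M u r x + ennreal K * osc2 p M u r x)"
      unfolding a_def b_def using K(2)[OF u x y r s d(1,2)] K(2)[OF u x y' r s' d(3,4)] by (intro mult_left_mono add_mono) auto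
    also have "\<dots> = ennreal (2 powr p * (2 * K)) * osc2 p M u r x"
      using K(1) by (simp add: ennreal_mult distrib_right[symmetric] mult.assoc) (simp add: mult_2[symmetric] mult_ac)
    finally show ?thesis by (simp add: a_def b_def)
  qed
  qed
qed

definition energy_density :: "real \<Rightarrow> real \<Rightarrow> ('a \<Rightarrow> real) \<Rightarrow> 'a \<Rightarrow> ennreal" where
  "energy_density s p u x = (\<integral>\<^sup>+y. bkern p M (s * p) u x y \<partial>M)"

lemma measurable_energy_density [measurable]:
  assumes [measurable]: "u \<in> borel_measurable M"
  shows "energy_density s p u \<in> borel_measurable M"
  unfolding energy_density_def[abs_def] by measurable

lemma energy_density_integral: "(\<integral>\<^sup>+x. energy_density s p u x \<partial>M) = besov_energy s p M u"
  by (simp add: energy_density_def besov_energy_kern)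

text \<open>The distance of \<open>z\<close> and \<open>w\<close> is below \<open>8 * r\<close>, and
  \<open>8 * r + 4 * r \<le> 2 ^ 4 * r\<close> yields the power of \<open>D\<close>; so the kernel
  at such a pair is at least a constant times \<open>1 / (r powr a * bm M x r)\<close>.\<close>

lemma powr_diff_le_kern:
  assumes z: "z \<in> space M" and x: "x \<in> space M" and r: "0 < r" and a: "0 < a" and p: "0 < p"
    and d: "dist z w < 8 * r" "dist z x < 4 * r"
  shows "\<bar>u w - u z\<bar> powr p \<le> D ^ 4 * 8 powr a * r powr a * bm M x r * (\<bar>u w - u z\<bar> powr p * kern M a z w)"
proof (cases "z = w")
  case False
  then have b: "0 < bm M z (dist z w)" "0 < dist z w" using bm_pos z by auto
  have "bm M z (dist z w) \<le> bm M z (8 * r)" using d by (intro bm_mono) auto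
  also have "\<dots> \<le> D ^ 4 * bm M x r" using d x r by (intro bm_comp) auto
  finally have "bm M z (dist z w) \<le> D ^ 4 * bm M x r" .
  moreover have "dist z w powr a \<le> 8 powr a * r powr a"
  proof -
    have "dist z w powr a \<le> (8 * r) powr a" using d a by (intro powr_mono2) auto
    then show ?thesis using r by (simp add: powr_mult)
  qed
  ultimately have "dist z w powr a * bm M z (dist z w) \<le> (8 powr a * r powr a) * (D ^ 4 * bm M x r)"
    by (intro mult_mono) auto
  then have "1 \<le> D ^ 4 * 8 powr a * r powr a * bm M x r * kern M a z w"
    using b by (simp add: kern_def powr_minus field_simps)
  from mult_left_mono[OF this, of "\<bar>u w - u z\<bar> powr p"] show ?thesis by (simp add: mult_ac)
qed simp

text \<open>All pairs counted in \<open>osc2\<close> are within \<open>8 * r\<close> of each other.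
  The bound by an integral over one ball is what can be summed over balls of bounded
  overlap.\<close>

lemma osc2_le_energy_density:
  assumes u[measurable]: "u \<in> borel_measurable M" and x: "x \<in> space M" and r: "0 < r" and s: "0 < s" and p: "1 < p"
  shows "osc2 p M u r x \<le> ennreal (D ^ 4 * 8 powr (s * p) * r powr (s * p) / bm M x r) * (\<integral>\<^sup>+z\<in>ball x (4 * r). energy_density s p u z \<partial>M)"
proof -
  define c where "c = D ^ 4 * 8 powr (s * p) * r powr (s * p) * bm M x r"
  have c: "0 \<le> c" using D_ge_1 by (simp add: c_def)
  have bx: "0 < bm M x r" using bm_pos x r by auto
  have "(\<integral>\<^sup>+z\<in>ball x (4 * r). devint p M u (u z) x (4 * r) \<partial>M)
     \<le> (\<integral>\<^sup>+z. ennreal c * (energy_density s p u z * indicator (ball x (4 * r)) z) \<partial>M)"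
  proof (intro nn_integral_mono)
    fix z assume z: "z \<in> space M"
    show "devint p M u (u z) x (4 * r) * indicator (ball x (4 * r)) z
        \<le> ennreal c * (energy_density s p u z * indicator (ball x (4 * r)) z)"
    proof (cases "z \<in> ball x (4 * r)")
      case True
      have "devint p M u (u z) x (4 * r)
          \<le> (\<integral>\<^sup>+w. ennreal c * bkern p M (s * p) u z w \<partial>M)"
      proof (intro nn_integral_mono)
        fix w assume "w \<in> space M"
        show "epow p (u w - u z) * indicator (ball x (4 * r)) w
            \<le> ennreal c * bkern p M (s * p) u z w"
        proof (cases "w \<in> ball x (4 * r)")
          case w: True
          have "dist z w < 8 * r" using True w dist_triangle3[of z w x] by auto
          then have "\<bar>u w - u z\<bar> powr p \<le> c * (\<bar>u w - u z\<bar> powr p * kern M (s * p) z w)"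
            unfolding c_def using z x r s p True by (intro powr_diff_le_kern) (auto simp: dist_commute)
          then show ?thesis using w c by (simp add: ennreal_mult'[symmetric] ennreal_leI)
        qed simp
      qed
      also have "\<dots> = ennreal c * energy_density s p u z"
        unfolding energy_density_def using z by (intro nn_integral_cmult) measurable
      finally show ?thesis using True by simp
    qed simp
  qed
  also have "\<dots> = ennreal c * (\<integral>\<^sup>+z\<in>ball x (4 * r). energy_density s p u z \<partial>M)"
    by (intro nn_integral_cmult) measurable
  finally have "osc2 p M u r x \<le> ennreal (1 / (bm M x r)\<^sup>2) * (ennreal c * (\<integral>\<^sup>+z\<in>ball x (4 * r). energy_density s p u z \<partial>M))"
    unfolding osc2_def by (intro mult_left_mono) auto
  also have "\<dots> = ennreal (D ^ 4 * 8 powr (s * p) * r powr (s * p) / bm M x r) * (\<integral>\<^sup>+z\<in>ball x (4 * r). energy_density s p u z \<partial>M)"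
    unfolding mult.assoc[symmetric] using bx c
    by (simp add: c_def ennreal_mult'[symmetric] power2_eq_square)
  finally show ?thesis .
qed

lemma scale_Suc: "scale (Suc j) = scale j / 2" by (simp add: scale_def)

lemma scale_diff: "k \<le> j \<Longrightarrow> scale j = scale k / 2 ^ (j - k)"
  by (simp add: scale_def power_diff)

text \<open>The weight is \<open>(2 powr a) ^ (j - k)\<close> and supplies the geometric decay for
  telescoping; the exponent \<open>a\<close> is chosen anew in each application.\<close>

abbreviation tail_osc :: "real \<Rightarrow> real \<Rightarrow> ('a \<Rightarrow> real) \<Rightarrow> nat \<Rightarrow> 'a \<Rightarrow> ennreal" where
  "tail_osc p a u k x \<equiv>
     (\<Sum>j. if k \<le> j then ennreal ((scale k / scale j) powr a) * osc2 p M u (scale j) x else 0)"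

lemma avg_telescope:
  assumes p: "1 < p" and a: "0 < a"
  obtains C where "0 \<le> C"
    "\<And>u x k. integrable M u \<Longrightarrow> x \<in> space M \<Longrightarrow> tail_osc p a u k x < \<infinity> \<Longrightarrow>
       convergent (\<lambda>j. avg M (scale j) u x)"
    "\<And>u x k. integrable M u \<Longrightarrow> x \<in> space M \<Longrightarrow> tail_osc p a u k x < \<infinity> \<Longrightarrow>
       epow p (lim (\<lambda>j. avg M (scale j) u x) - avg M (scale k) u x) \<le> ennreal C * tail_osc p a u k x"
proof (rule avg_osc2_diff[OF p], goal_cases)
  case cst: (1 K)
  note K = cst(2,3)
  define q where "q = (1/2::real) powr a"
  have q: "0 < q" "q < 1" using powr_less_mono2[of a "1/2" 1] a by (auto simp: q_def)
  define C where "C = 1 / (1 - q powr (1 / p)) powr p"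
  have main: "convergent (\<lambda>j. avg M (scale j) u x) \<and>
     epow p (lim (\<lambda>j. avg M (scale j) u x) - avg M (scale k) u x) \<le> ennreal (C * K) *
         tail_osc p a u k x"
    if u: "integrable M u" and x: "x \<in> space M" and
      fin: "tail_osc p a u k x < \<infinity>" for u x k
  proof -
    have eq: "(if k \<le> j then ennreal K * osc2 p M u (scale j) x / ennreal (q ^ (j - k)) else 0)
       = ennreal K * (if k \<le> j then ennreal ((scale k / scale j) powr a) * osc2 p M u (scale j) x else 0)" for j
    proof (cases "k \<le> j")
      case True
      have "scale k / scale j = 2 ^ (j - k)" unfolding scale_diff[OF True] by (simp add: scale_pos)
      then have "(scale k / scale j) powr a = 1 / q ^ (j - k)"
        unfolding q_def half_powr_power by (simp add: powr_divide)
      then have "ennreal ((scale k / scale j) powr a) = 1 / ennreal (q ^ (j - k))"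
        using q by (simp add: divide_ennreal[symmetric] ennreal_1[symmetric] del: ennreal_1)
      then show ?thesis using True by (simp add: divide_ennreal_def mult_ac)
    qed simp
    have S: "(\<Sum>j. if k \<le> j then ennreal K * osc2 p M u (scale j) x / ennreal (q ^ (j - k)) else 0)
      = ennreal K * tail_osc p a u k x"
      unfolding eq ennreal_suminf_cmult ..
    have h: "epow p (avg M (scale (Suc j)) u x - avg M (scale j) u x) \<le> ennreal K * osc2 p M u (scale j) x" for j
      by (rule K(2)[OF u x x x]) (use scale_pos[of j] in \<open>auto simp: scale_Suc\<close>)
    have S': "(\<Sum>j. if k \<le> j then ennreal K * osc2 p M u (scale j) x / ennreal (q ^ (j - k)) else 0) < \<infinity>"
      unfolding S using fin by (simp add: ennreal_mult_less_top)
    note t = telescope_powr_le[where a="\<lambda>j. avg M (scale j) u x" and h="\<lambda>j. ennreal K * osc2 p M u (scale j) x" and k=k, OF p q h S']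
    have "epow p (lim (\<lambda>j. avg M (scale j) u x) - avg M (scale k) u x) \<le> ennreal C *
       (ennreal K * tail_osc p a u k x)"
      using t(2) unfolding S C_def .
    moreover have "0 \<le> C" by (simp add: C_def)
    ultimately show ?thesis using t(1) K(1) by (simp add: ennreal_mult mult.assoc)
  qed
  show thesis
    by (rule that[of "C * K"]) (use main K(1) in \<open>auto simp: C_def\<close>)
qed

text \<open>A radius between two consecutive scales is compared with the larger one at the cost of
  one doubling, and \<open>u - c\<close> is split at the average of that scale.\<close>

lemma ball_average_le_osc2:
  assumes p: "1 < p"
  obtains C where "0 \<le> C"
    "\<And>u x j r c. integrable M u \<Longrightarrow> x \<in> space M \<Longrightarrow> scale j / 2 \<le> r \<Longrightarrow> r < scale j \<Longrightarrow>
      ennreal (1 / bm M x r) * devint p M u c x r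
        \<le> ennreal C * (osc2 p M u (scale j) x + epow p (avg M (scale j) u x - c))"
proof (rule avg_osc2_mean[OF p], goal_cases)
  case cst: (1 K)
  note K = cst(2,3)
  define C where "C = 2 powr p * (D * K + 1)"
  show thesis
  proof (rule that[of C])
    show "0 \<le> C" using K D_ge_1 by (simp add: C_def)
    fix u :: "'a \<Rightarrow> real" and x j and r c :: real
    assume u: "integrable M u" and x: "x \<in> space M" and r: "scale j / 2 \<le> r" "r < scale j"
    have [measurable]: "u \<in> borel_measurable M" using u by simp
    have r0: "0 < r" using r scale_pos[of j] by linarith
    have bx: "0 < bm M x r" "0 < bm M x (scale j)" using bm_pos[OF x] r0 by auto
    define A where "A = avg M (scale j) u x"
    have cmp: "1 / bm M x r \<le> D * (1 / bm M x (scale j))"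
    proof -
      have "bm M x (scale j) \<le> D ^ 1 * bm M x r" using x r r0 by (intro bm_comp) auto
      then show ?thesis using bx by (simp add: field_simps)
    qed
    have "ennreal (1 / bm M x r) * devint p M u c x r
      \<le> ennreal (1 / bm M x r) * (\<integral>\<^sup>+z\<in>ball x r. (ennreal (2 powr p) * (epow p (u z - A) + epow p (A - c))) \<partial>M)"
      using p by (intro mult_left_mono nn_integral_mono mult_right_mono ennreal_powr_le2) auto
    also have "\<dots> = ennreal (2 powr p) * (ennreal (1 / bm M x r) * devint p M u A x r
        + ennreal (1 / bm M x r) * (\<integral>\<^sup>+z\<in>ball x r. epow p (A - c) \<partial>M))"
    proof -
      have "(\<integral>\<^sup>+z\<in>ball x r. (ennreal (2 powr p) * (epow p (u z - A) + epow p (A - c))) \<partial>M)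
        = ennreal (2 powr p) * (\<integral>\<^sup>+z. epow p (u z - A) * indicator (ball x r) z + epow p (A - c) * indicator (ball x r) z \<partial>M)"
        by (subst nn_integral_cmult[symmetric]) (auto simp: distrib_right mult.assoc)
      also have "\<dots> = ennreal (2 powr p) * (devint p M u A x r + (\<integral>\<^sup>+z\<in>ball x r. epow p (A - c) \<partial>M))"
        by (subst nn_integral_add) auto
      finally show ?thesis by (simp add: distrib_left mult_ac)
    qed
    also have "ennreal (1 / bm M x r) * (\<integral>\<^sup>+z\<in>ball x r. epow p (A - c) \<partial>M) = epow p (A - c)"
    proof -
      have "(\<integral>\<^sup>+z\<in>ball x r. epow p (A - c) \<partial>M) = (\<integral>\<^sup>+z\<in>ball x r \<inter> space M. epow p (A - c) \<partial>M)"
        by (rule set_nn_integral_space[symmetric])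
      also have "\<dots> = epow p (A - c) * emeasure M (ball x r \<inter> space M)"
        by (subst nn_integral_cmult_indicator) auto
      finally show ?thesis using bx by (simp add: emeasure_ball ennreal_mult'[symmetric])
    qed
    also have "ennreal (1 / bm M x r) * devint p M u A x r
       \<le> ennreal (D * (1 / bm M x (scale j))) * devint p M u A x (4 * scale j)"
    proof (intro mult_mono ennreal_leI cmp nn_integral_mono)
      fix z show "indicator (ball x r) z \<le> (indicator (ball x (4 * scale j)) z :: ennreal)"
        using r r0 by (auto simp: indicator_def)
    qed auto
    also have "\<dots> = ennreal D * (ennreal (1 / bm M x (scale j)) * devint p M u A x (4 * scale j))"
      unfolding mult.assoc[symmetric] using D_ge_1 by (simp add: ennreal_mult'[symmetric])
    also have "\<dots> \<le> ennreal D * (ennreal K * osc2 p M u (scale j) x)"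
      unfolding A_def by (intro mult_left_mono K(2)[OF u x x]) auto
    finally have "ennreal (1 / bm M x r) * devint p M u c x r
       \<le> ennreal (2 powr p) * (ennreal D * (ennreal K * osc2 p M u (scale j) x) + epow p (A - c))"
      by (auto simp: mult_left_mono add_right_mono)
    also have "\<dots> \<le> ennreal (2 powr p) * (ennreal (D * K + 1) * (osc2 p M u (scale j) x + epow p (A - c)))"
    proof (intro mult_left_mono)
      have "ennreal (D * K + 1) = ennreal (D * K) + 1" using D_ge_1 K(1) by (subst ennreal_plus) auto
      then have "ennreal (D * K + 1) * (osc2 p M u (scale j) x + epow p (A - c))
          = ennreal (D * K) * osc2 p M u (scale j) x + epow p (A - c)
            + (ennreal (D * K) * epow p (A - c) + osc2 p M u (scale j) x)"
        by (simp add: distrib_left distrib_right add_ac)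
      then show "ennreal D * (ennreal K * osc2 p M u (scale j) x) + epow p (A - c)
         \<le> ennreal (D * K + 1) * (osc2 p M u (scale j) x + epow p (A - c))"
        using D_ge_1 by (simp add: ennreal_mult' mult.assoc)
    qed simp
    also have "\<dots> = ennreal C * (osc2 p M u (scale j) x + epow p (A - c))"
      using D_ge_1 K by (simp add: C_def ennreal_mult' mult.assoc)
    finally show "ennreal (1 / bm M x r) * devint p M u c x r
        \<le> ennreal C * (osc2 p M u (scale j) x + epow p (avg M (scale j) u x - c))"
      by (simp add: A_def)
  qed
qed

section \<open>From dyadic scales to all small radii\<close>

lemma eventually_scale_shell:
  assumes "\<forall>\<^sub>F j in sequentially. \<forall>r. scale j / 2 \<le> r \<longrightarrow> r < scale j \<longrightarrow> Q r"
  shows "\<forall>\<^sub>F r in at_right 0. Q r"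
proof -
  obtain J where J: "\<And>j r. J \<le> j \<Longrightarrow> scale j / 2 \<le> r \<Longrightarrow> r < scale j \<Longrightarrow> Q r"
    using assms by (auto simp: eventually_sequentially)
  have "\<forall>\<^sub>F r in at_right 0. r \<in> {0<..<scale J}" by (rule eventually_at_right_real) simp
  then show ?thesis
  proof eventually_elim
    fix r assume r: "r \<in> {0<..<scale J}"
    then obtain i where i: "scale J / 2 ^ i / 2 \<le> r" "r < scale J / 2 ^ i" using shell_in_ball_exists[of r "scale J"] by auto
    have "scale (J + i) = scale J / 2 ^ i" by (simp add: scale_def power_add)
    then show "Q r" using J[of "J + i" r] i by simp
  qed
qed

text \<open>The bound on the integral controls the average at scale \<open>k\<close>, the bound on
  the oscillations controls the telescoping series from there on, so the \<open>p\<close>-th power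
  of the limit of the averages is of order \<open>\<kappa>\<close>. The means follow, as the
  oscillation itself is below \<open>\<kappa>\<close> at small scales.\<close>

lemma ball_average_eventually_le:
  assumes p: "1 < p" and b: "0 < b"
  obtains C where "0 < C"
    "\<And>u x k \<kappa>. u \<in> borel_measurable M \<Longrightarrow> integrable M (\<lambda>x. \<bar>u x\<bar> powr p) \<Longrightarrow> x \<in> space M \<Longrightarrow> 0 < \<kappa> \<Longrightarrow>
       (\<integral>\<^sup>+z. epow p (u z) \<partial>M) \<le> ennreal (\<kappa> * bm M x (scale k)) \<Longrightarrow>
       (\<And>j. k \<le> j \<Longrightarrow> osc2 p M u (scale j) x \<le> ennreal (\<kappa> * scale j powr b)) \<Longrightarrow>
       \<forall>\<^sub>F r in at_right 0. ball_average M (\<lambda>x. \<bar>u x\<bar> powr p) x r \<le> C * \<kappa>"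
proof (rule avg_telescope[OF p half_gt_zero[OF b]], rule ball_average_le_osc2[OF p], goal_cases)
  case cst: (1 C1 C2)
  \<comment> \<open>Half of the decay \<open>scale j powr b\<close> is spent on the telescoping
    weight; the other half leaves a convergent geometric series.\<close>
  define a where "a = b / 2"
  note C1 = cst(2-4)[folded a_def] and C2 = cst(5,6)
  have a: "0 < a" using b by (simp add: a_def)
  define q where "q = (1/2::real) powr a"
  have q: "0 < q" "q < 1" using powr_less_mono2[of a "1/2" 1] a by (auto simp: q_def)
  define C3 where "C3 = R powr b * (1 / (1 - q))"
  have C3: "0 \<le> C3" using q by (simp add: C3_def)
  define C4 where "C4 = 2 powr p * (C1 * C3 + 2 powr p * D powr (p - 1))"
  have C4: "0 \<le> C4" using C1 C3 by (simp add: C4_def)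
  show thesis
  proof (rule that[of "C2 * (2 + C4) + 1"])
    show "0 < C2 * (2 + C4) + 1" using C2 C4 by (intro add_nonneg_pos mult_nonneg_nonneg) auto
    fix u x k \<kappa>
    assume u[measurable]: "u \<in> borel_measurable M" and up: "integrable M (\<lambda>x. \<bar>u x\<bar> powr p)" and x: "x \<in> space M" and \<kappa>: "0 < (\<kappa>::real)"
      and up_le: "(\<integral>\<^sup>+z. epow p (u z) \<partial>M) \<le> ennreal (\<kappa> * bm M x (scale k))"
      and osc: "\<And>j. k \<le> j \<Longrightarrow> osc2 p M u (scale j) x \<le> ennreal (\<kappa> * scale j powr b)"
    have u0: "integrable M u" using integrable_of_powr[OF u _ p] up by (simp add: integrable_iff_bounded)
    define S where "S = tail_osc p a u k x"
    have S: "S \<le> ennreal (C3 * \<kappa>)"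
    proof -
      have "S \<le> (\<Sum>j. if k \<le> j then ennreal (\<kappa> * R powr b * q ^ (j - k)) else 0)"
        unfolding S_def
      proof (intro suminf_le summableI)
        fix j
        show "(if k \<le> j then ennreal ((scale k / scale j) powr a) * osc2 p M u (scale j) x else 0)
            \<le> (if k \<le> j then ennreal (\<kappa> * R powr b * q ^ (j - k)) else 0)"
        proof (cases "k \<le> j")
          case True
          have bb: "b = a + a" by (simp add: a_def)
          have r: "scale j / scale k = 1 / 2 ^ (j - k)" unfolding scale_diff[OF True] by (simp add: scale_pos)
          have "(scale k / scale j) powr a * scale j powr b = scale k powr b * (scale j / scale k) powr a"
            unfolding bb powr_add by (simp add: powr_divide field_simps)
          also have "\<dots> = scale k powr b * q ^ (j - k)" unfolding r q_def half_powr_power ..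
          also have "\<dots> \<le> R powr b * q ^ (j - k)"
            using q b scale_le by (intro mult_right_mono powr_mono2) auto
          finally have "\<kappa> * ((scale k / scale j) powr a * scale j powr b) \<le> \<kappa> * (R powr b * q ^ (j - k))"
            using \<kappa> by (intro mult_left_mono) auto
          then have le: "(scale k / scale j) powr a * (\<kappa> * scale j powr b) \<le> \<kappa> * R powr b * q ^ (j - k)" by (simp add: mult_ac)
          have "ennreal ((scale k / scale j) powr a) * osc2 p M u (scale j) x \<le> ennreal ((scale k / scale j) powr a) * ennreal (\<kappa> * scale j powr b)"
            by (intro mult_left_mono osc True) auto
          also have "\<dots> \<le> ennreal (\<kappa> * R powr b * q ^ (j - k))"
            using le by (simp add: ennreal_mult'[symmetric] ennreal_leI)
          finally show ?thesis using True by simp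
        qed simp
      qed
      also have "\<dots> = (\<Sum>i. ennreal (\<kappa> * R powr b * q ^ i))"
        by (subst suminf_offset[of _ k, OF summableI]) (auto intro!: suminf_cong simp: sum.neutral)
      also have "\<dots> = ennreal (\<kappa> * R powr b * (1 / (1 - q)))"
        using q \<kappa> by (intro suminf_ennreal_eq sums_mult geometric_sums) auto
      finally show ?thesis by (simp add: C3_def mult_ac)
    qed
    then have Sfin: "S < \<infinity>" by (simp add: order.strict_trans1)
    define A where "A j = avg M (scale j) u x" for j
    define l where "l = lim A"
    have conv: "A \<longlonglongrightarrow> l" using C1(2)[OF u0 x Sfin[unfolded S_def]] unfolding l_def A_def[abs_def] by (simp add: convergent_LIMSEQ_iff)
    have "epow p (l - A k) \<le> ennreal C1 * S"
      using C1(3)[OF u0 x Sfin[unfolded S_def]] unfolding l_def A_def[abs_def] S_def .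
    also have "\<dots> \<le> ennreal C1 * ennreal (C3 * \<kappa>)" by (intro mult_left_mono S) auto
    finally have lA: "epow p (l - A k) \<le> ennreal (C1 * C3 * \<kappa>)" using C1(1) C3 \<kappa> by (simp add: ennreal_mult'[symmetric] mult_ac)
    have Ak: "epow p (A k) \<le> ennreal (2 powr p * D powr (p - 1) * \<kappa>)"
    proof -
      have "epow p (A k - 0) \<le> ennreal (2 powr p * D powr (p - 1) / bm M x (scale k)) *
          devint p M u 0 x (2 * scale k)"
        unfolding A_def using u0 x p bm_pos bm_double by (intro avg_diff_const_powr) auto
      also have "\<dots> \<le> ennreal (2 powr p * D powr (p - 1) / bm M x (scale k)) * (\<integral>\<^sup>+y. epow p (u y) \<partial>M)"
        by (intro mult_left_mono nn_integral_mono) (auto simp: indicator_def)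
      also have "\<dots> \<le> ennreal (2 powr p * D powr (p - 1) / bm M x (scale k)) * ennreal (\<kappa> * bm M x (scale k))"
        by (intro mult_left_mono up_le) auto
      also have "\<dots> = ennreal (2 powr p * D powr (p - 1) * \<kappa>)"
        using bm_pos[OF x scale_pos[of k]] by (simp add: ennreal_mult'[symmetric] mult.assoc)
      finally show ?thesis by simp
    qed
    have l: "\<bar>l\<bar> powr p \<le> C4 * \<kappa>"
    proof -
      have "epow p l \<le> ennreal (2 powr p) * (epow p (l - A k) + epow p (A k))"
        using p by (intro ennreal_powr_le2) auto
      also have "\<dots> \<le> ennreal (2 powr p) * (ennreal (C1 * C3 * \<kappa>) + ennreal (2 powr p * D powr (p - 1) * \<kappa>))"
        by (intro mult_left_mono add_mono lA Ak) auto
      also have "\<dots> = ennreal (C4 * \<kappa>)"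
        using C1(1) C3 \<kappa> by (simp add: C4_def ennreal_plus[symmetric] ennreal_mult'[symmetric] algebra_simps del: ennreal_plus)
      finally show ?thesis using C4 \<kappa> by (subst (asm) ennreal_le_iff) auto
    qed
    have ev1: "\<forall>\<^sub>F j in sequentially. \<bar>A j\<bar> powr p < C4 * \<kappa> + \<kappa>"
    proof -
      have "(\<lambda>j. \<bar>A j\<bar> powr p) \<longlonglongrightarrow> \<bar>l\<bar> powr p"
        using p by (intro tendsto_powr2 tendsto_rabs conv tendsto_const) auto
      then show ?thesis using l \<kappa> by (intro order_tendstoD(2)) auto
    qed
    have ev2: "\<forall>\<^sub>F j in sequentially. scale j powr b < 1"
    proof -
      have "(\<lambda>j. scale j powr b) \<longlonglongrightarrow> 0 powr b"
        using b by (intro tendsto_powr2 scale_tendsto tendsto_const) auto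
      then show ?thesis using b by (intro order_tendstoD(2)) auto
    qed
    show "\<forall>\<^sub>F r in at_right 0. ball_average M (\<lambda>x. \<bar>u x\<bar> powr p) x r \<le> (C2 * (2 + C4) + 1) * \<kappa>"
    proof (rule eventually_scale_shell)
      show "\<forall>\<^sub>F j in sequentially. \<forall>r. scale j / 2 \<le> r \<longrightarrow> r < scale j \<longrightarrow> ball_average M (\<lambda>x. \<bar>u x\<bar> powr p) x r \<le> (C2 * (2 + C4) + 1) * \<kappa>"
        using ev1 ev2 eventually_ge_at_top[of k]
      proof eventually_elim
        case (elim j)
        show ?case
        proof (intro allI impI)
          fix r assume r: "scale j / 2 \<le> r" "r < scale j"
          have r0: "0 < r" using r scale_pos[of j] by linarith
          have br: "0 < bm M x r" using bm_pos[OF x r0] .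
          let ?B = "ball_average M (\<lambda>x. \<bar>u x\<bar> powr p) x r"
          have "ennreal ?B = ennreal (1 / bm M x r) * (\<integral>\<^sup>+z\<in>ball x r. epow p (u z) \<partial>M)"
            using up x r0 br by (subst nn_integral_ball_average) (auto simp: ennreal_mult'[symmetric])
          also have "\<dots> \<le> ennreal C2 * (osc2 p M u (scale j) x + epow p (A j))"
            using C2(2)[OF u0 x r, of 0] by (simp add: A_def)
          also have "\<dots> \<le> ennreal C2 * (ennreal (\<kappa> * 1) + ennreal (C4 * \<kappa> + \<kappa>))"
            using elim \<kappa> by (intro mult_left_mono add_mono order_trans[OF osc] ennreal_leI) auto
          also have "\<dots> = ennreal (C2 * (2 + C4) * \<kappa>)"
            using C2(1) C4 \<kappa> by (simp add: ennreal_plus[symmetric] ennreal_mult'[symmetric] algebra_simps del: ennreal_plus)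
          finally have "?B \<le> C2 * (2 + C4) * \<kappa>" using C2(1) C4 \<kappa> by (subst (asm) ennreal_le_iff) auto
          also have "\<dots> \<le> (C2 * (2 + C4) + 1) * \<kappa>" using \<kappa> by (intro mult_right_mono) auto
          finally show "?B \<le> (C2 * (2 + C4) + 1) * \<kappa>" .
        qed
      qed
    qed
  qed
qed

end

section \<open>Hausdorff content and null sets\<close>

lemma ennreal_le_suminf: "f i \<le> (\<Sum>j. f j :: ennreal)"
  using sum_le_suminf[of f "{i}"] by simp

lemma codim_hausdorff_content_mono:
  assumes "A \<subseteq> B"
  shows "codim_hausdorff_content M \<sigma> \<delta> A \<le> codim_hausdorff_content M \<sigma> \<delta> B"
  unfolding codim_hausdorff_content_def using assms by (intro INF_superset_mono) auto

lemma codim_hausdorff_content_antimono: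
  assumes "\<delta> \<le> \<delta>'"
  shows "codim_hausdorff_content M \<sigma> \<delta>' A \<le> codim_hausdorff_content M \<sigma> \<delta> A"
  unfolding codim_hausdorff_content_def using assms by (intro INF_superset_mono) force+

text \<open>A cover is a set of pairs, so a ball that occurs at several levels is counted once; the
  sum over levels can only be larger.\<close>

lemma codim_hausdorff_content_le:
  assumes N: "\<And>j::nat. finite (N j)" "\<And>j. N j \<subseteq> space M" and r: "\<And>j. N j \<noteq> {} \<Longrightarrow> 0 < r j \<and> r j < \<delta>"
    and A: "A \<subseteq> (\<Union>j. \<Union>x\<in>N j. ball x (r j))"
  shows "codim_hausdorff_content M \<sigma> \<delta> A
           \<le> (\<Sum>j. \<Sum>x\<in>N j. emeasure M (ball x (r j) \<inter> space M) / ennreal (r j powr \<sigma>))"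
proof -
  define C where "C = (\<Union>j. N j \<times> {r j})"
  define g where "g = (\<lambda>(x, r). emeasure M (ball x r \<inter> space M) / ennreal (r powr \<sigma>))"
  have "codim_hausdorff_content M \<sigma> \<delta> A \<le> (\<integral>\<^sup>+z. g z \<partial>count_space C)"
    unfolding codim_hausdorff_content_def g_def
  proof (rule INF_lower, clarify, intro conjI)
    show "countable C" unfolding C_def using N(1) by (intro countable_UN) (auto intro: countable_finite)
    show "C \<subseteq> space M \<times> {0<..<\<delta>}" unfolding C_def using N(2) r by fastforce
    show "A \<subseteq> (\<Union>(x, r)\<in>C. ball x r)" unfolding C_def using A by fastforce
  qed
  also have "\<dots> = (\<integral>\<^sup>+z. g z * indicator C z \<partial>count_space UNIV)"
    by (subst nn_integral_count_space_indicator) auto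
  also have "\<dots> \<le> (\<integral>\<^sup>+z. (\<Sum>j. g z * indicator (N j \<times> {r j}) z) \<partial>count_space UNIV)"
  proof (intro nn_integral_mono)
    fix z
    show "g z * indicator C z \<le> (\<Sum>j. g z * indicator (N j \<times> {r j}) z)"
    proof (cases "z \<in> C")
      case True
      then obtain i where i: "z \<in> N i \<times> {r i}" by (auto simp: C_def)
      have "g z * indicator C z = g z * indicator (N i \<times> {r i}) z" using i True by simp
      also have "\<dots> \<le> (\<Sum>j. g z * indicator (N j \<times> {r j}) z)"
        by (rule ennreal_le_suminf)
      finally show ?thesis .
    qed simp
  qed
  also have "\<dots> = (\<Sum>j. \<integral>\<^sup>+z. g z * indicator (N j \<times> {r j}) z \<partial>count_space UNIV)"
    by (intro nn_integral_suminf) auto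
  also have "\<dots> = (\<Sum>j. \<Sum>x\<in>N j. g (x, r j))"
  proof (intro suminf_cong)
    fix j
    have "(\<integral>\<^sup>+z. g z * indicator (N j \<times> {r j}) z \<partial>count_space UNIV) = (\<integral>\<^sup>+z. g z \<partial>count_space (N j \<times> {r j}))"
      by (subst nn_integral_count_space_indicator[symmetric]) auto
    also have "\<dots> = (\<Sum>z\<in>N j \<times> {r j}. g z)" using N(1) by (intro nn_integral_count_space_finite) auto
    also have "\<dots> = (\<Sum>x\<in>N j. g (x, r j))"
      by (rule sum.reindex_bij_witness[of _ "\<lambda>x. (x, r j)" fst]) auto
    finally show "(\<integral>\<^sup>+z. g z * indicator (N j \<times> {r j}) z \<partial>count_space UNIV) = (\<Sum>x\<in>N j. g (x, r j))" .
  qed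
  finally show ?thesis by (simp add: g_def)
qed

text \<open>The exceptional set is not known to be Borel. Covers of cost below
  \<open>1 / (n + 1)\<close> by balls of radius below \<open>1 / (n + 1)\<close> are intersected
  over \<open>n\<close>; within \<open>S\<close> this is a Borel set that each of these covers still
  covers.\<close>

lemma codim_hausdorff_null_superset:
  assumes S: "A \<subseteq> S" and A: "\<And>\<delta>. 0 < \<delta> \<Longrightarrow> codim_hausdorff_content M \<sigma> \<delta> A = 0"
  obtains N where "A \<subseteq> N" "N \<subseteq> S" "N \<in> sets (restrict_space borel S)" "codim_hausdorff_outer M \<sigma> N = 0"
proof -
  define good where "good n C \<longleftrightarrow> countable C \<and> C \<subseteq> space M \<times> {0<..<1 / real (Suc n)} \<and> A \<subseteq> (\<Union>(x, r)\<in>C. ball x r) \<and>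
     (\<integral>\<^sup>+ (x, r). emeasure M (ball x r \<inter> space M) / ennreal (r powr \<sigma>) \<partial>count_space C) < ennreal (1 / real (Suc n))" for n C
  have "\<forall>n. \<exists>C. good n C"
  proof
    fix n
    have "codim_hausdorff_content M \<sigma> (1 / real (Suc n)) A < ennreal (1 / real (Suc n))" by (subst A) auto
    then show "\<exists>C. good n C" unfolding codim_hausdorff_content_def INF_less_iff good_def by auto
  qed
  from choice[OF this] obtain C where good: "\<And>n. good n (C n)" by blast
  have C: "\<And>n. countable (C n)" "\<And>n. C n \<subseteq> space M \<times> {0<..<1 / real (Suc n)}" "\<And>n. A \<subseteq> (\<Union>(x, r)\<in>C n. ball x r)"
     "\<And>n. (\<integral>\<^sup>+ (x, r). emeasure M (ball x r \<inter> space M) / ennreal (r powr \<sigma>) \<partial>count_space (C n)) < ennreal (1 / real (Suc n))"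
    using good unfolding good_def by blast+
  define N where "N = S \<inter> (\<Inter>n. \<Union>(x, r)\<in>C n. ball x r)"
  have "codim_hausdorff_content M \<sigma> \<delta> N = 0" if \<delta>: "0 < \<delta>" for \<delta>
  proof -
    have le: "codim_hausdorff_content M \<sigma> \<delta> N \<le> ennreal (1 / real (Suc n))" if n: "1 / real (Suc n) \<le> \<delta>" for n
    proof -
      have "codim_hausdorff_content M \<sigma> \<delta> N \<le> codim_hausdorff_content M \<sigma> (1 / real (Suc n)) N"
        by (rule codim_hausdorff_content_antimono[OF n])
      also have "\<dots> \<le> (\<integral>\<^sup>+ (x, r). emeasure M (ball x r \<inter> space M) / ennreal (r powr \<sigma>) \<partial>count_space (C n))"
        unfolding codim_hausdorff_content_def using C(1,2) by (intro INF_lower) (auto simp: N_def)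
      also have "\<dots> \<le> ennreal (1 / real (Suc n))" using C(4) by (rule less_imp_le)
      finally show ?thesis .
    qed
    have "(\<lambda>n. ennreal (1 / real (Suc n))) \<longlonglongrightarrow> ennreal 0"
      by (intro tendsto_ennrealI LIMSEQ_Suc lim_1_over_n)
    moreover have "\<forall>\<^sub>F n in sequentially. codim_hausdorff_content M \<sigma> \<delta> N \<le> ennreal (1 / real (Suc n))"
    proof -
      have "\<forall>\<^sub>F n in sequentially. 1 / real (Suc n) < \<delta>"
        using \<delta> by (intro order_tendstoD(2)[OF LIMSEQ_Suc[OF lim_1_over_n]])
      then show ?thesis by eventually_elim (intro le less_imp_le)
    qed
    ultimately have "codim_hausdorff_content M \<sigma> \<delta> N \<le> ennreal 0"
      by (rule tendsto_lowerbound) simp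
    then show ?thesis by simp
  qed
  then have "\<forall>\<^sub>F \<delta> in at_right 0. codim_hausdorff_content M \<sigma> \<delta> N = 0"
    by (auto simp: eventually_at_filter)
  then have "codim_hausdorff_outer M \<sigma> N = 0"
    unfolding codim_hausdorff_outer_def by (intro tendsto_Lim tendsto_eventually) auto
  moreover have "N \<in> sets (restrict_space borel S)"
  proof -
    have "open (\<Union>(x, r)\<in>C n. ball x r)" for n by (rule open_UN) auto
    then have "(\<Inter>n. \<Union>(x, r)\<in>C n. ball x r) \<in> sets borel"
      by (intro sets.countable_INT' borel_open) auto
    then show ?thesis unfolding N_def sets_restrict_space by (intro imageI)
  qed
  ultimately show thesis using that[of N] S C(3) by (auto simp: N_def)
qed

text \<open>A measure made by \<open>measure_of\<close> gives a set of its sigma-algebra either the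
  value of the outer measure or, should that not be a measure, 0. In both cases the Borel superset
  is null.\<close>

lemma codim_hausdorff_AE:
  assumes pos: "0 < emeasure (codim_hausdorff_measure M \<sigma> S) S"
    and A: "\<And>\<delta>. 0 < \<delta> \<Longrightarrow> codim_hausdorff_content M \<sigma> \<delta> {x \<in> S. \<not> Q x} = 0"
  shows "AE x in codim_hausdorff_measure M \<sigma> S. Q x"
proof -
  let ?P = "codim_hausdorff_measure M \<sigma> S"
  have sub: "sets (restrict_space borel S) \<subseteq> Pow S" by (auto simp: sets_restrict_space)
  have sp: "space ?P = S" unfolding codim_hausdorff_measure_def by (rule space_measure_of[OF sub])
  have sg: "sigma_sets S (sets (restrict_space borel S)) = sets (restrict_space borel S)"
    using sets.sigma_sets_eq[of "restrict_space borel S"] by (simp add: space_restrict_space)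
  have st: "sets ?P = sets (restrict_space borel S)"
    unfolding codim_hausdorff_measure_def by (simp add: sets_measure_of[OF sub] sg)
  have em: "emeasure ?P X = (if X \<in> sets (restrict_space borel S) \<and>
     measure_space S (sets (restrict_space borel S)) (codim_hausdorff_outer M \<sigma>) then codim_hausdorff_outer M \<sigma> X else 0)" for X
    unfolding codim_hausdorff_measure_def emeasure_measure_of_conv sg ..
  obtain N where N: "{x \<in> S. \<not> Q x} \<subseteq> N" "N \<subseteq> S" "N \<in> sets (restrict_space borel S)" "codim_hausdorff_outer M \<sigma> N = 0"
    using codim_hausdorff_null_superset[OF _ A] by (metis (no_types, lifting) mem_Collect_eq subsetI)
  have "N \<in> null_sets ?P" using N em[of N] st by (auto simp: null_sets_def)
  then show ?thesis using N(1) sp by (intro AE_I') auto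
qed

context doubling_space
begin

text \<open>Bounded overlap: a point lies in at most \<open>D ^ 5\<close> of the balls, since the
  packing bound asks for \<open>2 * (4 * r) + r \<le> 2 ^ 5 * (r / 2)\<close>.\<close>

lemma net_sum_le:
  assumes N: "finite N" "N \<subseteq> space M" "0 < r" "\<And>x y. x \<in> N \<Longrightarrow> y \<in> N \<Longrightarrow> x \<noteq> y \<Longrightarrow> r \<le> dist x y"
    and f[measurable]: "f \<in> borel_measurable M"
  shows "(\<Sum>x\<in>N. \<integral>\<^sup>+z\<in>ball x (4 * r). f z \<partial>M) \<le> ennreal (D ^ 5) * (\<integral>\<^sup>+z. f z \<partial>M)"
proof -
  have "(\<Sum>x\<in>N. \<integral>\<^sup>+z\<in>ball x (4 * r). f z \<partial>M) = (\<integral>\<^sup>+z. (\<Sum>x\<in>N. f z * indicator (ball x (4 * r)) z) \<partial>M)"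
    by (subst nn_integral_sum) auto
  also have "\<dots> \<le> (\<integral>\<^sup>+z. ennreal (D ^ 5) * f z \<partial>M)"
  proof (intro nn_integral_mono)
    fix z assume z: "z \<in> space M"
    have card: "real (card {x \<in> N. dist x z < 4 * r}) \<le> D ^ 5"
      by (rule card_separated_ball_le[of _ r z "4 * r"]) (use N z in auto)
    have "(\<Sum>x\<in>N. f z * indicator (ball x (4 * r)) z) = (\<Sum>x\<in>N. if dist x z < 4 * r then f z else 0)"
      by (intro sum.cong) (auto simp: indicator_ball)
    also have "\<dots> = (\<Sum>x\<in>{x \<in> N. dist x z < 4 * r}. f z)"
      using N(1) by (intro sum.inter_filter[symmetric])
    also have "\<dots> = ennreal (real (card {x \<in> N. dist x z < 4 * r})) * f z"
      by (simp only: sum_constant ennreal_of_nat_eq_real_of_nat)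
    also have "\<dots> \<le> ennreal (D ^ 5) * f z" using card by (intro mult_right_mono ennreal_leI) auto
    finally show "(\<Sum>x\<in>N. f z * indicator (ball x (4 * r)) z) \<le> ennreal (D ^ 5) * f z" .
  qed
  also have "\<dots> = ennreal (D ^ 5) * (\<integral>\<^sup>+z. f z \<partial>M)" by (intro nn_integral_cmult) measurable
  finally show ?thesis .
qed

text \<open>At a level \<open>j\<close> at which the oscillation exceeds \<open>\<kappa> r\<^sup>b\<close>, the energy of the
  ball controls \<open>\<nu>(B) / r\<^sup>\<sigma>\<close> up to the summable factor \<open>r\<^sup>b\<close>, so a maximal separated
  net at each level is an efficient cover and no Vitali covering is needed.\<close>

lemma content_large_osc2_le:
  assumes p: "1 < p" and s: "0 < s" and \<sigma>: "\<sigma> < s * p"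
  defines "b \<equiv> (s * p - \<sigma>) / 2"
  obtains C where "0 \<le> C"
    "\<And>u S k \<kappa> \<delta>. u \<in> borel_measurable M \<Longrightarrow> besov_energy s p M u < \<infinity> \<Longrightarrow> S \<subseteq> space M \<Longrightarrow> 0 < \<kappa> \<Longrightarrow> scale k < \<delta> \<Longrightarrow>
      codim_hausdorff_content M \<sigma> \<delta> {x \<in> S. \<exists>j\<ge>k. \<not> osc2 p M u (scale j) x \<le> ennreal (\<kappa> * scale j powr b)}
        \<le> ennreal (C / \<kappa>) * besov_energy s p M u"
proof -
  define c2 where "c2 = D ^ 5"
  have c2: "0 \<le> c2" using D_ge_1 by (simp add: c2_def)
  have b: "0 < b" using \<sigma> by (simp add: b_def)
  define c1 where "c1 = D ^ 4 * 8 powr (s * p)"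
  have c1: "0 < c1" using D_ge_1 by (simp add: c1_def)
  define q where "q = (1/2::real) powr b"
  have q: "0 < q" "q < 1" using powr_less_mono2[of b "1/2" 1] b by (auto simp: q_def)
  define C where "C = c1 * c2 * R powr b * (1 / (1 - q))"
  show thesis
  proof (rule that[of C])
    show "0 \<le> C" using c1 c2 q by (simp add: C_def)
    fix u :: "'a \<Rightarrow> real" and S k and \<kappa> \<delta> :: real
    assume u[measurable]: "u \<in> borel_measurable M" and uf: "besov_energy s p M u < \<infinity>" and S: "S \<subseteq> space M"
      and \<kappa>: "0 < \<kappa>" and \<delta>: "scale k < \<delta>"
    let ?X = "{x \<in> S. \<exists>j\<ge>k. \<not> osc2 p M u (scale j) x \<le> ennreal (\<kappa> * scale j powr b)}"
    let ?c = "\<lambda>j. ennreal (c1 / \<kappa> * scale j powr b)"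
    let ?I = "\<lambda>x j. \<integral>\<^sup>+z\<in>ball x (4 * scale j). energy_density s p u z \<partial>M"
    let ?m = "\<lambda>x j. emeasure M (ball x (scale j) \<inter> space M) / ennreal (scale j powr \<sigma>)"
    define E where "E = besov_energy s p M u"
    \<comment> \<open>Empty below level \<open>k\<close>, so that only radii below
      \<open>\<delta>\<close> occur in the cover.\<close>
    define B where "B j = (if k \<le> j then {x \<in> S. \<not> osc2 p M u (scale j) x \<le> ennreal (\<kappa> * scale j powr b)} else {})" for j
    have BS: "B j \<subseteq> S" for j by (auto simp: B_def)
    define net where "net j N \<longleftrightarrow> finite N \<and> N \<subseteq> B j \<and> (\<forall>x\<in>N. \<forall>y\<in>N. x \<noteq> y \<longrightarrow> scale j \<le> dist x y) \<and> B j \<subseteq> (\<Union>x\<in>N. ball x (scale j))" for j N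
    have "\<forall>j. \<exists>N. net j N"
    proof
      fix j
      have "B j \<subseteq> space M" using BS S by blast
      then show "\<exists>N. net j N" by (rule separated_net_exists[OF scale_pos[of j]]) (auto simp: net_def)
    qed
    from choice[OF this] obtain N where net: "\<And>j. net j (N j)" by blast
    have N: "\<And>j. finite (N j)" "\<And>j. N j \<subseteq> B j" "\<And>j x y. x \<in> N j \<Longrightarrow> y \<in> N j \<Longrightarrow> x \<noteq> y \<Longrightarrow> scale j \<le> dist x y"
      "\<And>j. B j \<subseteq> (\<Union>x\<in>N j. ball x (scale j))"
      using net by (simp_all add: net_def)
    have cost: "?m x j
        \<le> ?c j * ?I x j" if xN: "x \<in> N j" for x j
    proof -
      have x: "x \<in> space M" using xN N(2) BS S by blast
      have xB: "\<not> osc2 p M u (scale j) x \<le> ennreal (\<kappa> * scale j powr b)" using xN N(2)[of j] by (auto simp: B_def split: if_splits)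
      have bx: "0 < bm M x (scale j)" using bm_pos[OF x] by simp
      define I where "I = ?I x j"
      define F where "F = c1 * scale j powr (s * p) / bm M x (scale j)"
      have F: "0 < F" using c1 bx by (simp add: F_def)
      have "ennreal (\<kappa> * scale j powr b) \<le> ennreal F * I"
        using xB osc2_le_energy_density[OF u x scale_pos s p, of j] unfolding F_def c1_def I_def by (simp add: order.trans not_le less_imp_le)
      have "?m x j = ennreal (bm M x (scale j) / scale j powr \<sigma>)"
        using bx by (simp add: emeasure_ball divide_ennreal)
      also have "\<dots> = ennreal (c1 / \<kappa> * scale j powr b / F) * ennreal (\<kappa> * scale j powr b)"
      proof -
        \<comment> \<open>Of the two factors \<open>scale j powr b\<close> contained in the energy
          bound, one cancels the threshold and the other makes the sum over levels converge.\<close>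
        have tp: "s * p = \<sigma> + b + b" by (simp add: b_def)
        have "c1 / \<kappa> * scale j powr b / F * (\<kappa> * scale j powr b) = bm M x (scale j) / scale j powr \<sigma>"
          unfolding F_def tp powr_add using c1 \<kappa> bx by (simp add: field_simps)
        then show ?thesis using c1 \<kappa> F by (simp add: ennreal_mult'[symmetric])
      qed
      also have "\<dots> \<le> ennreal (c1 / \<kappa> * scale j powr b / F) * (ennreal F * I)"
        by (intro mult_left_mono) (fact, simp)
      also have "\<dots> = ?c j * I"
        unfolding mult.assoc[symmetric] using F c1 \<kappa> by (simp add: ennreal_mult'[symmetric])
      finally show ?thesis by (simp add: I_def)
    qed
    have "codim_hausdorff_content M \<sigma> \<delta> ?X
      \<le> (\<Sum>j. \<Sum>x\<in>N j. ?m x j)"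
    proof (rule codim_hausdorff_content_le)
      show "finite (N j)" for j by (rule N(1))
      show "N j \<subseteq> space M" for j using N(2) BS S by blast
      show "0 < scale j \<and> scale j < \<delta>" if "N j \<noteq> {}" for j
      proof -
        have "k \<le> j" using that N(2)[of j] by (auto simp: B_def split: if_splits)
        then have "scale j \<le> scale k" unfolding scale_def using R_pos by (intro divide_left_mono power_increasing) auto
        then show ?thesis using \<delta> by simp
      qed
      show "?X \<subseteq> (\<Union>j. \<Union>x\<in>N j. ball x (scale j))"
      proof
        fix x assume "x \<in> ?X"
        then obtain j where "x \<in> S" "k \<le> j" "\<not> osc2 p M u (scale j) x \<le> ennreal (\<kappa> * scale j powr b)" by blast
        then have "x \<in> B j" by (simp add: B_def)
        then show "x \<in> (\<Union>j. \<Union>x\<in>N j. ball x (scale j))" using N(4)[of j] by blast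
      qed
    qed
    also have "\<dots> \<le> (\<Sum>j. ?c j * (ennreal c2 * E))"
    proof (intro suminf_le summableI)
      fix j
      have "(\<Sum>x\<in>N j. ?m x j)
        \<le> (\<Sum>x\<in>N j. ?c j * ?I x j)"
        by (intro sum_mono cost)
      also have "\<dots> = ?c j * (\<Sum>x\<in>N j. ?I x j)"
        by (rule sum_distrib_left[symmetric])
      also have "\<dots> \<le> ?c j * (ennreal c2 * E)"
      proof (intro mult_left_mono)
        show "(\<Sum>x\<in>N j. ?I x j) \<le> ennreal c2 * E"
          unfolding E_def energy_density_integral[symmetric] c2_def
        proof (rule net_sum_le[OF N(1) _ scale_pos])
          show "N j \<subseteq> space M" using N(2) BS S by blast
        qed (use N(3) in auto)
      qed simp
      finally show "(\<Sum>x\<in>N j. ?m x j)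
         \<le> ?c j * (ennreal c2 * E)" .
    qed
    also have "\<dots> = (\<Sum>j. ?c j) * (ennreal c2 * E)" by (rule ennreal_suminf_multc)
    also have "(\<Sum>j. ?c j) = ennreal (c1 / \<kappa> * R powr b * (1 / (1 - q)))"
    proof (rule suminf_ennreal_eq)
      have eq: "c1 / \<kappa> * scale j powr b = c1 / \<kappa> * R powr b * q ^ j" for j
      proof -
        have "scale j powr b = (R * (1 / 2 ^ j)) powr b" by (simp add: scale_def)
        also have "\<dots> = R powr b * q ^ j" unfolding q_def half_powr_power using R_pos by (subst powr_mult) auto
        finally show ?thesis by simp
      qed
      show "(\<lambda>j. c1 / \<kappa> * scale j powr b) sums (c1 / \<kappa> * R powr b * (1 / (1 - q)))"
        unfolding eq using sums_mult[OF geometric_sums[of q], of "c1 / \<kappa> * R powr b"] q by simp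
    qed (use c1 \<kappa> in simp)
    also have "ennreal (c1 / \<kappa> * R powr b * (1 / (1 - q))) * (ennreal c2 * E) = ennreal (C / \<kappa>) * E"
    proof -
      have "c1 / \<kappa> * R powr b * (1 / (1 - q)) * c2 = C / \<kappa>" by (simp add: C_def mult_ac)
      then show ?thesis unfolding mult.assoc[symmetric] using c2 by (simp add: ennreal_mult''[symmetric])
    qed
    finally show "codim_hausdorff_content M \<sigma> \<delta> ?X
        \<le> ennreal (C / \<kappa>) * besov_energy s p M u" by (simp add: E_def)
  qed
qed

section \<open>Limits of compactly supported functions\<close>

lemma besov_approximableD:
  assumes p: "1 < p" and uB: "u \<in> besov_space s p M" and ap: "besov_approximable s p M Z u" and e: "0 < e"
  obtains f where "f \<in> borel_measurable M" "compactly_supported_in (space M) Z f" "besov_total s p M (\<lambda>x. f x - u x) < e"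
proof -
  obtain v where v: "\<And>k. v k \<in> besov_space s p M" "\<And>k. compactly_supported_in (space M) Z (v k)"
    "(\<lambda>k. besov_norm s p M (\<lambda>x. v k x - u x)) \<longlonglongrightarrow> 0"
    using ap by (auto simp: besov_approximable_def)
  have u: "u \<in> borel_measurable M" "besov_total s p M u < \<infinity>" using uB by (auto simp: besov_space_iff)
  define w where "w k x = v k x - u x" for k x
  have vm: "v k \<in> borel_measurable M" for k using v(1)[of k] by (simp add: besov_space_iff)
  have [measurable]: "w k \<in> borel_measurable M" for k unfolding w_def using vm[of k] u(1) by measurable
  have fin: "besov_total s p M (w k) < \<infinity>" for k
  proof -
    have "besov_total s p M (w k) \<le> ennreal (2 powr p) * (besov_total s p M (v k) + besov_total s p M u)"
      unfolding w_def using vm u(1) p by (intro besov_total_le2) auto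
    also have "\<dots> < \<infinity>" using v(1)[of k] u(2) by (simp add: besov_space_iff ennreal_mult_less_top)
    finally show ?thesis .
  qed
  define A where "A k = (\<integral>x. \<bar>w k x\<bar> powr p \<partial>M)" for k
  define B where "B k = enn2real (besov_energy s p M (w k))" for k
  have AB: "0 \<le> A k" "0 \<le> B k" for k by (auto simp: A_def B_def intro!: integral_nonneg_AE)
  have tot: "besov_total s p M (w k) = ennreal (A k) + ennreal (B k)" for k
  proof -
    have "A k = enn2real (\<integral>\<^sup>+x. epow p (w k x) \<partial>M)"
      unfolding A_def by (intro integral_eq_nn_integral) auto
    then show ?thesis using fin[of k] by (simp add: besov_total_def B_def)
  qed
  have n0: "(\<lambda>k. A k powr (1 / p) + B k powr (1 / p)) \<longlonglongrightarrow> 0"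
    using v(3) by (simp add: besov_norm_def w_def[abs_def] A_def B_def)
  have lim: "X \<longlonglongrightarrow> 0" if X: "\<And>k. 0 \<le> X k" "\<And>k. X k powr (1 / p) \<le> A k powr (1 / p) + B k powr (1 / p)" for X :: "nat \<Rightarrow> real"
  proof -
    have "(\<lambda>k. X k powr (1 / p)) \<longlonglongrightarrow> 0"
      by (rule tendsto_sandwich[OF _ _ tendsto_const n0]) (use X in auto)
    then have "(\<lambda>k. (X k powr (1 / p)) powr p) \<longlonglongrightarrow> 0 powr p"
      using p by (intro tendsto_powr2 tendsto_const) auto
    then show ?thesis using p X(1) by (simp add: powr_powr)
  qed
  have "(\<lambda>k. besov_total s p M (w k)) \<longlonglongrightarrow> ennreal 0 + ennreal 0"
    unfolding tot by (intro tendsto_add tendsto_ennrealI lim AB) auto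
  then have "\<forall>\<^sub>F k in sequentially. besov_total s p M (w k) < e"
    using e by (intro order_tendstoD(2)) auto
  then obtain k where "besov_total s p M (w k) < e" by (auto dest: eventually_happens)
  then show thesis using that[of "v k"] vm v(2) by (simp add: w_def[abs_def])
qed

lemma ball_average_cong_near:
  assumes "\<forall>\<^sub>F r in at_right 0. \<forall>y\<in>ball x r \<inter> space M. f y = g y"
  shows "\<forall>\<^sub>F r in at_right 0. ball_average M f x r = ball_average M g x r"
  using assms
proof eventually_elim
  case (elim r)
  have "(\<integral>y\<in>ball x r \<inter> space M. f y \<partial>M) = (\<integral>y\<in>ball x r \<inter> space M. g y \<partial>M)"
    unfolding set_lebesgue_integral_def
    by (intro Bochner_Integration.integral_cong refl) (use elim in \<open>auto simp: indicator_def\<close>)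
  then show ?case by (simp add: ball_average_def)
qed

text \<open>For a fixed level \<open>\<kappa>\<close> the content of the bad set is at most a
  constant times the energy of the error divided by \<open>\<kappa>\<close>. The error can be made
  arbitrarily small while the bad set of \<open>u\<close> stays the same, because near a boundary
  point the error equals \<open>- u\<close>. So the content is 0 for every \<open>\<delta>\<close>,
  and countably many levels give the limit.\<close>

theorem approximable_zero_trace:
  assumes p: "1 < p" and s: "0 < s" and \<sigma>: "\<sigma> < s * p" and S: "S \<subseteq> space M"
    and pos: "0 < emeasure (codim_hausdorff_measure M \<sigma> S) S"
    and uB: "u \<in> besov_space s p M" and ap: "besov_approximable s p M (space M - S) u"
  shows "AE \<zeta> in codim_hausdorff_measure M \<sigma> S. (ball_average M (\<lambda>x. \<bar>u x\<bar> powr p) \<zeta> \<longlongrightarrow> 0) (at_right 0)"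
proof (rule content_large_osc2_le[OF p s \<sigma>],
    rule ball_average_eventually_le[OF p half_gt_zero[OF iffD2[OF diff_gt_0_iff_gt \<sigma>]]], goal_cases)
  case cst: (1 C C2)
  define b where "b = (s * p - \<sigma>) / 2"
  note C = cst(1,2)[folded b_def] and C2 = cst(3,4)[folded b_def]
  have b: "0 < b" using \<sigma> by (simp add: b_def)
  have u: "u \<in> borel_measurable M" using uB by (simp add: besov_space_def)
  let ?B = "ball_average M (\<lambda>x. \<bar>u x\<bar> powr p)"
  have "AE \<zeta> in codim_hausdorff_measure M \<sigma> S. \<forall>\<^sub>F r in at_right 0. ?B \<zeta> r \<le> C2 * (1 / real (Suc n))" for n
  proof (rule codim_hausdorff_AE[OF pos])
    fix \<delta> :: real assume \<delta>: "0 < \<delta>"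
    define \<kappa> where "\<kappa> = 1 / real (Suc n)"
    have \<kappa>: "0 < \<kappa>" by (simp add: \<kappa>_def)
    have "\<forall>\<^sub>F k in sequentially. scale k < \<delta>" using scale_tendsto \<delta> by (rule order_tendstoD(2))
    then obtain k where k: "scale k < \<delta>" by (auto dest: eventually_happens)
    \<comment> \<open>The telescoping starts at scale \<open>k\<close>, where the average must be
      controlled in terms of \<open>\<kappa>\<close> at every boundary point; \<open>c\<close> turns
      this into a condition on the size of the error, which is the entry \<open>\<kappa> * c\<close>
      in the minimum below.\<close>
    obtain c where c: "0 < c" "\<And>x. x \<in> space M \<Longrightarrow> c \<le> bm M x (scale k)" using bm_lower_bound[OF scale_pos] by blast
    have le: "codim_hausdorff_content M \<sigma> \<delta> {\<zeta> \<in> S. \<not> (\<forall>\<^sub>F r in at_right 0. ?B \<zeta> r \<le> C2 * \<kappa>)} \<le> ennreal (C / \<kappa> * \<gamma>)"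
      if \<gamma>: "0 < \<gamma>" for \<gamma>
    proof -
      obtain f where f: "f \<in> borel_measurable M" "compactly_supported_in (space M) (space M - S) f"
        "besov_total s p M (\<lambda>x. f x - u x) < ennreal (min \<gamma> (\<kappa> * c))"
        using besov_approximableD[OF p uB ap, of "ennreal (min \<gamma> (\<kappa> * c))"] \<gamma> \<kappa> c(1) by auto
      define v where "v x = f x - u x" for x
      have vm[measurable]: "v \<in> borel_measurable M" unfolding v_def using f(1) u by measurable
      have vt: "besov_total s p M v < ennreal (min \<gamma> (\<kappa> * c))" using f(3) by (simp add: v_def[abs_def])
      have vt1: "besov_total s p M v \<le> ennreal \<gamma>" "besov_total s p M v \<le> ennreal (\<kappa> * c)"
        by (rule order_trans[OF less_imp_le[OF vt]], simp add: ennreal_leI)+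
      have vB: "v \<in> besov_space s p M" using vt1(1) vm by (auto simp: besov_space_iff intro: order.strict_trans1)
      have "{\<zeta> \<in> S. \<not> (\<forall>\<^sub>F r in at_right 0. ?B \<zeta> r \<le> C2 * \<kappa>)}
         \<subseteq> {x \<in> S. \<exists>j\<ge>k. \<not> osc2 p M v (scale j) x \<le> ennreal (\<kappa> * scale j powr b)}"
      proof (intro subsetI CollectI conjI, elim CollectE conjE, assumption, elim CollectE conjE, rule ccontr)
        fix x assume xS: "x \<in> S" and nB: "\<not> (\<forall>\<^sub>F r in at_right 0. ?B x r \<le> C2 * \<kappa>)"
          and "\<not> (\<exists>j\<ge>k. \<not> osc2 p M v (scale j) x \<le> ennreal (\<kappa> * scale j powr b))"
        then have osc: "\<And>j. k \<le> j \<Longrightarrow> osc2 p M v (scale j) x \<le> ennreal (\<kappa> * scale j powr b)" by blast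
        have x: "x \<in> space M" using xS S by blast
        have "\<forall>\<^sub>F r in at_right 0. ball_average M (\<lambda>x. \<bar>v x\<bar> powr p) x r \<le> C2 * \<kappa>"
        proof (rule C2(2)[OF vm _ x \<kappa> _ osc])
          show "integrable M (\<lambda>x. \<bar>v x\<bar> powr p)" using vB by (simp add: besov_space_def)
          have "(\<integral>\<^sup>+z. epow p (v z) \<partial>M) \<le> besov_total s p M v" by (simp add: besov_total_def)
          also have "\<dots> \<le> ennreal (\<kappa> * c)" by (rule vt1)
          also have "\<dots> \<le> ennreal (\<kappa> * bm M x (scale k))" using c(2)[OF x] \<kappa> by (intro ennreal_leI mult_left_mono) auto
          finally show "(\<integral>\<^sup>+z. epow p (v z) \<partial>M) \<le> ennreal (\<kappa> * bm M x (scale k))" .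
        qed
        moreover have "\<forall>\<^sub>F r in at_right 0. ball_average M (\<lambda>x. \<bar>v x\<bar> powr p) x r = ?B x r"
        proof (rule ball_average_cong_near)
          let ?K = "closure {x \<in> space M. f x \<noteq> 0}"
          \<comment> \<open>The closed support misses \<open>x\<close>, hence a whole ball about
            \<open>x\<close>, on which the error is \<open>- u\<close>.\<close>
          have "x \<in> - ?K" using f(2) xS by (auto simp: compactly_supported_in_def)
          then obtain e where e: "0 < e" "ball x e \<subseteq> - ?K" using open_contains_ball[of "- ?K"] by auto
          have "\<forall>\<^sub>F r in at_right 0. r \<in> {0<..<e}" by (rule eventually_at_right_real) (use e in simp)
          then show "\<forall>\<^sub>F r in at_right 0. \<forall>y\<in>ball x r \<inter> space M. \<bar>v y\<bar> powr p = \<bar>u y\<bar> powr p"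
          proof eventually_elim
            case (elim r)
            show ?case
            proof
              fix y assume y: "y \<in> ball x r \<inter> space M"
              then have "y \<in> ball x e" using elim by auto
              then have "y \<notin> ?K" using e(2) by blast
              then have "f y = 0" using y closure_subset[of "{x \<in> space M. f x \<noteq> 0}"] by auto
              then show "\<bar>v y\<bar> powr p = \<bar>u y\<bar> powr p" by (simp add: v_def)
            qed
          qed
        qed
        ultimately have "\<forall>\<^sub>F r in at_right 0. ?B x r \<le> C2 * \<kappa>" by eventually_elim simp
        with nB show False by simp
      qed
      then have "codim_hausdorff_content M \<sigma> \<delta> {\<zeta> \<in> S. \<not> (\<forall>\<^sub>F r in at_right 0. ?B \<zeta> r \<le> C2 * \<kappa>)}
         \<le> codim_hausdorff_content M \<sigma> \<delta> {x \<in> S. \<exists>j\<ge>k. \<not> osc2 p M v (scale j) x \<le> ennreal (\<kappa> * scale j powr b)}"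
        by (rule codim_hausdorff_content_mono)
      also have "\<dots> \<le> ennreal (C / \<kappa>) * besov_energy s p M v"
        using vB by (intro C(2)[OF vm _ S \<kappa> k]) (simp add: besov_space_def)
      also have "\<dots> \<le> ennreal (C / \<kappa>) * ennreal \<gamma>"
        using vt1(1) by (intro mult_left_mono) (auto simp: besov_total_def intro: order_trans[rotated])
      also have "\<dots> = ennreal (C / \<kappa> * \<gamma>)" using \<gamma> C(1) \<kappa> by (simp add: ennreal_mult'[symmetric])
      finally show ?thesis .
    qed
    have "codim_hausdorff_content M \<sigma> \<delta> {\<zeta> \<in> S. \<not> (\<forall>\<^sub>F r in at_right 0. ?B \<zeta> r \<le> C2 * \<kappa>)} \<le> ennreal (C / \<kappa> * 0)"
    proof (rule tendsto_lowerbound)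
      have "(\<lambda>m. 1 / real (Suc m)) \<longlonglongrightarrow> 0" by (rule LIMSEQ_Suc[OF lim_1_over_n])
      then show "(\<lambda>m. ennreal (C / \<kappa> * (1 / real (Suc m)))) \<longlonglongrightarrow> ennreal (C / \<kappa> * 0)"
        by (intro tendsto_ennrealI tendsto_mult tendsto_const)
      show "\<forall>\<^sub>F m in sequentially. codim_hausdorff_content M \<sigma> \<delta> {\<zeta> \<in> S. \<not> (\<forall>\<^sub>F r in at_right 0. ?B \<zeta> r \<le> C2 * \<kappa>)} \<le> ennreal (C / \<kappa> * (1 / real (Suc m)))"
        by (intro always_eventually allI le) simp
    qed simp
    then show "codim_hausdorff_content M \<sigma> \<delta> {\<zeta> \<in> S. \<not> (\<forall>\<^sub>F r in at_right 0. ?B \<zeta> r \<le> C2 * (1 / real (Suc n)))} = 0"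
      by (simp add: \<kappa>_def)
  qed
  then have "AE \<zeta> in codim_hausdorff_measure M \<sigma> S. \<forall>n. \<forall>\<^sub>F r in at_right 0. ?B \<zeta> r \<le> C2 * (1 / real (Suc n))"
    by (simp add: AE_all_countable)
  then show ?thesis
  proof eventually_elim
    case (elim \<zeta>)
    show ?case
    proof (rule tendstoI)
      fix e :: real assume e: "0 < e"
      have "(\<lambda>n. C2 * (1 / real (Suc n))) \<longlonglongrightarrow> C2 * 0" by (intro tendsto_intros LIMSEQ_Suc lim_1_over_n)
      then have "\<forall>\<^sub>F n in sequentially. C2 * (1 / real (Suc n)) < e" using e by (intro order_tendstoD(2)) auto
      then obtain n where n: "C2 * (1 / real (Suc n)) < e" by (auto dest: eventually_happens)
      have B0: "0 \<le> ?B \<zeta> r" for r by (rule ball_average_nonneg) simp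
      from elim have "\<forall>\<^sub>F r in at_right 0. ?B \<zeta> r \<le> C2 * (1 / real (Suc n))" by blast
      then show "\<forall>\<^sub>F r in at_right 0. dist (?B \<zeta> r) 0 < e"
        by eventually_elim (use n B0 in \<open>simp add: dist_real_def\<close>)
    qed
  qed
qed

end

section \<open>The trace operator\<close>

lemma powr_quotient:
  fixes a b s :: real
  assumes "0 \<le> a" "0 \<le> b"
  shows "(a / b) powr s = a powr s * b powr (- s)"
  using powr_divide[of a b s] powr_minus_divide[of b s] assms by simp

context doubling_space
begin

lemma scale_0: "scale 0 = R" by (simp add: scale_def)

lemma ball_average_tendsto_0:
  assumes p: "1 < p" and u: "integrable M u" and x: "x \<in> space M"
    and lim: "((\<lambda>r. ennreal (1 / bm M x r) * devint p M u c x r) \<longlongrightarrow> 0) (at_right 0)"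
  shows "(ball_average M (\<lambda>z. \<bar>u z - c\<bar>) x \<longlongrightarrow> 0) (at_right 0)"
proof -
  let ?B = "ball_average M (\<lambda>z. \<bar>u z - c\<bar>) x"
  let ?I = "\<lambda>r. ennreal (1 / bm M x r) * devint p M u c x r"
  have B0: "0 \<le> ?B r" for r by (rule ball_average_nonneg) simp
  have le: "ennreal (?B r powr p) \<le> ?I r" if r: "0 < r" for r
  proof -
    have "epow p (?B r) \<le> ennreal (1 powr p * 1 powr (p - 1) / bm M x r) *
       (\<integral>\<^sup>+z\<in>ball x r \<inter> space M. epow p (u z - c) \<partial>M)"
    proof (rule powr_le_mean_integral[where K=1 and L=1])
      have "?B r = (\<integral>z. \<bar>u z - c\<bar> * indicator (ball x r \<inter> space M) z \<partial>M) / bm M x r"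
        by (simp add: ball_average_def set_lebesgue_integral_def bm_def mult.commute)
      then show "\<bar>?B r\<bar> \<le> 1 / bm M x r * (\<integral>z. \<bar>u z - c\<bar> * indicator (ball x r \<inter> space M) z \<partial>M)"
        using B0[of r] by simp
    qed (use u p bm_pos[OF x r] in \<open>auto intro: integrable_abs_diff_ball simp: bm_def less_top[symmetric]\<close>)
    then show ?thesis using B0[of r] by (simp add: set_nn_integral_space)
  qed
  have "((\<lambda>r. ennreal (?B r powr p)) \<longlongrightarrow> 0) (at_right 0)"
    by (rule tendsto_sandwich[OF _ _ tendsto_const lim]) (use le in \<open>auto simp: eventually_at_filter\<close>)
  then have "((\<lambda>r. ennreal (?B r powr p)) \<longlongrightarrow> ennreal 0) (at_right 0)" unfolding ennreal_0 .
  then have "((\<lambda>r. ?B r powr p) \<longlongrightarrow> 0) (at_right 0)" by (rule tendsto_ennrealD) auto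
  then have "((\<lambda>r. (?B r powr p) powr (1 / p)) \<longlongrightarrow> 0 powr (1 / p)) (at_right 0)"
    using p by (intro tendsto_powr2 tendsto_const) auto
  then show ?thesis using p B0 by (simp add: powr_powr)
qed

lemma ball_average_tendsto_0_of_osc2:
  assumes p: "1 < p" and u: "integrable M u" and x: "x \<in> space M"
    and A: "(\<lambda>j. avg M (scale j) u x) \<longlonglongrightarrow> c" and h: "(\<lambda>j. osc2 p M u (scale j) x) \<longlonglongrightarrow> 0"
  shows "(ball_average M (\<lambda>z. \<bar>u z - c\<bar>) x \<longlongrightarrow> 0) (at_right 0)"
proof (rule ball_average_tendsto_0[OF p u x], rule ball_average_le_osc2[OF p], goal_cases)
  case C2: (1 C2)
  have "(\<lambda>j. \<bar>avg M (scale j) u x - c\<bar> powr p) \<longlonglongrightarrow> \<bar>c - c\<bar> powr p"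
    using p by (intro tendsto_powr2 tendsto_rabs tendsto_diff A tendsto_const) auto
  then have "(\<lambda>j. epow p (avg M (scale j) u x - c)) \<longlonglongrightarrow> epow p (c - c)"
    by (rule tendsto_ennrealI)
  then have "(\<lambda>j. epow p (avg M (scale j) u x - c)) \<longlonglongrightarrow> 0" by simp
  then have "(\<lambda>j. ennreal C2 * (osc2 p M u (scale j) x + epow p (avg M (scale j) u x - c))) \<longlonglongrightarrow> ennreal C2 * (0 + 0)"
    by (intro ennreal_tendsto_cmult tendsto_add h) auto
  then have lim: "(\<lambda>j. ennreal C2 * (osc2 p M u (scale j) x + epow p (avg M (scale j) u x - c))) \<longlonglongrightarrow> 0" by simp
  show "((\<lambda>r. ennreal (1 / bm M x r) * devint p M u c x r) \<longlongrightarrow> 0) (at_right 0)"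
  proof (rule order_tendstoI)
    fix e :: ennreal assume e: "0 < e"
    have "\<forall>\<^sub>F j in sequentially. ennreal C2 * (osc2 p M u (scale j) x + epow p (avg M (scale j) u x - c)) < e"
      using lim e by (rule order_tendstoD(2))
    then have "\<forall>\<^sub>F j in sequentially. \<forall>r. scale j / 2 \<le> r \<longrightarrow> r < scale j \<longrightarrow>
        ennreal (1 / bm M x r) * devint p M u c x r < e"
      by eventually_elim (use C2(2)[OF u x] in \<open>auto intro: order.strict_trans1\<close>)
    then show "\<forall>\<^sub>F r in at_right 0. ennreal (1 / bm M x r) * devint p M u c x r < e"
      by (rule eventually_scale_shell)
  qed simp
qed

lemma avg_AE_cong:
  assumes "AE x in M. u x = v x" "u \<in> borel_measurable M" "v \<in> borel_measurable M"
  shows "avg M r u x = avg M r v x"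
proof -
  have "(\<integral>y. max 0 (2 * r - dist x y) * u y \<partial>M) = (\<integral>y. max 0 (2 * r - dist x y) * v y \<partial>M)"
    by (intro integral_cong_AE) (use assms measurable_dist_P[of x] in auto)
  then show ?thesis by (simp add: avg_def)
qed

lemma avg_add:
  assumes "integrable M u" "integrable M v"
  shows "avg M r (\<lambda>y. u y + v y) x = avg M r u x + avg M r v x"
proof -
  have "(\<integral>y. max 0 (2 * r - dist x y) * (u y + v y) \<partial>M) = (\<integral>y. max 0 (2 * r - dist x y) * u y + max 0 (2 * r - dist x y) * v y \<partial>M)"
    by (intro Bochner_Integration.integral_cong) (auto simp: algebra_simps)
  also have "\<dots> = (\<integral>y. max 0 (2 * r - dist x y) * u y \<partial>M) + (\<integral>y. max 0 (2 * r - dist x y) * v y \<partial>M)"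
    by (intro Bochner_Integration.integral_add integrable_weight assms)
  finally show ?thesis by (simp add: avg_def add_divide_distrib)
qed

lemma avg_cmult: "avg M r (\<lambda>y. c * u y) x = c * avg M r u x"
proof -
  have "(\<integral>y. max 0 (2 * r - dist x y) * (c * u y) \<partial>M) = (\<integral>y. c * (max 0 (2 * r - dist x y) * u y) \<partial>M)"
    by (intro Bochner_Integration.integral_cong) (auto simp: algebra_simps)
  then show ?thesis by (simp add: avg_def)
qed

end

section \<open>Norm bounds and operators\<close>

text \<open>The norm adds two \<open>p\<close>-th roots, while the hypothesis bounds a sum of
  \<open>p\<close>-th powers; the factors 2 and \<open>2 powr (1 / p)\<close> come from splitting
  these roots.\<close>

lemma besov_norm_le:
  assumes p: "1 < p" and M: "doubling_space M D R" and N: "doubling_space N D' R'"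
    and u: "u \<in> besov_space s p M" and v: "v \<in> besov_space t p N"
    and le: "besov_total t p N v \<le> ennreal C * besov_total s p M u" and C: "0 \<le> C"
  shows "besov_norm t p N v \<le> 2 * C powr (1 / p) * 2 powr (1 / p) * besov_norm s p M u"
proof -
  interpret M: doubling_space M D R by fact
  interpret N: doubling_space N D' R' by fact
  define a where "a = (\<integral>x. \<bar>u x\<bar> powr p \<partial>M)"
  define b where "b = enn2real (besov_energy s p M u)"
  define a' where "a' = (\<integral>x. \<bar>v x\<bar> powr p \<partial>N)"
  define b' where "b' = enn2real (besov_energy t p N v)"
  have n: "0 \<le> a" "0 \<le> b" "0 \<le> a'" "0 \<le> b'"
    by (auto simp: a_def b_def a'_def b'_def intro!: integral_nonneg_AE)
  have tu: "besov_total s p M u = ennreal (a + b)"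
  proof -
    have "(\<integral>\<^sup>+x. epow p (u x) \<partial>M) = ennreal a"
      unfolding a_def using u by (intro nn_integral_eq_integral) (auto simp: besov_space_def)
    moreover have "besov_energy s p M u = ennreal b" using u by (simp add: b_def besov_space_def)
    ultimately show ?thesis using n by (simp add: besov_total_def ennreal_plus)
  qed
  have tv: "besov_total t p N v = ennreal (a' + b')"
  proof -
    have "(\<integral>\<^sup>+x. epow p (v x) \<partial>N) = ennreal a'"
      unfolding a'_def using v by (intro nn_integral_eq_integral) (auto simp: besov_space_def)
    moreover have "besov_energy t p N v = ennreal b'" using v by (simp add: b'_def besov_space_def)
    ultimately show ?thesis using n by (simp add: besov_total_def ennreal_plus)
  qed
  have "ennreal (a' + b') \<le> ennreal (C * (a + b))" using le C n by (simp add: tu tv ennreal_mult')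
  then have ab: "a' + b' \<le> C * (a + b)" using C n by (subst (asm) ennreal_le_iff) auto
  have one: "c powr (1 / p) \<le> C powr (1 / p) * (2 powr (1 / p) * (a powr (1 / p) + b powr (1 / p)))" if c: "0 \<le> c" "c \<le> a' + b'" for c
  proof -
    have "c powr (1 / p) \<le> (C * (a + b)) powr (1 / p)" using c ab p by (intro powr_mono2) auto
    also have "\<dots> = C powr (1 / p) * (a + b) powr (1 / p)" using C n by (subst powr_mult) auto
    also have "\<dots> \<le> C powr (1 / p) * (2 powr (1 / p) * (a powr (1 / p) + b powr (1 / p)))"
      using n p by (intro mult_left_mono powr_add_le) auto
    finally show ?thesis .
  qed
  have "besov_norm t p N v = a' powr (1 / p) + b' powr (1 / p)" by (simp add: besov_norm_def a'_def b'_def)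
  also have "\<dots> \<le> 2 * (C powr (1 / p) * (2 powr (1 / p) * (a powr (1 / p) + b powr (1 / p))))"
    using one[of a'] one[of b'] n by linarith
  finally show ?thesis by (simp add: besov_norm_def a_def b_def mult_ac)
qed

lemma besov_operatorI:
  assumes p: "1 < p" and M: "doubling_space M D R" and N: "doubling_space N D' R'"
    and meas: "\<And>u. u \<in> besov_space s p M \<Longrightarrow> T u \<in> borel_measurable N"
    and bound: "\<And>u. u \<in> besov_space s p M \<Longrightarrow> besov_total t p N (T u) \<le> ennreal C * besov_total s p M u"
    and C: "0 \<le> C"
    and cong: "\<And>u v. u \<in> besov_space s p M \<Longrightarrow> v \<in> besov_space s p M \<Longrightarrow> AE x in M. u x = v x \<Longrightarrow> AE x in N. T u x = T v x"
    and add: "\<And>u v. u \<in> besov_space s p M \<Longrightarrow> v \<in> besov_space s p M \<Longrightarrow> AE x in N. T (\<lambda>y. u y + v y) x = T u x + T v x"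
    and cmult: "\<And>c u. u \<in> besov_space s p M \<Longrightarrow> AE x in N. T (\<lambda>y. c * u y) x = c * T u x"
  shows "besov_operator s p M t p N T"
proof -
  interpret M: doubling_space M D R by fact
  interpret N: doubling_space N D' R' by fact
  have B: "T u \<in> besov_space t p N" if u: "u \<in> besov_space s p M" for u
  proof -
    have "ennreal C * besov_total s p M u < \<infinity>" using u by (simp add: M.besov_space_iff ennreal_mult_less_top)
    with bound[OF u] have "besov_total t p N (T u) < \<infinity>" by (rule order.strict_trans1)
    then show ?thesis using meas[OF u] by (simp add: N.besov_space_iff)
  qed
  show ?thesis unfolding besov_operator_def
  proof (intro conjI ballI allI impI)
    show "\<exists>C\<ge>0. \<forall>u\<in>besov_space s p M. besov_norm t p N (T u) \<le> C * besov_norm s p M u"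
    proof (intro exI[of _ "2 * C powr (1 / p) * 2 powr (1 / p)"] conjI ballI)
      fix u assume u: "u \<in> besov_space s p M"
      show "besov_norm t p N (T u) \<le> 2 * C powr (1 / p) * 2 powr (1 / p) * besov_norm s p M u"
        by (rule besov_norm_le[OF p M N u B[OF u] bound[OF u] C])
    qed simp
  qed (use B cong add cmult in blast)+
qed

text \<open>The boundary is a second doubling space with the same bound \<open>R\<close>. Masses are
  comparable up to radius \<open>64 * R\<close>, well beyond all distances, so that balls may be
  enlarged by constant factors.\<close>

locale codim_pair = M: doubling_space M D R + P: doubling_space P D' R
  for M P :: "'a::metric_space measure" and D D' R :: real +
  fixes \<sigma> K :: real
  assumes space_P: "space P \<subseteq> space M"
    and null: "emeasure M (space P) = 0"
    and \<sigma>: "0 < \<sigma>" and K: "0 < K"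
    and upper: "\<And>x r. x \<in> space P \<Longrightarrow> 0 < r \<Longrightarrow> r \<le> 64 * R \<Longrightarrow> r powr \<sigma> * bm P x r \<le> K * bm M x r"
    and lower: "\<And>x r. x \<in> space P \<Longrightarrow> 0 < r \<Longrightarrow> r \<le> 64 * R \<Longrightarrow> bm M x r \<le> K * (r powr \<sigma> * bm P x r)"
begin

lemma inclusion_measurable: "(\<lambda>x. x) \<in> measurable P M"
proof -
  have "(\<lambda>x. x) \<in> measurable (restrict_space borel (space P)) (restrict_space borel (space M))"
    using space_P by (intro measurable_restrict_space3) auto
  then show ?thesis using measurable_cong_sets[OF P.sets_M M.sets_M] by simp
qed

lemma measurable_restrict:
  "f \<in> borel_measurable M \<Longrightarrow> f \<in> borel_measurable P"
  using measurable_compose[OF inclusion_measurable] by blast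

lemma measurable_dist_MP [measurable (raw)]:
  assumes "f \<in> measurable N M" "g \<in> measurable N P"
  shows "(\<lambda>w. dist (f w) (g w)) \<in> borel_measurable N"
  by (rule measurable_dist_sep[OF M.sep_borel_M P.sets_M assms])

lemma measurable_dist_PM [measurable (raw)]:
  assumes "f \<in> measurable N P" "g \<in> measurable N M"
  shows "(\<lambda>w. dist (f w) (g w)) \<in> borel_measurable N"
  by (rule measurable_dist_sep[OF P.sep_borel_M M.sets_M assms])

lemma measurable_bm_P [measurable (raw)]:
  assumes "f \<in> measurable N P" "r \<in> borel_measurable N"
  shows "(\<lambda>w. bm M (f w) (r w)) \<in> borel_measurable N"
  using measurable_compose[OF assms(1) inclusion_measurable] assms(2) by (intro M.measurable_bm) auto

text \<open>The centre may be an interior point. Either the ball misses the boundary, or it lies in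
  a ball of twice the radius about a boundary point, where the mass comparison applies.\<close>

lemma bm_P_le:
  assumes z: "z \<in> space M" and r: "0 < r" "r \<le> 8 * R"
  shows "bm P z (4 * r) \<le> K * D * r powr (- \<sigma>) * bm M z (8 * r)"
proof (cases "ball z (4 * r) \<inter> space P = {}")
  case False
  then obtain x where x: "x \<in> space P" "dist z x < 4 * r" by auto
  have "ball z (4 * r) \<inter> space P \<subseteq> ball x (8 * r) \<inter> space P"
  proof
    fix y assume "y \<in> ball z (4 * r) \<inter> space P"
    then show "y \<in> ball x (8 * r) \<inter> space P" using dist_triangle[of x y z] x by (auto simp: dist_commute)
  qed
  then have "bm P z (4 * r) \<le> bm P x (8 * r)" unfolding bm_def by (intro P.finite_measure_mono) auto
  then have "(8 * r) powr \<sigma> * bm P z (4 * r) \<le> (8 * r) powr \<sigma> * bm P x (8 * r)" by (intro mult_left_mono) auto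
  also have "\<dots> \<le> K * bm M x (8 * r)" using x r by (intro upper) auto
  also have "\<dots> \<le> K * (D ^ 1 * bm M z (8 * r))"
    using K x z r by (intro mult_left_mono M.bm_comp) (auto simp: dist_commute)
  finally have 1: "(8 * r) powr \<sigma> * bm P z (4 * r) \<le> K * D * bm M z (8 * r)" by simp
  have "r powr \<sigma> * bm P z (4 * r) \<le> (8 * r) powr \<sigma> * bm P z (4 * r)"
    using r \<sigma> by (intro mult_right_mono powr_mono2) auto
  with 1 have "r powr \<sigma> * bm P z (4 * r) \<le> K * D * bm M z (8 * r)" by simp
  then show ?thesis using r by (simp add: powr_minus field_simps)
next
  case True
  then have "bm P z (4 * r) = 0" by (simp add: bm_def)
  then show ?thesis using K M.D_ge_1 by simp
qed

text \<open>The boundary variable is integrated first: for fixed \<open>z\<close> and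
  \<open>w\<close> it stays in \<open>ball z (4 * r)\<close>, whose boundary mass is at most of
  order \<open>r powr (- \<sigma>)\<close> times the mass of a ball. \<open>D ^ 8\<close> comes from
  the squared mass, one more \<open>D\<close> from \<open>bm_P_le\<close>.\<close>

lemma osc2_trace_integral_le:
  assumes u[measurable]: "u \<in> borel_measurable M" and r: "0 < r" "r \<le> 8 * R"
  shows "(\<integral>\<^sup>+x. osc2 p M u r x \<partial>P) \<le> (\<integral>\<^sup>+z. \<integral>\<^sup>+w. epow p (u w - u z) *
     (if dist z w < 8 * r then ennreal (K * D ^ 9 * r powr (- \<sigma>) / bm M z (8 * r)) else 0) \<partial>M \<partial>M)"
proof -
  interpret PM: pair_sigma_finite P M by unfold_locales
  define c where "c x = ennreal (1 / (bm M x r)\<^sup>2)" for x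
  define I where "I x y = (if dist x y < 4 * r then 1 else 0 :: ennreal)" for x y :: 'a
  have [measurable]: "c \<in> borel_measurable M" unfolding c_def by measurable
  have [measurable]: "c \<in> borel_measurable P" by (rule measurable_restrict) measurable
  have Im1: "(\<lambda>w. I (f w) (g w)) \<in> borel_measurable N" if [measurable]: "f \<in> measurable N P" "g \<in> measurable N M" for f g N
    unfolding I_def by measurable
  note Im1[measurable (raw)]
  have "(\<integral>\<^sup>+x. osc2 p M u r x \<partial>P) = (\<integral>\<^sup>+x. \<integral>\<^sup>+z. c x * ((\<integral>\<^sup>+w. epow p (u w - u z) * I x w \<partial>M) * I x z) \<partial>M \<partial>P)"
    unfolding osc2_def c_def[symmetric] indicator_ball I_def[symmetric]
    by (intro nn_integral_cong nn_integral_cmult[symmetric]) measurable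
  also have "\<dots> = (\<integral>\<^sup>+z. \<integral>\<^sup>+x. c x * ((\<integral>\<^sup>+w. epow p (u w - u z) * I x w \<partial>M) * I x z) \<partial>P \<partial>M)"
    by (rule PM.Fubini'[symmetric]) measurable
  also have "\<dots> = (\<integral>\<^sup>+z. \<integral>\<^sup>+x. \<integral>\<^sup>+w. epow p (u w - u z) * (c x * I x z * I x w) \<partial>M \<partial>P \<partial>M)"
  proof (intro nn_integral_cong)
    fix z x assume z: "z \<in> space M" and x: "x \<in> space P"
    note [measurable] = z x
    have "(\<integral>\<^sup>+w. epow p (u w - u z) * (c x * I x z * I x w) \<partial>M) = (\<integral>\<^sup>+w. (c x * I x z) * (epow p (u w - u z) * I x w) \<partial>M)"
      by (simp add: mult_ac)
    also have "\<dots> = (c x * I x z) * (\<integral>\<^sup>+w. epow p (u w - u z) * I x w \<partial>M)"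
      by (intro nn_integral_cmult) measurable
    finally show "c x * ((\<integral>\<^sup>+w. epow p (u w - u z) * I x w \<partial>M) * I x z)
        = (\<integral>\<^sup>+w. epow p (u w - u z) * (c x * I x z * I x w) \<partial>M)" by (simp add: mult_ac)
  qed
  also have "\<dots> = (\<integral>\<^sup>+z. \<integral>\<^sup>+w. \<integral>\<^sup>+x. epow p (u w - u z) * (c x * I x z * I x w) \<partial>P \<partial>M \<partial>M)"
  proof (intro nn_integral_cong)
    fix z assume z[measurable]: "z \<in> space M"
    show "(\<integral>\<^sup>+x. \<integral>\<^sup>+w. epow p (u w - u z) * (c x * I x z * I x w) \<partial>M \<partial>P)
      = (\<integral>\<^sup>+w. \<integral>\<^sup>+x. epow p (u w - u z) * (c x * I x z * I x w) \<partial>P \<partial>M)"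
      by (rule PM.Fubini'[symmetric]) measurable
  qed
  also have "\<dots> \<le> (\<integral>\<^sup>+z. \<integral>\<^sup>+w. epow p (u w - u z) *
     (if dist z w < 8 * r then ennreal (K * D ^ 9 * r powr (- \<sigma>) / bm M z (8 * r)) else 0) \<partial>M \<partial>M)"
  proof (intro nn_integral_mono)
    fix z w assume z: "z \<in> space M" and w: "w \<in> space M"
    note [measurable] = z w
    define b where "b = bm M z (8 * r)"
    have b: "0 < b" using M.bm_pos[OF z] r by (simp add: b_def)
    have "(\<integral>\<^sup>+x. epow p (u w - u z) * (c x * I x z * I x w) \<partial>P)
       = epow p (u w - u z) * (\<integral>\<^sup>+x. c x * I x z * I x w \<partial>P)"
      by (intro nn_integral_cmult) measurable
    also have "(\<integral>\<^sup>+x. c x * I x z * I x w \<partial>P) \<le> (if dist z w < 8 * r then ennreal (K * D ^ 9 * r powr (- \<sigma>) / b) else 0)"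
    proof (cases "dist z w < 8 * r")
      case True
      have "(\<integral>\<^sup>+x. c x * I x z * I x w \<partial>P) \<le> (\<integral>\<^sup>+x. ennreal (D ^ 8 / b\<^sup>2) * indicator (ball z (4 * r) \<inter> space P) x \<partial>P)"
      proof (intro nn_integral_mono)
        fix x assume x: "x \<in> space P"
        show "c x * I x z * I x w \<le> ennreal (D ^ 8 / b\<^sup>2) * indicator (ball z (4 * r) \<inter> space P) x"
        proof (cases "dist x z < 4 * r")
          case xz: True
          have xM: "x \<in> space M" using x space_P by auto
          have bx: "0 < bm M x r" using M.bm_pos[OF xM] r by simp
          have "b \<le> D ^ 4 * bm M x r" unfolding b_def using xM r xz by (intro M.bm_comp) (auto simp: dist_commute)
          then have "b\<^sup>2 \<le> (D ^ 4 * bm M x r)\<^sup>2" using b by (intro power_mono) auto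
          then have "b\<^sup>2 \<le> D ^ 8 * (bm M x r)\<^sup>2" by (simp add: power_mult_distrib power_mult[symmetric])
          then have "1 / (bm M x r)\<^sup>2 \<le> D ^ 8 / b\<^sup>2" using b bx by (simp add: field_simps)
          then have "c x * I x z * I x w \<le> ennreal (D ^ 8 / b\<^sup>2)" by (auto simp: c_def I_def ennreal_leI)
          then show ?thesis using xz x by (simp add: dist_commute)
        qed (simp add: I_def)
      qed
      also have "\<dots> = ennreal (D ^ 8 / b\<^sup>2) * ennreal (bm P z (4 * r))"
        by (subst nn_integral_cmult_indicator) (simp_all add: P.emeasure_ball)
      also have "\<dots> \<le> ennreal (D ^ 8 / b\<^sup>2) * ennreal (K * D * r powr (- \<sigma>) * b)"
        unfolding b_def using bm_P_le[OF z r] by (intro mult_left_mono ennreal_leI) auto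
      also have "\<dots> = ennreal (K * D ^ 9 * r powr (- \<sigma>) / b)"
      proof -
        have "D ^ 8 / b\<^sup>2 * (K * D * r powr (- \<sigma>) * b) = K * (D ^ 8 * D) * r powr (- \<sigma>) / b"
          using b by (simp add: power2_eq_square)
        also have "D ^ 8 * D = D ^ 9" by (simp flip: power_Suc2)
        finally show ?thesis using M.D_ge_1 by (simp add: ennreal_mult'[symmetric])
      qed
      finally show ?thesis using True by simp
    next
      case False
      have "c x * I x z * I x w = 0" for x
        using False dist_triangle3[of z w x] by (auto simp: I_def)
      then have "(\<integral>\<^sup>+x. c x * I x z * I x w \<partial>P) = (\<integral>\<^sup>+x. 0 \<partial>P)" by (rule nn_integral_cong)
      then show ?thesis by (simp only: nn_integral_const mult_zero_left zero_le)
    qed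
    finally show "(\<integral>\<^sup>+x. epow p (u w - u z) * (c x * I x z * I x w) \<partial>P) \<le> epow p (u w - u z) *
     (if dist z w < 8 * r then ennreal (K * D ^ 9 * r powr (- \<sigma>) / bm M z (8 * r)) else 0)"
      unfolding b_def by (simp add: mult_left_mono)
  qed
  finally show ?thesis .
qed

text \<open>The factor \<open>r powr (- \<sigma>)\<close> from the integration over the boundary
  completes the weight to \<open>r powr (- (s * p))\<close>, and the sum over the scales above
  \<open>d / 8\<close> restores the kernel of the energy.\<close>

lemma osc2_trace_sum_le:
  assumes p: "1 < p" and s: "0 < s"
  obtains C where "0 \<le> C" "\<And>u. u \<in> borel_measurable M \<Longrightarrow>
    (\<Sum>j. ennreal (M.scale j powr (- (s * p - \<sigma>))) * (\<integral>\<^sup>+x. osc2 p M u (M.scale j) x \<partial>P)) \<le> ennreal C * besov_energy s p M u"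
proof (rule geometric_scales_ge[OF mult_pos_pos[OF s less_trans[OF zero_less_one p]] M.R_pos], goal_cases)
  case cst: (1 C)
  note C = cst(2,3)
  show thesis
  proof (rule that[of "K * D ^ 9 * C * 8 powr (s * p)"])
    show "0 \<le> K * D ^ 9 * C * 8 powr (s * p)" using C K M.D_ge_1 by simp
    fix u :: "'a \<Rightarrow> real" assume u[measurable]: "u \<in> borel_measurable M"
    let ?c = "\<lambda>j z. K * D ^ 9 * M.scale j powr (- \<sigma>) / bm M z (8 * M.scale j)"
    let ?s = "\<lambda>j. ennreal (M.scale j powr (- (s * p - \<sigma>)))"
    let ?o = "\<lambda>j. \<integral>\<^sup>+x. osc2 p M u (M.scale j) x \<partial>P"
    let ?d = "\<lambda>z w. \<bar>u w - u z\<bar> powr p"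
    let ?g = "\<lambda>j z w. ?s j * (epow p (u w - u z) * (if dist z w < 8 * M.scale j then ennreal (?c j z) else 0))"
    have "(\<Sum>j. ?s j * ?o j)
       \<le> (\<Sum>j. \<integral>\<^sup>+z. \<integral>\<^sup>+w. ?g j z w \<partial>M \<partial>M)"
    proof (intro suminf_le summableI)
      fix j
      have "M.scale j \<le> 8 * R" using M.scale_le[of j] M.R_pos by linarith
      note le = mult_left_mono[OF osc2_trace_integral_le[OF u M.scale_pos this, of p] zero_le, of "?s j"]
      have eq: "(\<integral>\<^sup>+z. \<integral>\<^sup>+w. ?g j z w \<partial>M \<partial>M) = ?s j *
        (\<integral>\<^sup>+z. \<integral>\<^sup>+w. epow p (u w - u z) *
     (if dist z w < 8 * M.scale j then ennreal (?c j z) else 0) \<partial>M \<partial>M)"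
        by (rule M.nn_integral_double_cmult) measurable
      show "?s j * ?o j \<le> (\<integral>\<^sup>+z. \<integral>\<^sup>+w. ?g j z w \<partial>M \<partial>M)"
        unfolding eq by (rule le)
    qed
    also have "\<dots> = (\<integral>\<^sup>+z. (\<Sum>j. \<integral>\<^sup>+w. ?g j z w \<partial>M) \<partial>M)"
      by (intro nn_integral_suminf[symmetric]) measurable
    also have "\<dots> = (\<integral>\<^sup>+z. \<integral>\<^sup>+w. (\<Sum>j. ?g j z w) \<partial>M \<partial>M)"
      by (intro nn_integral_cong nn_integral_suminf[symmetric]) measurable
    also have "\<dots> \<le> (\<integral>\<^sup>+z. \<integral>\<^sup>+w. ennreal (K * D ^ 9 * C * 8 powr (s * p)) * bkern p M (s * p) u z w \<partial>M \<partial>M)"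
    proof (intro nn_integral_mono)
      fix z w assume z: "z \<in> space M" and w: "w \<in> space M"
      define d where "d = dist z w"
      show "(\<Sum>j. ?g j z w) \<le> ennreal (K * D ^ 9 * C * 8 powr (s * p)) * bkern p M (s * p) u z w"
      proof (cases "z = w")
        case False
        then have d: "0 < d" by (simp add: d_def)
        have bd: "0 < bm M z d" using M.bm_pos z d by simp
        define L where "L = ?d z w * (K * D ^ 9 / bm M z d)"
        have L: "0 \<le> L" using M.D_ge_1 K by (simp add: L_def)
        have "(\<Sum>j. ?g j z w) \<le> (\<Sum>j. ennreal L * (if d / 8 < R / 2 ^ j then ennreal ((R / 2 ^ j) powr (- (s * p))) else 0))"
        proof (intro suminf_le summableI)
          fix j
          show "?g j z w \<le> ennreal L * (if d / 8 < R / 2 ^ j then ennreal ((R / 2 ^ j) powr (- (s * p))) else 0)"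
          proof (cases "d < 8 * M.scale j")
            case True
            have "bm M z d \<le> bm M z (8 * M.scale j)" using True by (intro M.bm_mono) simp
            then have le: "1 / bm M z (8 * M.scale j) \<le> 1 / bm M z d" using bd by (intro divide_left_mono) auto
            have "M.scale j powr (- (s * p - \<sigma>)) * (?d z w * (?c j z))
               = (?d z w * (K * D ^ 9) * (M.scale j powr (- (s * p - \<sigma>)) * M.scale j powr (- \<sigma>))) * (1 / bm M z (8 * M.scale j))" by simp
            also have "M.scale j powr (- (s * p - \<sigma>)) * M.scale j powr (- \<sigma>) = M.scale j powr (- (s * p))"
              by (simp add: powr_add[symmetric])
            also have "(?d z w * (K * D ^ 9) * M.scale j powr (- (s * p))) * (1 / bm M z (8 * M.scale j))
                \<le> (?d z w * (K * D ^ 9) * M.scale j powr (- (s * p))) * (1 / bm M z d)"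
              using le K M.D_ge_1 by (intro mult_left_mono) auto
            also have "\<dots> = L * M.scale j powr (- (s * p))" by (simp add: L_def)
            finally have "ennreal (M.scale j powr (- (s * p - \<sigma>)) * (?d z w * (?c j z)))
               \<le> ennreal (L * M.scale j powr (- (s * p)))" by (rule ennreal_leI)
            moreover have "?g j z w = ennreal (M.scale j powr (- (s * p - \<sigma>)) * (?d z w * (?c j z)))"
              using True by (simp only: d_def if_True ennreal_mult' powr_ge_zero)
            moreover have "d / 8 < R / 2 ^ j" using True by (simp add: M.scale_def mult.commute)
            ultimately show ?thesis by (simp only: if_True M.scale_def ennreal_mult'[OF L])
          qed (simp add: d_def)
        qed
        also have "\<dots> \<le> ennreal L * ennreal (C * (d / 8) powr (- (s * p)))"
          unfolding ennreal_suminf_cmult using C(2)[of "d / 8"] d by (intro mult_left_mono) auto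
        also have "\<dots> = ennreal (K * D ^ 9 * C * 8 powr (s * p)) * bkern p M (s * p) u z w"
        proof -
          have "L * (C * (d / 8) powr (- (s * p))) = K * D ^ 9 * C * 8 powr (s * p) * (?d z w * kern M (s * p) z w)"
            using d by (simp add: L_def kern_def d_def powr_divide powr_minus field_simps)
          then show ?thesis using L K C(1) M.D_ge_1 by (simp add: ennreal_mult'[symmetric])
        qed
        finally show ?thesis .
      qed simp
    qed
    also have "\<dots> = ennreal (K * D ^ 9 * C * 8 powr (s * p)) * besov_energy s p M u"
      unfolding M.besov_energy_kern by (intro M.nn_integral_double_cmult) measurable
    finally show "(\<Sum>j. ?s j * ?o j)
        \<le> ennreal (K * D ^ 9 * C * 8 powr (s * p)) * besov_energy s p M u" .
  qed
qed

section \<open>The trace as a limit of averages\<close>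

text \<open>\<open>lim\<close> is total; the value has a meaning where \<open>good\<close> holds,
  which for a Besov function is almost everywhere on the boundary.\<close>

definition trace :: "('a \<Rightarrow> real) \<Rightarrow> 'a \<Rightarrow> real" where
  "trace u x = lim (\<lambda>j. avg M (M.scale j) u x)"

lemma measurable_trace [measurable]:
  assumes [measurable]: "u \<in> borel_measurable M"
  shows "trace u \<in> borel_measurable P"
  unfolding trace_def[abs_def] by (intro borel_measurable_lim_metric measurable_restrict) measurable

abbreviation osc2_sum :: "real \<Rightarrow> real \<Rightarrow> ('a \<Rightarrow> real) \<Rightarrow> 'a \<Rightarrow> ennreal" where
  "osc2_sum s p u x \<equiv> (\<Sum>j. ennreal (M.scale j powr (- (s * p - \<sigma>))) * osc2 p M u (M.scale j) x)"

definition good :: "real \<Rightarrow> real \<Rightarrow> ('a \<Rightarrow> real) \<Rightarrow> 'a \<Rightarrow> bool" where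
  "good s p u x \<longleftrightarrow> osc2_sum s p u x < \<infinity>"

lemma AE_good:
  assumes p: "1 < p" and s: "0 < s" and uB: "u \<in> besov_space s p M"
  shows "AE x in P. good s p u x"
proof (rule osc2_trace_sum_le[OF p s], goal_cases)
  case C: (1 C)
  have [measurable]: "u \<in> borel_measurable M" and uf: "besov_energy s p M u < \<infinity>" using uB by (auto simp: besov_space_def)
  have [measurable]: "(\<lambda>x. osc2 p M u r x) \<in> borel_measurable P" for r by (rule measurable_restrict) measurable
  have "(\<integral>\<^sup>+x. osc2_sum s p u x \<partial>P)
     = (\<Sum>j. ennreal (M.scale j powr (- (s * p - \<sigma>))) * (\<integral>\<^sup>+x. osc2 p M u (M.scale j) x \<partial>P))"
    by (simp add: nn_integral_suminf nn_integral_cmult)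
  also have "\<dots> \<le> ennreal C * besov_energy s p M u" by (rule C(2)) measurable
  also have "\<dots> < \<infinity>" using uf by (simp add: ennreal_mult_less_top)
  finally have "(\<integral>\<^sup>+x. osc2_sum s p u x \<partial>P) \<noteq> \<infinity>" by simp
  then have "AE x in P. osc2_sum s p u x \<noteq> \<infinity>"
    by (intro nn_integral_noteq_infinite) auto
  then show ?thesis by eventually_elim (simp add: good_def less_top)
qed

text \<open>Scales are at most \<open>R\<close>, so telescoping weights with exponent at most
  \<open>s * p - \<sigma>\<close> are dominated by the weights in \<open>good\<close>, up to the
  factor \<open>R powr (s * p - \<sigma>)\<close>.\<close>

lemma good_tail:
  assumes sp: "0 < s * p - \<sigma>" and a: "0 < a" "a \<le> s * p - \<sigma>" and g: "good s p u x"
  shows "M.tail_osc p a u k x < \<infinity>"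
    and "(\<lambda>j. osc2 p M u (M.scale j) x) \<longlonglongrightarrow> 0"
proof -
  have le: "(M.scale k / M.scale j) powr a \<le> R powr (s * p - \<sigma>) * M.scale j powr (- (s * p - \<sigma>))" if "k \<le> j" for k j
  proof -
    have "1 \<le> M.scale k / M.scale j" using that M.scale_pos[of k] unfolding M.scale_diff[OF that] by simp
    then have "(M.scale k / M.scale j) powr a \<le> (M.scale k / M.scale j) powr (s * p - \<sigma>)" using a by (intro powr_mono) auto
    also have "\<dots> \<le> (R / M.scale j) powr (s * p - \<sigma>)"
      using sp M.scale_le[of k] by (intro powr_mono2 divide_right_mono) auto
    also have "\<dots> = R powr (s * p - \<sigma>) * M.scale j powr (- (s * p - \<sigma>))"
      using M.R_pos by (intro powr_quotient) auto
    finally show ?thesis .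
  qed
  have "M.tail_osc p a u k x
     \<le> (\<Sum>j. ennreal (R powr (s * p - \<sigma>)) * (ennreal (M.scale j powr (- (s * p - \<sigma>))) * osc2 p M u (M.scale j) x))" for k
  proof (intro suminf_le summableI)
    fix j show "(if k \<le> j then ennreal ((M.scale k / M.scale j) powr a) * osc2 p M u (M.scale j) x else 0)
       \<le> ennreal (R powr (s * p - \<sigma>)) * (ennreal (M.scale j powr (- (s * p - \<sigma>))) * osc2 p M u (M.scale j) x)"
      unfolding mult.assoc[symmetric] using le[of k j]
      by (auto simp: ennreal_mult'[symmetric] intro!: mult_right_mono ennreal_leI)
  qed
  also have "(\<Sum>j. ennreal (R powr (s * p - \<sigma>)) * (ennreal (M.scale j powr (- (s * p - \<sigma>))) * osc2 p M u (M.scale j) x)) < \<infinity>"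
    unfolding ennreal_suminf_cmult using g by (simp add: good_def ennreal_mult_less_top)
  finally show fin: "M.tail_osc p a u k x < \<infinity>" for k .
  have "(\<lambda>j. if 0 \<le> j then ennreal ((M.scale 0 / M.scale j) powr a) * osc2 p M u (M.scale j) x else 0) \<longlonglongrightarrow> 0"
    by (rule ennreal_suminf_tendsto_0[OF fin])
  then have lim: "(\<lambda>j. ennreal ((M.scale 0 / M.scale j) powr a) * osc2 p M u (M.scale j) x) \<longlonglongrightarrow> 0" by simp
  show "(\<lambda>j. osc2 p M u (M.scale j) x) \<longlonglongrightarrow> 0"
  proof (rule tendsto_sandwich[OF _ _ tendsto_const lim])
    show "\<forall>\<^sub>F j in sequentially. osc2 p M u (M.scale j) x \<le> ennreal ((M.scale 0 / M.scale j) powr a) * osc2 p M u (M.scale j) x"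
    proof (intro always_eventually allI)
      fix j
      have "1 \<le> M.scale 0 / M.scale j" using M.scale_pos[of 0] unfolding M.scale_diff[of 0 j, OF le0] by simp
      then have "1 \<le> (M.scale 0 / M.scale j) powr a" using a by (intro ge_one_powr_ge_zero) auto
      then have "1 * osc2 p M u (M.scale j) x \<le> ennreal ((M.scale 0 / M.scale j) powr a) * osc2 p M u (M.scale j) x"
        by (intro mult_right_mono) (auto simp: ennreal_1[symmetric] simp del: ennreal_1 intro: ennreal_leI)
      then show "osc2 p M u (M.scale j) x \<le> ennreal ((M.scale 0 / M.scale j) powr a) * osc2 p M u (M.scale j) x" by simp
    qed
  qed simp
qed

lemma trace_limit:
  assumes p: "1 < p" and sp: "0 < s * p - \<sigma>" and u: "integrable M u" and x: "x \<in> space P" and g: "good s p u x"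
  shows "(\<lambda>j. avg M (M.scale j) u x) \<longlonglongrightarrow> trace u x"
proof (rule M.avg_telescope[OF p sp], goal_cases)
  case C1: (1 C1)
  have xM: "x \<in> space M" using x space_P by auto
  have "convergent (\<lambda>j. avg M (M.scale j) u x)"
    using C1(2)[OF u xM good_tail(1)[OF sp sp order_refl g]] .
  then show ?thesis by (simp add: trace_def convergent_LIMSEQ_iff)
qed

lemma trace_lebesgue_point:
  assumes p: "1 < p" and sp: "0 < s * p - \<sigma>" and u: "integrable M u" and x: "x \<in> space P" and g: "good s p u x"
  shows "(ball_average M (\<lambda>z. \<bar>u z - trace u x\<bar>) x \<longlongrightarrow> 0) (at_right 0)"
proof -
  have xM: "x \<in> space M" using x space_P by auto
  show ?thesis
    by (rule M.ball_average_tendsto_0_of_osc2[OF p u xM trace_limit[OF assms] good_tail(2)[OF sp sp order_refl g]])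
qed

text \<open>The scale with \<open>scale k / 2 \<le> d < scale k\<close> serves both points: the
  traces are telescoped from it, and the two averages are compared there. Hence only scales up to
  \<open>2 * d\<close> occur, and this is what the integration against the boundary kernel
  exploits.\<close>

lemma trace_increment:
  assumes p: "1 < p" and a: "0 < a" "a \<le> s * p - \<sigma>"
  obtains C where "0 \<le> C"
    "\<And>u x y. integrable M u \<Longrightarrow> x \<in> space P \<Longrightarrow> y \<in> space P \<Longrightarrow> good s p u x \<Longrightarrow> good s p u y \<Longrightarrow>
       epow p (trace u y - trace u x) \<le> ennreal C *
        (\<Sum>j. (if M.scale j \<le> 2 * dist x y then ennreal ((dist x y / M.scale j) powr a) else 0) * (osc2 p M u (M.scale j) x + osc2 p M u (M.scale j) y))"
    "\<And>u x. integrable M u \<Longrightarrow> x \<in> space P \<Longrightarrow> good s p u x \<Longrightarrow>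
       epow p (trace u x - avg M R u x) \<le> ennreal C *
        osc2_sum s p u x"
proof (rule M.avg_telescope[OF p a(1)], rule M.avg_osc2_diff[OF p], goal_cases)
  case cst: (1 C1 C2)
  note C1 = cst(2,3,4) and C2 = cst(5,6)
  have sp: "0 < s * p - \<sigma>" using a by linarith
  define c where "c = max C1 C2"
  define C where "C = max (3 powr p * (c * 2 * 2 powr a)) (C1 * R powr (s * p - \<sigma>))"
  have c: "0 \<le> c" "C1 \<le> c" "C2 \<le> c" using C1(1) by (auto simp: c_def)
  show thesis
  proof (rule that[of C])
    show "0 \<le> C" using c by (simp add: C_def le_max_iff_disj)
    fix u x assume u: "integrable M u" and x: "x \<in> space P" and gx: "good s p u x"
    have xM: "x \<in> space M" using x space_P by auto
    let ?h = "\<lambda>j x. osc2 p M u (M.scale j) x"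
    have tel: "epow p (trace u x - avg M (M.scale k) u x) \<le> ennreal C1 *
         (\<Sum>j. if k \<le> j then ennreal ((M.scale k / M.scale j) powr a) * ?h j x else 0)" if "x \<in> space P" "good s p u x" for k x
      unfolding trace_def using that space_P by (intro C1(3) u good_tail(1)[OF sp a]) auto
    have "epow p (trace u x - avg M (M.scale 0) u x) \<le> ennreal C1 *
         (\<Sum>j. if 0 \<le> j then ennreal ((M.scale 0 / M.scale j) powr a) * ?h j x else 0)" by (rule tel[OF x gx])
    also have "\<dots> \<le> ennreal C1 * (\<Sum>j. ennreal (R powr (s * p - \<sigma>)) * (ennreal (M.scale j powr (- (s * p - \<sigma>))) * ?h j x))"
    proof (intro mult_left_mono suminf_le summableI)
      fix j
      have "1 \<le> M.scale 0 / M.scale j" using M.scale_pos[of 0] unfolding M.scale_diff[of 0 j, OF le0] by simp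
      then have "(M.scale 0 / M.scale j) powr a \<le> (M.scale 0 / M.scale j) powr (s * p - \<sigma>)" using a by (intro powr_mono) auto
      also have "\<dots> = R powr (s * p - \<sigma>) * M.scale j powr (- (s * p - \<sigma>))"
        unfolding M.scale_0 using M.R_pos by (intro powr_quotient) auto
      finally show "(if 0 \<le> j then ennreal ((M.scale 0 / M.scale j) powr a) * ?h j x else 0)
          \<le> ennreal (R powr (s * p - \<sigma>)) * (ennreal (M.scale j powr (- (s * p - \<sigma>))) * ?h j x)"
        unfolding mult.assoc[symmetric] by (auto simp: ennreal_mult'[symmetric] intro!: mult_right_mono ennreal_leI)
    qed simp
    also have "\<dots> = ennreal (C1 * R powr (s * p - \<sigma>)) * (\<Sum>j. ennreal (M.scale j powr (- (s * p - \<sigma>))) * ?h j x)"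
      unfolding ennreal_suminf_cmult using C1(1) by (simp add: ennreal_mult' mult.assoc)
    also have "\<dots> \<le> ennreal C * (\<Sum>j. ennreal (M.scale j powr (- (s * p - \<sigma>))) * ?h j x)"
      by (intro mult_right_mono ennreal_leI) (auto simp: C_def)
    finally show "epow p (trace u x - avg M R u x) \<le> ennreal C *
        (\<Sum>j. ennreal (M.scale j powr (- (s * p - \<sigma>))) * ?h j x)" by (simp add: M.scale_def)
    fix y assume y: "y \<in> space P" and gy: "good s p u y"
    have yM: "y \<in> space M" using y space_P by auto
    show "epow p (trace u y - trace u x) \<le> ennreal C *
        (\<Sum>j. (if M.scale j \<le> 2 * dist x y then ennreal ((dist x y / M.scale j) powr a) else 0) * (?h j x + ?h j y))"
    proof (cases "x = y")
      case False
      define d where "d = dist x y"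
      have d: "0 < d" "d < R" using False M.dist_less[OF xM yM] by (auto simp: d_def)
      let ?c = "\<lambda>j. if M.scale j \<le> 2 * d then ennreal ((d / M.scale j) powr a) else 0"
      obtain k where k: "M.scale k / 2 \<le> d" "d < M.scale k"
        using shell_in_ball_exists[OF d] unfolding M.scale_def by blast
      define S where "S x = (\<Sum>j. if k \<le> j then ennreal ((M.scale k / M.scale j) powr a) * ?h j x else 0)" for x
      have hS: "?h k x \<le> S x"
      proof -
        have "?h k x = (if k \<le> k then ennreal ((M.scale k / M.scale k) powr a) * ?h k x else 0)" by simp
        also have "\<dots> \<le> S x" unfolding S_def by (rule ennreal_le_suminf)
        finally show ?thesis .
      qed
      have "epow p (trace u y - trace u x) \<le> ennreal (3 powr p) * (epow p (trace u x - avg M (M.scale k) u x)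
         + epow p (avg M (M.scale k) u x - avg M (M.scale k) u y) + epow p (trace u y - avg M (M.scale k) u y))"
        using p by (intro ennreal_powr_le3) auto
      also have "\<dots> \<le> ennreal (3 powr p) * (ennreal c * S x + ennreal c * S x + ennreal c * S y)"
      proof (intro mult_left_mono add_mono)
        show "epow p (trace u x - avg M (M.scale k) u x) \<le> ennreal c * S x"
          using tel[OF x gx, of k] unfolding S_def by (rule order_trans) (intro mult_right_mono ennreal_leI c(2) zero_le)
        show "epow p (trace u y - avg M (M.scale k) u y) \<le> ennreal c * S y"
          using tel[OF y gy, of k] unfolding S_def by (rule order_trans) (intro mult_right_mono ennreal_leI c(2) zero_le)
        have "epow p (avg M (M.scale k) u x - avg M (M.scale k) u y) \<le> ennreal C2 * ?h k x"
          using k d by (intro C2(2)[OF u xM xM yM]) (auto simp: d_def)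
        also have "\<dots> \<le> ennreal c * S x" using hS c(3) by (intro mult_mono ennreal_leI) auto
        finally show "epow p (avg M (M.scale k) u x - avg M (M.scale k) u y) \<le> ennreal c * S x" .
      qed simp
      also have "\<dots> \<le> ennreal (3 powr p) * (ennreal (c * 2) * (S x + S y))"
      proof (intro mult_left_mono)
        have "ennreal (c * 2) = ennreal c + ennreal c" using c(1) by (simp add: ennreal_plus[symmetric] del: ennreal_plus)
        then have "ennreal (c * 2) * (S x + S y) = (ennreal c * S x + ennreal c * S x + ennreal c * S y) + ennreal c * S y"
          by (simp add: distrib_left distrib_right add_ac)
        then show "ennreal c * S x + ennreal c * S x + ennreal c * S y \<le> ennreal (c * 2) * (S x + S y)" by simp
      qed simp
      also have "S x + S y \<le> ennreal (2 powr a) * (\<Sum>j. ?c j * (?h j x + ?h j y))"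
      proof -
        have "S x + S y = (\<Sum>j. if k \<le> j then ennreal ((M.scale k / M.scale j) powr a) * (?h j x + ?h j y) else 0)"
          unfolding S_def by (subst suminf_add[OF summableI summableI]) (auto intro!: suminf_cong simp: distrib_left)
        also have "\<dots> \<le> (\<Sum>j. ennreal (2 powr a) * (?c j * (?h j x + ?h j y)))"
        proof (intro suminf_le summableI)
          fix j
          show "(if k \<le> j then ennreal ((M.scale k / M.scale j) powr a) * (?h j x + ?h j y) else 0)
             \<le> ennreal (2 powr a) * (?c j * (?h j x + ?h j y))"
          proof (cases "k \<le> j")
            case True
            have "M.scale j \<le> M.scale k" unfolding M.scale_def using True M.R_pos by (intro divide_left_mono power_increasing) auto
            then have jd: "M.scale j \<le> 2 * d" using k by linarith
            have "(M.scale k / M.scale j) powr a \<le> (2 * (d / M.scale j)) powr a"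
            proof (intro powr_mono2)
              have "M.scale k / M.scale j \<le> (2 * d) / M.scale j" using k by (intro divide_right_mono) auto
              then show "M.scale k / M.scale j \<le> 2 * (d / M.scale j)" by simp
            qed (use a in auto)
            also have "\<dots> = 2 powr a * (d / M.scale j) powr a" using d by (subst powr_mult) auto
            finally have "ennreal ((M.scale k / M.scale j) powr a) \<le> ennreal (2 powr a) * ennreal ((d / M.scale j) powr a)"
              by (simp add: ennreal_mult'[symmetric] ennreal_leI)
            from mult_right_mono[OF this, of "?h j x + ?h j y"] show ?thesis using True jd by (simp add: mult.assoc)
          qed simp
        qed
        also have "\<dots> = ennreal (2 powr a) * (\<Sum>j. ?c j * (?h j x + ?h j y))"
          by (rule ennreal_suminf_cmult)
        finally show ?thesis .
      qed
      finally have "epow p (trace u y - trace u x) \<le> ennreal (3 powr p) * (ennreal (c * 2) * (ennreal (2 powr a) * (\<Sum>j. ?c j * (?h j x + ?h j y))))"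
        by (auto simp: mult_left_mono)
      also have "\<dots> = ennreal (3 powr p * (c * 2 * 2 powr a)) * (\<Sum>j. ?c j * (?h j x + ?h j y))"
        using c(1) by (simp only: ennreal_mult' mult.assoc powr_ge_zero zero_le_numeral mult_nonneg_nonneg)
      also have "\<dots> \<le> ennreal C * (\<Sum>j. ?c j * (?h j x + ?h j y))"
        by (intro mult_right_mono ennreal_leI) (auto simp: C_def)
      finally show ?thesis unfolding d_def .
    qed (use p in simp)
  qed
qed

text \<open>With \<open>a\<close> half of \<open>s * p - \<sigma>\<close>, the weight
  \<open>(d / scale j) powr a\<close> turns the boundary kernel into one of order
  \<open>a > 0\<close>, integrable off \<open>ball x (scale j / 2)\<close>. The result
  \<open>scale j powr (- (s * p - \<sigma>))\<close> is exactly the weight in the summed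
  oscillations over the boundary.\<close>

lemma trace_bounded:
  assumes p: "1 < p" and s: "0 < s" and sp: "0 < s * p - \<sigma>"
  obtains C where "0 \<le> C" "\<And>u. u \<in> besov_space s p M \<Longrightarrow> besov_total (s - \<sigma> / p) p P (trace u) \<le> ennreal C * besov_total s p M u"
proof (rule osc2_trace_sum_le[OF p s], rule P.kern_integral_off_ball[OF half_gt_zero[OF sp]],
    rule trace_increment[where s=s, OF p half_gt_zero[OF sp]], goal_cases)
  case 1
  show ?case using sp by (simp add: mult.commute)
next
  case cst: (2 C1 C2 C3)
  define a where "a = (s * p - \<sigma>) / 2"
  note C1 = cst(2,3) and C2 = cst(4,5)[folded a_def] and C3 = cst(6,7,8)[folded a_def]
  have se: "(s - \<sigma> / p) * p = s * p - \<sigma>" using p by (simp add: field_simps)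
  define m where "m = measure M (space M)"
  define L1 where "L1 = 2 powr p * (C3 * C1 + 2 powr p * D powr (p - 1) / m * measure P (space P))"
  define L2 where "L2 = C3 * ((1 + D') * (C2 * 2 powr a) * C1)"
  have L: "0 \<le> L1" "0 \<le> L2" using C1(1) C2(1) C3(1) P.D_ge_1 by (auto simp: L1_def L2_def m_def)
  show thesis
  proof (rule that[of "L1 + L2"])
    show "0 \<le> L1 + L2" using L by simp
    fix u assume uB: "u \<in> besov_space s p M"
    have u[measurable]: "u \<in> borel_measurable M" using uB by (simp add: besov_space_def)
    have ui: "integrable M u" by (rule M.besov_integrable[OF uB p])
    have [measurable]: "(\<lambda>x. osc2 p M u r x) \<in> borel_measurable P" for r by (rule measurable_restrict) measurable
    have ag: "AE x in P. good s p u x" by (rule AE_good[OF p s uB])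
    let ?h = "\<lambda>j x. osc2 p M u (M.scale j) x"
    let ?T = "\<lambda>x. \<Sum>j. ennreal (M.scale j powr (- (s * p - \<sigma>))) * ?h j x"
    have Tint: "(\<integral>\<^sup>+x. ?T x \<partial>P) \<le> ennreal C1 * besov_total s p M u"
    proof -
      have "(\<integral>\<^sup>+x. ?T x \<partial>P) = (\<Sum>j. ennreal (M.scale j powr (- (s * p - \<sigma>))) * (\<integral>\<^sup>+x. ?h j x \<partial>P))"
        by (simp add: nn_integral_suminf nn_integral_cmult)
      also have "\<dots> \<le> ennreal C1 * besov_energy s p M u" by (rule C1(2)) measurable
      also have "\<dots> \<le> ennreal C1 * besov_total s p M u" by (intro mult_left_mono) (auto simp: besov_total_def)
      finally show ?thesis .
    qed
    have Lp: "(\<integral>\<^sup>+x. epow p (trace u x) \<partial>P) \<le> ennreal L1 * besov_total s p M u"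
    proof -
      define U where "U = (\<integral>\<^sup>+x. epow p (u x) \<partial>M)"
      define c where "c = 2 powr p * D powr (p - 1) / m"
      have c0: "0 \<le> c" by (simp add: c_def m_def)
      \<comment> \<open>At scale 0 the ball is the whole space, so this average is bounded by the
        full integral, uniformly in \<open>x\<close>.\<close>
      have A0: "epow p (avg M R u x) \<le> ennreal c * U" if x: "x \<in> space P" for x
      proof -
        have xM: "x \<in> space M" using x space_P by auto
        have "epow p (avg M R u x - 0) \<le> ennreal (2 powr p * D powr (p - 1) / bm M x R) *
            devint p M u 0 x (2 * R)"
          using ui xM p M.R_pos M.bm_pos M.bm_double by (intro M.avg_diff_const_powr) auto
        also have "\<dots> \<le> ennreal c * U"
          unfolding U_def c_def m_def M.bm_whole[OF xM order_refl]
          by (intro mult_left_mono nn_integral_mono) (auto simp: indicator_def)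
        finally show ?thesis by simp
      qed
      have "(\<integral>\<^sup>+x. epow p (trace u x) \<partial>P) \<le> (\<integral>\<^sup>+x. ennreal (2 powr p) * (ennreal C3 * ?T x + ennreal c * U) \<partial>P)"
      proof (rule nn_integral_mono_AE)
        show "AE x in P. epow p (trace u x) \<le> ennreal (2 powr p) * (ennreal C3 * ?T x + ennreal c * U)"
          using ag AE_space
        proof eventually_elim
          case (elim x)
          have "epow p (trace u x) \<le> ennreal (2 powr p) * (epow p (trace u x - avg M R u x) + epow p (avg M R u x))"
            using p by (intro ennreal_powr_le2) auto
          also have "\<dots> \<le> ennreal (2 powr p) * (ennreal C3 * ?T x + ennreal c * U)"
            using elim by (intro mult_left_mono add_mono C3(3)[OF ui] A0) auto
          finally show ?case .
        qed
      qed
      also have "\<dots> = ennreal (2 powr p) * (ennreal C3 * (\<integral>\<^sup>+x. ?T x \<partial>P) + ennreal c * U * emeasure P (space P))"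
        by (simp add: nn_integral_cmult nn_integral_add)
      also have "\<dots> \<le> ennreal (2 powr p) * (ennreal C3 * (ennreal C1 * besov_total s p M u) + ennreal c * besov_total s p M u * emeasure P (space P))"
        by (intro mult_left_mono add_mono mult_right_mono Tint) (auto simp: U_def besov_total_def)
      also have "\<dots> = ennreal L1 * besov_total s p M u"
      proof -
        have "emeasure P (space P) = ennreal (measure P (space P))" by (rule P.emeasure_eq_measure)
        moreover have "ennreal L1 = ennreal (2 powr p) * (ennreal C3 * ennreal C1 + ennreal c * ennreal (measure P (space P)))"
          unfolding L1_def c_def[symmetric] using C1(1) C3(1) c0 by (simp add: ennreal_mult ennreal_plus)
        ultimately show ?thesis by (simp add: distrib_left distrib_right mult_ac)
      qed
      finally show ?thesis .
    qed
    define k where "k j x y = ennreal (if M.scale j \<le> 2 * dist x y then (dist x y / M.scale j) powr a * kern P (s * p - \<sigma>) x y else 0)" for j x y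
    have km[measurable]: "(\<lambda>(x, y). k j x y) \<in> borel_measurable (P \<Otimes>\<^sub>M P)" for j unfolding k_def by measurable
    have kint: "(\<integral>\<^sup>+y. k j x y \<partial>P) \<le> ennreal (C2 * 2 powr a) * ennreal (M.scale j powr (- (s * p - \<sigma>)))" if x: "x \<in> space P" for j x
    proof -
      have [measurable]: "(\<lambda>y. kern P a x y) \<in> borel_measurable P" using x by measurable
      have "(\<integral>\<^sup>+y. k j x y \<partial>P) \<le> (\<integral>\<^sup>+y. ennreal (M.scale j powr (- a)) * (ennreal (kern P a x y) * indicator (- ball x (M.scale j / 2)) y) \<partial>P)"
      proof (intro nn_integral_mono)
        fix y
        show "k j x y \<le> ennreal (M.scale j powr (- a)) * (ennreal (kern P a x y) * indicator (- ball x (M.scale j / 2)) y)"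
        proof (cases "M.scale j \<le> 2 * dist x y")
          case True
          then have d: "0 < dist x y" using M.scale_pos[of j] by linarith
          have "dist x y powr a * dist x y powr (- (s * p - \<sigma>)) = dist x y powr (- a)"
          proof -
            have "a + - (s * p - \<sigma>) = - a" by (simp add: a_def field_simps)
            then show ?thesis by (simp only: powr_add[symmetric])
          qed
          then have "(dist x y / M.scale j) powr a * kern P (s * p - \<sigma>) x y = M.scale j powr (- a) * kern P a x y"
            using d by (simp add: kern_def powr_divide powr_minus_divide)
          then show ?thesis using True by (simp add: k_def ennreal_mult')
        qed (simp add: k_def)
      qed
      also have "\<dots> = ennreal (M.scale j powr (- a)) * (\<integral>\<^sup>+y\<in>- ball x (M.scale j / 2). ennreal (kern P a x y) \<partial>P)"
        by (rule nn_integral_cmult) measurable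
      also have "\<dots> \<le> ennreal (M.scale j powr (- a)) * ennreal (C2 * (M.scale j / 2) powr (- a))"
        by (intro mult_left_mono C2(2) x) auto
      also have "\<dots> = ennreal (C2 * 2 powr a) * ennreal (M.scale j powr (- (s * p - \<sigma>)))"
      proof -
        have "M.scale j powr (- a) * (C2 * (M.scale j / 2) powr (- a)) = C2 * 2 powr a * (M.scale j powr (- a) * M.scale j powr (- a))"
          by (simp add: powr_divide powr_minus field_simps)
        also have "M.scale j powr (- a) * M.scale j powr (- a) = M.scale j powr (- (s * p - \<sigma>))"
          by (simp add: powr_add[symmetric] a_def)
        finally show ?thesis using C2(1) by (simp add: ennreal_mult'[symmetric])
      qed
      finally show ?thesis .
    qed
    have En: "besov_energy (s - \<sigma> / p) p P (trace u) \<le> ennreal L2 * besov_total s p M u"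
    proof -
      have "besov_energy (s - \<sigma> / p) p P (trace u) \<le> (\<integral>\<^sup>+x. \<integral>\<^sup>+y. ennreal C3 * (\<Sum>j. k j x y * (?h j x + ?h j y)) \<partial>P \<partial>P)"
        unfolding P.besov_energy_kern se
      proof (rule nn_integral_mono_AE)
        show "AE x in P. (\<integral>\<^sup>+y. bkern p P (s * p - \<sigma>) (trace u) x y \<partial>P)
            \<le> (\<integral>\<^sup>+y. ennreal C3 * (\<Sum>j. k j x y * (?h j x + ?h j y)) \<partial>P)"
          using ag AE_space
        proof eventually_elim
          case x: (elim x)
          show ?case
          proof (rule nn_integral_mono_AE)
            show "AE y in P. bkern p P (s * p - \<sigma>) (trace u) x y
               \<le> ennreal C3 * (\<Sum>j. k j x y * (?h j x + ?h j y))"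
              using ag AE_space
            proof eventually_elim
              case y: (elim y)
              let ?c = "\<lambda>j. (if M.scale j \<le> 2 * dist x y then ennreal ((dist x y / M.scale j) powr a) else 0)"
              from mult_right_mono[OF C3(2)[OF ui x(2) y(2) x(1) y(1)], of "ennreal (kern P (s * p - \<sigma>) x y)"]
              have "bkern p P (s * p - \<sigma>) (trace u) x y
                 \<le> ennreal C3 * ((\<Sum>j. ?c j * (?h j x + ?h j y)) * ennreal (kern P (s * p - \<sigma>) x y))"
                by (simp add: ennreal_mult mult.assoc)
              also have "(\<Sum>j. ?c j * (?h j x + ?h j y)) * ennreal (kern P (s * p - \<sigma>) x y) = (\<Sum>j. k j x y * (?h j x + ?h j y))"
                unfolding ennreal_suminf_multc[symmetric] by (intro suminf_cong) (auto simp: k_def ennreal_mult mult_ac)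
              finally show ?case .
            qed
          qed
        qed
      qed
      also have "\<dots> = ennreal C3 * (\<integral>\<^sup>+x. \<integral>\<^sup>+y. (\<Sum>j. k j x y * (?h j x + ?h j y)) \<partial>P \<partial>P)"
        by (intro P.nn_integral_double_cmult) measurable
      also have "(\<integral>\<^sup>+x. \<integral>\<^sup>+y. (\<Sum>j. k j x y * (?h j x + ?h j y)) \<partial>P \<partial>P) = (\<Sum>j. \<integral>\<^sup>+x. \<integral>\<^sup>+y. k j x y * (?h j x + ?h j y) \<partial>P \<partial>P)"
      by (rule P.nn_integral_double_suminf) measurable
      also have "\<dots> \<le> (\<Sum>j. (1 + ennreal D') * (\<integral>\<^sup>+x. ?h j x * (\<integral>\<^sup>+y. k j x y \<partial>P) \<partial>P))"
      proof (intro suminf_le summableI P.nn_integral_kernel_symmetric)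
        fix j x y assume xy: "x \<in> space P" "y \<in> space P"
        have "(dist x y / M.scale j) powr a * kern P (s * p - \<sigma>) x y \<le> (dist x y / M.scale j) powr a * (D' * kern P (s * p - \<sigma>) y x)"
          using P.kern_commute[OF xy] by (intro mult_left_mono) auto
        then show "k j x y \<le> ennreal D' * k j y x"
          using P.D_ge_1 by (auto simp: k_def ennreal_mult'[symmetric] dist_commute mult_ac intro!: ennreal_leI)
      qed measurable
      also have "\<dots> \<le> (\<Sum>j. (1 + ennreal D') * (\<integral>\<^sup>+x. ?h j x * (ennreal (C2 * 2 powr a) * ennreal (M.scale j powr (- (s * p - \<sigma>)))) \<partial>P))"
        by (intro suminf_le summableI mult_left_mono nn_integral_mono kint) auto
      also have "\<dots> = (\<Sum>j. (1 + ennreal D') * ennreal (C2 * 2 powr a) * (ennreal (M.scale j powr (- (s * p - \<sigma>))) * (\<integral>\<^sup>+x. ?h j x \<partial>P)))"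
        by (simp add: nn_integral_cmult nn_integral_multc mult_ac)
      also have "\<dots> \<le> (1 + ennreal D') * ennreal (C2 * 2 powr a) * (ennreal C1 * besov_total s p M u)"
        unfolding ennreal_suminf_cmult
        by (intro mult_left_mono order_trans[OF C1(2)[OF u]]) (auto simp: besov_total_def)
      finally have "besov_energy (s - \<sigma> / p) p P (trace u) \<le> ennreal C3 * ((1 + ennreal D') * ennreal (C2 * 2 powr a) * (ennreal C1 * besov_total s p M u))"
        by (auto simp: mult_left_mono)
      also have "\<dots> = ennreal L2 * besov_total s p M u"
      proof -
        have "1 + ennreal D' = ennreal (1 + D')" using P.D_ge_1 by (simp add: ennreal_plus)
        then show ?thesis unfolding L2_def using C1(1) C2(1) C3(1) P.D_ge_1 by (simp add: ennreal_mult mult.assoc)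
      qed
      finally show ?thesis .
    qed
    show "besov_total (s - \<sigma> / p) p P (trace u) \<le> ennreal (L1 + L2) * besov_total s p M u"
      unfolding besov_total_def[of _ _ P] using add_mono[OF Lp En] L by (simp add: ennreal_plus distrib_right)
  qed
qed

text \<open>Linearity is inherited from the averages wherever they converge for all functions
  involved, hence almost everywhere.\<close>

lemma trace_operator:
  assumes p: "1 < p" and s: "0 < s" and sp: "0 < s * p - \<sigma>"
  shows "besov_operator s p M (s - \<sigma> / p) p P trace"
proof (rule trace_bounded[OF p s sp], goal_cases)
  case C: (1 C)
  show ?thesis
  proof (rule besov_operatorI[OF p M.doubling_space_axioms P.doubling_space_axioms _ C(2) C(1)])
    fix u assume uB: "u \<in> besov_space s p M"
    have u: "u \<in> borel_measurable M" and ui: "integrable M u" using uB M.besov_integrable[OF uB p] by (auto simp: besov_space_def)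
    show "trace u \<in> borel_measurable P" using u by measurable
    show "AE x in P. trace (\<lambda>y. c * u y) x = c * trace u x" for c
      using AE_good[OF p s uB] AE_space
    proof eventually_elim
      case (elim x)
      have "(\<lambda>j. c * avg M (M.scale j) u x) \<longlonglongrightarrow> c * trace u x"
        by (intro tendsto_mult tendsto_const trace_limit[OF p sp ui elim(2,1)])
      then show ?case unfolding trace_def[of "\<lambda>y. c * u y"] M.avg_cmult by (rule limI)
    qed
    fix v assume vB: "v \<in> besov_space s p M"
    have v: "v \<in> borel_measurable M" and vi: "integrable M v" using vB M.besov_integrable[OF vB p] by (auto simp: besov_space_def)
    show "AE x in P. trace u x = trace v x" if "AE x in M. u x = v x"
      unfolding trace_def M.avg_AE_cong[OF that u v] by simp
    show "AE x in P. trace (\<lambda>y. u y + v y) x = trace u x + trace v x"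
      using AE_good[OF p s uB] AE_good[OF p s vB] AE_space
    proof eventually_elim
      case (elim x)
      have "(\<lambda>j. avg M (M.scale j) u x + avg M (M.scale j) v x) \<longlonglongrightarrow> trace u x + trace v x"
        by (intro tendsto_add trace_limit[OF p sp ui elim(3,1)] trace_limit[OF p sp vi elim(3,2)])
      then show ?case unfolding trace_def[of "\<lambda>y. u y + v y"] M.avg_add[OF ui vi] by (rule limI)
    qed
  qed
qed

end

section \<open>The extension operator\<close>

text \<open>Both conditions serve \<open>bdist_pos\<close>: off a closed set the distance is
  positive, and \<open>infdist\<close> to the empty set would be 0 by convention.\<close>

locale extension_pair = codim_pair +
  assumes closed_P: "closed (space P)" and nonempty_P: "space P \<noteq> {}"
begin

definition bdist :: "'a \<Rightarrow> real" where "bdist x = infdist x (space P)"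

text \<open>16 is 4 times 4: the extension averages with radius \<open>4 * bdist x\<close>, and the
  Lipschitz estimate for averages sees four times the radius.\<close>

definition near :: "'a \<Rightarrow> 'a \<Rightarrow> ennreal" where "near x z = (if dist x z < 16 * bdist x then 1 else 0)"

text \<open>The radius is half of \<open>4 * bdist x\<close>, since the Lipschitz estimate for
  averages normalises with \<open>bm P x (r / 2)\<close>.\<close>

definition wgt :: "'a \<Rightarrow> ennreal" where "wgt x = ennreal (1 / bm P x (2 * bdist x))"

text \<open>A Whitney type extension with a continuous choice of scale in place of a sum over a
  Whitney cover. At boundary points the radius is 0 and the value is \<open>0 / 0 = 0\<close>; they
  form a null set of \<open>M\<close>.\<close>

definition extend :: "('a \<Rightarrow> real) \<Rightarrow> 'a \<Rightarrow> real" where "extend f x = avg P (4 * bdist x) f x"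

lemma measurable_bdist [measurable]: "bdist \<in> borel_measurable M"
  unfolding bdist_def[abs_def] by (intro M.measurable_continuous_on continuous_intros)

lemma measurable_bm_MP [measurable (raw)]:
  assumes [measurable]: "f \<in> measurable N M" "r \<in> borel_measurable N"
  shows "(\<lambda>w. bm P (f w) (r w)) \<in> borel_measurable N"
proof -
  have "bm P x r = enn2real (\<integral>\<^sup>+y. (if dist x y < r then 1 else 0) \<partial>P)" for x r
  proof -
    have "(\<integral>\<^sup>+y. (if dist x y < r then 1 else 0) \<partial>P) = (\<integral>\<^sup>+y. indicator (ball x r \<inter> space P) y \<partial>P)"
      by (intro nn_integral_cong) (auto simp: indicator_def)
    then show ?thesis by (simp add: bm_def measure_def)
  qed
  then show ?thesis by simp
qed

lemma measurable_wgt [measurable]: "wgt \<in> borel_measurable M"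
  unfolding wgt_def[abs_def] by measurable

lemma measurable_near [measurable (raw)]:
  assumes [measurable]: "f \<in> measurable N M" "g \<in> measurable N P"
  shows "(\<lambda>w. near (f w) (g w)) \<in> borel_measurable N"
  unfolding near_def by measurable

lemma measurable_extend [measurable]:
  assumes [measurable]: "f \<in> borel_measurable P"
  shows "extend f \<in> borel_measurable M"
proof -
  have "(\<lambda>x. avg P (4 * bdist x) f x) \<in> borel_measurable M"
    by (intro P.measurable_avg) measurable
  then show ?thesis by (simp add: extend_def[abs_def])
qed

lemma AE_off: "AE x in M. x \<notin> space P"
proof (rule AE_not_in)
  have "space P \<in> sets M"
  proof -
    have "space M \<inter> space P \<in> sets (restrict_space borel (space M))"
      unfolding sets_restrict_space using closed_P by (intro imageI) simp
    then show ?thesis using M.sets_M space_P by (simp add: Int_absorb1)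
  qed
  then show "space P \<in> null_sets M" using null by (simp add: null_sets_def)
qed

lemma bdist_pos: "x \<notin> space P \<Longrightarrow> 0 < bdist x"
  unfolding bdist_def using infdist_pos_not_in_closed[OF closed_P nonempty_P] by blast

lemma bdist_le: "z \<in> space P \<Longrightarrow> bdist x \<le> dist x z"
  unfolding bdist_def by (rule infdist_le)

lemma bdist_lipschitz: "\<bar>bdist x - bdist y\<bar> \<le> dist x y"
  unfolding bdist_def by (rule infdist_triangle_abs)

lemma nearest:
  assumes "x \<notin> space P"
  obtains z where "z \<in> space P" "dist x z < 3/2 * bdist x"
proof -
  have "(INF z\<in>space P. dist x z) < 3/2 * bdist x"
    using bdist_pos[OF assms] nonempty_P by (simp add: bdist_def infdist_def)
  then show thesis using that nonempty_P by (subst (asm) cINF_less_iff) auto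
qed

text \<open>A boundary point within \<open>3/2 * bdist x\<close> carries a ball of radius
  \<open>bdist x / 2\<close> inside \<open>ball x (2 * bdist x)\<close>.\<close>

lemma mass_pos:
  assumes x: "x \<notin> space P"
  shows "0 < bm P x (2 * bdist x)"
proof -
  obtain z where z: "z \<in> space P" "dist x z < 3/2 * bdist x" using nearest[OF x] .
  have "0 < bm P z (bdist x / 2)" using P.bm_pos[OF z(1)] bdist_pos[OF x] by simp
  also have "\<dots> \<le> bm P x (2 * bdist x)" unfolding bm_def
  proof (intro P.finite_measure_mono)
    show "ball z (bdist x / 2) \<inter> space P \<subseteq> ball x (2 * bdist x) \<inter> space P"
    proof
      fix y assume "y \<in> ball z (bdist x / 2) \<inter> space P"
      then show "y \<in> ball x (2 * bdist x) \<inter> space P" using dist_triangle[of x y z] z(2) by auto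
    qed
  qed auto
  finally show ?thesis .
qed

text \<open>The exponent 7 is the least \<open>n\<close> with
  \<open>(16 + 16 + 3/2) * bdist x \<le> 2 ^ n * (bdist x / 2)\<close>.\<close>

lemma mass_comp:
  assumes x: "x \<notin> space P" and z: "dist x z < 16 * bdist x"
  shows "bm P z (16 * bdist x) \<le> D' ^ 7 * bm P x (2 * bdist x)"
proof -
  have dx: "0 < bdist x" by (rule bdist_pos[OF x])
  obtain y where y: "y \<in> space P" "dist x y < 3/2 * bdist x" using nearest[OF x] .
  have "bm P z (16 * bdist x) \<le> D' ^ 7 * bm P y (bdist x / 2)"
    using y z dx dist_triangle3[of z y x] by (intro P.bm_comp) auto
  also have "\<dots> \<le> D' ^ 7 * bm P x (2 * bdist x)"
  proof (intro mult_left_mono)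
    show "bm P y (bdist x / 2) \<le> bm P x (2 * bdist x)" unfolding bm_def
    proof (intro P.finite_measure_mono)
      show "ball y (bdist x / 2) \<inter> space P \<subseteq> ball x (2 * bdist x) \<inter> space P"
      proof
        fix w assume "w \<in> ball y (bdist x / 2) \<inter> space P"
        then show "w \<in> ball x (2 * bdist x) \<inter> space P" using dist_triangle[of x w y] y(2) by auto
      qed
    qed auto
  qed (use P.D_ge_1 in simp)
  finally show ?thesis .
qed

lemma wgt_le_inverse:
  assumes x: "x \<notin> space P" and z: "z \<in> space P" "dist x z < 16 * bdist x" and r: "0 < r" "r \<le> 16 * bdist x"
  shows "wgt x \<le> ennreal (D' ^ 7 / bm P z r)"
proof -
  have m: "0 < bm P x (2 * bdist x)" by (rule mass_pos[OF x])
  have b: "0 < bm P z r" using P.bm_pos z r by simp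
  have "bm P z r \<le> bm P z (16 * bdist x)" using r by (intro P.bm_mono)
  also have "\<dots> \<le> D' ^ 7 * bm P x (2 * bdist x)" by (rule mass_comp[OF x z(2)])
  finally show ?thesis unfolding wgt_def using m b by (intro ennreal_leI) (simp add: field_simps)
qed

text \<open>Here boundary mass is exchanged for mass of \<open>M\<close>: as a function of
  \<open>x\<close>, the weight of a boundary point \<open>z\<close> in the mean seen from
  \<open>x\<close> is controlled by a Riesz type kernel of order \<open>\<sigma>\<close> centred at
  \<open>z\<close>, whose integrals over \<open>M\<close> are known.\<close>

lemma wgt_near_le_kern:
  assumes xM: "x \<in> space M" and x: "x \<notin> space P" and z: "z \<in> space P"
  shows "wgt x * near x z \<le> ennreal (D' ^ 7 * K * kern M (- \<sigma>) z x)"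
proof (cases "dist x z < 16 * bdist x")
  case True
  define d where "d = dist x z"
  have zM: "z \<in> space M" using z space_P by auto
  have d: "0 < d" using x z by (auto simp: d_def)
  have "d < R" unfolding d_def by (rule M.dist_less[OF xM zM])
  then have dR: "d \<le> 64 * R" using M.R_pos by linarith
  have b: "0 < bm P z d" "0 < bm M z d" using P.bm_pos[OF z d] M.bm_pos[OF zM d] .
  have "bm M z d \<le> K * (d powr \<sigma> * bm P z d)" by (rule lower[OF z d dR])
  then have le: "1 / bm P z d \<le> K * (d powr \<sigma> / bm M z d)" using b by (simp add: field_simps)
  have "wgt x * near x z = wgt x" using True by (simp add: near_def)
  also have "\<dots> \<le> ennreal (D' ^ 7 / bm P z d)"
    using True by (intro wgt_le_inverse x z d) (auto simp: d_def)
  also have "\<dots> \<le> ennreal (D' ^ 7 * K * kern M (- \<sigma>) z x)"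
  proof (intro ennreal_leI)
    have "D' ^ 7 * (1 / bm P z d) \<le> D' ^ 7 * (K * (d powr \<sigma> / bm M z d))"
      using le P.D_ge_1 by (intro mult_left_mono) auto
    then show "D' ^ 7 / bm P z d \<le> D' ^ 7 * K * kern M (- \<sigma>) z x" by (simp add: kern_def d_def dist_commute mult.assoc)
  qed
  finally show ?thesis .
qed (simp add: near_def)

abbreviation nearint :: "real \<Rightarrow> ('a \<Rightarrow> real) \<Rightarrow> real \<Rightarrow> 'a \<Rightarrow> ennreal" where
  "nearint p f c x \<equiv> (\<integral>\<^sup>+z. epow p (f z - c) * near x z \<partial>P)"

lemma extend_diff_const:
  assumes p: "1 < p"
  obtains C where "0 \<le> C" "\<And>f x c. integrable P f \<Longrightarrow> x \<notin> space P \<Longrightarrow>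
    epow p (extend f x - c) \<le> ennreal C * (wgt x * nearint p f c x)"
proof (rule that[of "2 powr p * (D' ^ 7) powr (p - 1)"])
  fix f :: "'a \<Rightarrow> real" and x c
  assume f: "integrable P f" and x: "x \<notin> space P"
  have dx: "0 < bdist x" by (rule bdist_pos[OF x])
  have m: "0 < bm P x (2 * bdist x)" by (rule mass_pos[OF x])
  have m4: "bm P x (2 * bdist x) \<le> bm P x (4 * bdist x)" using dx by (intro P.bm_mono) auto
  have "bm P x (2 * (4 * bdist x)) \<le> bm P x (16 * bdist x)" using dx by (intro P.bm_mono) auto
  also have "\<dots> \<le> D' ^ 7 * bm P x (2 * bdist x)" using dx by (intro mass_comp x) auto
  also have "\<dots> \<le> D' ^ 7 * bm P x (4 * bdist x)" using m4 P.D_ge_1 by (intro mult_left_mono) auto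
  finally have "epow p (extend f x - c) \<le> ennreal (2 powr p * (D' ^ 7) powr (p - 1) / bm P x (4 * bdist x)) *
      devint p P f c x (2 * (4 * bdist x))"
    unfolding extend_def using f dx m m4 p by (intro P.avg_diff_const_powr) auto
  also have "\<dots> \<le> ennreal (2 powr p * (D' ^ 7) powr (p - 1) * (1 / bm P x (2 * bdist x))) *
      nearint p f c x"
  proof (intro mult_mono ennreal_leI nn_integral_mono)
    have "1 / bm P x (4 * bdist x) \<le> 1 / bm P x (2 * bdist x)" using m m4 by (intro divide_left_mono) auto
    then have "2 powr p * (D' ^ 7) powr (p - 1) * (1 / bm P x (4 * bdist x)) \<le> 2 powr p * (D' ^ 7) powr (p - 1) * (1 / bm P x (2 * bdist x))"
      by (intro mult_left_mono) auto
    then show "2 powr p * (D' ^ 7) powr (p - 1) / bm P x (4 * bdist x) \<le> 2 powr p * (D' ^ 7) powr (p - 1) * (1 / bm P x (2 * bdist x))" by simp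
    fix z show "indicator (ball x (2 * (4 * bdist x))) z \<le> near x z" using dx by (auto simp: indicator_def near_def)
  qed auto
  also have "\<dots> = ennreal (2 powr p * (D' ^ 7) powr (p - 1)) * (wgt x * nearint p f c x)"
    unfolding wgt_def mult.assoc[symmetric] using P.D_ge_1 by (simp add: ennreal_mult'[symmetric])
  finally show "epow p (extend f x - c) \<le>
     ennreal (2 powr p * (D' ^ 7) powr (p - 1)) * (wgt x * nearint p f c x)" .
qed simp

text \<open>The radius \<open>4 * bdist\<close> changes by at most \<open>4 * dist x y\<close>, the
  change that the Lipschitz estimate for averages allows;
  \<open>16 * dist x y \<le> 4 * bdist x\<close> is its smallness condition.\<close>

lemma extend_lipschitz:
  assumes p: "1 < p"
  obtains C where "0 \<le> C" "\<And>f x y c. integrable P f \<Longrightarrow> x \<notin> space P \<Longrightarrow> 4 * dist x y \<le> bdist x \<Longrightarrow>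
    epow p (extend f y - extend f x) \<le> ennreal (C * (dist x y / bdist x) powr p) *
      (wgt x * nearint p f c x)"
proof -
  define C where "C = (9 + 30 * D' ^ 7) powr p * (D' ^ 7) powr (p - 1)"
  show thesis
  proof (rule that[of C])
    show "0 \<le> C" by (simp add: C_def)
    fix f :: "'a \<Rightarrow> real" and x y c
    assume f: "integrable P f" and x: "x \<notin> space P" and d: "4 * dist x y \<le> bdist x"
    have dx: "0 < bdist x" by (rule bdist_pos[OF x])
    have m: "0 < bm P x (4 * bdist x / 2)" using mass_pos[OF x] by simp
    have K': "bm P x (4 * (4 * bdist x)) \<le> D' ^ 7 * bm P x (4 * bdist x / 2)" using mass_comp[OF x, of x] dx by simp
    have "epow p (avg P (4 * bdist x) f x - avg P (4 * bdist y) f y) \<le>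
      ennreal ((9 + 30 * D' ^ 7) powr p * (D' ^ 7) powr (p - 1) * (dist x y / (4 * bdist x)) powr p / bm P x (4 * bdist x / 2)) *
           devint p P f c x (4 * (4 * bdist x))"
      using d dx bdist_lipschitz[of x y] P.D_ge_1 by (intro P.avg_lipschitz_powr[OF f _ _ _ m K' _ p]) auto
    also have "\<dots> \<le> ennreal (C * (dist x y / bdist x) powr p * (1 / bm P x (2 * bdist x))) * nearint p f c x"
    proof (intro mult_mono ennreal_leI nn_integral_mono)
      have "(dist x y / (4 * bdist x)) powr p \<le> (dist x y / bdist x) powr p"
        using dx p by (intro powr_mono2 divide_left_mono) auto
      then have "C * (dist x y / (4 * bdist x)) powr p * (1 / bm P x (2 * bdist x)) \<le> C * (dist x y / bdist x) powr p * (1 / bm P x (2 * bdist x))"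
        by (intro mult_right_mono mult_left_mono) (auto simp: C_def)
      then show "(9 + 30 * D' ^ 7) powr p * (D' ^ 7) powr (p - 1) * (dist x y / (4 * bdist x)) powr p / bm P x (4 * bdist x / 2)
          \<le> C * (dist x y / bdist x) powr p * (1 / bm P x (2 * bdist x))" by (simp add: C_def)
      fix z show "indicator (ball x (4 * (4 * bdist x))) z \<le> near x z" by (auto simp: indicator_def near_def)
    qed auto
    also have "\<dots> = ennreal (C * (dist x y / bdist x) powr p) * (wgt x * nearint p f c x)"
      unfolding wgt_def mult.assoc[symmetric] by (simp add: ennreal_mult'[symmetric] C_def)
    finally show "epow p (extend f y - extend f x) \<le> ennreal (C * (dist x y / bdist x) powr p) *
      (wgt x * nearint p f c x)"
      by (simp add: extend_def abs_minus_commute)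
  qed
qed

text \<open>Double mean of boundary differences with both points near \<open>x\<close>; in
  \<open>osc_far\<close> one point is near \<open>x\<close> and the other near \<open>y\<close>.
  Neither involves values of the extension.\<close>

definition osc_near :: "real \<Rightarrow> ('a \<Rightarrow> real) \<Rightarrow> 'a \<Rightarrow> ennreal" where
  "osc_near p f x = wgt x * (\<integral>\<^sup>+z. (wgt x * nearint p f (f z) x) * near x z \<partial>P)"

definition osc_far :: "real \<Rightarrow> ('a \<Rightarrow> real) \<Rightarrow> 'a \<Rightarrow> 'a \<Rightarrow> ennreal" where
  "osc_far p f x y = wgt x * (\<integral>\<^sup>+z. (wgt y * nearint p f (f z) y) * near x z \<partial>P)"

lemma measurable_osc_near [measurable]:
  assumes [measurable]: "f \<in> borel_measurable P"
  shows "osc_near p f \<in> borel_measurable M"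
  unfolding osc_near_def[abs_def] by measurable

lemma measurable_osc_far [measurable]:
  assumes [measurable]: "f \<in> borel_measurable P"
  shows "(\<lambda>(x, y). osc_far p f x y) \<in> borel_measurable (M \<Otimes>\<^sub>M M)"
  unfolding osc_far_def by measurable

text \<open>For close points the Lipschitz bound holds with any constant, here \<open>f z\<close>,
  and is averaged over \<open>z\<close> near \<open>x\<close>. For distant points the constant is
  first \<open>extend f y\<close> and then \<open>f z\<close>, until only boundary differences
  remain.\<close>

lemma extend_increment:
  assumes p: "1 < p"
  obtains C where "0 \<le> C"
    "\<And>f x y. integrable P f \<Longrightarrow> x \<in> space M \<Longrightarrow> x \<notin> space P \<Longrightarrow> y \<notin> space P \<Longrightarrow>
      epow p (extend f y - extend f x) \<le> ennreal C *
        (ennreal ((min 1 (dist x y / bdist x)) powr p) * osc_near p f x + (if bdist x < 4 * dist x y then osc_far p f x y else 0))"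
proof (rule extend_diff_const[OF p], rule extend_lipschitz[OF p], goal_cases)
  case cst: (1 C1 C2)
  note C1 = cst(2,3) and C2 = cst(4,5)
  define C where "C = max C2 (C1 * C1)"
  show thesis
  proof (rule that[of C])
    show "0 \<le> C" using C2(1) by (simp add: C_def)
    fix f :: "'a \<Rightarrow> real" and x y
    assume f: "integrable P f" and xM: "x \<in> space M" and x: "x \<notin> space P" and y: "y \<notin> space P"
    have [measurable]: "f \<in> borel_measurable P" using f by simp
    note xM[measurable]
    show "epow p (extend f y - extend f x) \<le> ennreal C *
        (ennreal ((min 1 (dist x y / bdist x)) powr p) * osc_near p f x + (if bdist x < 4 * dist x y then osc_far p f x y else 0))"
    proof (cases "4 * dist x y \<le> bdist x")
      case True
      have dx: "0 < bdist x" by (rule bdist_pos[OF x])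
      define e where "e = (dist x y / bdist x) powr p"
      have mn: "min 1 (dist x y / bdist x) = dist x y / bdist x" using True dx zero_le_dist[of x y] by (simp add: min_def field_simps)
      define L where "L = epow p (extend f y - extend f x)"
      have m: "0 < bm P x (2 * bdist x)" by (rule mass_pos[OF x])
      have one: "1 \<le> wgt x * (\<integral>\<^sup>+z. near x z \<partial>P)"
      proof -
        have "ennreal (bm P x (2 * bdist x)) = (\<integral>\<^sup>+z. indicator (ball x (2 * bdist x) \<inter> space P) z \<partial>P)" by (simp add: P.emeasure_ball)
        also have "\<dots> \<le> (\<integral>\<^sup>+z. near x z \<partial>P)" using dx by (intro nn_integral_mono) (auto simp: indicator_def near_def)
        finally have "wgt x * ennreal (bm P x (2 * bdist x)) \<le> wgt x * (\<integral>\<^sup>+z. near x z \<partial>P)" by (rule mult_left_mono) simp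
        moreover have "wgt x * ennreal (bm P x (2 * bdist x)) = 1" using m by (simp add: wgt_def ennreal_mult'[symmetric])
        ultimately show ?thesis by simp
      qed
      have "L = 1 * L" by simp
      also have "\<dots> \<le> wgt x * (\<integral>\<^sup>+z. near x z \<partial>P) * L" by (intro mult_right_mono one) simp
      also have "\<dots> = wgt x * (\<integral>\<^sup>+z. L * near x z \<partial>P)" by (subst nn_integral_cmult) (auto simp: mult_ac)
      also have "\<dots> \<le> wgt x * (\<integral>\<^sup>+z. (ennreal (C2 * e) * (wgt x * nearint p f (f z) x)) * near x z \<partial>P)"
        unfolding L_def e_def by (intro mult_left_mono nn_integral_mono mult_right_mono C2(2)[OF f x True]) auto
      also have "\<dots> = ennreal (C2 * e) * osc_near p f x"
      proof -
        have "(\<integral>\<^sup>+z. (ennreal (C2 * e) * (wgt x * nearint p f (f z) x)) * near x z \<partial>P)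
          = ennreal (C2 * e) * (\<integral>\<^sup>+z. (wgt x * nearint p f (f z) x) * near x z \<partial>P)"
          unfolding mult.assoc by (rule nn_integral_cmult) measurable
        then show ?thesis by (simp add: osc_near_def mult_ac)
      qed
      also have "\<dots> \<le> ennreal C * (ennreal e * osc_near p f x)"
        unfolding mult.assoc[symmetric] using C2(1)
        by (intro mult_right_mono) (auto simp: ennreal_mult'[symmetric] e_def C_def intro!: ennreal_leI mult_right_mono)
      also have "\<dots> \<le> ennreal C * (ennreal e * osc_near p f x + (if bdist x < 4 * dist x y then osc_far p f x y else 0))"
        by (intro mult_left_mono) auto
      finally show ?thesis by (simp only: L_def e_def mn)
    next
      case False
      have "epow p (extend f x - extend f y) \<le> ennreal C1 * (wgt x * nearint p f (extend f y) x)"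
        by (rule C1(2)[OF f x])
      also have "\<dots> \<le> ennreal C1 * (wgt x * (\<integral>\<^sup>+z. (ennreal C1 * (wgt y * nearint p f (f z) y)) * near x z \<partial>P))"
        using C1(2)[OF f y] by (intro mult_left_mono nn_integral_mono mult_right_mono) (auto simp: abs_minus_commute)
      also have "\<dots> = ennreal (C1 * C1) * osc_far p f x y"
      proof -
        have "(\<integral>\<^sup>+z. (ennreal C1 * (wgt y * nearint p f (f z) y)) * near x z \<partial>P)
          = ennreal C1 * (\<integral>\<^sup>+z. (wgt y * nearint p f (f z) y) * near x z \<partial>P)"
          unfolding mult.assoc
        proof (rule nn_integral_cmult)
          have "(\<lambda>w. near y w) \<in> borel_measurable P" unfolding near_def using P.measurable_dist_P[of y] by measurable
          note this[measurable]
          show "(\<lambda>z. wgt y * (nearint p f (f z) y * near x z)) \<in> borel_measurable P" by measurable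
        qed
        then show ?thesis using C1(1) by (simp add: osc_far_def ennreal_mult mult_ac)
      qed
      also have "\<dots> \<le> ennreal C * osc_far p f x y" by (intro mult_right_mono ennreal_leI) (auto simp: C_def)
      also have "\<dots> \<le> ennreal C * (ennreal ((min 1 (dist x y / bdist x)) powr p) * osc_near p f x + (if bdist x < 4 * dist x y then osc_far p f x y else 0))"
        using False by (intro mult_left_mono) auto
      finally show ?thesis by (simp add: abs_minus_commute)
    qed
  qed
qed

lemma pair_PM: "pair_sigma_finite P M" by unfold_locales

lemma wgt_near_integral:
  obtains C where "0 \<le> C" "\<And>z r. z \<in> space P \<Longrightarrow> 0 < r \<Longrightarrow>
    (\<integral>\<^sup>+x. wgt x * near x z * indicator (ball z r) x \<partial>M) \<le> ennreal (C * r powr \<sigma>)"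
proof (rule M.kern_integral_ball[OF \<sigma>], goal_cases)
  case cst: (1 C)
  note C = cst(2,3)
  define c where "c = D' ^ 7 * K"
  have c: "0 \<le> c" using P.D_ge_1 K by (simp add: c_def)
  show thesis
  proof (rule that[of "c * C"])
    show "0 \<le> c * C" using C c by simp
    fix z and r :: real assume z: "z \<in> space P" and r: "0 < r"
    have zM[measurable]: "z \<in> space M" using z space_P by auto
    have "(\<integral>\<^sup>+x. wgt x * near x z * indicator (ball z r) x \<partial>M) \<le> (\<integral>\<^sup>+x. ennreal c * (ennreal (kern M (- \<sigma>) z x) * indicator (ball z r) x) \<partial>M)"
    proof (rule nn_integral_mono_AE)
      show "AE x in M. wgt x * near x z * indicator (ball z r) x \<le> ennreal c * (ennreal (kern M (- \<sigma>) z x) * indicator (ball z r) x)"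
        using AE_off AE_space
      proof eventually_elim
        case (elim x)
        from mult_right_mono[OF wgt_near_le_kern[OF elim(2,1) z], of "indicator (ball z r) x"]
        show ?case using c by (simp add: c_def[symmetric] ennreal_mult mult.assoc)
      qed
    qed
    also have "\<dots> = ennreal c * (\<integral>\<^sup>+x\<in>ball z r. ennreal (kern M (- \<sigma>) z x) \<partial>M)" by (intro nn_integral_cmult) measurable
    also have "\<dots> \<le> ennreal c * ennreal (C * r powr \<sigma>)" by (intro mult_left_mono C(2) zM r) auto
    also have "\<dots> = ennreal (c * C * r powr \<sigma>)" using c by (simp add: ennreal_mult'[symmetric] mult.assoc)
    finally show "(\<integral>\<^sup>+x. wgt x * near x z * indicator (ball z r) x \<partial>M) \<le> ennreal (c * C * r powr \<sigma>)" .
  qed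
qed

text \<open>After Fubini each boundary point contributes the integral of its kernel over the whole
  space, which is at most of order \<open>R powr \<sigma>\<close>.\<close>

lemma extend_Lp:
  assumes p: "1 < p"
  obtains C where "0 \<le> C" "\<And>f. integrable P f \<Longrightarrow>
    (\<integral>\<^sup>+x. epow p (extend f x) \<partial>M) \<le> ennreal C * (\<integral>\<^sup>+z. epow p (f z) \<partial>P)"
proof (rule extend_diff_const[OF p], rule wgt_near_integral, goal_cases)
  case cst: (1 C1 C2)
  note C1 = cst(2,3) and C2 = cst(4,5)
  show thesis
  proof (rule that[of "C1 * (C2 * R powr \<sigma>)"])
    show "0 \<le> C1 * (C2 * R powr \<sigma>)" using C1 C2 by simp
    fix f :: "'a \<Rightarrow> real" assume f: "integrable P f"
    have fm[measurable]: "f \<in> borel_measurable P" using f by simp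
    interpret PM: pair_sigma_finite P M by (rule pair_PM)
    have "(\<integral>\<^sup>+x. epow p (extend f x) \<partial>M) \<le> (\<integral>\<^sup>+x. ennreal C1 * (wgt x * (\<integral>\<^sup>+z. epow p (f z) * near x z \<partial>P)) \<partial>M)"
    proof (rule nn_integral_mono_AE)
      show "AE x in M. epow p (extend f x) \<le> ennreal C1 * (wgt x * (\<integral>\<^sup>+z. epow p (f z) * near x z \<partial>P))"
        using AE_off by eventually_elim (use C1(2)[OF f, of _ 0] in simp)
    qed
    also have "\<dots> = ennreal C1 * (\<integral>\<^sup>+x. \<integral>\<^sup>+z. epow p (f z) * (wgt x * near x z) \<partial>P \<partial>M)"
    proof -
      have "wgt x * (\<integral>\<^sup>+z. epow p (f z) * near x z \<partial>P) = (\<integral>\<^sup>+z. epow p (f z) * (wgt x * near x z) \<partial>P)" if x[measurable]: "x \<in> space M" for x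
        by (subst nn_integral_cmult[symmetric]) (measurable, simp add: mult_ac)
      then have eq: "(\<integral>\<^sup>+x. wgt x * (\<integral>\<^sup>+z. epow p (f z) * near x z \<partial>P) \<partial>M) = (\<integral>\<^sup>+x. \<integral>\<^sup>+z. epow p (f z) * (wgt x * near x z) \<partial>P \<partial>M)"
        by (rule nn_integral_cong)
      show ?thesis unfolding eq[symmetric] by (rule nn_integral_cmult) measurable
    qed
    also have "(\<integral>\<^sup>+x. \<integral>\<^sup>+z. epow p (f z) * (wgt x * near x z) \<partial>P \<partial>M) = (\<integral>\<^sup>+z. \<integral>\<^sup>+x. epow p (f z) * (wgt x * near x z) \<partial>M \<partial>P)"
      by (rule PM.Fubini') measurable
    also have "\<dots> \<le> (\<integral>\<^sup>+z. ennreal (C2 * R powr \<sigma>) * epow p (f z) \<partial>P)"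
    proof (intro nn_integral_mono)
      fix z assume z[measurable]: "z \<in> space P"
      have zM: "z \<in> space M" using z space_P by auto
      have "(\<integral>\<^sup>+x. epow p (f z) * (wgt x * near x z) \<partial>M) = epow p (f z) * (\<integral>\<^sup>+x. wgt x * near x z \<partial>M)"
        by (intro nn_integral_cmult) measurable
      also have "(\<integral>\<^sup>+x. wgt x * near x z \<partial>M) = (\<integral>\<^sup>+x. wgt x * near x z * indicator (ball z R) x \<partial>M)"
        using M.dist_less[OF zM] by (intro nn_integral_cong) (auto simp: indicator_def)
      also have "\<dots> \<le> ennreal (C2 * R powr \<sigma>)" by (rule C2(2)[OF z M.R_pos])
      finally have "(\<integral>\<^sup>+x. epow p (f z) * (wgt x * near x z) \<partial>M) \<le> epow p (f z) * ennreal (C2 * R powr \<sigma>)"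
        by (auto simp: mult_left_mono)
      then show "(\<integral>\<^sup>+x. epow p (f z) * (wgt x * near x z) \<partial>M) \<le> ennreal (C2 * R powr \<sigma>) * epow p (f z)"
        by (simp only: mult.commute)
    qed
    also have "\<dots> = ennreal (C2 * R powr \<sigma>) * (\<integral>\<^sup>+z. epow p (f z) \<partial>P)" by (intro nn_integral_cmult) measurable
    finally show "(\<integral>\<^sup>+x. epow p (extend f x) \<partial>M) \<le> ennreal (C1 * (C2 * R powr \<sigma>)) * (\<integral>\<^sup>+z. epow p (f z) \<partial>P)"
      using C1(1) C2(1) by (simp add: ennreal_mult mult_left_mono mult.assoc)
  qed
qed

end

section \<open>The energy of the extension\<close>

text \<open>Fubini for double means. The outer measure \<open>N\<close> is general, because it is
  \<open>M\<close> for the near part of the energy and the product of \<open>M\<close> with itself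
  for the far part.\<close>

lemma nn_integral_swap_pair:
  assumes O: "sigma_finite_measure N" and P: "sigma_finite_measure P"
    and [measurable]: "k \<in> borel_measurable N" "(\<lambda>(z, w). E z w) \<in> borel_measurable (P \<Otimes>\<^sub>M P)"
      "(\<lambda>(x, z). g x z) \<in> borel_measurable (N \<Otimes>\<^sub>M P)" "(\<lambda>(x, z). h x z) \<in> borel_measurable (N \<Otimes>\<^sub>M P)"
  shows "(\<integral>\<^sup>+x. k x * (\<integral>\<^sup>+z. (\<integral>\<^sup>+w. E z w * h x w \<partial>P) * g x z \<partial>P) \<partial>N) =
     (\<integral>\<^sup>+z. \<integral>\<^sup>+w. E z w * (\<integral>\<^sup>+x. k x * (g x z * h x w) \<partial>N) \<partial>P \<partial>P)"
proof -
  interpret N: sigma_finite_measure N by fact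
  interpret P: sigma_finite_measure P by fact
  interpret PN: pair_sigma_finite P N by unfold_locales
  have "(\<integral>\<^sup>+x. k x * (\<integral>\<^sup>+z. (\<integral>\<^sup>+w. E z w * h x w \<partial>P) * g x z \<partial>P) \<partial>N)
     = (\<integral>\<^sup>+x. \<integral>\<^sup>+z. \<integral>\<^sup>+w. E z w * (k x * (g x z * h x w)) \<partial>P \<partial>P \<partial>N)"
  proof (intro nn_integral_cong)
    fix x assume x[measurable]: "x \<in> space N"
    have "k x * (\<integral>\<^sup>+z. (\<integral>\<^sup>+w. E z w * h x w \<partial>P) * g x z \<partial>P) = (\<integral>\<^sup>+z. k x * ((\<integral>\<^sup>+w. E z w * h x w \<partial>P) * g x z) \<partial>P)"
      by (rule nn_integral_cmult[symmetric]) measurable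
    also have "\<dots> = (\<integral>\<^sup>+z. \<integral>\<^sup>+w. E z w * (k x * (g x z * h x w)) \<partial>P \<partial>P)"
    proof (intro nn_integral_cong)
      fix z assume z[measurable]: "z \<in> space P"
      have "(\<integral>\<^sup>+w. E z w * (k x * (g x z * h x w)) \<partial>P) = (\<integral>\<^sup>+w. (k x * g x z) * (E z w * h x w) \<partial>P)" by (simp add: mult_ac)
      also have "\<dots> = (k x * g x z) * (\<integral>\<^sup>+w. E z w * h x w \<partial>P)" by (rule nn_integral_cmult) measurable
      finally show "k x * ((\<integral>\<^sup>+w. E z w * h x w \<partial>P) * g x z) = (\<integral>\<^sup>+w. E z w * (k x * (g x z * h x w)) \<partial>P)" by (simp add: mult_ac)
    qed
    finally show "k x * (\<integral>\<^sup>+z. (\<integral>\<^sup>+w. E z w * h x w \<partial>P) * g x z \<partial>P) = \<dots>" .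
  qed
  also have "\<dots> = (\<integral>\<^sup>+z. \<integral>\<^sup>+x. \<integral>\<^sup>+w. E z w * (k x * (g x z * h x w)) \<partial>P \<partial>N \<partial>P)"
    by (rule PN.Fubini') measurable
  also have "\<dots> = (\<integral>\<^sup>+z. \<integral>\<^sup>+w. \<integral>\<^sup>+x. E z w * (k x * (g x z * h x w)) \<partial>N \<partial>P \<partial>P)"
  proof (intro nn_integral_cong)
    fix z assume z[measurable]: "z \<in> space P"
    show "(\<integral>\<^sup>+x. \<integral>\<^sup>+w. E z w * (k x * (g x z * h x w)) \<partial>P \<partial>N) = (\<integral>\<^sup>+w. \<integral>\<^sup>+x. E z w * (k x * (g x z * h x w)) \<partial>N \<partial>P)"
      by (rule PN.Fubini') measurable
  qed
  also have "\<dots> = (\<integral>\<^sup>+z. \<integral>\<^sup>+w. E z w * (\<integral>\<^sup>+x. k x * (g x z * h x w) \<partial>N) \<partial>P \<partial>P)"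
  proof (intro nn_integral_cong)
    fix z w assume [measurable]: "z \<in> space P" "w \<in> space P"
    show "(\<integral>\<^sup>+x. E z w * (k x * (g x z * h x w)) \<partial>N) = E z w * (\<integral>\<^sup>+x. k x * (g x z * h x w) \<partial>N)"
      by (rule nn_integral_cmult) measurable
  qed
  finally show ?thesis .
qed

context extension_pair
begin

lemma osc_far_eq:
  assumes [measurable]: "f \<in> borel_measurable P" and [measurable]: "x \<in> space M" "y \<in> space M"
  shows "osc_far p f x y = wgt x * wgt y * (\<integral>\<^sup>+z. nearint p f (f z) y * near x z \<partial>P)"
proof -
  have "(\<integral>\<^sup>+z. (wgt y * nearint p f (f z) y) * near x z \<partial>P)
    = wgt y * (\<integral>\<^sup>+z. nearint p f (f z) y * near x z \<partial>P)"
    unfolding mult.assoc by (rule nn_integral_cmult) measurable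
  then show ?thesis by (simp add: osc_far_def mult.assoc)
qed

lemma osc_near_eq: "osc_near p f x = osc_far p f x x"
  by (simp add: osc_near_def osc_far_def)

text \<open>Both parts of the energy are reduced to bounding one integral by the boundary kernel at
  \<open>z \<noteq> w\<close>; on the diagonal the boundary difference vanishes.\<close>

lemma nn_integral_osc_kernel_le:
  assumes "sigma_finite_measure N" and [measurable]: "f \<in> borel_measurable P" "k \<in> borel_measurable N"
      "(\<lambda>(x, z). g x z) \<in> borel_measurable (N \<Otimes>\<^sub>M P)" "(\<lambda>(x, z). h x z) \<in> borel_measurable (N \<Otimes>\<^sub>M P)"
    and p: "1 < p" and C: "0 \<le> C"
    and ker: "\<And>z w. z \<in> space P \<Longrightarrow> w \<in> space P \<Longrightarrow> z \<noteq> w \<Longrightarrow>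
      (\<integral>\<^sup>+x. k x * (g x z * h x w) \<partial>N) \<le> ennreal (C * kern P (s * p - \<sigma>) z w)"
  shows "(\<integral>\<^sup>+x. k x * (\<integral>\<^sup>+z. (\<integral>\<^sup>+w. epow p (f w - f z) * h x w \<partial>P) * g x z \<partial>P) \<partial>N)
    \<le> ennreal C * besov_energy (s - \<sigma> / p) p P f"
proof -
  have se: "(s - \<sigma> / p) * p = s * p - \<sigma>" using p by (simp add: field_simps)
  have "(\<integral>\<^sup>+x. k x * (\<integral>\<^sup>+z. (\<integral>\<^sup>+w. epow p (f w - f z) * h x w \<partial>P) * g x z \<partial>P) \<partial>N)
    = (\<integral>\<^sup>+z. \<integral>\<^sup>+w. epow p (f w - f z) * (\<integral>\<^sup>+x. k x * (g x z * h x w) \<partial>N) \<partial>P \<partial>P)"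
    by (rule nn_integral_swap_pair[OF assms(1) P.sigma_finite_measure_axioms]) measurable
  also have "\<dots> \<le> (\<integral>\<^sup>+z. \<integral>\<^sup>+w. ennreal C * bkern p P (s * p - \<sigma>) f z w \<partial>P \<partial>P)"
  proof (intro nn_integral_mono)
    fix z w assume zw: "z \<in> space P" "w \<in> space P"
    show "epow p (f w - f z) * (\<integral>\<^sup>+x. k x * (g x z * h x w) \<partial>N)
       \<le> ennreal C * bkern p P (s * p - \<sigma>) f z w"
    proof (cases "z = w")
      case False
      from mult_left_mono[OF ker[OF zw False], of "epow p (f w - f z)"]
      show ?thesis using C by (simp add: ennreal_mult mult_ac)
    qed (use p in simp)
  qed
  also have "\<dots> = ennreal C * besov_energy (s - \<sigma> / p) p P f"
    unfolding P.besov_energy_kern se by (rule P.nn_integral_double_cmult) measurable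
  finally show ?thesis .
qed

text \<open>If \<open>x\<close> is near both \<open>z\<close> and \<open>w\<close>, then
  \<open>dist z w \<le> 32 * bdist x\<close>, so \<open>x\<close> stays outside
  \<open>ball z (d / 32)\<close>. One of the two weights is bounded through
  \<open>1 / bm P z d\<close>, the other by the kernel of order \<open>\<sigma>\<close>; what is
  left to integrate decays with order \<open>s * p - \<sigma> > 0\<close>.\<close>

lemma near_energy_le:
  assumes p: "1 < p" and s: "0 < s" and sp: "0 < s * p - \<sigma>"
  obtains C where "0 \<le> C" "\<And>f. f \<in> borel_measurable P \<Longrightarrow>
    (\<integral>\<^sup>+x. ennreal (bdist x powr (- (s * p))) * osc_near p f x \<partial>M) \<le> ennreal C * besov_energy (s - \<sigma> / p) p P f"
proof (rule M.kern_integral_off_ball[OF sp], goal_cases)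
  case cst: (1 C1)
  note C1 = cst(2,3)
  define c where "c = D' ^ 8 * (D' ^ 7 * K) * 16 powr (s * p)"
  have c: "0 \<le> c" using P.D_ge_1 K by (simp add: c_def)
  define C where "C = c * C1 * 32 powr (s * p - \<sigma>)"
  have C0: "0 \<le> C" using c C1(1) by (simp add: C_def)
  have ker: "(\<integral>\<^sup>+x. (ennreal (bdist x powr (- (s * p))) * (wgt x * wgt x)) * (near x z * near x w) \<partial>M) \<le> ennreal (C * kern P (s * p - \<sigma>) z w)"
    if z: "z \<in> space P" and w: "w \<in> space P" and zw: "z \<noteq> w" for z w
  proof -
    define d where "d = dist z w"
    have d: "0 < d" using zw by (simp add: d_def)
    have zM[measurable]: "z \<in> space M" using z space_P by auto
    have bd: "0 < bm P z d" using P.bm_pos[OF z d] .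
    have "(\<integral>\<^sup>+x. (ennreal (bdist x powr (- (s * p))) * (wgt x * wgt x)) * (near x z * near x w) \<partial>M)
       \<le> (\<integral>\<^sup>+x. ennreal (c / bm P z d) * (ennreal (kern M (s * p - \<sigma>) z x) * indicator (- ball z (d / 32)) x) \<partial>M)"
    proof (rule nn_integral_mono_AE)
      show "AE x in M. (ennreal (bdist x powr (- (s * p))) * (wgt x * wgt x)) * (near x z * near x w)
         \<le> ennreal (c / bm P z d) * (ennreal (kern M (s * p - \<sigma>) z x) * indicator (- ball z (d / 32)) x)"
        using AE_off AE_space
      proof eventually_elim
        case (elim x)
        show ?case
        proof (cases "dist x z < 16 * bdist x \<and> dist x w < 16 * bdist x")
          case True
          define t where "t = dist x z"
          have dx: "0 < bdist x" by (rule bdist_pos[OF elim(1)])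
          have t: "bdist x \<le> t" unfolding t_def by (rule bdist_le[OF z])
          have t0: "0 < t" using dx t by linarith
          have dd: "d \<le> 32 * bdist x" using True dist_triangle3[of z w x] by (auto simp: d_def)
          \<comment> \<open>The radius \<open>d / 2\<close> is at most \<open>16 * bdist x\<close>,
            as \<open>wgt_le_inverse\<close> requires; returning to \<open>d\<close> costs one
            doubling.\<close>
          have w1: "wgt x \<le> ennreal (D' ^ 8 / bm P z d)"
          proof -
            have "wgt x \<le> ennreal (D' ^ 7 / bm P z (d / 2))"
              using True dd d by (intro wgt_le_inverse elim(1) z) auto
            also have "\<dots> \<le> ennreal (D' ^ 8 / bm P z d)"
            proof (intro ennreal_leI)
              have b2: "0 < bm P z (d / 2)" using P.bm_pos[OF z] d by simp
              have "bm P z d \<le> D' * bm P z (d / 2)" using P.bm_double[OF z, of "d / 2"] d by simp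
              then have "1 / bm P z (d / 2) \<le> D' / bm P z d" using b2 bd by (simp add: field_simps)
              then have "D' ^ 7 * (1 / bm P z (d / 2)) \<le> D' ^ 7 * (D' / bm P z d)" using P.D_ge_1 by (intro mult_left_mono) auto
              also have "\<dots> = D' ^ 8 / bm P z d" by (simp add: power_Suc2[symmetric] numeral_eq_Suc)
              finally show "D' ^ 7 / bm P z (d / 2) \<le> D' ^ 8 / bm P z d" by simp
            qed
            finally show ?thesis .
          qed
          have w2: "wgt x \<le> ennreal (D' ^ 7 * K * kern M (- \<sigma>) z x)"
            using wgt_near_le_kern[OF elim(2,1) z] True by (simp add: near_def)
          have pw: "bdist x powr (- (s * p)) \<le> 16 powr (s * p) * t powr (- (s * p))"
          proof -
            have "bdist x powr (- (s * p)) \<le> (t / 16) powr (- (s * p))"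
              using True t0 p s by (intro powr_mono2') (auto simp: t_def)
            then show ?thesis using t0 by (simp add: powr_divide powr_minus divide_simps)
          qed
          have "ennreal (bdist x powr (- (s * p))) * (wgt x * wgt x) * (near x z * near x w) = ennreal (bdist x powr (- (s * p))) * (wgt x * wgt x)"
            using True by (simp add: near_def)
          also have "\<dots> \<le> ennreal (16 powr (s * p) * t powr (- (s * p))) * (ennreal (D' ^ 8 / bm P z d) * ennreal (D' ^ 7 * K * kern M (- \<sigma>) z x))"
            by (intro mult_mono ennreal_leI pw w1 w2) auto
          also have "\<dots> = ennreal (c / bm P z d) * ennreal (kern M (s * p - \<sigma>) z x)"
          proof -
            have k: "t powr (- (s * p)) * kern M (- \<sigma>) z x = kern M (s * p - \<sigma>) z x"
            proof -
              have "t powr (- (s * p)) * t powr \<sigma> = t powr (- (s * p - \<sigma>))" by (simp add: powr_add[symmetric])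
              then show ?thesis by (simp add: kern_def t_def dist_commute)
            qed
            have "16 powr (s * p) * t powr (- (s * p)) * (D' ^ 8 / bm P z d * (D' ^ 7 * K * kern M (- \<sigma>) z x))
              = (c / bm P z d) * (t powr (- (s * p)) * kern M (- \<sigma>) z x)" by (simp add: c_def)
            also have "\<dots> = c / bm P z d * kern M (s * p - \<sigma>) z x" unfolding k ..
            finally show ?thesis using c K P.D_ge_1 by (simp add: ennreal_mult'[symmetric])
          qed
          also have "\<dots> = ennreal (c / bm P z d) * (ennreal (kern M (s * p - \<sigma>) z x) * indicator (- ball z (d / 32)) x)"
            using t dd by (simp add: indicator_def t_def dist_commute)
          finally show ?thesis .
        qed (auto simp: near_def)
      qed
    qed
    also have "\<dots> = ennreal (c / bm P z d) * (\<integral>\<^sup>+x\<in>- ball z (d / 32). ennreal (kern M (s * p - \<sigma>) z x) \<partial>M)"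
      by (rule nn_integral_cmult) measurable
    also have "\<dots> \<le> ennreal (c / bm P z d) * ennreal (C1 * (d / 32) powr (- (s * p - \<sigma>)))"
      using d by (intro mult_left_mono C1(2) zM) auto
    also have "\<dots> = ennreal (C * kern P (s * p - \<sigma>) z w)"
    proof -
      have "(d / 32) powr (- (s * p - \<sigma>)) = 32 powr (s * p - \<sigma>) * d powr (- (s * p - \<sigma>))"
        using d by (simp add: powr_quotient mult.commute del: minus_diff_eq)
      then have "c / bm P z d * (C1 * (d / 32) powr (- (s * p - \<sigma>))) = C * kern P (s * p - \<sigma>) z w"
        by (simp add: C_def kern_def d_def)
      then show ?thesis using c by (simp add: ennreal_mult'[symmetric])
    qed
    finally show ?thesis .
  qed
  show thesis
  proof (rule that[OF C0])
    fix f :: "'a \<Rightarrow> real" assume f[measurable]: "f \<in> borel_measurable P"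
    have "(\<integral>\<^sup>+x. ennreal (bdist x powr (- (s * p))) * osc_near p f x \<partial>M) =
      (\<integral>\<^sup>+x. (ennreal (bdist x powr (- (s * p))) * (wgt x * wgt x)) * (\<integral>\<^sup>+z. nearint p f (f z) x * near x z \<partial>P) \<partial>M)"
      by (intro nn_integral_cong) (simp add: osc_near_eq osc_far_eq mult.assoc)
    also have "\<dots> \<le> ennreal C * besov_energy (s - \<sigma> / p) p P f"
      by (rule nn_integral_osc_kernel_le[OF M.sigma_finite_measure_axioms f _ _ _ p C0 ker]) measurable
    finally show "(\<integral>\<^sup>+x. ennreal (bdist x powr (- (s * p))) * osc_near p f x \<partial>M) \<le> ennreal C * besov_energy (s - \<sigma> / p) p P f" .
  qed
qed

text \<open>The truncation at \<open>d\<close> leaves a kernel of order \<open>\<sigma>\<close>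
  inside \<open>ball z d\<close>, integrable at the centre, and decay of order
  \<open>b - \<sigma>\<close> outside.\<close>

lemma kern_truncated_integral:
  assumes b: "\<sigma> < b"
  obtains C where "0 \<le> C" "\<And>z d. z \<in> space M \<Longrightarrow> 0 < d \<Longrightarrow>
    (\<integral>\<^sup>+x. ennreal (kern M (- \<sigma>) z x * max d (dist z x) powr (- b)) \<partial>M) \<le> ennreal (C * d powr (- (b - \<sigma>)))"
proof (rule M.kern_integral_ball[OF \<sigma>], goal_cases)
  case cst: (1 C1)
  note C1 = cst(2,3)
  have bs: "0 < b - \<sigma>" using b by simp
  obtain C2 where C2: "0 \<le> C2" "\<And>x r. x \<in> space M \<Longrightarrow> 0 < r \<Longrightarrow>
      (\<integral>\<^sup>+y\<in>- ball x r. ennreal (kern M (b - \<sigma>) x y) \<partial>M) \<le> ennreal (C2 * r powr (- (b - \<sigma>)))"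
    using M.kern_integral_off_ball[OF bs] by blast
  show thesis
  proof (rule that[of "C1 + C2"])
    show "0 \<le> C1 + C2" using C1 C2 by simp
    fix z and d :: real assume z[measurable]: "z \<in> space M" and d: "0 < d"
    have "(\<integral>\<^sup>+x. ennreal (kern M (- \<sigma>) z x * max d (dist z x) powr (- b)) \<partial>M)
       \<le> (\<integral>\<^sup>+x. ennreal (d powr (- b)) * (ennreal (kern M (- \<sigma>) z x) * indicator (ball z d) x)
          + ennreal (kern M (b - \<sigma>) z x) * indicator (- ball z d) x \<partial>M)"
    proof (intro nn_integral_mono)
      fix x
      show "ennreal (kern M (- \<sigma>) z x * max d (dist z x) powr (- b)) \<le> ennreal (d powr (- b)) * (ennreal (kern M (- \<sigma>) z x) * indicator (ball z d) x)
          + ennreal (kern M (b - \<sigma>) z x) * indicator (- ball z d) x"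
      proof (cases "dist z x < d")
        case True
        then have mx: "max d (dist z x) = d" by simp
        show ?thesis unfolding mx using True by (simp add: ennreal_mult mult.commute)
      next
        case False
        then have mx: "max d (dist z x) = dist z x" by simp
        have "dist z x powr \<sigma> * dist z x powr (- b) = dist z x powr (- (b - \<sigma>))" by (simp add: powr_add[symmetric])
        then have "kern M (- \<sigma>) z x * dist z x powr (- b) = kern M (b - \<sigma>) z x" by (simp add: kern_def)
        then show ?thesis unfolding mx using False by simp
      qed
    qed
    also have "\<dots> = ennreal (d powr (- b)) * (\<integral>\<^sup>+x\<in>ball z d. ennreal (kern M (- \<sigma>) z x) \<partial>M)
       + (\<integral>\<^sup>+x\<in>- ball z d. ennreal (kern M (b - \<sigma>) z x) \<partial>M)"
      by (subst nn_integral_add, measurable, subst nn_integral_cmult, measurable)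
    also have "\<dots> \<le> ennreal (d powr (- b)) * ennreal (C1 * d powr \<sigma>) + ennreal (C2 * d powr (- (b - \<sigma>)))"
      by (intro add_mono mult_left_mono C1(2) C2(2) z d) auto
    also have "\<dots> = ennreal ((C1 + C2) * d powr (- (b - \<sigma>)))"
    proof -
      have "d powr (- b) * (C1 * d powr \<sigma>) = C1 * (d powr (- b) * d powr \<sigma>)" by simp
      also have "d powr (- b) * d powr \<sigma> = d powr (- (b - \<sigma>))" by (simp add: powr_add[symmetric])
      finally have e: "d powr (- b) * (C1 * d powr \<sigma>) = C1 * d powr (- (b - \<sigma>))" .
      have "ennreal (d powr (- b)) * ennreal (C1 * d powr \<sigma>) = ennreal (C1 * d powr (- (b - \<sigma>)))"
        unfolding e[symmetric] by (simp add: ennreal_mult')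
      then show ?thesis using C1 C2 by (simp only: distrib_right) (simp add: ennreal_plus)
    qed
    finally show "(\<integral>\<^sup>+x. ennreal (kern M (- \<sigma>) z x * max d (dist z x) powr (- b)) \<partial>M) \<le> ennreal ((C1 + C2) * d powr (- (b - \<sigma>)))" .
  qed
qed

text \<open>In the far region \<open>t = d(x, y)\<close> dominates all distances among \<open>x, y, z, w\<close>, so
  \<open>t\<^sup>-\<^sup>2\<^sup>b\<close> splits into a factor depending on \<open>x\<close> and a factor depending on \<open>y\<close>.\<close>

lemma far_kernel_le:
  assumes p: "1 < p" and s: "0 < s" and sp: "0 < s * p - \<sigma>"
  defines "b \<equiv> (s * p + \<sigma>) / 2"
  obtains C where "0 \<le> C"
    "\<And>x y z w. x \<in> space M \<Longrightarrow> y \<in> space M \<Longrightarrow> x \<notin> space P \<Longrightarrow> y \<notin> space P \<Longrightarrow> z \<in> space P \<Longrightarrow> w \<in> space P \<Longrightarrow> z \<noteq> w \<Longrightarrow>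
      bdist x < 4 * dist x y \<Longrightarrow>
      ennreal (kern M (s * p) x y) * (wgt x * wgt y) * (near x z * near y w) \<le>
      ennreal (C / bm P z (dist z w)) * (ennreal (kern M (- \<sigma>) z x * max (dist z w) (dist z x) powr (- b))
         * ennreal (kern M (- \<sigma>) w y * max (dist z w) (dist w y) powr (- b)))"
proof -
  have b0: "0 < b" using \<sigma> p s by (simp add: b_def add_pos_pos)
  define c where "c = D ^ 7 * K * D' ^ 8 * (145 powr b * 145 powr b) * ((D' ^ 7 * K) * (D' ^ 7 * K))"
  show thesis
  proof (rule that[of c])
    show "0 \<le> c" using M.D_ge_1 P.D_ge_1 K by (simp add: c_def)
    fix x y z w
    assume xM: "x \<in> space M" and yM: "y \<in> space M" and x: "x \<notin> space P" and y: "y \<notin> space P"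
      and z: "z \<in> space P" and w: "w \<in> space P" and zw: "z \<noteq> w" and xy: "bdist x < 4 * dist x y"
    define d where "d = dist z w"
    define t where "t = dist x y"
    have d: "0 < d" using zw by (simp add: d_def)
    have zM: "z \<in> space M" using z space_P by auto
    let ?q = "kern M (- \<sigma>) z x * max d (dist z x) powr (- b)"
    let ?r = "kern M (- \<sigma>) w y * max d (dist w y) powr (- b)"
    show "ennreal (kern M (s * p) x y) * (wgt x * wgt y) * (near x z * near y w) \<le>
      ennreal (c / bm P z (dist z w)) * (ennreal (kern M (- \<sigma>) z x * max (dist z w) (dist z x) powr (- b))
         * ennreal (kern M (- \<sigma>) w y * max (dist z w) (dist w y) powr (- b)))"
    proof (cases "dist x z < 16 * bdist x \<and> dist y w < 16 * bdist y")
      case True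
      have dx: "0 < bdist x" by (rule bdist_pos[OF x])
      have t: "0 < t" using xy dx unfolding t_def by linarith
      have tR: "t \<le> 64 * R" using M.dist_less[OF xM yM] M.R_pos by (simp add: t_def)
      \<comment> \<open>\<open>bdist x < 4 * t\<close> gives \<open>dist z x < 64 * t\<close>,
        \<open>bdist y < 5 * t\<close> gives \<open>dist w y < 80 * t\<close>, and
        \<open>64 + 1 + 80 = 145\<close> bounds \<open>dist z w\<close> in units of
        \<open>t\<close>.\<close>
      have dy: "bdist y < 5 * t" using bdist_lipschitz[of x y] xy by (simp add: t_def)
      have xz: "dist z x < 64 * t" using True xy by (simp add: t_def dist_commute)
      have yw: "dist w y < 80 * t" using True dy by (simp add: dist_commute)
      have "d \<le> dist z x + dist x w" unfolding d_def by (rule dist_triangle)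
      also have "dist x w \<le> t + dist y w" unfolding t_def by (rule dist_triangle)
      finally have dt: "d \<le> 145 * t" using xz yw by (simp add: dist_commute)
      have m1: "max d (dist z x) \<le> 145 * t" "max d (dist w y) \<le> 145 * t" using dt xz yw t by auto
      have half: "t powr (- b) \<le> 145 powr b * v powr (- b)" if v: "0 < v" "v \<le> 145 * t" for v
      proof -
        have "t powr (- b) = 145 powr b * (145 * t) powr (- b)" using t by (simp add: powr_mult powr_minus)
        also have "(145 * t) powr (- b) \<le> v powr (- b)" using v b0 by (intro powr_mono2') auto
        finally show ?thesis by simp
      qed
      have bpos: "0 < bm M x t" "0 < bm M z t" "0 < bm P z t" "0 < bm P z d"
        using M.bm_pos[OF xM t] M.bm_pos[OF zM t] P.bm_pos[OF z t] P.bm_pos[OF z d] .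
      have k1: "kern M (s * p) x y \<le> D ^ 7 * K * D' ^ 8 / bm P z d * (t powr (- b) * t powr (- b))"
      proof -
        have "bm M z t \<le> D ^ 7 * bm M x t" using xM t xz by (intro M.bm_comp) auto
        then have "1 / bm M x t \<le> D ^ 7 * (1 / bm M z t)" using bpos by (simp add: field_simps)
        also have "1 / bm M z t \<le> K * t powr (- \<sigma>) * (1 / bm P z t)"
        proof -
          have "t powr \<sigma> * bm P z t \<le> K * bm M z t" by (rule upper[OF z t tR])
          then show ?thesis using bpos t by (simp add: powr_minus field_simps)
        qed
        also have "1 / bm P z t \<le> D' ^ 8 * (1 / bm P z d)"
        proof -
          have "bm P z d \<le> D' ^ 8 * bm P z t" using z t dt by (intro P.bm_comp) auto
          then show ?thesis using bpos by (simp add: field_simps)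
        qed
        finally have "1 / bm M x t \<le> D ^ 7 * (K * t powr (- \<sigma>) * (D' ^ 8 * (1 / bm P z d)))"
          using M.D_ge_1 K by (simp add: mult_left_mono)
        then have "t powr (- (s * p)) * (1 / bm M x t) \<le> t powr (- (s * p)) * (D ^ 7 * (K * t powr (- \<sigma>) * (D' ^ 8 * (1 / bm P z d))))"
          by (intro mult_left_mono) auto
        also have "\<dots> = D ^ 7 * K * D' ^ 8 / bm P z d * (t powr (- (s * p)) * t powr (- \<sigma>))" by simp
        \<comment> \<open>The origin of \<open>b\<close>: the kernel contributes
          \<open>s * p\<close>, the exchange of mass of \<open>M\<close> for boundary mass
          contributes \<open>\<sigma>\<close>, and the total \<open>2 * b\<close> is shared equally
          by \<open>x\<close> and \<open>y\<close>.\<close>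
        also have "t powr (- (s * p)) * t powr (- \<sigma>) = t powr (- b) * t powr (- b)"
          unfolding powr_add[symmetric] by (simp add: b_def)
        finally show ?thesis by (simp add: kern_def t_def)
      qed
      have k2: "kern M (s * p) x y \<le> D ^ 7 * K * D' ^ 8 * (145 powr b * 145 powr b) / bm P z d * (max d (dist z x) powr (- b) * max d (dist w y) powr (- b))"
      proof -
        have "D ^ 7 * K * D' ^ 8 / bm P z d * (t powr (- b) * t powr (- b)) \<le> D ^ 7 * K * D' ^ 8 / bm P z d *
           ((145 powr b * max d (dist z x) powr (- b)) * (145 powr b * max d (dist w y) powr (- b)))"
          using d M.D_ge_1 P.D_ge_1 K by (intro mult_left_mono mult_mono half m1) auto
        with k1 show ?thesis by (simp add: mult_ac)
      qed
      have w1: "wgt x \<le> ennreal (D' ^ 7 * K * kern M (- \<sigma>) z x)" using wgt_near_le_kern[OF xM x z] True by (simp add: near_def)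
      have w2: "wgt y \<le> ennreal (D' ^ 7 * K * kern M (- \<sigma>) w y)" using wgt_near_le_kern[OF yM y w] True by (simp add: near_def)
      have "ennreal (kern M (s * p) x y) * (wgt x * wgt y) * (near x z * near y w) = ennreal (kern M (s * p) x y) * (wgt x * wgt y)"
        using True by (simp add: near_def)
      also have "\<dots> \<le> ennreal (D ^ 7 * K * D' ^ 8 * (145 powr b * 145 powr b) / bm P z d * (max d (dist z x) powr (- b) * max d (dist w y) powr (- b))) *
         (ennreal (D' ^ 7 * K * kern M (- \<sigma>) z x) * ennreal (D' ^ 7 * K * kern M (- \<sigma>) w y))"
        by (intro mult_mono ennreal_leI k2 w1 w2) auto
      also have "\<dots> = ennreal (c / bm P z d) * (ennreal ?q * ennreal ?r)"
      proof -
        have "D ^ 7 * K * D' ^ 8 * (145 powr b * 145 powr b) / bm P z d * (max d (dist z x) powr (- b) * max d (dist w y) powr (- b)) *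
           ((D' ^ 7 * K * kern M (- \<sigma>) z x) * (D' ^ 7 * K * kern M (- \<sigma>) w y)) = c / bm P z d * (?q * ?r)"
          by (simp add: c_def)
        then show ?thesis using M.D_ge_1 P.D_ge_1 K \<open>0 \<le> c\<close> by (simp add: ennreal_mult'[symmetric])
      qed
      finally show ?thesis by (simp add: d_def)
    qed (auto simp: near_def)
  qed
qed

text \<open>With the split kernel the integrals over \<open>x\<close> and \<open>y\<close> separate,
  and each gives \<open>d powr (- (b - \<sigma>))\<close>. Since
  \<open>2 * (b - \<sigma>) = s * p - \<sigma>\<close>, their product yields the boundary
  kernel.\<close>

lemma far_energy_le:
  assumes p: "1 < p" and s: "0 < s" and sp: "0 < s * p - \<sigma>"
  obtains C where "0 \<le> C" "\<And>f. f \<in> borel_measurable P \<Longrightarrow>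
    (\<integral>\<^sup>+x. \<integral>\<^sup>+y. ennreal (kern M (s * p) x y) * (if bdist x < 4 * dist x y then osc_far p f x y else 0) \<partial>M \<partial>M)
      \<le> ennreal C * besov_energy (s - \<sigma> / p) p P f"
proof (rule far_kernel_le[OF p s sp],
    rule kern_truncated_integral[of "(s * p + \<sigma>) / 2"], goal_cases)
  case 1
  show ?case using sp by simp
next
  case cst: (2 C1 C2)
  define b where "b = (s * p + \<sigma>) / 2"
  note C1 = cst(2,3)[folded b_def] and C2 = cst(4,5)[folded b_def]
  define C where "C = C1 * (C2 * C2)"
  have C0: "0 \<le> C" using C1(1) C2(1) by (simp add: C_def)
  interpret MM: pair_sigma_finite M M by unfold_locales
  define k where "k x y = (if bdist x < 4 * dist x y then ennreal (kern M (s * p) x y) * (wgt x * wgt y) else 0)" for x y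
  have km[measurable]: "(\<lambda>(x, y). k x y) \<in> borel_measurable (M \<Otimes>\<^sub>M M)" unfolding k_def by measurable
  have ker: "(\<integral>\<^sup>+v. k (fst v) (snd v) * (near (fst v) z * near (snd v) w) \<partial>(M \<Otimes>\<^sub>M M)) \<le> ennreal (C * kern P (s * p - \<sigma>) z w)"
    if z: "z \<in> space P" and w: "w \<in> space P" and zw: "z \<noteq> w" for z w
  proof -
    define d where "d = dist z w"
    have d: "0 < d" using zw by (simp add: d_def)
    have zM[measurable]: "z \<in> space M" and wM[measurable]: "w \<in> space M" using z w space_P by auto
    note z[measurable] w[measurable]
    have bd: "0 < bm P z d" using P.bm_pos[OF z d] .
    let ?q = "\<lambda>z x. ennreal (kern M (- \<sigma>) z x * max d (dist z x) powr (- b))"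
    have meas: "(\<lambda>v. k (fst v) (snd v) * (near (fst v) z * near (snd v) w)) \<in> borel_measurable (M \<Otimes>\<^sub>M M)" by measurable
    have "(\<integral>\<^sup>+v. k (fst v) (snd v) * (near (fst v) z * near (snd v) w) \<partial>(M \<Otimes>\<^sub>M M)) = (\<integral>\<^sup>+x. \<integral>\<^sup>+y. k x y * (near x z * near y w) \<partial>M \<partial>M)"
      using M.nn_integral_fst[OF meas] by (simp only: fst_conv snd_conv)
    also have "\<dots> \<le> (\<integral>\<^sup>+x. \<integral>\<^sup>+y. ennreal (C1 / bm P z d) * ?q z x * ?q w y \<partial>M \<partial>M)"
    proof (rule nn_integral_mono_AE)
      show "AE x in M. (\<integral>\<^sup>+y. k x y * (near x z * near y w) \<partial>M) \<le> (\<integral>\<^sup>+y. ennreal (C1 / bm P z d) * ?q z x * ?q w y \<partial>M)"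
        using AE_off AE_space
      proof eventually_elim
        case x: (elim x)
        show ?case
        proof (rule nn_integral_mono_AE)
          show "AE y in M. k x y * (near x z * near y w) \<le> ennreal (C1 / bm P z d) * ?q z x * ?q w y"
            using AE_off AE_space
          proof eventually_elim
            case y: (elim y)
            show ?case
            proof (cases "bdist x < 4 * dist x y")
              case True
              then show ?thesis using C1(2)[OF x(2) y(2) x(1) y(1) z w zw True] by (simp add: k_def d_def mult.assoc)
            qed (simp add: k_def)
          qed
        qed
      qed
    qed
    also have "\<dots> = (\<integral>\<^sup>+x. ennreal (C1 / bm P z d) * ?q z x * (\<integral>\<^sup>+y. ?q w y \<partial>M) \<partial>M)"
      by (intro nn_integral_cong nn_integral_cmult) measurable
    also have "\<dots> = (\<integral>\<^sup>+x. ennreal (C1 / bm P z d) * ?q z x \<partial>M) * (\<integral>\<^sup>+y. ?q w y \<partial>M)"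
      by (rule nn_integral_multc) measurable
    also have "(\<integral>\<^sup>+x. ennreal (C1 / bm P z d) * ?q z x \<partial>M) = ennreal (C1 / bm P z d) * (\<integral>\<^sup>+x. ?q z x \<partial>M)"
      by (rule nn_integral_cmult) measurable
    also have "ennreal (C1 / bm P z d) * (\<integral>\<^sup>+x. ?q z x \<partial>M) * (\<integral>\<^sup>+y. ?q w y \<partial>M)
        \<le> ennreal (C1 / bm P z d) * ennreal (C2 * d powr (- (b - \<sigma>))) * ennreal (C2 * d powr (- (b - \<sigma>)))"
      by (intro mult_mono C2(2) zM wM d) auto
    also have "\<dots> = ennreal (C * kern P (s * p - \<sigma>) z w)"
    proof -
      have "d powr (- (b - \<sigma>)) * d powr (- (b - \<sigma>)) = d powr (- (s * p - \<sigma>))"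
        unfolding powr_add[symmetric] by (rule arg_cong2[where f="(powr)"]) (simp_all add: b_def field_simps)
      then have "C1 / bm P z d * (C2 * d powr (- (b - \<sigma>))) * (C2 * d powr (- (b - \<sigma>))) = C * kern P (s * p - \<sigma>) z w"
        unfolding C_def kern_def d_def[symmetric] by (simp add: mult_ac)
      then show ?thesis using C1(1) C2(1) bd by (simp add: ennreal_mult'[symmetric])
    qed
    finally show ?thesis .
  qed
  show thesis
  proof (rule that[OF C0])
    fix f :: "'a \<Rightarrow> real" assume f[measurable]: "f \<in> borel_measurable P"
    let ?A = "\<lambda>x y. (\<integral>\<^sup>+z. nearint p f (f z) y * near x z \<partial>P)"
    have meas: "(\<lambda>v. k (fst v) (snd v) * ?A (fst v) (snd v)) \<in> borel_measurable (M \<Otimes>\<^sub>M M)" by measurable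
    have "(\<integral>\<^sup>+x. \<integral>\<^sup>+y. ennreal (kern M (s * p) x y) * (if bdist x < 4 * dist x y then osc_far p f x y else 0) \<partial>M \<partial>M)
       = (\<integral>\<^sup>+x. \<integral>\<^sup>+y. k x y * ?A x y \<partial>M \<partial>M)"
      by (intro nn_integral_cong) (simp add: k_def osc_far_eq mult.assoc)
    also have "\<dots> = (\<integral>\<^sup>+v. k (fst v) (snd v) * ?A (fst v) (snd v) \<partial>(M \<Otimes>\<^sub>M M))"
      using M.nn_integral_fst[OF meas] by (simp only: fst_conv snd_conv)
    also have "\<dots> \<le> ennreal C * besov_energy (s - \<sigma> / p) p P f"
      by (rule nn_integral_osc_kernel_le[OF MM.P.sigma_finite_measure_axioms f _ _ _ p C0 ker]) measurable
    finally show "(\<integral>\<^sup>+x. \<integral>\<^sup>+y. ennreal (kern M (s * p) x y) * (if bdist x < 4 * dist x y then osc_far p f x y else 0) \<partial>M \<partial>M)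
      \<le> ennreal C * besov_energy (s - \<sigma> / p) p P f" .
  qed
qed

end

context extension_pair
begin

text \<open>Integrating the near part in \<open>y\<close> at radius \<open>bdist x\<close> produces
  the weight \<open>bdist x powr (- (s * p))\<close> that \<open>near_energy_le\<close>
  expects.\<close>

lemma extend_bounded:
  assumes p: "1 < p" and s: "0 < s" "s < 1" and sp: "0 < s * p - \<sigma>"
  obtains C where "0 \<le> C" "\<And>f. f \<in> besov_space (s - \<sigma> / p) p P \<Longrightarrow>
    besov_total s p M (extend f) \<le> ennreal C * besov_total (s - \<sigma> / p) p P f"
proof (rule extend_increment[OF p],
    rule M.min_kern_integral[OF p s],
    rule near_energy_le[OF p s(1) sp],
    rule far_energy_le[OF p s(1) sp],
    rule extend_Lp[OF p], goal_cases)
  case cst: (1 C1 C2 C3 C4 C5)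
  note C1 = cst(2,3) and C2 = cst(4,5) and C3 = cst(6,7) and C4 = cst(8,9) and C5 = cst(10,11)
  show thesis
  proof (rule that[of "C5 + C1 * (C2 * C3 + C4)"])
    show "0 \<le> C5 + C1 * (C2 * C3 + C4)" using C1(1) C2(1) C3(1) C4(1) C5(1) by simp
    fix f assume fB: "f \<in> besov_space (s - \<sigma> / p) p P"
    have f[measurable]: "f \<in> borel_measurable P" using fB by (simp add: besov_space_def)
    have fi: "integrable P f" by (rule P.besov_integrable[OF fB p])
    let ?N = "besov_total (s - \<sigma> / p) p P f"
    let ?k = "\<lambda>x y. ennreal ((min 1 (dist x y / bdist x)) powr p * kern M (s * p) x y)"
    let ?l = "\<lambda>x y. ennreal (kern M (s * p) x y) * (if bdist x < 4 * dist x y then osc_far p f x y else 0)"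
    have [measurable]: "(\<lambda>(x, y). ?k x y * osc_near p f x) \<in> borel_measurable (M \<Otimes>\<^sub>M M)"
      "(\<lambda>(x, y). ?l x y) \<in> borel_measurable (M \<Otimes>\<^sub>M M)" by measurable
    have "besov_energy s p M (extend f) \<le> (\<integral>\<^sup>+x. \<integral>\<^sup>+y. ennreal C1 * (?k x y * osc_near p f x + ?l x y) \<partial>M \<partial>M)"
      unfolding M.besov_energy_kern
    proof (rule nn_integral_mono_AE)
      show "AE x in M. (\<integral>\<^sup>+y. bkern p M (s * p) (extend f) x y \<partial>M)
        \<le> (\<integral>\<^sup>+y. ennreal C1 * (?k x y * osc_near p f x + ?l x y) \<partial>M)"
        using AE_off AE_space
      proof eventually_elim
        case x: (elim x)
        show ?case
        proof (rule nn_integral_mono_AE)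
          show "AE y in M. bkern p M (s * p) (extend f) x y \<le> ennreal C1 * (?k x y * osc_near p f x + ?l x y)"
            using AE_off
          proof eventually_elim
            case y: (elim y)
            show ?case
              using mult_right_mono[OF C1(2)[OF fi x(2,1) y] zero_le, of "ennreal (kern M (s * p) x y)"]
              by (simp only: ennreal_mult' powr_ge_zero kern_nonneg distrib_right distrib_left mult_ac)
          qed
        qed
      qed
    qed
    also have "\<dots> = ennreal C1 * ((\<integral>\<^sup>+x. \<integral>\<^sup>+y. ?k x y * osc_near p f x \<partial>M \<partial>M) + (\<integral>\<^sup>+x. \<integral>\<^sup>+y. ?l x y \<partial>M \<partial>M))"
      by (subst M.nn_integral_double_cmult, measurable) (subst M.nn_integral_double_add, measurable)
    also have "\<dots> \<le> ennreal C1 * (ennreal C2 * (ennreal C3 * ?N) + ennreal C4 * ?N)"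
    proof (intro mult_left_mono add_mono)
      have "(\<integral>\<^sup>+x. \<integral>\<^sup>+y. ?k x y * osc_near p f x \<partial>M \<partial>M) \<le> (\<integral>\<^sup>+x. ennreal C2 * (ennreal (bdist x powr (- (s * p))) * osc_near p f x) \<partial>M)"
      proof (rule nn_integral_mono_AE)
        show "AE x in M. (\<integral>\<^sup>+y. ?k x y * osc_near p f x \<partial>M) \<le> ennreal C2 * (ennreal (bdist x powr (- (s * p))) * osc_near p f x)"
          using AE_off AE_space
        proof eventually_elim
          case (elim x)
          note elim(2)[measurable]
          have "(\<integral>\<^sup>+y. ?k x y * osc_near p f x \<partial>M) = (\<integral>\<^sup>+y. ?k x y \<partial>M) * osc_near p f x"
            by (rule nn_integral_multc) measurable
          also have "\<dots> \<le> ennreal (C2 * bdist x powr (- (s * p))) * osc_near p f x"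
            by (intro mult_right_mono C2(2) elim(2) bdist_pos elim(1)) simp
          finally show ?case using C2(1) by (simp add: ennreal_mult' mult.assoc)
        qed
      qed
      also have "\<dots> = ennreal C2 * (\<integral>\<^sup>+x. ennreal (bdist x powr (- (s * p))) * osc_near p f x \<partial>M)"
        by (rule nn_integral_cmult) measurable
      also have "\<dots> \<le> ennreal C2 * (ennreal C3 * ?N)"
        by (intro mult_left_mono order_trans[OF C3(2)[OF f]]) (auto simp: besov_total_def)
      finally show "(\<integral>\<^sup>+x. \<integral>\<^sup>+y. ?k x y * osc_near p f x \<partial>M \<partial>M) \<le> ennreal C2 * (ennreal C3 * ?N)" .
      show "(\<integral>\<^sup>+x. \<integral>\<^sup>+y. ?l x y \<partial>M \<partial>M) \<le> ennreal C4 * ?N"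
        by (rule order_trans[OF C4(2)[OF f]]) (auto simp: besov_total_def intro: mult_left_mono)
    qed simp
    finally have E: "besov_energy s p M (extend f) \<le> ennreal C1 * (ennreal C2 * (ennreal C3 * ?N) + ennreal C4 * ?N)" .
    have L: "(\<integral>\<^sup>+x. epow p (extend f x) \<partial>M) \<le> ennreal C5 * ?N"
      by (rule order_trans[OF C5(2)[OF fi]]) (auto simp: besov_total_def intro: mult_left_mono)
    have "besov_total s p M (extend f) \<le> ennreal C5 * ?N + ennreal C1 * (ennreal C2 * (ennreal C3 * ?N) + ennreal C4 * ?N)"
      unfolding besov_total_def[of s p M] by (intro add_mono L E)
    also have "\<dots> = ennreal (C5 + C1 * (C2 * C3 + C4)) * ?N"
      using C1(1) C2(1) C3(1) C4(1) C5(1)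
      by (simp add: ennreal_plus ennreal_mult distrib_left distrib_right mult_ac)
    finally show "besov_total s p M (extend f) \<le> ennreal (C5 + C1 * (C2 * C3 + C4)) * ?N" .
  qed
qed

lemma extend_operator:
  assumes p: "1 < p" and s: "0 < s" "s < 1" and sp: "0 < s * p - \<sigma>"
  shows "besov_operator (s - \<sigma> / p) p P s p M extend"
proof (rule extend_bounded[OF p s sp], goal_cases)
  case C: (1 C)
  show ?thesis
  proof (rule besov_operatorI[OF p P.doubling_space_axioms M.doubling_space_axioms _ C(2) C(1)])
    fix f assume fB: "f \<in> besov_space (s - \<sigma> / p) p P"
    have f: "f \<in> borel_measurable P" and fi: "integrable P f" using fB P.besov_integrable[OF fB p] by (auto simp: besov_space_def)
    show "extend f \<in> borel_measurable M" using f by (rule measurable_extend)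
    show "AE x in M. extend (\<lambda>y. c * f y) x = c * extend f x" for c
      by (simp add: extend_def P.avg_cmult)
    fix g assume gB: "g \<in> besov_space (s - \<sigma> / p) p P"
    have g: "g \<in> borel_measurable P" and gi: "integrable P g" using gB P.besov_integrable[OF gB p] by (auto simp: besov_space_def)
    show "AE x in M. extend f x = extend g x" if "AE x in P. f x = g x"
      unfolding extend_def P.avg_AE_cong[OF that f g] by simp
    show "AE x in M. extend (\<lambda>y. f y + g y) x = extend f x + extend g x"
      unfolding extend_def P.avg_add[OF fi gi] by simp
  qed
qed

section \<open>The trace of the extension\<close>

text \<open>A point \<open>x\<close> of \<open>ball z r\<close> has \<open>bdist x < r\<close>, so
  the boundary points near it are within \<open>16 * r\<close> of \<open>x\<close> and
  \<open>17 * r\<close> of \<open>z\<close>. For such a point \<open>w\<close> the integral in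
  \<open>x\<close> over \<open>ball w (16 * r)\<close> is of order
  \<open>r powr \<sigma>\<close>.\<close>

lemma extend_ball_le:
  assumes p: "1 < p"
  obtains C where "0 \<le> C" "\<And>f z r. integrable P f \<Longrightarrow> z \<in> space P \<Longrightarrow> 0 < r \<Longrightarrow>
    devint p M (extend f) (f z) z r \<le>
      ennreal (C * r powr \<sigma>) * devint p P f (f z) z (17 * r)"
proof (rule extend_diff_const[OF p], rule wgt_near_integral, goal_cases)
  case cst: (1 C1 C2)
  note C1 = cst(2,3) and C2 = cst(4,5)
  show thesis
  proof (rule that[of "C1 * (C2 * 16 powr \<sigma>)"])
    show "0 \<le> C1 * (C2 * 16 powr \<sigma>)" using C1 C2 by simp
    fix f :: "'a \<Rightarrow> real" and z and r :: real assume f: "integrable P f" and z: "z \<in> space P" and r: "0 < r"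
    have fm[measurable]: "f \<in> borel_measurable P" using f by simp
    interpret PM: pair_sigma_finite P M by (rule pair_PM)
    let ?e = "\<lambda>w. epow p (f w - f z)"
    let ?I = "\<lambda>x. indicator (ball z r) x :: ennreal"
    let ?n = "\<lambda>x w. ?e w * (wgt x * near x w * ?I x)"
    let ?i = "\<lambda>w. ?e w * indicator (ball z (17 * r)) w"
    let ?J = "\<integral>\<^sup>+w\<in>ball z (17 * r). ?e w \<partial>P"
    let ?c = "ennreal (C2 * (16 * r) powr \<sigma>)"
    have "devint p M (extend f) (f z) z r
       \<le> (\<integral>\<^sup>+x. ennreal C1 * (\<integral>\<^sup>+w. ?n x w \<partial>P) \<partial>M)"
    proof (rule nn_integral_mono_AE)
      show "AE x in M. epow p (extend f x - f z) * ?I x \<le> ennreal C1 * (\<integral>\<^sup>+w. ?n x w \<partial>P)"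
        using AE_off AE_space
      proof eventually_elim
        case (elim x)
        note elim(2)[measurable]
        have "(\<integral>\<^sup>+w. ?n x w \<partial>P) = (\<integral>\<^sup>+w. (wgt x * ?I x) * (?e w * near x w) \<partial>P)" by (simp add: mult_ac)
        also have "\<dots> = (wgt x * ?I x) * (\<integral>\<^sup>+w. ?e w * near x w \<partial>P)" by (rule nn_integral_cmult) measurable
        finally have eq: "(\<integral>\<^sup>+w. ?n x w \<partial>P) = (wgt x * ?I x) * (\<integral>\<^sup>+w. ?e w * near x w \<partial>P)" .
        from mult_right_mono[OF C1(2)[OF f elim(1), of "f z"], of "?I x"]
        show ?case unfolding eq by (simp only: mult_ac zero_le)
      qed
    qed
    also have "\<dots> = ennreal C1 * (\<integral>\<^sup>+x. \<integral>\<^sup>+w. ?n x w \<partial>P \<partial>M)"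
      by (rule nn_integral_cmult) measurable
    also have "(\<integral>\<^sup>+x. \<integral>\<^sup>+w. ?n x w \<partial>P \<partial>M) = (\<integral>\<^sup>+w. \<integral>\<^sup>+x. ?n x w \<partial>M \<partial>P)"
      by (rule PM.Fubini') measurable
    also have "\<dots> \<le> (\<integral>\<^sup>+w. ?c * ?i w \<partial>P)"
    proof (intro nn_integral_mono)
      fix w assume w: "w \<in> space P"
      note w[measurable]
      have "(\<integral>\<^sup>+x. ?n x w \<partial>M) \<le> (\<integral>\<^sup>+x. ?i w * (wgt x * near x w * indicator (ball w (16 * r)) x) \<partial>M)"
      proof (intro nn_integral_mono)
        fix x
        show "?n x w \<le> ?i w * (wgt x * near x w * indicator (ball w (16 * r)) x)"
        proof (cases "dist z x < r \<and> dist x w < 16 * bdist x")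
          case True
          have "bdist x < r" using bdist_le[OF z, of x] True by (simp add: dist_commute)
          then have 1: "dist x w < 16 * r" using True by linarith
          then have "dist z w < 17 * r" using True dist_triangle[of z w x] by linarith
          then show ?thesis using True 1 by (simp add: indicator_def dist_commute mult.assoc)
        qed (auto simp: near_def indicator_def)
      qed
      also have "\<dots> = ?i w * (\<integral>\<^sup>+x. wgt x * near x w * indicator (ball w (16 * r)) x \<partial>M)"
        by (rule nn_integral_cmult) measurable
      also have "\<dots> \<le> ?i w * ?c"
        using r by (intro mult_left_mono C2(2) w) auto
      finally show "(\<integral>\<^sup>+x. ?n x w \<partial>M) \<le> ?c * ?i w"
        by (simp only: mult.commute)
    qed
    also have "\<dots> = ?c * ?J"
      by (rule nn_integral_cmult) measurable
    finally have "devint p M (extend f) (f z) z r \<le> ennreal C1 * (?c * ?J)"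
      by (auto simp: mult_left_mono)
    also have "\<dots> = ennreal (C1 * (C2 * 16 powr \<sigma>) * r powr \<sigma>) * ?J"
    proof -
      have "C1 * (C2 * (16 * r) powr \<sigma>) = C1 * (C2 * 16 powr \<sigma>) * r powr \<sigma>" using r by (simp add: powr_mult)
      then have "ennreal C1 * ?c = ennreal (C1 * (C2 * 16 powr \<sigma>) * r powr \<sigma>)"
        using C1(1) by (metis ennreal_mult')
      then show ?thesis by (simp only: mult.assoc[symmetric])
    qed
    finally show "devint p M (extend f) (f z) z r \<le>
      ennreal (C1 * (C2 * 16 powr \<sigma>) * r powr \<sigma>) * ?J" .
  qed
qed

text \<open>A finite energy density at \<open>z\<close> gives a rate: on
  \<open>ball z (17 * r)\<close> the boundary kernel is bounded below, so the mean deviation from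
  \<open>f z\<close> is at most of order \<open>r powr (s * p - \<sigma>)\<close>. The factor
  \<open>r powr \<sigma>\<close> of \<open>extend_ball_le\<close> is used up in passing from
  boundary mass to mass of \<open>M\<close>.\<close>

lemma extend_mean_tendsto:
  assumes p: "1 < p" and sp: "0 < s * p - \<sigma>" and f: "integrable P f" and z: "z \<in> space P"
    and fin: "P.energy_density (s - \<sigma> / p) p f z < \<infinity>"
  shows "((\<lambda>r. ennreal (1 / bm M z r) * devint p M (extend f) (f z) z r) \<longlongrightarrow> 0) (at_right 0)"
proof (rule extend_ball_le[OF p], goal_cases)
  case C: (1 C)
  have se: "(s - \<sigma> / p) * p = s * p - \<sigma>" using p by (simp add: field_simps)
  have fm[measurable]: "f \<in> borel_measurable P" using f by simp
  note z[measurable]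
  have zM: "z \<in> space M" using z space_P by auto
  let ?E = "P.energy_density (s - \<sigma> / p) p f z"
  define c where "c = C * K * D' ^ 5 * 17 powr (s * p - \<sigma>)"
  have bound: "ennreal (1 / bm M z r) * devint p M (extend f) (f z) z r \<le> ennreal (c * r powr (s * p - \<sigma>)) * ?E"
    if r: "0 < r" "r < R" for r
  proof -
    have b: "0 < bm M z r" "0 < bm P z r" using M.bm_pos[OF zM r(1)] P.bm_pos[OF z r(1)] .
    define L where "L = D' ^ 5 * bm P z r * (17 * r) powr (s * p - \<sigma>)"
    have L: "0 \<le> L" using P.D_ge_1 by (simp add: L_def)
    have "devint p P f (f z) z (17 * r) \<le> (\<integral>\<^sup>+w. ennreal L * bkern p P (s * p - \<sigma>) f z w \<partial>P)"
    proof (intro nn_integral_mono)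
      fix w
      show "epow p (f w - f z) * indicator (ball z (17 * r)) w \<le> ennreal L * bkern p P (s * p - \<sigma>) f z w"
      proof (cases "w \<in> ball z (17 * r) \<and> w \<noteq> z")
        case True
        define d where "d = dist z w"
        have d: "0 < d" "d < 17 * r" using True by (auto simp: d_def)
        have bd: "0 < bm P z d" using P.bm_pos[OF z d(1)] .
        have "bm P z d \<le> D' ^ 5 * bm P z r" using z r d by (intro P.bm_comp) auto
        moreover have "d powr (s * p - \<sigma>) \<le> (17 * r) powr (s * p - \<sigma>)" using d sp by (intro powr_mono2) auto
        ultimately have "bm P z d * d powr (s * p - \<sigma>) \<le> L" unfolding L_def using d P.D_ge_1 by (intro mult_mono mult_nonneg_nonneg) auto
        then have "1 \<le> L * kern P (s * p - \<sigma>) z w" using bd d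
          by (simp only: kern_def d_def[symmetric] powr_minus) (simp add: field_simps)
        from mult_left_mono[OF this, of "\<bar>f w - f z\<bar> powr p"]
        have "\<bar>f w - f z\<bar> powr p \<le> L * (\<bar>f w - f z\<bar> powr p * kern P (s * p - \<sigma>) z w)" by (simp add: mult_ac)
        then show ?thesis using True L by (simp add: ennreal_mult'[symmetric] ennreal_leI)
      qed (use p in \<open>auto simp: indicator_def\<close>)
    qed
    also have "\<dots> = ennreal L * ?E" unfolding P.energy_density_def se by (rule nn_integral_cmult) measurable
    finally have I: "devint p P f (f z) z (17 * r) \<le> ennreal L * ?E" .
    have "ennreal (1 / bm M z r) * devint p M (extend f) (f z) z r
       \<le> ennreal (1 / bm M z r) * (ennreal (C * r powr \<sigma>) * (ennreal L * ?E))"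
      by (intro mult_left_mono order_trans[OF C(2)[OF f z r(1)]] I) auto
    also have "\<dots> = ennreal (1 / bm M z r * (C * r powr \<sigma>) * L) * ?E"
      unfolding mult.assoc[symmetric] using C(1) b L by (simp add: ennreal_mult'[symmetric])
    also have "\<dots> \<le> ennreal (c * r powr (s * p - \<sigma>)) * ?E"
    proof (intro mult_right_mono ennreal_leI)
      have "r powr \<sigma> * bm P z r \<le> K * bm M z r" using r M.R_pos by (intro upper z) auto
      then have "1 / bm M z r * (r powr \<sigma> * bm P z r) \<le> K" using b by (simp add: field_simps)
      then have "(C * D' ^ 5 * (17 * r) powr (s * p - \<sigma>)) * (1 / bm M z r * (r powr \<sigma> * bm P z r)) \<le> (C * D' ^ 5 * (17 * r) powr (s * p - \<sigma>)) * K"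
        using C(1) P.D_ge_1 by (intro mult_left_mono) auto
      also have "\<dots> = c * r powr (s * p - \<sigma>)" using r by (simp add: c_def powr_mult)
      finally show "1 / bm M z r * (C * r powr \<sigma>) * L \<le> c * r powr (s * p - \<sigma>)" by (simp add: L_def mult_ac)
    qed simp
    finally show ?thesis .
  qed
  have "((\<lambda>r. c * r powr (s * p - \<sigma>)) \<longlongrightarrow> c * 0 powr (s * p - \<sigma>)) (at_right 0)"
    using sp by (intro tendsto_mult tendsto_const tendsto_powr2 tendsto_ident_at) (auto simp: eventually_at_filter)
  then have "((\<lambda>r. ennreal (c * r powr (s * p - \<sigma>))) \<longlongrightarrow> ennreal (c * 0 powr (s * p - \<sigma>))) (at_right 0)"
    by (rule tendsto_ennrealI)
  then have "((\<lambda>r. ?E * ennreal (c * r powr (s * p - \<sigma>))) \<longlongrightarrow> ?E * ennreal (c * 0 powr (s * p - \<sigma>))) (at_right 0)"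
    using fin by (intro ennreal_tendsto_cmult) auto
  then have lim: "((\<lambda>r. ennreal (c * r powr (s * p - \<sigma>)) * ?E) \<longlongrightarrow> 0) (at_right 0)"
    by (simp add: mult.commute)
  have "\<forall>\<^sub>F r in at_right 0. r \<in> {0<..<R}" by (rule eventually_at_right_real) (rule M.R_pos)
  then have "\<forall>\<^sub>F r in at_right 0. ennreal (1 / bm M z r) * devint p M (extend f) (f z) z r \<le> ennreal (c * r powr (s * p - \<sigma>)) * ?E"
    by eventually_elim (rule bound, auto)
  then show ?thesis by (rule tendsto_sandwich[OF _ _ tendsto_const lim, rotated]) auto
qed

text \<open>The energy density is finite almost everywhere on the boundary. At such points the means
  over balls of radius \<open>2 * scale j\<close> control the weighted averages whose limit is the
  trace.\<close>

lemma trace_extend: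
  assumes p: "1 < p" and s: "0 < s" "s < 1" and sp: "0 < s * p - \<sigma>" and fB: "f \<in> besov_space (s - \<sigma> / p) p P"
  shows "AE z in P. trace (extend f) z = f z"
proof -
  have f[measurable]: "f \<in> borel_measurable P" and fe: "besov_energy (s - \<sigma> / p) p P f < \<infinity>" using fB by (auto simp: besov_space_def)
  have fi: "integrable P f" by (rule P.besov_integrable[OF fB p])
  have EB: "extend f \<in> besov_space s p M" using extend_operator[OF p s sp] fB by (auto simp: besov_operator_def)
  have Ei: "integrable M (extend f)" by (rule M.besov_integrable[OF EB p])
  have "(\<integral>\<^sup>+z. P.energy_density (s - \<sigma> / p) p f z \<partial>P) \<noteq> \<infinity>" using fe by (simp add: P.energy_density_integral)
  then have "AE z in P. P.energy_density (s - \<sigma> / p) p f z \<noteq> \<infinity>" by (intro nn_integral_noteq_infinite) measurable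
  then show ?thesis using AE_space
  proof eventually_elim
    case (elim z)
    have zM: "z \<in> space M" using elim(2) space_P by auto
    let ?I = "\<lambda>r. ennreal (1 / bm M z r) * devint p M (extend f) (f z) z r"
    have lim: "(?I \<longlongrightarrow> 0) (at_right 0)"
      by (rule extend_mean_tendsto[OF p sp fi elim(2)]) (use elim(1) in \<open>simp add: less_top\<close>)
    have "filterlim (\<lambda>j. 2 * M.scale j) (at_right 0) sequentially"
    proof -
      have "(\<lambda>j. 2 * M.scale j) \<longlonglongrightarrow> 2 * 0" by (intro tendsto_intros M.scale_tendsto)
      then show ?thesis by (intro tendsto_imp_filterlim_at_right) auto
    qed
    then have "(\<lambda>j. ?I (2 * M.scale j)) \<longlonglongrightarrow> 0" by (rule filterlim_compose[OF lim])
    then have "(\<lambda>j. ennreal (2 powr p * D powr (p - 1) * D) * ?I (2 * M.scale j)) \<longlonglongrightarrow> ennreal (2 powr p * D powr (p - 1) * D) * 0"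
      by (intro ennreal_tendsto_cmult) auto
    then have lim2: "(\<lambda>j. ennreal (2 powr p * D powr (p - 1) * D) * ?I (2 * M.scale j)) \<longlonglongrightarrow> 0" by simp
    have bound: "epow p (avg M r (extend f) z - f z) \<le> ennreal (2 powr p * D powr (p - 1) * D) * ?I (2 * r)" if r: "0 < r" for r
    proof -
      have b: "0 < bm M z r" "0 < bm M z (2 * r)" using M.bm_pos[OF zM] r by auto
      have "epow p (avg M r (extend f) z - f z) \<le> ennreal (2 powr p * D powr (p - 1) / bm M z r) *
          devint p M (extend f) (f z) z (2 * r)"
        using Ei zM r p M.bm_pos M.bm_double by (intro M.avg_diff_const_powr) auto
      also have "\<dots> \<le> ennreal (2 powr p * D powr (p - 1) * D * (1 / bm M z (2 * r))) *
          devint p M (extend f) (f z) z (2 * r)"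
      proof (intro mult_right_mono ennreal_leI)
        have "1 / bm M z r \<le> D * (1 / bm M z (2 * r))" using M.bm_double[OF zM r] b by (simp add: field_simps)
        then have "2 powr p * D powr (p - 1) * (1 / bm M z r) \<le> 2 powr p * D powr (p - 1) * (D * (1 / bm M z (2 * r)))"
          by (intro mult_left_mono) auto
        then show "2 powr p * D powr (p - 1) / bm M z r \<le> 2 powr p * D powr (p - 1) * D * (1 / bm M z (2 * r))" by simp
      qed simp
      also have "\<dots> = ennreal (2 powr p * D powr (p - 1) * D) * ?I (2 * r)"
        unfolding mult.assoc[symmetric] using M.D_ge_1 by (simp add: ennreal_mult'[symmetric])
      finally show ?thesis .
    qed
    have "(\<lambda>j. epow p (avg M (M.scale j) (extend f) z - f z)) \<longlonglongrightarrow> 0"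
      by (rule tendsto_sandwich[OF _ _ tendsto_const lim2]) (auto intro!: always_eventually bound)
    then have "(\<lambda>j. avg M (M.scale j) (extend f) z - f z) \<longlonglongrightarrow> 0"
      by (rule tendsto_0_of_powr) (use p in simp)
    then have "(\<lambda>j. avg M (M.scale j) (extend f) z) \<longlonglongrightarrow> f z" by (rule LIM_zero_cancel)
    then show ?case unfolding trace_def by (rule limI)
  qed
qed

theorem trace_extension_operators:
  assumes p: "1 < p" and s: "0 < s" "s < 1" and sp: "0 < s * p - \<sigma>"
  shows "\<exists>T E. besov_operator s p M (s - \<sigma> / p) p P T \<and> besov_operator (s - \<sigma> / p) p P s p M E \<and>
     (\<forall>f\<in>besov_space (s - \<sigma> / p) p P. AE \<zeta> in P. T (E f) \<zeta> = f \<zeta>) \<and>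
     (\<forall>u\<in>besov_space s p M. AE \<zeta> in P. (ball_average M (\<lambda>x. \<bar>u x - T u \<zeta>\<bar>) \<zeta> \<longlongrightarrow> 0) (at_right 0))"
proof (intro exI conjI ballI)
  show "besov_operator s p M (s - \<sigma> / p) p P trace" by (rule trace_operator[OF p s(1) sp])
  show "besov_operator (s - \<sigma> / p) p P s p M extend" by (rule extend_operator[OF p s sp])
  show "AE \<zeta> in P. trace (extend f) \<zeta> = f \<zeta>" if "f \<in> besov_space (s - \<sigma> / p) p P" for f
    by (rule trace_extend[OF p s sp that])
  fix u assume u: "u \<in> besov_space s p M"
  show "AE \<zeta> in P. (ball_average M (\<lambda>x. \<bar>u x - trace u \<zeta>\<bar>) \<zeta> \<longlongrightarrow> 0) (at_right 0)"
    using AE_good[OF p s(1) u] AE_space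
    by eventually_elim (rule trace_lebesgue_point[OF p sp M.besov_integrable[OF u p]])
qed

end

section \<open>Extension of the measure to the completion\<close>

text \<open>Balls about a boundary point are compared with balls about a point \<open>z\<close> of
  \<open>Z\<close> at distance below \<open>r / 2\<close>: \<open>ball x (2 * r)\<close> lies in
  \<open>ball z (4 * r)\<close>, and \<open>ball z (r / 2)\<close> in \<open>ball x r\<close>, hence
  three doublings. Finite nets make the closure totally bounded, and completeness of the type makes
  it compact.\<close>

lemma null_extension_doubling_space:
  fixes Z :: "'a::complete_space set"
  assumes lc: "locally compact Z" and nc: "\<not> complete Z" and bd: "bounded Z"
    and \<nu>: "borel_measure_on Z \<nu>" and db: "doubling_measure \<nu>"
    and ext: "\<nu>b = null_extension \<nu> (closure Z)"
  obtains D where "doubling_space \<nu>b D (2 * diameter (closure Z))" "space \<nu>b = closure Z"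
    "closed (closure Z - Z)" "closure Z - Z \<noteq> {}" "emeasure \<nu>b (closure Z - Z) = 0" "compact (closure Z)"
proof -
  define W where "W = closure Z"
  have sp: "space \<nu> = Z" and st: "sets \<nu> = sets (restrict_space borel Z)" using \<nu> by (auto simp: borel_measure_on_def)
  have ZW: "Z \<subseteq> W" by (simp add: W_def closure_subset)
  obtain T where T: "open T" "Z = T \<inter> W" using locally_compact_open_Int_closure[OF lc] unfolding W_def by blast
  have SW: "W - Z = W \<inter> - T" using T by auto
  have closedS: "closed (W - Z)" unfolding SW by (rule closed_Int) (use T(1) in \<open>auto simp: W_def closed_def\<close>)
  have ncl: "\<not> closed Z" using nc by (simp add: complete_eq_closed)
  then have neS: "W - Z \<noteq> {}" using ZW closure_closed[of Z] unfolding W_def by (metis Diff_eq_empty_iff closed_closure subset_antisym)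
  have neZ: "Z \<noteq> {}" using ncl by auto
  have bW: "bounded W" using bd by (simp add: W_def bounded_closure)
  have sb: "space \<nu>b = W" unfolding ext null_extension_def W_def[symmetric] by (simp add: space_restrict_space)
  have stb: "sets \<nu>b = sets (restrict_space borel W)" unfolding ext null_extension_def W_def[symmetric] by simp
  have id: "(\<lambda>x. x) \<in> measurable \<nu> (restrict_space borel W)"
  proof -
    have "(\<lambda>x. x) \<in> measurable (restrict_space borel Z) (restrict_space borel W)"
      using ZW by (intro measurable_restrict_space3) auto
    then show ?thesis unfolding measurable_cong_sets[OF st refl] .
  qed
  have em: "emeasure \<nu>b A = emeasure \<nu> (A \<inter> Z)" if "A \<in> sets \<nu>b" for A
    using that id stb unfolding ext null_extension_def W_def[symmetric]
    by (subst emeasure_distr) (auto simp: sp)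
  have ballW: "ball x r \<inter> W \<in> sets \<nu>b" for x r
  proof -
    have "W \<inter> ball x r \<in> sets (restrict_space borel W)" unfolding sets_restrict_space by (intro imageI) simp
    then show ?thesis using stb by (simp add: Int_commute)
  qed
  have ballZ: "ball x r \<inter> Z \<in> sets \<nu>" for x r
  proof -
    have "Z \<inter> ball x r \<in> sets (restrict_space borel Z)" unfolding sets_restrict_space by (intro imageI) simp
    then show ?thesis using st by (simp add: Int_commute)
  qed
  obtain C where C: "1 \<le> C" "\<And>z r. z \<in> Z \<Longrightarrow> 0 < r \<Longrightarrow> 0 < emeasure \<nu> (ball z (2 * r) \<inter> Z)"
     "\<And>z r. z \<in> Z \<Longrightarrow> 0 < r \<Longrightarrow> emeasure \<nu> (ball z (2 * r) \<inter> Z) \<le> ennreal C * emeasure \<nu> (ball z r \<inter> Z)"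
     "\<And>z r. z \<in> Z \<Longrightarrow> 0 < r \<Longrightarrow> ennreal C * emeasure \<nu> (ball z r \<inter> Z) < \<infinity>"
    using db unfolding doubling_measure_def sp by auto
  obtain z0 where z0: "z0 \<in> Z" using neZ by auto
  obtain r0 where r0: "0 < r0" "Z \<subseteq> ball z0 r0" using bounded_subset_ballD[OF bd, of z0] by auto
  have finZ: "emeasure \<nu> Z < \<infinity>"
  proof -
    have "emeasure \<nu> Z = 1 * emeasure \<nu> (ball z0 r0 \<inter> Z)" using r0 by (simp add: Int_absorb1)
    also have "\<dots> \<le> ennreal C * emeasure \<nu> (ball z0 r0 \<inter> Z)"
      using C(1) by (intro mult_right_mono) (auto simp: ennreal_1[symmetric] simp del: ennreal_1 intro: ennreal_leI)
    also have "\<dots> < \<infinity>" by (rule C(4)[OF z0 r0(1)])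
    finally show ?thesis .
  qed
  interpret N: finite_measure \<nu> by (rule finite_measureI) (use finZ sp in auto)
  define V where "V x r = measure \<nu> (ball x r \<inter> Z)" for x r
  have bm: "bm \<nu>b x r = V x r" for x r
  proof -
    have "emeasure \<nu>b (ball x r \<inter> W) = emeasure \<nu> (ball x r \<inter> Z)"
      using em[OF ballW] ZW by (simp add: Int_assoc Int_absorb1)
    then show ?thesis by (simp add: bm_def V_def sb measure_def)
  qed
  have V: "0 < V z r" "V z (2 * r) \<le> C * V z r" if z: "z \<in> Z" and r: "0 < r" for z r
  proof -
    have "0 < emeasure \<nu> (ball z (2 * (r / 2)) \<inter> Z)" using C(2)[OF z, of "r / 2"] r by simp
    then show "0 < V z r" by (simp add: V_def N.emeasure_eq_measure)
    have "ennreal (V z (2 * r)) \<le> ennreal (C * V z r)"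
      using C(3)[OF z r] C(1) by (simp add: V_def N.emeasure_eq_measure ennreal_mult')
    then show "V z (2 * r) \<le> C * V z r" using C(1) by (subst (asm) ennreal_le_iff) (auto simp: V_def)
  qed
  have Vmono: "V x r \<le> V y s" if "ball x r \<subseteq> ball y s" for x y r s
    unfolding V_def using that ballZ by (intro N.finite_measure_mono) auto
  have close: "\<exists>z\<in>Z. dist x z < e" if "x \<in> W" "0 < e" for x e
    using that unfolding W_def by (metis closure_approachable dist_commute)
  have ds: "doubling_space \<nu>b (C ^ 3) (2 * diameter W)"
  proof
    show "sets \<nu>b = sets (restrict_space borel (space \<nu>b))" by (simp add: stb sb)
    have "W \<in> sets \<nu>b" using stb sets.top[of "restrict_space borel W"] by (simp add: space_restrict_space)
    from em[OF this] show "emeasure \<nu>b (space \<nu>b) \<noteq> \<infinity>" using finZ ZW by (simp add: sb Int_absorb1)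
    \<comment> \<open>A boundary point differs from a point of \<open>Z\<close>, so the diameter is
      positive and twice the diameter is a strict bound for distances.\<close>
    obtain s where s: "s \<in> W" "s \<notin> Z" using neS by auto
    have "0 < dist s z0" using s z0 by auto
    also have "dist s z0 \<le> diameter W" using bW s z0 ZW by (intro diameter_bounded_bound) auto
    finally have dp: "0 < diameter W" .
    then show "0 < 2 * diameter W" by simp
    fix x y assume "x \<in> space \<nu>b" "y \<in> space \<nu>b"
    then have "dist x y \<le> diameter W" using bW by (intro diameter_bounded_bound) (auto simp: sb)
    then show "dist x y < 2 * diameter W" using dp by simp
  next
    fix x and r :: real assume x: "x \<in> space \<nu>b" and r: "0 < r"
    obtain z where z: "z \<in> Z" "dist x z < r / 2" using close[of x "r / 2"] x r by (auto simp: sb)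
    have 1: "V z (r / 2) \<le> V x r"
    proof (rule Vmono, rule subsetI)
      fix y assume "y \<in> ball z (r / 2)"
      then show "y \<in> ball x r" using dist_triangle[of x y z] z(2) by auto
    qed
    have "0 < V z (r / 2)" using V(1)[OF z(1), of "r / 2"] r by simp
    with 1 show "0 < bm \<nu>b x r" by (simp add: bm)
    have "V x (2 * r) \<le> V z (4 * r)"
    proof (rule Vmono, rule subsetI)
      fix y assume "y \<in> ball x (2 * r)"
      then show "y \<in> ball z (4 * r)" using dist_triangle[of z y x] z(2) r by (auto simp: dist_commute)
    qed
    also have "\<dots> \<le> C * V z (2 * r)" using V(2)[OF z(1), of "2 * r"] r by simp
    also have "\<dots> \<le> C * (C * V z r)" using V(2)[OF z(1) r] C(1) by (intro mult_left_mono) auto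
    also have "\<dots> \<le> C * (C * (C * V z (r / 2)))" using V(2)[OF z(1), of "r / 2"] r C(1) by (intro mult_left_mono) auto
    also have "\<dots> \<le> C * (C * (C * V x r))" using 1 C(1) by (intro mult_left_mono) auto
    finally show "bm \<nu>b x (2 * r) \<le> C ^ 3 * bm \<nu>b x r" by (simp add: bm power3_eq_cube mult.assoc)
  next
    show "1 \<le> C ^ 3" using C(1) by simp
  qed
  interpret M: doubling_space \<nu>b "C ^ 3" "2 * diameter W" by (rule ds)
  have cW: "compact W"
    unfolding compact_eq_totally_bounded
  proof (intro conjI allI impI)
    show "complete W" by (simp add: W_def complete_eq_closed)
    fix e :: real assume e: "0 < e"
    show "\<exists>k. finite k \<and> W \<subseteq> (\<Union>x\<in>k. ball x e)"
      by (rule M.separated_net_exists[OF e, of W]) (auto simp: sb)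
  qed
  have nullS: "emeasure \<nu>b (W - Z) = 0"
  proof -
    have "W \<inter> (W - Z) \<in> sets (restrict_space borel W)"
      unfolding sets_restrict_space using closedS by (intro imageI) simp
    then have "W - Z \<in> sets \<nu>b" using stb by (simp add: Int_absorb1)
    moreover have "(W - Z) \<inter> Z = {}" by auto
    ultimately show ?thesis using em by simp
  qed
  show thesis
    using that[of "C ^ 3"] ds sb closedS neS nullS cW by (simp add: W_def)
qed

text \<open>Regularity speaks of radii below \<open>R\<close>, twice the diameter, but the pair asks
  for all radii up to \<open>64 * R\<close>. Beyond the diameter balls no longer grow, so a larger
  radius is replaced by \<open>3/4 * R\<close>, which exceeds the diameter and is still admissible;
  the factor \<open>128 powr \<sigma>\<close> pays for the change in the power of the radius.
  Doubling of the boundary measure follows by passing to \<open>M\<close> and back.\<close>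

lemma codim_ahlfors_regular_pair:
  assumes M: "doubling_space M D (2 * diameter (space M))" and bW: "bounded (space M)"
    and P: "sets P = sets (restrict_space borel (space P))" "emeasure P (space P) < \<infinity>" "space P \<subseteq> space M"
    and null: "emeasure M (space P) = 0" and \<sigma>: "0 < \<sigma>" and reg: "codim_ahlfors_regular M \<sigma> P"
  obtains D' K where "codim_pair M P D D' (2 * diameter (space M)) \<sigma> K"
proof -
  define R where "R = 2 * diameter (space M)"
  interpret M: doubling_space M D R unfolding R_def by (rule M)
  interpret P: finite_measure P by (rule finite_measureI) (use P(2) in auto)
  interpret P: finite_borel P by unfold_locales (rule P(1))
  obtain C where C: "1 \<le> C" and low: "\<And>x r. x \<in> space P \<Longrightarrow> 0 < r \<Longrightarrow> r < R \<Longrightarrow>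
      ennreal (1 / C) * (emeasure M (ball x r \<inter> space M) / ennreal (r powr \<sigma>)) \<le> emeasure P (ball x r \<inter> space P)"
    and upp: "\<And>x r. x \<in> space P \<Longrightarrow> 0 < r \<Longrightarrow> r < R \<Longrightarrow>
      emeasure P (ball x r \<inter> space P) \<le> ennreal C * (emeasure M (ball x r \<inter> space M) / ennreal (r powr \<sigma>))"
    using reg unfolding codim_ahlfors_regular_def R_def by auto
  have conv: "emeasure P (ball x r \<inter> space P) = ennreal (bm P x r)" for x r
    by (simp add: bm_def P.emeasure_eq_measure)
  have small: "r powr \<sigma> * bm P x r \<le> C * bm M x r" "bm M x r \<le> C * (r powr \<sigma> * bm P x r)"
    if x: "x \<in> space P" and r: "0 < r" "r < R" for x r
  proof -
    have q: "emeasure M (ball x r \<inter> space M) / ennreal (r powr \<sigma>) = ennreal (bm M x r / r powr \<sigma>)"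
      using r by (simp add: M.emeasure_ball divide_ennreal)
    have "ennreal (bm P x r) \<le> ennreal (C * (bm M x r / r powr \<sigma>))"
      using upp[OF x r] C unfolding q conv by (subst ennreal_mult') auto
    moreover have "0 \<le> C * (bm M x r / r powr \<sigma>)" using C by simp
    ultimately have "bm P x r \<le> C * (bm M x r / r powr \<sigma>)" by (rule ennreal_le_iff[THEN iffD1, rotated])
    then show "r powr \<sigma> * bm P x r \<le> C * bm M x r" using r by (simp add: field_simps)
    have "ennreal (1 / C * (bm M x r / r powr \<sigma>)) \<le> ennreal (bm P x r)"
      using low[OF x r] C unfolding q conv by (subst ennreal_mult') auto
    then have "1 / C * (bm M x r / r powr \<sigma>) \<le> bm P x r" by (rule ennreal_le_iff[THEN iffD1, rotated]) auto
    then show "bm M x r \<le> C * (r powr \<sigma> * bm P x r)" using r C by (simp add: field_simps)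
  qed
  have whole: "bm P x r = bm P x (3/4 * R) \<and> bm M x r = bm M x (3/4 * R)" if x: "x \<in> space P" and r: "R \<le> r" for x r
  proof -
    have "y \<in> ball x s" if y: "y \<in> space M" and s: "3/4 * R \<le> s" for y s
    proof -
      have "dist x y \<le> R / 2" unfolding R_def using bW x y P(3) by (simp add: diameter_bounded_bound subsetD)
      then show ?thesis using s M.R_pos by simp
    qed
    then have "ball x r \<inter> space M = space M" "ball x (3/4 * R) \<inter> space M = space M"
      "ball x r \<inter> space P = space P" "ball x (3/4 * R) \<inter> space P = space P"
      using r M.R_pos P(3) by (auto simp del: mem_ball)
    then show ?thesis by (simp add: bm_def)
  qed
  define K where "K = C * 128 powr \<sigma>"
  have p1: "1 \<le> 128 powr \<sigma>" using \<sigma> by (intro ge_one_powr_ge_zero) auto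
  have CK: "C \<le> K" "0 < K" using C p1 by (auto simp: K_def)
  have up: "r powr \<sigma> * bm P x r \<le> K * bm M x r" and lo: "bm M x r \<le> K * (r powr \<sigma> * bm P x r)"
    if x: "x \<in> space P" and r: "0 < r" "r \<le> 64 * R" for x r
  proof -
    have "r powr \<sigma> * bm P x r \<le> K * bm M x r \<and> bm M x r \<le> K * (r powr \<sigma> * bm P x r)"
    proof (cases "r < R")
      case True
      have "C * bm M x r \<le> K * bm M x r" "C * (r powr \<sigma> * bm P x r) \<le> K * (r powr \<sigma> * bm P x r)"
        using CK by (auto intro!: mult_right_mono)
      with small[OF x r(1) True] show ?thesis by linarith
    next
      case False
      define s where "s = 3/4 * R"
      have s: "0 < s" "s < R" "s \<le> r" using M.R_pos False by (auto simp: s_def)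
      have w: "bm P x r = bm P x s" "bm M x r = bm M x s" using whole[OF x] False by (auto simp: s_def)
      have "r powr \<sigma> \<le> (128 * s) powr \<sigma>" using r \<sigma> by (intro powr_mono2) (auto simp: s_def)
      then have "r powr \<sigma> * bm P x s \<le> 128 powr \<sigma> * (s powr \<sigma> * bm P x s)"
        using s mult_right_mono[of "r powr \<sigma>" "(128 * s) powr \<sigma>" "bm P x s"] by (simp add: powr_mult mult.assoc)
      also have "\<dots> \<le> 128 powr \<sigma> * (C * bm M x s)" using small(1)[OF x s(1,2)] by (intro mult_left_mono) auto
      finally have 1: "r powr \<sigma> * bm P x r \<le> K * bm M x r" by (simp add: w K_def mult_ac)
      have "bm M x s \<le> C * (s powr \<sigma> * bm P x s)" by (rule small(2)[OF x s(1,2)])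
      also have "\<dots> \<le> K * (r powr \<sigma> * bm P x s)"
        using CK C s \<sigma> by (intro mult_mono mult_right_mono powr_mono2) auto
      finally show ?thesis using 1 by (simp add: w)
    qed
    then show "r powr \<sigma> * bm P x r \<le> K * bm M x r" "bm M x r \<le> K * (r powr \<sigma> * bm P x r)" by auto
  qed
  define D' where "D' = max 1 (K * D * K)"
  have "doubling_space P D' R"
  proof
    show "sets P = sets (restrict_space borel (space P))" by (rule P(1))
    show "emeasure P (space P) \<noteq> \<infinity>" using P(2) by simp
    show "dist x y < R" if "x \<in> space P" "y \<in> space P" for x y using that P(3) by (intro M.dist_less) auto
    show "0 < R" by (rule M.R_pos)
    show "1 \<le> D'" by (simp add: D'_def)
    have pos: "0 < bm P x r" if x: "x \<in> space P" and r: "0 < r" "r \<le> 64 * R" for x r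
    proof -
      have "0 < bm M x r" using x P(3) r by (intro M.bm_pos) auto
      also have "\<dots> \<le> K * (r powr \<sigma> * bm P x r)" by (rule lo[OF x r])
      finally show ?thesis using CK r by (simp add: zero_less_mult_iff)
    qed
    fix x and r :: real assume x: "x \<in> space P" and r: "0 < r"
    have xM: "x \<in> space M" using x P(3) by auto
    show "0 < bm P x r"
    proof (cases "r \<le> 64 * R")
      case False
      have "0 < bm P x R" using pos[OF x M.R_pos] M.R_pos by simp
      also have "\<dots> \<le> bm P x r" using False M.R_pos by (intro P.bm_mono_P) auto
      finally show ?thesis .
    qed (use pos[OF x r] in simp)
    show "bm P x (2 * r) \<le> D' * bm P x r"
    proof (cases "2 * r \<le> 64 * R")
      case True
      have "(2 * r) powr \<sigma> * bm P x (2 * r) \<le> K * bm M x (2 * r)" using True r by (intro up x) auto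
      also have "\<dots> \<le> K * (D * bm M x r)" using M.bm_double[OF xM r] CK by (intro mult_left_mono) auto
      also have "\<dots> \<le> K * (D * (K * (r powr \<sigma> * bm P x r)))"
        using True r CK M.D_ge_1 by (intro mult_left_mono lo x) auto
      finally have "(2 * r) powr \<sigma> * bm P x (2 * r) \<le> r powr \<sigma> * (K * D * K * bm P x r)" by (simp add: mult_ac)
      moreover have "r powr \<sigma> * bm P x (2 * r) \<le> (2 * r) powr \<sigma> * bm P x (2 * r)"
        using r \<sigma> by (intro mult_right_mono powr_mono2) auto
      ultimately have "r powr \<sigma> * bm P x (2 * r) \<le> r powr \<sigma> * (K * D * K * bm P x r)" by (rule order_trans[rotated])
      then have "bm P x (2 * r) \<le> K * D * K * bm P x r" using r by simp
      also have "\<dots> \<le> D' * bm P x r" by (intro mult_right_mono) (auto simp: D'_def)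
      finally show ?thesis .
    next
      case False
      then have "bm P x (2 * r) = bm P x r" using whole[OF x, of "2 * r"] whole[OF x, of r] M.R_pos by simp
      moreover have "1 * bm P x r \<le> D' * bm P x r" by (intro mult_right_mono) (auto simp: D'_def)
      ultimately show ?thesis by simp
    qed
  qed
  then interpret PP: doubling_space P D' R .
  have "codim_pair M P D D' R \<sigma> K"
    by unfold_locales (use P(3) null \<sigma> CK(2) up lo in auto)
  then show thesis using that by (simp add: R_def)
qed

theorem theorem1p1:
  fixes Z :: "'a::complete_space set"
    and \<nu> \<nu>b \<pi> :: "'a measure"
    and \<sigma> \<theta> p :: real
  assumes "locally compact Z" and "\<not> complete Z" and "bounded Z"
    and "borel_measure_on Z \<nu>" and "doubling_measure \<nu>"
    and "\<nu>b = null_extension \<nu> (closure Z)"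
    and "\<sigma> > 0"
    and "\<pi> = codim_hausdorff_measure \<nu>b \<sigma> (closure Z - Z)"
    and "0 < emeasure \<pi> (closure Z - Z)" and "emeasure \<pi> (closure Z - Z) < \<infinity>"
    and "0 < \<theta>" and "\<theta> < 1" and "1 < p"
  shows
    "(\<forall>u\<in>besov_space \<theta> p \<nu>b.
        p > max 1 (\<sigma> / \<theta>) \<and> besov_approximable \<theta> p \<nu>b Z u \<longrightarrow>
        (AE \<zeta> in \<pi>. (ball_average \<nu>b (\<lambda>x. \<bar>u x\<bar> powr p) \<zeta> \<longlongrightarrow> 0) (at_right 0)))
     \<and>
     (\<forall>u\<in>besov_space \<theta> p \<nu>b.
        besov_capacity \<theta> p \<nu>b
          {\<zeta> \<in> closure Z - Z.
             \<not> (ball_average \<nu>b (\<lambda>x. \<bar>u x\<bar> powr p) \<zeta> \<longlongrightarrow> 0) (at_right 0)} = 0 \<longrightarrow>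
        besov_approximable \<theta> p \<nu>b Z u)
     \<and>
     (p > max 1 (\<sigma> / \<theta>) \<and> codim_ahlfors_regular \<nu>b \<sigma> \<pi> \<longrightarrow>
        (\<exists>T E. besov_operator \<theta> p \<nu>b (\<theta> - \<sigma> / p) p \<pi> T \<and>
               besov_operator (\<theta> - \<sigma> / p) p \<pi> \<theta> p \<nu>b E \<and>
               (\<forall>f\<in>besov_space (\<theta> - \<sigma> / p) p \<pi>. AE \<zeta> in \<pi>. T (E f) \<zeta> = f \<zeta>) \<and>
               (\<forall>u\<in>besov_space \<theta> p \<nu>b. AE \<zeta> in \<pi>.
                  (ball_average \<nu>b (\<lambda>x. \<bar>u x - T u \<zeta>\<bar>) \<zeta> \<longlongrightarrow> 0) (at_right 0))))"
proof -
  obtain D where D: "doubling_space \<nu>b D (2 * diameter (closure Z))" and sb: "space \<nu>b = closure Z"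
    and S: "closed (closure Z - Z)" "closure Z - Z \<noteq> {}" "emeasure \<nu>b (closure Z - Z) = 0" and cW: "compact (closure Z)"
    using null_extension_doubling_space[OF assms(1-6)] by blast
  interpret M: doubling_space \<nu>b D "2 * diameter (closure Z)" by (rule D)
  have SM: "closure Z - Z \<subseteq> space \<nu>b" by (simp add: sb)
  have Zeq: "space \<nu>b - (closure Z - Z) = Z" using closure_subset[of Z] by (auto simp: sb)
  \<comment> \<open>In this form the condition says that the smoothness
    \<open>\<theta> - \<sigma> / p\<close> of the trace space is positive.\<close>
  have \<sigma>: "\<sigma> < \<theta> * p" if "p > max 1 (\<sigma> / \<theta>)" using that assms(11) by (simp add: field_simps)
  show ?thesis
  proof (intro conjI ballI impI)
    fix u assume u: "u \<in> besov_space \<theta> p \<nu>b" and h: "p > max 1 (\<sigma> / \<theta>) \<and> besov_approximable \<theta> p \<nu>b Z u"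
    then have ap: "besov_approximable \<theta> p \<nu>b (space \<nu>b - (closure Z - Z)) u" by (simp add: Zeq)
    show "AE \<zeta> in \<pi>. (ball_average \<nu>b (\<lambda>x. \<bar>u x\<bar> powr p) \<zeta> \<longlongrightarrow> 0) (at_right 0)"
      unfolding assms(8)
      using assms(9) h unfolding assms(8) by (intro M.approximable_zero_trace[OF assms(13,11) _ SM _ u ap] \<sigma>) auto
  next
    fix u assume u: "u \<in> besov_space \<theta> p \<nu>b"
      and cap: "besov_capacity \<theta> p \<nu>b {\<zeta> \<in> closure Z - Z. \<not> (ball_average \<nu>b (\<lambda>x. \<bar>u x\<bar> powr p) \<zeta> \<longlongrightarrow> 0) (at_right 0)} = 0"
    from M.zero_trace_approximable[OF assms(13,11,12) u _ SM cap] cW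
    show "besov_approximable \<theta> p \<nu>b Z u" by (simp add: sb Zeq[unfolded sb])
  next
    assume h: "p > max 1 (\<sigma> / \<theta>) \<and> codim_ahlfors_regular \<nu>b \<sigma> \<pi>"
    \<comment> \<open>Space and sigma-algebra of a \<open>measure_of\<close> are determined by the
      generating sets alone, whether or not the set function is a measure.\<close>
    have sp: "space \<pi> = closure Z - Z" and st: "sets \<pi> = sets (restrict_space borel (closure Z - Z))"
    proof -
      have sub: "sets (restrict_space borel (closure Z - Z)) \<subseteq> Pow (closure Z - Z)" by (auto simp: sets_restrict_space)
      show "space \<pi> = closure Z - Z" unfolding assms(8) codim_hausdorff_measure_def by (rule space_measure_of[OF sub])
      have "sigma_sets (closure Z - Z) (sets (restrict_space borel (closure Z - Z))) = sets (restrict_space borel (closure Z - Z))"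
        using sets.sigma_sets_eq[of "restrict_space borel (closure Z - Z)"] by (simp add: space_restrict_space)
      then show "sets \<pi> = sets (restrict_space borel (closure Z - Z))"
        unfolding assms(8) codim_hausdorff_measure_def by (simp add: sets_measure_of[OF sub])
    qed
    have bW: "bounded (space \<nu>b)" using assms(3) by (simp add: sb bounded_closure)
    obtain D' K where "codim_pair \<nu>b \<pi> D D' (2 * diameter (space \<nu>b)) \<sigma> K"
      using codim_ahlfors_regular_pair[OF D[folded sb] bW _ _ _ _ assms(7), of \<pi>] h st sp assms(10) SM S(3) by auto
    then interpret cp: codim_pair \<nu>b \<pi> D D' "2 * diameter (space \<nu>b)" \<sigma> K .
    interpret ep: extension_pair \<nu>b \<pi> D D' "2 * diameter (space \<nu>b)" \<sigma> K
      by unfold_locales (use S sp in auto)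
    show "\<exists>T E. besov_operator \<theta> p \<nu>b (\<theta> - \<sigma> / p) p \<pi> T \<and>
               besov_operator (\<theta> - \<sigma> / p) p \<pi> \<theta> p \<nu>b E \<and>
               (\<forall>f\<in>besov_space (\<theta> - \<sigma> / p) p \<pi>. AE \<zeta> in \<pi>. T (E f) \<zeta> = f \<zeta>) \<and>
               (\<forall>u\<in>besov_space \<theta> p \<nu>b. AE \<zeta> in \<pi>.
                  (ball_average \<nu>b (\<lambda>x. \<bar>u x - T u \<zeta>\<bar>) \<zeta> \<longlongrightarrow> 0) (at_right 0))"
      using h by (intro ep.trace_extension_operators assms) (use \<sigma> in auto)
  qed
qed

end
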